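(* Let $1\leq p<2$, let $\Psi$ be a nonconstant holomorphic function defined on a connected open set $O\subseteq\mathbb{C}$ containing $\gamma(S_{p})$, and let $\Psi(\mathcal{L})$ be the multiplier on $\mathcal{S}_{p}(\mathcal{X})$ with symbol $\Psi\circ\gamma$, where $\Psi\circ\gamma(z)\neq 0$ for all $z\in S_{p}$. Let $\{f_{k}\}_{k\in\mathbb{Z}}$ be a bi-infinite sequence of functions on $\mathcal{X}$ satisfying $\|f_{k}\|_{L^{p^{\prime},\infty}(\mathcal{X})}\leq M$ for all $k\in\mathbb{Z}$ and some constant $M>0$. Let $A\in\mathbb{C}\setminus\{0\}$, and suppose that one of the following holds: (a) $\Psi(\mathcal{L})f_k=A\,f_{k+1}$ for all $k\in\mathbb{Z}_{+}$, $|A|= \min\{|\Psi\circ\gamma(z)|:z\in S_{p}\}$, and the range $\Psi\circ\gamma(S_p)$ intersects $\{w\in\mathbb{C}:|w|=|A|\}$ at finitely many distinct points; or (b) $\Psi(\mathcal{L})f_{-k}=A\,f_{-k+1}$ for all $k\in\mathbb{N}=\{1,2,\ldots\}$, $|A|= \max\{|\Psi\circ\gamma(z)|:z\in S_{p}\}$, and the range $\Psi\circ\gamma(S_p)$ intersects $\{w\in\mathbb{C}:|w|=|A|\}$ at finitely many distinct points. Then $f_{0}$ can be uniquely written as $f_{0}=g_{1}+\cdots+g_{m}$ for some $g_{l}\in L^{p^{\prime},\infty}(\mathcal{X})$, $l=1,\ldots,m$, satisfying $\mathcal{L}g_{l}=\gamma(\alpha_{l}+i\delta_{p^{\prime}})g_{l}$,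 where $-\tau/2< \alpha_{l}\leq\tau/2$ are distinct and $|\Psi\circ\gamma(\alpha_{l}+i\delta_{p^{\prime}})|=|A|$. In particular, for all $l=1,\ldots,m$, $g_{l}=\mathcal{P}_{\alpha_{l}+i\delta_{p^{\prime}}}F_{l}$ for some $F_{l}\in L^{p^{\prime}}(\Omega)$.
   Context: Let $q\geq 2$ be an integer and let $\mathcal{X}$ be the homogeneous tree of degree $q+1$ (the connected graph without cycles in which every vertex has $q+1$ neighbours), identified with its set of vertices, with graph distance $d$, counting measure, a fixed reference vertex $o$, and $|x|=d(o,x)$. A function on $\mathcal{X}$ is radial if its value at $x$ depends only on $|x|$; for radial $k$ we write $k(n)$ for its value at vertices with $|x|=n$. For $k$ radial, $f\ast k(x)=\sum_{y\in\mathcal{X}}f(y)k(d(x,y))$. $\mathbb{Z}_+$ is the set of nonnegative integers. $p'$ is the conjugate exponent of $p$ ($p'=\infty$ if $p=1$). For $p\in(1,\infty)$ put $\delta_p=\frac1p-\frac12$; $\delta_1=\frac12=-\delta_\infty$. $S_p=\{z\in\mathbb{C}:|\Im z|\le|\delta_p|\}$ and $\tau=2\pi/\log q$. The Laplacian is $\mathcal{L}f(x)=f(x)-\frac{1}{q+1}\sum_{y:d(x,y)=1}f(y)$, and $\gamma(z)=1-\frac{q^{1/2+iz}+q^{1/2-iz}}{q+1}$ for $z\in\mathbb{C}$. For $r\in[1,\infty)$, $L^{r,\infty}(\mathcal{X})$ is the space of functions $f$ on $\mathcal X$ with $\|f\|_{L^{r,\infty}(\mathcal{X})}=\sup_{t>0}t\,(\#\{x:|f(x)|>t\})^{1/r}<\infty$;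 $L^{\infty,\infty}(\mathcal{X})=L^\infty(\mathcal{X})$. $\Omega$ is the set of infinite geodesic rays $\omega=\{\omega_0,\omega_1,\dots\}$ starting at $\omega_0=o$; $c(x,\omega)$ is the last vertex of the geodesic path from $o$ to $x$ that lies on $\omega$. $\nu$ is the Borel probability measure on $\Omega$ giving mass $(q+1)^{-1}q^{-n+1}$ to each set $\{\omega:|c(x,\omega)|=|x|\}$ with $|x|=n\ge1$ (these sets, for $x\in\mathcal X$, form a basis of the topology); $L^r(\Omega)=L^r(\Omega,\nu)$. With $p(x,\omega)=q^{2|c(x,\omega)|-|x|}$, the Poisson transform of $F$ is $\mathcal{P}_zF(x)=\int_\Omega p^{1/2+iz}(x,\omega)F(\omega)\,d\nu(\omega)$, and $\phi_z=\mathcal{P}_z\mathbf{1}$ is the elementary spherical function. For radial $k$, $\widehat{k}(z)=\sum_{x\in\mathcal{X}}k(x)\phi_z(x)$. For $1\le p<2$, $\mathcal{S}_p(\mathcal{X})$ is the space of functions $\phi$ on $\mathcal{X}$ with $\nu_{p,m}(\phi)=\sup_{x}(1+|x|)^m q^{|x|/p}|\phi(x)|<\infty$ for all integers $m\ge0$. For $\Psi$ holomorphic on a connected open set containing $\gamma(S_p)$ there is a unique radial $k\in\mathcal{S}_p(\mathcal{X})$ with $\widehat{k}(z)=\Psi(\gamma(z))$ for $z\in S_p$; the multiplier $\Psi(\mathcal{L})$ with symbol $\Psi\circ\gamma$ is the operator $f\mapsto f\ast k$, which is defined on $\mathcal{S}_p(\mathcal{X})$ and also on $L^{p',\infty}(\mathcal{X})$.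 *)

theory Defs
  imports "HOL-Complex_Analysis.Complex_Analysis" "HOL-Probability.Probability"
begin

section \<open>The homogeneous tree\<close>

text \<open>Graphs are given by their adjacency relation \<open>E\<close>; the vertex set is the whole type \<open>'v\<close>.\<close>

definition homogeneous_tree :: "nat \<Rightarrow> ('v \<Rightarrow> 'v \<Rightarrow> bool) \<Rightarrow> bool" where
  "homogeneous_tree q E \<longleftrightarrow>
     symp E \<and> irreflp E \<and>
     (\<forall>x y. E\<^sup>*\<^sup>* x y) \<and>
     (\<nexists>xs. length xs \<ge> 3 \<and> distinct xs \<and> successively E xs \<and> E (last xs) (hd xs)) \<and>
     (\<forall>x. card {y. E x y} = q + 1)"

definition gdist :: "('v \<Rightarrow> 'v \<Rightarrow> bool) \<Rightarrow> 'v \<Rightarrow> 'v \<Rightarrow> nat" where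
  "gdist E x y = (LEAST n. (E ^^ n) x y)"

definition laplacian :: "nat \<Rightarrow> ('v \<Rightarrow> 'v \<Rightarrow> bool) \<Rightarrow> ('v \<Rightarrow> complex) \<Rightarrow> 'v \<Rightarrow> complex" where
  "laplacian q E f x = f x - (1 / (of_nat q + 1)) * (\<Sum>y | gdist E x y = 1. f y)"

text \<open>A radial function is represented by its profile \<open>k :: nat \<Rightarrow> complex\<close>,
  the function on vertices being \<open>x \<mapsto> k (gdist E v0 x)\<close>.\<close>

definition radial_conv ::
  "('v \<Rightarrow> 'v \<Rightarrow> bool) \<Rightarrow> ('v \<Rightarrow> complex) \<Rightarrow> (nat \<Rightarrow> complex) \<Rightarrow> 'v \<Rightarrow> complex" where
  "radial_conv E f k x = (\<Sum>\<^sub>\<infinity>y. f y * k (gdist E x y))"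


section \<open>Exponents, the strip and the symbol of the Laplacian\<close>

definition conj_exp :: "real \<Rightarrow> ennreal" where
  "conj_exp p = (if p = 1 then \<infinity> else ennreal (p / (p - 1)))"

text \<open>Since \<open>1 / \<infinity> = 0\<close> in \<open>ennreal\<close>, this gives \<open>delta \<infinity> = - 1/2\<close>.\<close>

definition delta :: "ennreal \<Rightarrow> real" where
  "delta r = enn2real (1 / r) - 1 / 2"

definition strip :: "real \<Rightarrow> complex set" where
  "strip p = {z. \<bar>Im z\<bar> \<le> \<bar>delta (ennreal p)\<bar>}"

definition tau :: "nat \<Rightarrow> real" where
  "tau q = 2 * pi / ln (real q)"

definition gam :: "nat \<Rightarrow> complex \<Rightarrow> complex" where
  "gam q z = 1 - (of_nat q powr (1/2 + \<i> * z) + of_nat q powr (1/2 - \<i> * z)) / (of_nat q + 1)"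


section \<open>Function spaces\<close>

text \<open>The quasi-norm of \<open>L\<^bsup>r,\<infinity>\<^esup>\<close> with respect to counting measure, with value \<open>\<infinity>\<close>
  when some level set is infinite and \<open>r < \<infinity>\<close>.\<close>

definition weak_norm :: "ennreal \<Rightarrow> ('v \<Rightarrow> complex) \<Rightarrow> ennreal" where
  "weak_norm r f =
     (if r = \<infinity> then (SUP x. ennreal (cmod (f x)))
      else (SUP t\<in>{0::real<..}.
              if finite {x. cmod (f x) > t}
              then ennreal (t * real (card {x. cmod (f x) > t}) powr (1 / enn2real r))
              else \<infinity>))"

definition weak_space :: "ennreal \<Rightarrow> ('v \<Rightarrow> complex) set" where
  "weak_space r = {f. weak_norm r f < \<infinity>}"

definition schwartz_space ::
  "nat \<Rightarrow> ('v \<Rightarrow> 'v \<Rightarrow> bool) \<Rightarrow> 'v \<Rightarrow> real \<Rightarrow> ('v \<Rightarrow> complex) set" where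
  "schwartz_space q E v0 p =
     {\<phi>. \<forall>m::nat. bdd_above (range (\<lambda>x.
           (1 + real (gdist E v0 x)) ^ m * real q powr (real (gdist E v0 x) / p) * cmod (\<phi> x)))}"


section \<open>Boundary and Poisson transform\<close>

definition boundary :: "('v \<Rightarrow> 'v \<Rightarrow> bool) \<Rightarrow> 'v \<Rightarrow> (nat \<Rightarrow> 'v) set" where
  "boundary E v0 = {\<omega>. \<omega> 0 = v0 \<and> (\<forall>m n. m \<le> n \<longrightarrow> gdist E (\<omega> m) (\<omega> n) = n - m)}"

text \<open>In a tree the geodesic from \<open>v0\<close> to \<open>x\<close> consists of the vertices \<open>y\<close> with
  \<open>d(v0,y) + d(y,x) = d(v0,x)\<close>; the last of these on \<open>\<omega>\<close> is the one farthest from \<open>v0\<close>.\<close>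

definition confluence :: "('v \<Rightarrow> 'v \<Rightarrow> bool) \<Rightarrow> 'v \<Rightarrow> 'v \<Rightarrow> (nat \<Rightarrow> 'v) \<Rightarrow> 'v" where
  "confluence E v0 x \<omega> =
     arg_max (gdist E v0)
       (\<lambda>y. gdist E v0 y + gdist E y x = gdist E v0 x \<and> y \<in> range \<omega>)"

definition cylinder :: "('v \<Rightarrow> 'v \<Rightarrow> bool) \<Rightarrow> 'v \<Rightarrow> 'v \<Rightarrow> (nat \<Rightarrow> 'v) set" where
  "cylinder E v0 x =
     {\<omega> \<in> boundary E v0. gdist E v0 (confluence E v0 x \<omega>) = gdist E v0 x}"

definition boundary_topology :: "('v \<Rightarrow> 'v \<Rightarrow> bool) \<Rightarrow> 'v \<Rightarrow> (nat \<Rightarrow> 'v) topology" where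
  "boundary_topology E v0 = topology_generated_by (range (cylinder E v0))"

text \<open>These conditions determine the measure uniquely.\<close>

definition boundary_measure ::
  "nat \<Rightarrow> ('v \<Rightarrow> 'v \<Rightarrow> bool) \<Rightarrow> 'v \<Rightarrow> (nat \<Rightarrow> 'v) measure \<Rightarrow> bool" where
  "boundary_measure q E v0 \<nu> \<longleftrightarrow>
     prob_space \<nu> \<and>
     space \<nu> = boundary E v0 \<and>
     sets \<nu> = sigma_sets (boundary E v0) {U. openin (boundary_topology E v0) U} \<and>
     (\<forall>x. gdist E v0 x \<ge> 1 \<longrightarrow>
        measure \<nu> (cylinder E v0 x) = 1 / ((real q + 1) * real q ^ (gdist E v0 x - 1)))"

definition Lr_space :: "'a measure \<Rightarrow> ennreal \<Rightarrow> ('a \<Rightarrow> complex) set" where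
  "Lr_space M r =
     {F \<in> borel_measurable M.
        if r = \<infinity> then (\<exists>C. AE \<omega> in M. cmod (F \<omega>) \<le> C)
        else integrable M (\<lambda>\<omega>. cmod (F \<omega>) powr enn2real r)}"

definition poisson_kernel ::
  "nat \<Rightarrow> ('v \<Rightarrow> 'v \<Rightarrow> bool) \<Rightarrow> 'v \<Rightarrow> 'v \<Rightarrow> (nat \<Rightarrow> 'v) \<Rightarrow> real" where
  "poisson_kernel q E v0 x \<omega> =
     real q powi (2 * int (gdist E v0 (confluence E v0 x \<omega>)) - int (gdist E v0 x))"

definition poisson_transform ::
  "nat \<Rightarrow> ('v \<Rightarrow> 'v \<Rightarrow> bool) \<Rightarrow> 'v \<Rightarrow> (nat \<Rightarrow> 'v) measure \<Rightarrow> complex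
     \<Rightarrow> ((nat \<Rightarrow> 'v) \<Rightarrow> complex) \<Rightarrow> 'v \<Rightarrow> complex" where
  "poisson_transform q E v0 \<nu> z F x =
     (LINT \<omega>|\<nu>. complex_of_real (poisson_kernel q E v0 x \<omega>) powr (1/2 + \<i> * z) * F \<omega>)"


section \<open>Spherical transform and multipliers\<close>

definition spherical ::
  "nat \<Rightarrow> ('v \<Rightarrow> 'v \<Rightarrow> bool) \<Rightarrow> 'v \<Rightarrow> (nat \<Rightarrow> 'v) measure \<Rightarrow> complex \<Rightarrow> 'v \<Rightarrow> complex" where
  "spherical q E v0 \<nu> z = poisson_transform q E v0 \<nu> z (\<lambda>_. 1)"

definition spherical_transform ::
  "nat \<Rightarrow> ('v \<Rightarrow> 'v \<Rightarrow> bool) \<Rightarrow> 'v \<Rightarrow> (nat \<Rightarrow> 'v) measure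
     \<Rightarrow> (nat \<Rightarrow> complex) \<Rightarrow> complex \<Rightarrow> complex" where
  "spherical_transform q E v0 \<nu> k z =
     (\<Sum>\<^sub>\<infinity>x. k (gdist E v0 x) * spherical q E v0 \<nu> z x)"

definition multiplier_kernel ::
  "nat \<Rightarrow> ('v \<Rightarrow> 'v \<Rightarrow> bool) \<Rightarrow> 'v \<Rightarrow> (nat \<Rightarrow> 'v) measure \<Rightarrow> real
     \<Rightarrow> (complex \<Rightarrow> complex) \<Rightarrow> nat \<Rightarrow> complex" where
  "multiplier_kernel q E v0 \<nu> p \<Psi> =
     (THE k. (\<lambda>x. k (gdist E v0 x)) \<in> schwartz_space q E v0 p \<and>
             (\<forall>z\<in>strip p. spherical_transform q E v0 \<nu> k z = \<Psi> (gam q z)))"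

text \<open>The operator \<open>\<Psi>(\<L>)\<close>, as convolution with its kernel.\<close>

definition multiplier ::
  "nat \<Rightarrow> ('v \<Rightarrow> 'v \<Rightarrow> bool) \<Rightarrow> 'v \<Rightarrow> (nat \<Rightarrow> 'v) measure \<Rightarrow> real
     \<Rightarrow> (complex \<Rightarrow> complex) \<Rightarrow> ('v \<Rightarrow> complex) \<Rightarrow> 'v \<Rightarrow> complex" where
  "multiplier q E v0 \<nu> p \<Psi> f = radial_conv E f (multiplier_kernel q E v0 \<nu> p \<Psi>)"


section \<open>Decompositions into eigenfunctions\<close>

text \<open>\<open>h = g 1 + \<dots> + g m\<close>, with \<open>g l\<close> an eigenfunction (possibly zero) of the Laplacian for
  the parameter \<open>\<alpha> l + i \<delta>\<^bsub>p'\<^esub>\<close>, the \<open>\<alpha> l\<close> being distinct.\<close>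

definition eigen_decomposition ::
  "nat \<Rightarrow> ('v \<Rightarrow> 'v \<Rightarrow> bool) \<Rightarrow> real \<Rightarrow> (complex \<Rightarrow> complex) \<Rightarrow> complex \<Rightarrow> ('v \<Rightarrow> complex)
     \<Rightarrow> nat \<Rightarrow> (nat \<Rightarrow> real) \<Rightarrow> (nat \<Rightarrow> 'v \<Rightarrow> complex) \<Rightarrow> bool" where
  "eigen_decomposition q E p \<Psi> A h m \<alpha> g \<longleftrightarrow>
     inj_on \<alpha> {1..m} \<and>
     (\<forall>l\<in>{1..m}.
        - tau q / 2 < \<alpha> l \<and> \<alpha> l \<le> tau q / 2 \<and>
        cmod (\<Psi> (gam q (Complex (\<alpha> l) (delta (conj_exp p))))) = cmod A \<and>
        g l \<in> weak_space (conj_exp p) \<and>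
        (\<forall>x. laplacian q E (g l) x = gam q (Complex (\<alpha> l) (delta (conj_exp p))) * g l x)) \<and>
     (\<forall>x. h x = (\<Sum>l=1..m. g l x))"

end

theory Submission
  imports Defs
begin

text \<open>
  Put \<open>t = q powr (i z)\<close> and let \<open>J\<close> be the neighbour sum divided by \<open>sqrt q\<close>. In the variable \<open>t\<close> the
  operator \<open>J\<close> has the symbol \<open>t + 1 / t\<close>, the strip becomes the closed annulus
  \<open>1 / R \<le> cmod t \<le> R\<close> with \<open>R = q powr (1 / p - 1 / 2) > 1\<close>, and the symbol of the multiplier becomes a
  function of \<open>t\<close> that is holomorphic on a larger annulus and invariant under \<open>t \<mapsto> 1 / t\<close>. If \<open>a\<close> are its
  Laurent coefficients, the multiplier acts as the sum of \<open>a m\<close> times the \<open>m\<close>-th Chebyshev polynomial of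
  \<open>J / 2\<close> (\<open>multiplier_eq_apply_symbol\<close>). A function in the weak space satisfies
  \<open>(\<Sum>x\<in>S. cmod (f x)) \<le> C * card S powr (1 / p)\<close> for all finite \<open>S\<close>; testing on spheres shows that its
  Chebyshev images grow at most like \<open>R ^ m\<close>. Hence a symbol acts with norm at most the
  weighted \<open>l1\<close> norm of its coefficients, and products of symbols act as compositions.

  Both alternatives say that \<open>f 0\<close> is the image of a uniformly bounded sequence \<open>h n\<close> under the powers of
  one symbol \<open>\<Phi>\<close> that is at most \<open>1\<close> in modulus on the annulus: \<open>\<Phi>\<close> is \<open>A\<close> divided by the symbol of
  the multiplier in the first case, and the symbol divided by \<open>A\<close> in the second. By the maximum
  principle \<open>\<Phi>\<close> reaches modulus \<open>1\<close> on the circle \<open>cmod t = R\<close>, and it does so in a finite set \<open>T\<close>. Let \<open>B\<close> be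
  the product of the factors \<open>u + 1 / u - (t + 1 / t)\<close> over \<open>t \<in> T\<close>. A Lojasiewicz inequality bounds
  \<open>1 - (cmod \<Phi>)\<^sup>2\<close> below by a power of \<open>cmod B\<close> on the circle, so that for a large exponent \<open>N\<close> the function
  \<open>\<Phi> ^ n * B ^ N\<close> tends to \<open>0\<close> together with its second derivative; then its
  coefficients tend to \<open>0\<close> in the weighted \<open>l1\<close> norm. Applied to \<open>h n\<close> this gives \<open>B(J) ^ N f 0 = 0\<close>
  (\<open>annihilator_exists\<close>).

  A Jordan block of size two at \<open>cmod t = R\<close> would make the Chebyshev images grow like \<open>n * R ^ n\<close>, which the
  weak space forbids (\<open>no_jordan_block\<close>). Therefore \<open>f 0\<close> is a sum of eigenfunctions of \<open>J\<close>, one for each point of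
  \<open>T\<close> (\<open>spectral_decomposition\<close>), and uniqueness is the independence of eigenvectors with distinct
  eigenvalues.

  Finally let \<open>g\<close> be an eigenfunction with \<open>cmod t = R\<close> and put \<open>Q = sqrt q * t\<close>. The differences
  \<open>g x - g (parent x) / Q\<close>, suitably normalised, form an additive function of the cylinders, so its densities at the
  successive levels form a martingale. If the densities were large, descending from each
  vertex of a level as many generations as its density deserves would produce a finite set that violates the
  weak-type bound on \<open>g\<close>; this bounds the martingale in \<open>L\<^sup>r\<close> with \<open>r\<close> the conjugate exponent, and \<open>g\<close> is the
  Poisson transform of its limit (\<open>eigenfunction_is_poisson_transform\<close>).
\<close>

section \<open>Weak Lebesgue spaces\<close>

text \<open>In contrast to the weak quasinorm this bound is subadditive and can be tested directly on spheres. It describes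
  the weak space of the conjugate exponent: for \<open>p = 1\<close> it is boundedness.\<close>

definition marcinkiewicz :: "real \<Rightarrow> real \<Rightarrow> ('v \<Rightarrow> complex) \<Rightarrow> bool" where
  "marcinkiewicz p C f \<longleftrightarrow>
     (\<forall>S. finite S \<longrightarrow> (\<Sum>x\<in>S. cmod (f x)) \<le> C * real (card S) powr (1 / p))"

lemma marcinkiewiczD:
  "marcinkiewicz p C f \<Longrightarrow> finite S \<Longrightarrow> (\<Sum>x\<in>S. cmod (f x)) \<le> C * real (card S) powr (1 / p)"
  by (simp add: marcinkiewicz_def)

lemma marcinkiewicz_nonneg: "marcinkiewicz p C (f :: 'v \<Rightarrow> complex) \<Longrightarrow> 0 \<le> C"
  using order_trans[OF norm_ge_zero[of "f undefined"]] marcinkiewiczD[of p C f "{undefined}"]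
  by simp

lemma enn2real_conj_exp:
  assumes "1 < p"
  shows "enn2real (conj_exp p) = p / (p - 1)"
  using assms by (simp add: conj_exp_def)

lemma conj_exp_eq_top_iff: "conj_exp p = \<infinity> \<longleftrightarrow> p = 1"
  by (simp add: conj_exp_def)

text \<open>A concave power grows from \<open>n\<close> to \<open>n + 1\<close> by at least its derivative at \<open>n + 1\<close>; this is a case of Young's inequality.
  It makes the sum of \<open>j powr (a - 1)\<close> telescope.\<close>

lemma powr_pred_le:
  fixes a :: real and n :: nat
  assumes a: "0 < a" "a \<le> 1"
  shows "real n powr a + a * real (Suc n) powr (a - 1) \<le> real (Suc n) powr a"
proof (cases "n = 0")
  case True
  then show ?thesis using a by simp
next
  case False
  have "real n powr a * real (Suc n) powr (1 - a) \<le> a * real n + (1 - a) * real (Suc n)"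
    using a False by (intro Youngs_inequality_0) auto
  also have "\<dots> = real (Suc n) - a" by (simp add: algebra_simps)
  finally have "(real n powr a * real (Suc n) powr (1 - a)) * real (Suc n) powr (a - 1)
      \<le> (real (Suc n) - a) * real (Suc n) powr (a - 1)"
    by (intro mult_right_mono) auto
  moreover have "(real n powr a * real (Suc n) powr (1 - a)) * real (Suc n) powr (a - 1) = real n powr a"
    by (simp add: mult.assoc powr_add[symmetric])
  moreover have "real (Suc n) * real (Suc n) powr (a - 1) = real (Suc n) powr a"
    by (simp add: powr_mult_base)
  ultimately show ?thesis by (simp only: left_diff_distrib)
qed

text \<open>In a finite set of \<open>n\<close> points some value is at most \<open>M * n powr (1 / p - 1)\<close>, since otherwise a level set would be too
  large. Removing the smallest value again and again, the sum is at most \<open>M\<close> times the sum of \<open>j powr (1 / p - 1)\<close> over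
  \<open>1 \<le> j \<le> n\<close>.\<close>

lemma weak_norm_imp_marcinkiewicz:
  fixes f :: "'v \<Rightarrow> complex"
  assumes p: "1 \<le> p" and M: "0 \<le> M" and f: "weak_norm (conj_exp p) f \<le> ennreal M"
  shows "marcinkiewicz p (p * M) f"
proof (cases "p = 1")
  case True
  have le: "cmod (f x) \<le> M" for x
  proof -
    have "ennreal (cmod (f x)) \<le> weak_norm (conj_exp p) f"
      using True by (auto simp: weak_norm_def conj_exp_def intro: SUP_upper)
    also note f
    finally show ?thesis using M by simp
  qed
  have "(\<Sum>x\<in>S. cmod (f x)) \<le> M * real (card S)" for S
    using sum_bounded_above[of S "\<lambda>x. cmod (f x)" M] le by (simp add: mult.commute)
  then show ?thesis using True by (simp add: marcinkiewicz_def)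
next
  case False
  define a where "a = 1 / p"
  have p1: "1 < p" using p False by simp
  have a: "0 < a" "a < 1" using p1 by (auto simp: a_def)
  have ex: "1 / enn2real (conj_exp p) = 1 - a"
    using p1 by (simp add: enn2real_conj_exp a_def field_simps)
  have level: "finite {x. cmod (f x) > t} \<and> t * real (card {x. cmod (f x) > t}) powr (1 - a) \<le> M"
    if "t > 0" for t
  proof -
    have "(if finite {x. cmod (f x) > t}
              then ennreal (t * real (card {x. cmod (f x) > t}) powr (1 - a))
              else \<infinity>) \<le> weak_norm (conj_exp p) f"
      unfolding weak_norm_def ex if_not_P[OF False[folded conj_exp_eq_top_iff]]
      using that by (intro SUP_upper2[of t]) auto
    also note f
    finally show ?thesis using M by (auto split: if_splits simp: top_unique)
  qed
  have small: "\<exists>x\<in>S. cmod (f x) \<le> M * real (card S) powr (a - 1)" if S: "finite S" "S \<noteq> {}" for S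
  proof -
    define m where "m = Min ((\<lambda>x. cmod (f x)) ` S)"
    have "m \<in> (\<lambda>x. cmod (f x)) ` S" unfolding m_def using S by (intro Min_in) auto
    then obtain x where x: "x \<in> S" "cmod (f x) = m" by auto
    have mle: "m \<le> cmod (f y)" if "y \<in> S" for y unfolding m_def using S that by auto
    have card: "0 < real (card S)" using S by (simp add: card_gt_0_iff)
    have "m \<le> M * real (card S) powr (a - 1)"
    proof (rule dense_le)
      fix t assume t: "t < m"
      show "t \<le> M * real (card S) powr (a - 1)"
      proof (cases "t > 0")
        case True
        have "S \<subseteq> {x. cmod (f x) > t}" using mle t by force
        then have "card S \<le> card {x. cmod (f x) > t}" using level[OF True] by (intro card_mono) auto
        then have "t * real (card S) powr (1 - a) \<le> t * real (card {x. cmod (f x) > t}) powr (1 - a)"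
          using True a by (intro mult_left_mono powr_mono2) auto
        also have "\<dots> \<le> M" using level[OF True] by simp
        finally have "t * real (card S) powr (1 - a) * real (card S) powr (a - 1) \<le> M * real (card S) powr (a - 1)"
          by (intro mult_right_mono) auto
        then show ?thesis using card by (simp add: mult.assoc powr_add[symmetric])
      next
        case False
        then show ?thesis using M by (meson dual_order.trans leI mult_nonneg_nonneg powr_ge_zero)
      qed
    qed
    then show ?thesis using x by auto
  qed
  have "(\<Sum>x\<in>S. cmod (f x)) \<le> p * M * real (card S) powr a" if "finite S" for S
    using that
  proof (induction "card S" arbitrary: S)
    case 0
    then show ?case by simp
  next
    case (Suc n)
    then have "S \<noteq> {}" by auto
    then obtain x where x: "x \<in> S" "cmod (f x) \<le> M * real (card S) powr (a - 1)"
      using small Suc.prems by blast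
    have c: "card (S - {x}) = n" using Suc x by simp
    have "(\<Sum>x\<in>S. cmod (f x)) = cmod (f x) + (\<Sum>x\<in>S - {x}. cmod (f x))"
      using Suc.prems x by (simp add: sum.remove)
    also have "\<dots> \<le> M * real (Suc n) powr (a - 1) + p * M * real n powr a"
      using x Suc.hyps(1)[of "S - {x}"] Suc.hyps(2)[symmetric] Suc.prems c by simp
    also have "\<dots> = p * M * (real n powr a + a * real (Suc n) powr (a - 1))"
      using p1 by (simp add: a_def field_simps)
    also have "\<dots> \<le> p * M * real (Suc n) powr a"
      using powr_pred_le[of a n] a M p by (intro mult_left_mono) auto
    finally show ?case using Suc.hyps(2) by simp
  qed
  then show ?thesis by (simp add: marcinkiewicz_def a_def)
qed

text \<open>On a finite part of a level set every value exceeds \<open>t\<close>, which bounds its cardinality; as the bound is uniform, the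
  whole level set is finite.\<close>

lemma marcinkiewicz_imp_weak_space:
  fixes f :: "'v \<Rightarrow> complex"
  assumes p: "1 \<le> p" and f: "marcinkiewicz p C f"
  shows "f \<in> weak_space (conj_exp p)"
proof (cases "p = 1")
  case True
  have "cmod (f x) \<le> C" for x
    using marcinkiewiczD[OF f, of "{x}"] by simp
  then have "weak_norm (conj_exp p) f \<le> ennreal C"
    using True by (auto simp: weak_norm_def conj_exp_def intro!: SUP_least ennreal_leI)
  also have "\<dots> < \<infinity>" by simp
  finally show ?thesis by (simp add: weak_space_def)
next
  case False
  define a where "a = 1 / p"
  have p1: "1 < p" using p False by simp
  have a: "0 < a" "a < 1" using p1 by (auto simp: a_def)
  have C: "0 \<le> C" using marcinkiewicz_nonneg[OF f] .
  have ex: "1 / enn2real (conj_exp p) = 1 - a"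
    using p1 by (simp add: enn2real_conj_exp a_def field_simps)
  have fin_le: "t * real (card S) powr (1 - a) \<le> C"
    if t: "t > 0" and S: "finite S" "S \<subseteq> {x. cmod (f x) > t}" for t S
  proof (cases "card S = 0")
    case True
    then show ?thesis using C by simp
  next
    case False
    have "t * real (card S) \<le> (\<Sum>x\<in>S. cmod (f x))"
      using sum_bounded_below[of S t "\<lambda>x. cmod (f x)"] S by (force simp: mult.commute)
    also have "\<dots> \<le> C * real (card S) powr a" using marcinkiewiczD[OF f S(1)] by (simp add: a_def)
    finally have "t * real (card S) * real (card S) powr (- a) \<le> C * real (card S) powr a * real (card S) powr (- a)"
      by (intro mult_right_mono) auto
    then show ?thesis using False by (simp add: mult.assoc powr_add[symmetric] powr_mult_base)
  qed
  have level: "finite {x. cmod (f x) > t}" if t: "t > 0" for t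
  proof (rule ccontr)
    assume inf: "infinite {x. cmod (f x) > t}"
    define N where "N = nat \<lceil>(C / t) powr (1 / (1 - a))\<rceil> + 1"
    obtain S where S: "S \<subseteq> {x. cmod (f x) > t}" "finite S" "card S = N"
      using infinite_arbitrarily_large[OF inf] by blast
    have "(C / t) powr (1 / (1 - a)) < real N" unfolding N_def by linarith
    then have "((C / t) powr (1 / (1 - a))) powr (1 - a) < real N powr (1 - a)"
      using a by (intro powr_less_mono2) auto
    then have "C / t < real N powr (1 - a)"
      using a C t by (simp add: powr_powr)
    then have "C < t * real N powr (1 - a)" using t by (simp add: field_simps)
    then show False using fin_le[OF t S(2,1)] S(3) by simp
  qed
  have "weak_norm (conj_exp p) f \<le> ennreal C"
    unfolding weak_norm_def ex using False conj_exp_eq_top_iff[of p] level fin_le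
    by (auto simp: ex intro!: SUP_least ennreal_leI)
  also have "\<dots> < \<infinity>" by simp
  finally show ?thesis by (simp add: weak_space_def)
qed

lemma marcinkiewicz_add:
  assumes "marcinkiewicz p C f" "marcinkiewicz p D g"
  shows "marcinkiewicz p (C + D) (\<lambda>x. f x + g x)"
  unfolding marcinkiewicz_def
proof (intro allI impI)
  fix S :: "'a set" assume S: "finite S"
  have "(\<Sum>x\<in>S. cmod (f x + g x)) \<le> (\<Sum>x\<in>S. cmod (f x)) + (\<Sum>x\<in>S. cmod (g x))"
    by (simp add: sum.distrib[symmetric] sum_mono norm_triangle_ineq)
  then show "(\<Sum>x\<in>S. cmod (f x + g x)) \<le> (C + D) * real (card S) powr (1 / p)"
    using marcinkiewiczD[OF assms(1) S] marcinkiewiczD[OF assms(2) S]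
    by (simp add: algebra_simps)
qed

lemma marcinkiewicz_cmult:
  assumes "marcinkiewicz p C f"
  shows "marcinkiewicz p (cmod c * C) (\<lambda>x. c * f x)"
  unfolding marcinkiewicz_def
proof (intro allI impI)
  fix S :: "'a set" assume S: "finite S"
  then show "(\<Sum>x\<in>S. cmod (c * f x)) \<le> cmod c * C * real (card S) powr (1 / p)"
    using mult_left_mono[OF marcinkiewiczD[OF assms S], of "cmod c"]
    by (simp add: norm_mult sum_distrib_left mult.assoc)
qed

text \<open>Grouping the points of \<open>S\<close> by their image leaves a sum over \<open>h ` S\<close>, which is no larger than \<open>S\<close>.\<close>

lemma marcinkiewicz_comp:
  assumes f: "marcinkiewicz p C f" and p: "1 \<le> p"
    and h: "\<And>y. finite {x. h x = y}" "\<And>y. card {x. h x = y} \<le> n"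
  shows "marcinkiewicz p (real n * C) (\<lambda>x. f (h x))"
  unfolding marcinkiewicz_def
proof (intro allI impI)
  fix S :: "'b set" assume S: "finite S"
  have "(\<Sum>x\<in>S. cmod (f (h x))) = (\<Sum>y\<in>h ` S. \<Sum>x\<in>{x\<in>S. h x = y}. cmod (f (h x)))"
    by (rule sum.image_gen[OF S])
  also have "\<dots> \<le> (\<Sum>y\<in>h ` S. real n * cmod (f y))"
  proof (rule sum_mono)
    fix y
    have "(\<Sum>x\<in>{x\<in>S. h x = y}. cmod (f (h x))) = real (card {x\<in>S. h x = y}) * cmod (f y)"
      by simp
    also have "card {x\<in>S. h x = y} \<le> card {x. h x = y}" using h(1) by (intro card_mono) auto
    then have "real (card {x\<in>S. h x = y}) * cmod (f y) \<le> real n * cmod (f y)"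
      using h(2)[of y] by (intro mult_right_mono) auto
    finally show "(\<Sum>x\<in>{x\<in>S. h x = y}. cmod (f (h x))) \<le> real n * cmod (f y)" .
  qed
  also have "\<dots> = real n * (\<Sum>y\<in>h ` S. cmod (f y))" by (simp add: sum_distrib_left)
  also have "\<dots> \<le> real n * (C * real (card (h ` S)) powr (1 / p))"
    using S by (intro mult_left_mono marcinkiewiczD[OF f]) auto
  also have "\<dots> \<le> real n * (C * real (card S) powr (1 / p))"
    using S p marcinkiewicz_nonneg[OF f] by (intro mult_left_mono powr_mono2) (auto simp: card_image_le)
  finally show "(\<Sum>x\<in>S. cmod (f (h x))) \<le> real n * C * real (card S) powr (1 / p)"
    by (simp add: mult.assoc)
qed

section \<open>Distances and spheres in a homogeneous tree\<close>

locale tree =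
  fixes q :: nat and E :: "'v \<Rightarrow> 'v \<Rightarrow> bool"
  assumes q2: "2 \<le> q" and homogeneous: "homogeneous_tree q E"
begin

abbreviation d :: "'v \<Rightarrow> 'v \<Rightarrow> nat" where "d \<equiv> gdist E"

lemma E_sym: "E x y \<Longrightarrow> E y x"
  using homogeneous by (auto simp: homogeneous_tree_def symp_def)

lemma E_irrefl: "\<not> E x x"
  using homogeneous by (auto simp: homogeneous_tree_def irreflp_def)

lemma E_connected: "E\<^sup>*\<^sup>* x y"
  using homogeneous by (auto simp: homogeneous_tree_def)

lemma E_acyclic: "3 \<le> length xs \<Longrightarrow> distinct xs \<Longrightarrow> successively E xs \<Longrightarrow> \<not> E (last xs) (hd xs)"
  using homogeneous by (auto simp: homogeneous_tree_def)

lemma card_neighbours: "card {y. E x y} = q + 1"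
  using homogeneous by (auto simp: homogeneous_tree_def)

lemma finite_neighbours [simp]: "finite {y. E x y}"
  using card_neighbours[of x] by (intro card_ge_0_finite) simp

lemma d_le: "(E ^^ n) x y \<Longrightarrow> d x y \<le> n"
  unfolding gdist_def by (rule Least_le)

lemma geodesic: "(E ^^ d x y) x y"
proof -
  obtain n where "(E ^^ n) x y" using rtranclp_imp_relpowp[OF E_connected] by blast
  then show ?thesis unfolding gdist_def by (rule LeastI)
qed

lemma relpow_sym: "(E ^^ n) x y \<Longrightarrow> (E ^^ n) y x"
proof (induction n arbitrary: y)
  case (Suc n)
  then obtain z where "(E ^^ n) x z" "E z y" by auto
  then show ?case using Suc.IH E_sym relpowp_Suc_I2 by metis
qed auto

lemma d_sym: "d x y = d y x"
  using d_le relpow_sym geodesic by (meson order_antisym)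

lemma d_refl [simp]: "d x x = 0"
  using d_le[of 0 x x] by simp

lemma d_eq_0_iff [simp]: "d x y = 0 \<longleftrightarrow> x = y"
  using geodesic[of x y] by (auto simp del: relpowp.simps(2))

lemma d_triangle: "d x z \<le> d x y + d y z"
  by (rule d_le) (use geodesic[of x y] geodesic[of y z] in \<open>auto simp: relpowp_add\<close>)

lemma d_eq_1_iff: "d x y = Suc 0 \<longleftrightarrow> E x y"
proof
  assume "d x y = Suc 0"
  then show "E x y" using geodesic[of x y] by auto
next
  assume E: "E x y"
  then have "d x y \<le> Suc 0" by (intro d_le) auto
  moreover have "d x y \<noteq> 0" using E E_irrefl by auto
  ultimately show "d x y = Suc 0" by linarith
qed

lemma neighbour_closer:
  assumes "d x w = Suc n"
  obtains y where "E x y" "d y w = n"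
proof -
  obtain y where y: "E x y" "(E ^^ n) y w"
    using geodesic[of x w] relpowp_Suc_D2[of n E x w] assms by auto
  have "d x w \<le> Suc (d y w)" using d_triangle[of x w y] y(1) d_eq_1_iff[of x y] by simp
  then show ?thesis using that y d_le[OF y(2)] assms by force
qed

lemma avoiding_path:
  assumes "(\<lambda>a b. E a b \<and> a \<noteq> x \<and> b \<noteq> x)\<^sup>*\<^sup>* y z" "y \<noteq> x"
  shows "\<exists>xs. xs \<noteq> [] \<and> hd xs = y \<and> last xs = z \<and> distinct xs \<and> successively E xs \<and> x \<notin> set xs"
  using assms
proof (induction rule: rtranclp_induct)
  case base
  then show ?case by (intro exI[of _ "[y]"]) auto
next
  case (step z z')
  then obtain xs where xs: "xs \<noteq> []" "hd xs = y" "last xs = z" "distinct xs" "successively E xs" "x \<notin> set xs"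
    by auto
  show ?case
  proof (cases "z' \<in> set xs")
    case True
    then obtain us vs where us: "xs = (us @ [z']) @ vs" by (auto simp: in_set_conv_decomp)
    then have "successively E (us @ [z'])" using xs(5) successively_append_iff by blast
    then have "us @ [z'] \<noteq> [] \<and> hd (us @ [z']) = y \<and> last (us @ [z']) = z' \<and> distinct (us @ [z']) \<and>
        successively E (us @ [z']) \<and> x \<notin> set (us @ [z'])"
      using xs us by (cases us) (auto split: if_splits)
    then show ?thesis by blast
  next
    case False
    then have "xs @ [z'] \<noteq> [] \<and> hd (xs @ [z']) = y \<and> last (xs @ [z']) = z' \<and> distinct (xs @ [z']) \<and>
        successively E (xs @ [z']) \<and> x \<notin> set (xs @ [z'])"
      using xs step by (auto simp: successively_append_iff)
    then show ?thesis by blast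
  qed
qed

text \<open>Two neighbours of a vertex can be joined only through that vertex, for a path that avoids it would close up
  to a cycle. All metric properties of the tree below come from this remark.\<close>

lemma neighbours_separated:
  assumes "E x y" "E x z" "(\<lambda>a b. E a b \<and> a \<noteq> x \<and> b \<noteq> x)\<^sup>*\<^sup>* y z"
  shows "y = z"
proof (rule ccontr)
  assume ne: "y \<noteq> z"
  have "y \<noteq> x" using assms E_irrefl by auto
  then obtain xs where xs: "xs \<noteq> []" "hd xs = y" "last xs = z" "distinct xs" "successively E xs" "x \<notin> set xs"
    using avoiding_path[OF assms(3)] by auto
  have "2 \<le> length xs" using xs ne by (cases xs; cases "tl xs") auto
  then have "\<not> E (last (x # xs)) (hd (x # xs))"
    using xs assms by (intro E_acyclic) (auto simp: successively_Cons)
  then show False using xs assms E_sym by auto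
qed

lemma avoiding_walk:
  assumes "d y w \<le> d x w" "y \<noteq> x" "x \<noteq> w"
  shows "(\<lambda>a b. E a b \<and> a \<noteq> x \<and> b \<noteq> x)\<^sup>*\<^sup>* y w"
  using assms(1,2)
proof (induction "d y w" arbitrary: y)
  case 0
  then show ?case by simp
next
  case (Suc n)
  then obtain y' where y': "E y y'" "d y' w = n" using neighbour_closer[of y w n] by auto
  then have "y' \<noteq> x" using Suc by auto
  then have "(\<lambda>a b. E a b \<and> a \<noteq> x \<and> b \<noteq> x)\<^sup>*\<^sup>* y' w" using Suc y' by auto
  then show ?case using y' \<open>y' \<noteq> x\<close> Suc by (intro converse_rtranclp_into_rtranclp[of _ y y']) auto
qed

lemma unique_closer_neighbour:
  assumes "x \<noteq> w" "E x y" "d y w \<le> d x w" "E x z" "d z w \<le> d x w"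
  shows "y = z"
proof -
  let ?R = "\<lambda>a b. E a b \<and> a \<noteq> x \<and> b \<noteq> x"
  have ne: "y \<noteq> x" "z \<noteq> x" using assms E_irrefl by auto
  have "symp ?R" using E_sym by (auto simp: symp_def)
  then have "symp ?R\<^sup>*\<^sup>*" by (rule symp_rtranclp)
  moreover have "?R\<^sup>*\<^sup>* z w" by (rule avoiding_walk) (use assms ne in auto)
  ultimately have "?R\<^sup>*\<^sup>* w z" by (rule sympD)
  moreover have "?R\<^sup>*\<^sup>* y w" by (rule avoiding_walk) (use assms ne in auto)
  ultimately have "?R\<^sup>*\<^sup>* y z" by (rule rtranclp_trans[rotated])
  then show ?thesis using neighbours_separated assms by blast
qed

text \<open>A tree is bipartite: a step changes the distance to every fixed vertex.\<close>

lemma neighbour_dist: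
  assumes "E x y" "x \<noteq> w"
  shows "Suc (d y w) = d x w \<or> d y w = Suc (d x w)"
proof (cases "d y w \<le> d x w")
  case True
  obtain n where n: "d x w = Suc n" using assms(2) by (cases "d x w") auto
  then obtain z where z: "E x z" "d z w = n" using neighbour_closer by blast
  then have "y = z" using unique_closer_neighbour[of x w y z] assms True n by auto
  then show ?thesis using z n by simp
next
  case False
  then show ?thesis using d_triangle[of y w x] assms d_eq_1_iff[of y x] E_sym[of x y] by auto
qed

lemma card_closer: "x \<noteq> w \<Longrightarrow> card {y. E x y \<and> Suc (d y w) = d x w} = 1"
proof -
  assume ne: "x \<noteq> w"
  obtain n where n: "d x w = Suc n" using ne by (cases "d x w") auto
  then obtain z where z: "E x z" "d z w = n" using neighbour_closer by blast
  have "y = z" if "E x y" "Suc (d y w) = d x w" for y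
    by (rule unique_closer_neighbour[OF ne]) (use that z n in auto)
  moreover have "Suc (d z w) = d x w" using z(2) n by simp
  ultimately have "{y. E x y \<and> Suc (d y w) = d x w} = {z}"
    using z(1) by blast
  then show ?thesis by simp
qed

lemma card_farther: "card {y. E x y \<and> d y w = Suc (d x w)} = (if x = w then q + 1 else q)"
proof (cases "x = w")
  case True
  have "E w y \<and> d y w = Suc (d w w) \<longleftrightarrow> E w y" for y
    using d_eq_1_iff[of y w] E_sym by auto
  then show ?thesis using True card_neighbours[of w] by simp
next
  case False
  have "{y. E x y \<and> Suc (d y w) = d x w} \<union> {y. E x y \<and> d y w = Suc (d x w)} = {y. E x y}"
    using neighbour_dist[OF _ False] by blast
  moreover have "card ({y. E x y \<and> Suc (d y w) = d x w} \<union> {y. E x y \<and> d y w = Suc (d x w)})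
      = card {y. E x y \<and> Suc (d y w) = d x w} + card {y. E x y \<and> d y w = Suc (d x w)}"
    by (rule card_Un_disjoint) auto
  ultimately have "card {y. E x y} = card {y. E x y \<and> Suc (d y w) = d x w} + card {y. E x y \<and> d y w = Suc (d x w)}"
    by (simp only:)
  then show ?thesis by (simp only: card_closer[OF False] card_neighbours) (use False in simp)
qed

definition vsphere :: "'v \<Rightarrow> nat \<Rightarrow> 'v set" where "vsphere x n = {y. d x y = n}"

definition neighbour_sum :: "('v \<Rightarrow> complex) \<Rightarrow> 'v \<Rightarrow> complex" where
  "neighbour_sum f x = (\<Sum>y | E x y. f y)"

definition sphere_sum :: "nat \<Rightarrow> ('v \<Rightarrow> complex) \<Rightarrow> 'v \<Rightarrow> complex" where
  "sphere_sum n f x = (\<Sum>y\<in>vsphere x n. f y)"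

lemma sphere_0 [simp]: "vsphere x 0 = {x}"
  by (auto simp: vsphere_def)

lemma sphere_1: "vsphere x (Suc 0) = {y. E x y}"
  by (auto simp: vsphere_def d_eq_1_iff)

lemma finite_vsphere [simp]: "finite (vsphere x n)"
proof (induction n arbitrary: x)
  case (Suc n)
  have "vsphere x (Suc n) \<subseteq> (\<Union>y\<in>{y. E x y}. vsphere y n)"
  proof
    fix w assume "w \<in> vsphere x (Suc n)"
    then obtain y where "E x y" "d y w = n" using neighbour_closer[of x w n] by (auto simp: vsphere_def)
    then show "w \<in> (\<Union>y\<in>{y. E x y}. vsphere y n)" by (auto simp: vsphere_def)
  qed
  then show ?case using Suc by (meson finite_UN_I finite_neighbours finite_subset)
qed simp

lemma sphere_sum_0 [simp]: "sphere_sum 0 f = f"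
  by (simp add: sphere_sum_def fun_eq_iff)

lemma sphere_sum_1: "sphere_sum (Suc 0) f = neighbour_sum f"
  by (simp add: sphere_sum_def sphere_1 neighbour_sum_def fun_eq_iff)

text \<open>Each vertex at distance \<open>n + 2\<close> is adjacent to one vertex of the sphere of radius \<open>n + 1\<close>, each vertex at
  distance \<open>n\<close> to \<open>q\<close> of them (\<open>q + 1\<close> at the centre).\<close>

lemma neighbour_sum_sphere_sum:
  "neighbour_sum (sphere_sum (Suc n) f) x =
     sphere_sum (Suc (Suc n)) f x + of_nat (if n = 0 then q + 1 else q) * sphere_sum n f x"
proof -
  let ?W = "vsphere x (Suc (Suc n)) \<union> vsphere x n"
  let ?c = "\<lambda>w. card {y. E x y \<and> d y w = Suc n}"
  have W: "w \<in> ?W" if "E x y" "d y w = Suc n" for y w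
  proof (cases "x = w")
    case True
    then show ?thesis using that d_eq_1_iff[of y x] E_sym by (auto simp: vsphere_def)
  next
    case False
    then show ?thesis using neighbour_dist[OF that(1) False] that(2) by (auto simp: vsphere_def)
  qed
  have "neighbour_sum (sphere_sum (Suc n) f) x = (\<Sum>y | E x y. \<Sum>w | w \<in> ?W \<and> d y w = Suc n. f w)"
    unfolding neighbour_sum_def sphere_sum_def
  proof (rule sum.cong[OF refl], rule sum.cong)
    fix y assume "y \<in> {y. E x y}"
    then show "vsphere y (Suc n) = {w \<in> ?W. d y w = Suc n}" using W[of y] unfolding vsphere_def by blast
  qed simp
  also have "\<dots> = (\<Sum>w\<in>?W. \<Sum>y | y \<in> {y. E x y} \<and> d y w = Suc n. f w)"
    by (rule sum.swap_restrict) auto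
  also have "\<dots> = (\<Sum>w\<in>?W. of_nat (?c w) * f w)"
    by (simp only: sum_constant mem_Collect_eq)
  also have "\<dots> = (\<Sum>w\<in>vsphere x (Suc (Suc n)). of_nat (?c w) * f w) + (\<Sum>w\<in>vsphere x n. of_nat (?c w) * f w)"
    by (rule sum.union_disjoint[OF finite_vsphere finite_vsphere]) (auto simp: vsphere_def)
  also have "(\<Sum>w\<in>vsphere x (Suc (Suc n)). of_nat (?c w) * f w) = sphere_sum (Suc (Suc n)) f x"
    unfolding sphere_sum_def
  proof (rule sum.cong[OF refl])
    fix w assume w: "w \<in> vsphere x (Suc (Suc n))"
    then have "x \<noteq> w" by (auto simp: vsphere_def)
    then show "of_nat (?c w) * f w = f w" using card_closer[of x w] w by (simp add: vsphere_def)
  qed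
  also have "(\<Sum>w\<in>vsphere x n. of_nat (?c w) * f w) = of_nat (if n = 0 then q + 1 else q) * sphere_sum n f x"
    unfolding sphere_sum_def sum_distrib_left
  proof (rule sum.cong[OF refl])
    fix w assume w: "w \<in> vsphere x n"
    then show "of_nat (?c w) * f w = of_nat (if n = 0 then q + 1 else q) * f w"
      using card_farther[of x w] by (auto simp: vsphere_def)
  qed
  finally show ?thesis .
qed

lemma card_sphere: "card (vsphere x (Suc n)) = (q + 1) * q ^ n"
proof -
  have c: "sphere_sum n (\<lambda>_. 1) y = of_nat (card (vsphere y n))" for n y
    by (simp add: sphere_sum_def)
  have step: "(\<Sum>y | E x y. of_nat (card (vsphere y (Suc n)))) =
      (of_nat (card (vsphere x (Suc (Suc n)))) + of_nat (if n = 0 then q + 1 else q) * of_nat (card (vsphere x n)) :: complex)"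
    for n x using neighbour_sum_sphere_sum[of n "\<lambda>_. 1" x] by (simp only: c neighbour_sum_def)
  have "(card (vsphere x (Suc n)) = (q + 1) * q ^ n) \<and> card (vsphere x (Suc (Suc n))) = (q + 1) * q ^ Suc n" for x
  proof (induction n arbitrary: x)
    case 0
    have 1: "card (vsphere y (Suc 0)) = q + 1" for y by (simp add: sphere_1 card_neighbours)
    have "of_nat (card (vsphere x (Suc (Suc 0)))) = (of_nat ((q + 1) * q) :: complex)"
      using step[of 0 x] by (simp add: 1 card_neighbours algebra_simps)
    then show ?case using 1 by (simp only: of_nat_eq_iff) auto
  next
    case (Suc n)
    have "of_nat (card (vsphere x (Suc (Suc (Suc n))))) = (of_nat ((q + 1) * q ^ Suc (Suc n)) :: complex)"
      using step[of "Suc n" x] Suc.IH by (simp add: card_neighbours algebra_simps)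
    then show ?case using Suc.IH by (simp only: of_nat_eq_iff)
  qed
  then show ?thesis by simp
qed

lemma sphere_nonempty: "vsphere x n \<noteq> {}"
  using card_sphere[of x "n - 1"] q2 by (cases n) (auto simp: card_eq_0_iff)

lemma card_sphere_le: "real (card (vsphere x n)) \<le> 2 * real q ^ n"
proof (cases n)
  case (Suc m)
  have "(q + 1) * q ^ m \<le> 2 * q ^ n" using q2 Suc by (simp add: algebra_simps)
  then have "real (card (vsphere x n)) \<le> real (2 * q ^ n)" using card_sphere[of x m] Suc by (simp only: of_nat_le_iff)
  then show ?thesis by simp
qed simp

lemma has_sum_spheres:
  fixes F :: "'v \<Rightarrow> complex"
  assumes "summable (\<lambda>n. \<Sum>y\<in>vsphere x n. cmod (F y))"
  shows "(F has_sum (\<Sum>n. \<Sum>y\<in>vsphere x n. F y)) UNIV"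
proof -
  have bij: "bij_betw (\<lambda>y. (d x y, y)) UNIV (Sigma UNIV (vsphere x))"
    by (rule bij_betwI[of _ _ _ snd]) (auto simp: vsphere_def)
  have "(\<lambda>z. norm (case z of (n, y) \<Rightarrow> F y)) summable_on Sigma UNIV (vsphere x)"
    unfolding Infinite_Sum.abs_summable_on_Sigma_iff
  proof (intro conjI ballI)
    show "(\<lambda>n. norm (\<Sum>\<^sub>\<infinity>y\<in>vsphere x n. norm (case (n, y) of (n, y) \<Rightarrow> F y))) summable_on UNIV"
      using assms by (simp add: infsum_finite sum_nonneg summable_on_UNIV_nonneg_real_iff)
  qed auto
  then have S: "(\<lambda>(n, y). F y) summable_on Sigma UNIV (vsphere x)"
    by (rule abs_summable_summable)
  have "infsum F UNIV = infsum (\<lambda>(n, y). F y) (Sigma UNIV (vsphere x))"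
    using infsum_reindex_bij_betw[OF bij, of "\<lambda>(n, y). F y"] by simp
  also have "\<dots> = (\<Sum>\<^sub>\<infinity>n. \<Sum>\<^sub>\<infinity>y\<in>vsphere x n. F y)"
    using infsum_Sigma'_banach[of "\<lambda>n y. F y", OF S] by (rule sym)
  also have "\<dots> = (\<Sum>\<^sub>\<infinity>n. \<Sum>y\<in>vsphere x n. F y)" by (simp only: infsum_finite finite_vsphere)
  also have "\<dots> = (\<Sum>n. \<Sum>y\<in>vsphere x n. F y)"
  proof (rule infsumI, rule norm_summable_imp_has_sum)
    show "summable (\<lambda>n. norm (\<Sum>y\<in>vsphere x n. F y))"
      by (rule summable_comparison_test'[OF assms, of 0]) (simp add: norm_sum)
    then show "(\<lambda>n. \<Sum>y\<in>vsphere x n. F y) sums (\<Sum>n. \<Sum>y\<in>vsphere x n. F y)"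
      by (simp add: summable_norm_cancel summable_sums)
  qed
  finally have "infsum F UNIV = (\<Sum>n. \<Sum>y\<in>vsphere x n. F y)" .
  moreover have "F summable_on UNIV"
    using summable_on_reindex_bij_betw[OF bij, of "\<lambda>(n, y). F y"] S by simp
  ultimately show ?thesis using has_sum_infsum[of F UNIV] by simp
qed

end

section \<open>Laurent series with weighted summable coefficients\<close>

definition weighted_l1 :: "real \<Rightarrow> (int \<Rightarrow> complex) \<Rightarrow> bool" where
  "weighted_l1 R a \<longleftrightarrow> (\<lambda>m. cmod (a m) * R ^ nat \<bar>m\<bar>) summable_on UNIV"

definition conv :: "(int \<Rightarrow> complex) \<Rightarrow> (int \<Rightarrow> complex) \<Rightarrow> int \<Rightarrow> complex" where
  "conv a b N = (\<Sum>\<^sub>\<infinity>m. a m * b (N - m))"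

text \<open>The symbol with coefficients \<open>a\<close>. With the weight \<open>R ^ \<bar>m\<bar>\<close> it converges on the closed annulus
  \<open>1 / R \<le> cmod t \<le> R\<close>, boundary included.\<close>

definition laurent :: "(int \<Rightarrow> complex) \<Rightarrow> complex \<Rightarrow> complex" where
  "laurent a t = (\<Sum>\<^sub>\<infinity>m. a m * t powi m)"

lemma pow_nat_abs_add_le:
  fixes R :: real
  assumes "1 \<le> R"
  shows "R ^ nat \<bar>m + n\<bar> \<le> R ^ nat \<bar>m\<bar> * R ^ nat \<bar>n\<bar>"
  unfolding power_add[symmetric] using assms by (intro power_increasing) auto

lemma norm_powi_le:
  assumes R: "1 \<le> R" and t: "1 / R \<le> cmod t" "cmod t \<le> R"
  shows "cmod (t powi m) \<le> R ^ nat \<bar>m\<bar>"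
proof (cases "m \<ge> 0")
  case True
  then show ?thesis using t by (simp add: power_int_def norm_power power_mono)
next
  case False
  have t0: "0 < cmod t" using t R by (smt (verit) divide_pos_pos)
  then have "1 / cmod t \<le> R" using t R by (simp add: field_simps)
  then have "(1 / cmod t) ^ nat (- m) \<le> R ^ nat (- m)" using t0 by (intro power_mono) auto
  moreover have "cmod (t powi m) = (1 / cmod t) ^ nat (- m)"
    using False by (simp add: power_int_def norm_power norm_inverse power_one_over inverse_eq_divide norm_divide)
  ultimately show ?thesis using False by simp
qed

lemma weighted_l1_pairing:
  assumes a: "weighted_l1 R a" and v: "\<And>m. cmod (v m) \<le> C * R ^ nat \<bar>m\<bar>"
  shows "(\<lambda>m. cmod (a m * v m)) summable_on UNIV"
    and "(\<lambda>m. a m * v m) summable_on UNIV"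
    and "cmod (\<Sum>\<^sub>\<infinity>m. a m * v m) \<le> C * (\<Sum>\<^sub>\<infinity>m. cmod (a m) * R ^ nat \<bar>m\<bar>)"
proof -
  have S: "(\<lambda>m. C * (cmod (a m) * R ^ nat \<bar>m\<bar>)) summable_on UNIV"
    using a unfolding weighted_l1_def by (rule summable_on_cmult_right)
  have le: "cmod (a m * v m) \<le> C * (cmod (a m) * R ^ nat \<bar>m\<bar>)" for m
    using mult_left_mono[OF v[of m] norm_ge_zero[of "a m"]] by (simp add: norm_mult mult_ac)
  show 1: "(\<lambda>m. cmod (a m * v m)) summable_on UNIV"
    by (rule summable_on_comparison_test[OF S]) (use le in auto)
  then show "(\<lambda>m. a m * v m) summable_on UNIV" by (rule abs_summable_summable)
  have "cmod (\<Sum>\<^sub>\<infinity>m. a m * v m) \<le> (\<Sum>\<^sub>\<infinity>m. cmod (a m * v m))"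
    using 1 by (rule norm_infsum_bound)
  also have "\<dots> \<le> (\<Sum>\<^sub>\<infinity>m. C * (cmod (a m) * R ^ nat \<bar>m\<bar>))"
    by (rule infsum_mono[OF 1 S]) (use le in auto)
  also have "\<dots> = C * (\<Sum>\<^sub>\<infinity>m. cmod (a m) * R ^ nat \<bar>m\<bar>)"
    by (rule infsum_cmult_right')
  finally show "cmod (\<Sum>\<^sub>\<infinity>m. a m * v m) \<le> C * (\<Sum>\<^sub>\<infinity>m. cmod (a m) * R ^ nat \<bar>m\<bar>)" .
qed

lemma laurent_summable:
  assumes "weighted_l1 R a" "1 \<le> R" "1 / R \<le> cmod t" "cmod t \<le> R"
  shows "(\<lambda>m. a m * t powi m) summable_on UNIV"
  using weighted_l1_pairing(2)[OF assms(1), of "\<lambda>m. t powi m" 1] norm_powi_le[OF assms(2-4)] by simp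

lemma conv_bound_summable:
  assumes R: "1 \<le> R" and a: "weighted_l1 R a" and b: "weighted_l1 R b"
    and v: "\<And>N. cmod (v N) \<le> C * R ^ nat \<bar>N\<bar>"
  shows "(\<lambda>(m, n). cmod (a m * b n * v (m + n))) summable_on (UNIV \<times> UNIV)"
proof -
  have C: "0 \<le> C" using order_trans[OF norm_ge_zero v[of 0]] by simp
  let ?x = "\<lambda>m. cmod (a m) * R ^ nat \<bar>m\<bar>" and ?y = "\<lambda>m. cmod (b m) * R ^ nat \<bar>m\<bar>"
  have x: "?x summable_on UNIV" and y: "?y summable_on UNIV" using a b by (auto simp: weighted_l1_def)
  have nn: "0 \<le> ?x m" "0 \<le> ?y m" for m using R by auto
  have "(\<lambda>z. norm (case z of (m, n) \<Rightarrow> ?x m * ?y n)) summable_on (UNIV \<times> UNIV)"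
    unfolding Infinite_Sum.abs_summable_on_Sigma_iff
  proof (intro conjI ballI)
    fix m :: int
    show "(\<lambda>n. norm (case (m, n) of (m, n) \<Rightarrow> ?x m * ?y n)) summable_on UNIV"
      using summable_on_cmult_right[OF y, of "?x m"] nn R by (simp add: abs_mult)
  next
    have "(\<lambda>m. ?x m * infsum ?y UNIV) summable_on UNIV"
      by (rule summable_on_cmult_left[OF x])
    moreover have "norm (\<Sum>\<^sub>\<infinity>n. norm (case (m, n) of (m, n) \<Rightarrow> ?x m * ?y n)) = ?x m * infsum ?y UNIV" for m
    proof -
      have "(\<Sum>\<^sub>\<infinity>n. norm (case (m, n) of (m, n) \<Rightarrow> ?x m * ?y n)) = (\<Sum>\<^sub>\<infinity>n. ?x m * ?y n)"
        using R by (simp add: abs_mult)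
      also have "\<dots> = ?x m * infsum ?y UNIV" by (rule infsum_cmult_right')
      finally show ?thesis using nn infsum_nonneg[of UNIV ?y] by simp
    qed
    ultimately show "(\<lambda>m. norm (\<Sum>\<^sub>\<infinity>n. norm (case (m, n) of (m, n) \<Rightarrow> ?x m * ?y n))) summable_on UNIV"
      by (simp only:)
  qed
  moreover have "norm (case z of (m, n) \<Rightarrow> ?x m * ?y n) = (case z of (m, n) \<Rightarrow> ?x m * ?y n)" for z
    using nn R by (auto simp: abs_mult split: prod.splits)
  ultimately have "(\<lambda>(m, n). ?x m * ?y n) summable_on (UNIV \<times> UNIV)" by simp
  then have "(\<lambda>z. C * (case z of (m, n) \<Rightarrow> ?x m * ?y n)) summable_on (UNIV \<times> UNIV)"
    by (rule summable_on_cmult_right)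
  then show ?thesis
  proof (rule summable_on_comparison_test)
    fix z :: "int \<times> int"
    obtain m n where z: "z = (m, n)" by (cases z)
    have "cmod (v (m + n)) \<le> C * (R ^ nat \<bar>m\<bar> * R ^ nat \<bar>n\<bar>)"
      using v[of "m + n"] mult_left_mono[OF pow_nat_abs_add_le[OF R, of m n] C] by linarith
    then have "cmod (a m) * cmod (b n) * cmod (v (m + n)) \<le> cmod (a m) * cmod (b n) * (C * (R ^ nat \<bar>m\<bar> * R ^ nat \<bar>n\<bar>))"
      by (intro mult_left_mono) auto
    then show "(case z of (m, n) \<Rightarrow> cmod (a m * b n * v (m + n))) \<le> C * (case z of (m, n) \<Rightarrow> ?x m * ?y n)"
      by (simp add: z norm_mult mult_ac)
  qed (auto split: prod.splits)
qed

lemma bij_shear: "bij_betw (\<lambda>(N::int, m). (m, N - m)) (UNIV \<times> UNIV) (UNIV \<times> UNIV)"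
  by (rule bij_betwI[of _ _ _ "\<lambda>(m, n). (m + n, m)"]) auto

text \<open>By Fubini, for pairings that depend on \<open>m + n\<close> only. With \<open>v N = t powi N\<close> this says that evaluation is
  multiplicative; with the Chebyshev images of a function it says that symbols compose.\<close>

lemma conv_pairing:
  assumes R: "1 \<le> R" and a: "weighted_l1 R a" and b: "weighted_l1 R b"
    and v: "\<And>N. cmod (v N) \<le> C * R ^ nat \<bar>N\<bar>"
  shows "(\<Sum>\<^sub>\<infinity>m. a m * (\<Sum>\<^sub>\<infinity>n. b n * v (m + n))) = (\<Sum>\<^sub>\<infinity>N. conv a b N * v N)"
proof -
  let ?F = "\<lambda>m n. a m * b n * v (m + n)"
  have "(\<lambda>z. cmod (case z of (m, n) \<Rightarrow> ?F m n)) summable_on (UNIV \<times> UNIV)"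
    using conv_bound_summable[OF R a b v] by (simp add: case_prod_unfold)
  then have S: "(\<lambda>(m, n). ?F m n) summable_on (UNIV \<times> UNIV)" by (rule abs_summable_summable)
  have S': "(\<lambda>(N, m). ?F m (N - m)) summable_on (UNIV \<times> UNIV)"
    using summable_on_reindex_bij_betw[OF bij_shear, of "\<lambda>(m, n). ?F m n"] S
    by (simp add: case_prod_unfold)
  have "(\<Sum>\<^sub>\<infinity>m. a m * (\<Sum>\<^sub>\<infinity>n. b n * v (m + n))) = (\<Sum>\<^sub>\<infinity>m. \<Sum>\<^sub>\<infinity>n. ?F m n)"
    by (simp only: mult.assoc infsum_cmult_right')
  also have "\<dots> = infsum (\<lambda>(m, n). ?F m n) (UNIV \<times> UNIV)"
    by (rule infsum_Sigma'_banach[OF S])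
  also have "\<dots> = infsum (\<lambda>(N, m). ?F m (N - m)) (UNIV \<times> UNIV)"
    using infsum_reindex_bij_betw[OF bij_shear, of "\<lambda>(m, n). ?F m n"]
    by (simp add: case_prod_unfold)
  also have "\<dots> = (\<Sum>\<^sub>\<infinity>N. \<Sum>\<^sub>\<infinity>m. ?F m (N - m))"
    by (rule infsum_Sigma'_banach[OF S', symmetric])
  also have "\<dots> = (\<Sum>\<^sub>\<infinity>N. conv a b N * v N)"
    by (simp add: conv_def infsum_cmult_left')
  finally show ?thesis .
qed

lemma weighted_l1_conv:
  assumes R: "1 \<le> R" and a: "weighted_l1 R a" and b: "weighted_l1 R b"
  shows "weighted_l1 R (conv a b)"
proof -
  let ?v = "\<lambda>N. complex_of_real (R ^ nat \<bar>N\<bar>)"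
  let ?F = "\<lambda>m n. cmod (a m * b n * ?v (m + n))"
  have v: "cmod (?v N) \<le> 1 * R ^ nat \<bar>N\<bar>" for N
    unfolding norm_of_real using R by simp
  have S: "(\<lambda>(m, n). ?F m n) summable_on (UNIV \<times> UNIV)"
    by (rule conv_bound_summable[OF R a b v])
  have S': "(\<lambda>(N, m). ?F m (N - m)) summable_on (UNIV \<times> UNIV)"
    using summable_on_reindex_bij_betw[OF bij_shear, of "\<lambda>(m, n). ?F m n"] S
    by (simp add: case_prod_unfold)
  have T: "(\<lambda>m. ?F m (N - m)) summable_on UNIV" for N
    using summable_on_SigmaD1[OF S', of N] by simp
  have "(\<lambda>N. \<Sum>\<^sub>\<infinity>m. ?F m (N - m)) summable_on UNIV"
    by (rule summable_on_Sigma_banach[OF S'])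
  then show ?thesis unfolding weighted_l1_def
  proof (rule summable_on_comparison_test)
    fix N :: int
    have "conv a b N * ?v N = (\<Sum>\<^sub>\<infinity>m. a m * b (N - m) * ?v (m + (N - m)))"
      by (simp add: conv_def infsum_cmult_left')
    then have "cmod (conv a b N) * cmod (?v N) \<le> (\<Sum>\<^sub>\<infinity>m. ?F m (N - m))"
      using norm_infsum_bound[of "\<lambda>m. a m * b (N - m) * ?v (m + (N - m))" UNIV, OF T[of N]]
      by (simp only: norm_mult[symmetric])
    then show "cmod (conv a b N) * R ^ nat \<bar>N\<bar> \<le> (\<Sum>\<^sub>\<infinity>m. ?F m (N - m))"
      unfolding norm_of_real using R by simp
  qed (use R in auto)
qed

lemma conv_symmetric:
  assumes "\<And>m. a (- m) = a m" "\<And>m. b (- m) = b m"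
  shows "conv a b (- N) = conv a b N"
proof -
  have bij: "bij_betw uminus UNIV (UNIV :: int set)"
    by (rule bij_betwI[of _ _ _ uminus]) auto
  have "conv a b (- N) = (\<Sum>\<^sub>\<infinity>m. a (- m) * b (- N - - m))"
    unfolding conv_def by (rule infsum_reindex_bij_betw[OF bij, symmetric])
  also have "\<dots> = conv a b N"
    unfolding conv_def
  proof (rule infsum_cong)
    fix m show "a (- m) * b (- N - - m) = a m * b (N - m)"
      using assms(1)[of m] assms(2)[of "N - m"] by simp
  qed
  finally show ?thesis .
qed

lemma laurent_conv:
  assumes R: "1 \<le> R" and a: "weighted_l1 R a" and b: "weighted_l1 R b"
    and t: "1 / R \<le> cmod t" "cmod t \<le> R"
  shows "laurent (conv a b) t = laurent a t * laurent b t"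
proof -
  have t0: "t \<noteq> 0" using t R by (smt (verit) divide_pos_pos norm_zero)
  have "laurent (conv a b) t = (\<Sum>\<^sub>\<infinity>m. a m * (\<Sum>\<^sub>\<infinity>n. b n * t powi (m + n)))"
    unfolding laurent_def
    by (rule conv_pairing[OF R a b, of _ 1, symmetric]) (use norm_powi_le[OF R t] in simp)
  also have "\<dots> = (\<Sum>\<^sub>\<infinity>m. a m * t powi m * laurent b t)"
    using t0 by (simp add: power_int_add laurent_def infsum_cmult_right'[symmetric] mult_ac)
  also have "\<dots> = laurent a t * laurent b t"
    by (simp add: infsum_cmult_left' laurent_def)
  finally show ?thesis .
qed

lemma contour_integral_powi:
  assumes r: "0 < r"
  shows "((\<lambda>t. t powi k) has_contour_integral (if k = -1 then 2 * of_real pi * \<i> else 0)) (circlepath 0 r)"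
proof (cases "k = -1")
  case True
  have "((\<lambda>u. 1 / (u - 0)) has_contour_integral (2 * of_real pi * \<i> * 1)) (circlepath 0 r)"
    by (rule Cauchy_integral_circlepath_simple) (use r in auto)
  then show ?thesis using True by (simp add: power_int_minus divide_inverse)
next
  case False
  have "((\<lambda>t. t powi k) has_contour_integral
      (pathfinish (circlepath 0 r) powi (k + 1) / of_int (k + 1)
        - pathstart (circlepath 0 r) powi (k + 1) / of_int (k + 1))) (circlepath 0 r)"
  proof (rule contour_integral_primitive[where S = "- {0}"])
    fix x :: complex assume "x \<in> - {0}"
    moreover have "(of_int k + 1 :: complex) \<noteq> 0"
    proof -
      have "k + 1 \<noteq> 0" using False by simp
      then have "(of_int (k + 1) :: complex) \<noteq> 0" by (simp only: of_int_eq_0_iff not_False_eq_True)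
      then show ?thesis by simp
    qed
    ultimately show "((\<lambda>t. t powi (k + 1) / of_int (k + 1)) has_field_derivative x powi k) (at x within - {0})"
      by (auto intro!: derivative_eq_intros simp: divide_simps)
  qed (use r in auto)
  then show ?thesis using False by simp
qed

text \<open>Termwise integration, where the series is cut off at a finite set beyond which the weights are small.\<close>

lemma laurent_coefficient:
  assumes a: "weighted_l1 R a" and R: "1 \<le> R" and r: "1 / R \<le> r" "r \<le> R"
    and f: "continuous_on (sphere 0 r) f" "\<And>t. cmod t = r \<Longrightarrow> f t = laurent a t"
  shows "((\<lambda>t. f t * t powi (- n - 1)) has_contour_integral 2 * of_real pi * \<i> * a n) (circlepath 0 r)"
proof -
  have r0: "0 < r" using r R by (smt (verit) divide_pos_pos)
  have cont: "continuous_on (path_image (circlepath 0 r)) (\<lambda>t. f t * t powi (- n - 1))"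
    using f(1) r0 by (intro continuous_intros) auto
  define I where "I = contour_integral (circlepath 0 r) (\<lambda>t. f t * t powi (- n - 1))"
  have I: "((\<lambda>t. f t * t powi (- n - 1)) has_contour_integral I) (circlepath 0 r)"
    unfolding I_def using contour_integrable_continuous_circlepath[OF cont]
    by (rule has_contour_integral_integral)
  define w where "w = (\<lambda>m. cmod (a m) * R ^ nat \<bar>m\<bar>)"
  have w: "w summable_on UNIV" using a by (simp add: w_def weighted_l1_def)
  have "cmod (I - 2 * of_real pi * \<i> * a n) \<le> e * (cmod (of_real r powi (- n - 1)) * (2 * pi * r))" if e: "0 < e" for e
  proof -
    have "(sum w \<longlongrightarrow> infsum w UNIV) (finite_subsets_at_top UNIV)"
      using has_sum_infsum[OF w] by (simp add: has_sum_def)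
    from tendstoD[OF this e] obtain X where X: "finite X"
      "\<forall>Y. finite Y \<and> X \<subseteq> Y \<and> Y \<subseteq> UNIV \<longrightarrow> dist (sum w Y) (infsum w UNIV) < e"
      unfolding eventually_finite_subsets_at_top by blast
    define Y where "Y = insert n X"
    have Y: "finite Y" "n \<in> Y" "dist (sum w Y) (infsum w UNIV) < e"
      unfolding Y_def using X(1) X(2)[rule_format, of "insert n X"] by auto
    have wY: "infsum w (- Y) \<le> e"
    proof -
      have "infsum w (UNIV - Y) = infsum w UNIV - infsum w Y"
        by (rule infsum_Diff[OF w]) (use Y in auto)
      then show ?thesis using Y by (simp add: Compl_eq_Diff_UNIV dist_real_def)
    qed
    have "((\<lambda>t. \<Sum>m\<in>Y. a m * t powi (m - n - 1)) has_contour_integral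
        (\<Sum>m\<in>Y. a m * (if m - n - 1 = -1 then 2 * of_real pi * \<i> else 0))) (circlepath 0 r)"
      by (intro has_contour_integral_sum has_contour_integral_lmul contour_integral_powi r0 Y)
    moreover have "(\<Sum>m\<in>Y. a m * (if m - n - 1 = -1 then 2 * of_real pi * \<i> else 0)) = 2 * of_real pi * \<i> * a n"
    proof -
      have "(\<Sum>m\<in>Y. a m * (if m - n - 1 = -1 then 2 * of_real pi * \<i> else 0))
          = (\<Sum>m\<in>Y. if n = m then 2 * of_real pi * \<i> * a n else 0)"
        by (intro sum.cong) auto
      then show ?thesis using Y by simp
    qed
    ultimately have P: "((\<lambda>t. f t * t powi (- n - 1) - (\<Sum>m\<in>Y. a m * t powi (m - n - 1)))
        has_contour_integral (I - 2 * of_real pi * \<i> * a n)) (circlepath 0 r)"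
      using has_contour_integral_diff[OF I] by simp
    have "cmod (I - 2 * of_real pi * \<i> * a n) \<le> (e * cmod (of_real r powi (- n - 1))) * (2 * pi * r)"
    proof (rule has_contour_integral_bound_circlepath[OF P _ r0])
      fix t :: complex assume "cmod (t - 0) = r"
      then have t: "cmod t = r" by simp
      then have t0: "t \<noteq> 0" using r0 by auto
      have le: "cmod (t powi m) \<le> R ^ nat \<bar>m\<bar>" for m by (rule norm_powi_le[OF R]) (use t r in auto)
      have S: "(\<lambda>m. a m * t powi m) summable_on UNIV" by (rule laurent_summable[OF a R]) (use t r in auto)
      have wle: "cmod (a m * t powi m) \<le> w m" for m
        unfolding w_def norm_mult using le[of m] by (intro mult_left_mono) auto
      have wC: "w summable_on (- Y)" using w by (rule summable_on_subset_banach) simp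
      have Sn: "(\<lambda>m. norm (a m * t powi m)) summable_on (- Y)"
        by (rule summable_on_comparison_test[OF wC]) (use wle in auto)
      have "f t - (\<Sum>m\<in>Y. a m * t powi m) = (\<Sum>\<^sub>\<infinity>m\<in>-Y. a m * t powi m)"
        using infsum_Diff[OF S, of Y] Y f(2)[OF t] by (simp add: laurent_def Compl_eq_Diff_UNIV)
      then have "cmod (f t - (\<Sum>m\<in>Y. a m * t powi m)) \<le> (\<Sum>\<^sub>\<infinity>m\<in>-Y. cmod (a m * t powi m))"
        using norm_infsum_bound[OF Sn] by simp
      also have "\<dots> \<le> infsum w (- Y)" by (rule infsum_mono[OF Sn wC]) (use wle in auto)
      finally have 1: "cmod (f t - (\<Sum>m\<in>Y. a m * t powi m)) \<le> e" using wY by simp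
      have "f t * t powi (- n - 1) - (\<Sum>m\<in>Y. a m * t powi (m - n - 1))
          = (f t - (\<Sum>m\<in>Y. a m * t powi m)) * t powi (- n - 1)"
      proof -
        have "t powi (m - n - 1) = t powi m * t powi (- n - 1)" for m
          using t0 power_int_add[of t m "- n - 1"] by (simp add: algebra_simps)
        then show ?thesis by (simp add: left_diff_distrib sum_distrib_right mult.assoc)
      qed
      moreover have "cmod (t powi (- n - 1)) = cmod (of_real r powi (- n - 1))"
        using t r0 by (simp add: norm_power_int)
      ultimately show "cmod (f t * t powi (- n - 1) - (\<Sum>m\<in>Y. a m * t powi (m - n - 1)))
          \<le> e * cmod (of_real r powi (- n - 1))"
        using 1 by (simp add: norm_mult mult_right_mono)
    qed (use e in auto)
    then show ?thesis by (simp add: mult.assoc)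
  qed
  then have "cmod (I - 2 * of_real pi * \<i> * a n) \<le> 0"
  proof -
    assume H: "\<And>e. 0 < e \<Longrightarrow> cmod (I - 2 * of_real pi * \<i> * a n) \<le> e * (cmod (of_real r powi (- n - 1)) * (2 * pi * r))"
    define K where "K = cmod (complex_of_real r powi (- n - 1)) * (2 * pi * r) + 1"
    have K: "0 < K" using r0 by (simp add: K_def add_nonneg_pos)
    show ?thesis
    proof (rule field_le_epsilon)
      fix e :: real assume e: "0 < e"
      have "cmod (I - 2 * of_real pi * \<i> * a n) \<le> (e / K) * (K - 1)"
        using H[of "e / K"] e K by (simp add: K_def)
      also have "\<dots> \<le> 0 + e" using e K by (simp add: field_simps)
      finally show "cmod (I - 2 * of_real pi * \<i> * a n) \<le> 0 + e" .
    qed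
  qed
  then show ?thesis using I by simp
qed

section \<open>Laurent expansion on an annulus\<close>

definition annulus :: "real \<Rightarrow> real \<Rightarrow> complex set" where
  "annulus r1 r2 = {t. r1 < cmod t \<and> cmod t < r2}"

lemma open_annulus: "open (annulus r1 r2)"
  unfolding annulus_def by (intro open_Collect_conj open_Collect_less continuous_intros)

lemma connected_annulus_0: "connected (annulus r1 r2)"
  using connected_annulus(1)[of r1 "0::complex" r2] by (simp add: annulus_def)

lemma contour_integral_circlepath_annulus:
  assumes g: "g holomorphic_on annulus r1 r2"
    and r: "0 \<le> r1" "r1 < r" "r < r2" "r1 < s" "s < r2"
  shows "contour_integral (circlepath 0 r) g = contour_integral (circlepath 0 s) g"
proof (rule Cauchy_theorem_homotopic_loops[where S = "annulus r1 r2"])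
  show "homotopic_loops (annulus r1 r2) (circlepath 0 r) (circlepath 0 s)"
  proof (rule homotopic_loops_linear)
    fix u :: real
    show "closed_segment (circlepath 0 r u) (circlepath 0 s u) \<subseteq> annulus r1 r2"
    proof
      fix x assume "x \<in> closed_segment (circlepath 0 r u) (circlepath 0 s u)"
      then obtain v where v: "0 \<le> v" "v \<le> 1" "x = (1 - v) *\<^sub>R circlepath 0 r u + v *\<^sub>R circlepath 0 s u"
        by (auto simp: in_segment)
      have "x = of_real ((1 - v) * r + v * s) * exp (2 * of_real pi * \<i> * of_real u)"
        using v(3) by (simp add: circlepath scaleR_conv_of_real algebra_simps)
      moreover have "cmod (exp (2 * of_real pi * \<i> * of_real u)) = 1" by simp
      ultimately have "cmod x = \<bar>(1 - v) * r + v * s\<bar>" by (simp only: norm_mult norm_of_real mult_1_right)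
      moreover have "r1 < (1 - v) * r + v * s" "(1 - v) * r + v * s < r2"
        using convex_bound_lt[of "-r" "-r1" "-s" "1 - v" v] convex_bound_lt[of r r2 s "1 - v" v] v r
        by (auto simp: algebra_simps)
      ultimately show "x \<in> annulus r1 r2" using r by (simp add: annulus_def)
    qed
  qed auto
qed (use g open_annulus in auto)

text \<open>The geometric series may be integrated term by term as the ratio is bounded by \<open>c < 1\<close>.\<close>

lemma contour_integral_geometric:
  assumes r: "0 < r" and h: "continuous_on (sphere 0 r) h" and x: "continuous_on (sphere 0 r) x"
    and bound: "\<And>w. cmod w = r \<Longrightarrow> cmod (x w) \<le> c" and c: "c < 1"
  shows "(\<lambda>n. contour_integral (circlepath 0 r) (\<lambda>w. h w * x w ^ n))
           sums contour_integral (circlepath 0 r) (\<lambda>w. h w / (1 - x w))"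
proof -
  have c0: "0 \<le> c" using order_trans[OF norm_ge_zero bound[of "of_real r"]] r by simp
  have "compact (h ` sphere 0 r)" by (rule compact_continuous_image[OF h]) simp
  then obtain K where K: "\<And>w. cmod w = r \<Longrightarrow> cmod (h w) \<le> K"
    by (force dest: compact_imp_bounded simp: bounded_iff)
  have K0: "0 \<le> K" using order_trans[OF norm_ge_zero K[of "of_real r"]] r by simp
  have xlt: "cmod (x w) < 1" if "cmod w = r" for w using bound[OF that] c by simp
  have int: "(\<lambda>w. h w * x w ^ n) contour_integrable_on circlepath 0 r" for n
    using r h x by (intro contour_integrable_continuous_circlepath continuous_intros) auto
  have ul: "uniform_limit (sphere 0 r) (\<lambda>n w. \<Sum>i<n. h w * x w ^ i) (\<lambda>w. \<Sum>i. h w * x w ^ i) sequentially"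
  proof (rule Weierstrass_m_test)
    show "norm (h w * x w ^ n) \<le> K * c ^ n" if "w \<in> sphere 0 r" for n w
      using that K[of w] bound[of w] K0 c0 by (simp add: norm_mult norm_power mult_mono power_mono)
    show "summable (\<lambda>n. K * c ^ n)" using c c0 by (intro summable_mult summable_geometric) auto
  qed
  then have "uniform_limit (sphere 0 r) (\<lambda>n w. \<Sum>i<n. h w * x w ^ i) (\<lambda>w. h w / (1 - x w)) sequentially"
  proof (rule uniform_limit_cong'[THEN iffD1, rotated -1])
    show "(\<Sum>i. h w * x w ^ i) = h w / (1 - x w)" if "w \<in> sphere 0 r" for w
      using that xlt[of w] suminf_mult[OF summable_geometric, of "x w" "h w"] suminf_geometric[of "x w"] by simp
  qed auto
  then have "(\<lambda>n. contour_integral (circlepath 0 r) (\<lambda>w. \<Sum>i<n. h w * x w ^ i))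
      \<longlonglongrightarrow> contour_integral (circlepath 0 r) (\<lambda>w. h w / (1 - x w))"
    using r int by (intro contour_integral_uniform_limit_circlepath(2)) (auto intro!: always_eventually contour_integrable_sum)
  moreover have "contour_integral (circlepath 0 r) (\<lambda>w. \<Sum>i<n. h w * x w ^ i)
      = (\<Sum>i<n. contour_integral (circlepath 0 r) (\<lambda>w. h w * x w ^ i))" for n
    using int by (intro contour_integral_sum) auto
  ultimately show ?thesis by (simp add: sums_def)
qed

text \<open>The difference quotient of \<open>H\<close> at \<open>u\<close> is holomorphic, so its integrals over both circles agree, and only the outer
  circle winds around \<open>u\<close>.\<close>

lemma cauchy_annulus:
  assumes H: "H holomorphic_on annulus r1 r2" and r: "0 \<le> r1" "r1 < s" "s < r" "r < r2"
    and u: "s < cmod u" "cmod u < r"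
  shows "2 * of_real pi * \<i> * H u =
           contour_integral (circlepath 0 r) (\<lambda>w. H w / (w - u)) - contour_integral (circlepath 0 s) (\<lambda>w. H w / (w - u))"
proof -
  define g where "g = (\<lambda>w. if w = u then deriv H u else (H w - H u) / (w - u))"
  have "g holomorphic_on annulus r1 r2"
    unfolding g_def by (rule pole_lemma_open[OF H open_annulus])
  then have eq: "contour_integral (circlepath 0 r) g = contour_integral (circlepath 0 s) g"
    by (rule contour_integral_circlepath_annulus) (use r in auto)
  have split: "contour_integral (circlepath 0 x) g
      = contour_integral (circlepath 0 x) (\<lambda>w. H w / (w - u)) - contour_integral (circlepath 0 x) (\<lambda>w. H u / (w - u))"
    if x: "r1 < x" "x < r2" "x \<noteq> cmod u" for x
  proof -
    have Hc: "continuous_on (sphere 0 x) H"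
      by (rule holomorphic_on_imp_continuous_on[THEN continuous_on_subset, OF H])
         (use x in \<open>auto simp: annulus_def\<close>)
    have "contour_integral (circlepath 0 x) g = contour_integral (circlepath 0 x) (\<lambda>w. H w / (w - u) - H u / (w - u))"
      by (rule contour_integral_cong) (use x r in \<open>auto simp: g_def diff_divide_distrib\<close>)
    also have "\<dots> = contour_integral (circlepath 0 x) (\<lambda>w. H w / (w - u)) - contour_integral (circlepath 0 x) (\<lambda>w. H u / (w - u))"
      by (intro contour_integral_diff contour_integrable_continuous_circlepath continuous_intros)
         (use x r Hc in auto)
    finally show ?thesis .
  qed
  have "contour_integral (circlepath 0 r) (\<lambda>w. H u / (w - u)) = 2 * of_real pi * \<i> * H u"
    by (rule contour_integral_unique, rule Cauchy_integral_circlepath_simple[of "\<lambda>_. H u"]) (use u in auto)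
  moreover have "contour_integral (circlepath 0 s) (\<lambda>w. H u / (w - u)) = 0"
  proof (rule contour_integral_unique, rule Cauchy_theorem_convex_simple[of _ "ball 0 (cmod u)"])
    show "(\<lambda>w. H u / (w - u)) holomorphic_on ball 0 (cmod u)"
      by (intro holomorphic_intros) auto
  qed (use u r in auto)
  moreover have "contour_integral (circlepath 0 r) g
      = contour_integral (circlepath 0 r) (\<lambda>w. H w / (w - u)) - contour_integral (circlepath 0 r) (\<lambda>w. H u / (w - u))"
    by (rule split) (use u r in auto)
  moreover have "contour_integral (circlepath 0 s) g
      = contour_integral (circlepath 0 s) (\<lambda>w. H w / (w - u)) - contour_integral (circlepath 0 s) (\<lambda>w. H u / (w - u))"
    by (rule split) (use u r in auto)
  ultimately show ?thesis using eq by (simp add: algebra_simps)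
qed

lemma has_sum_int_split:
  fixes f :: "int \<Rightarrow> complex"
  assumes "summable (\<lambda>n. cmod (f (int n)))" "(\<lambda>n. f (int n)) sums x"
    and "summable (\<lambda>n. cmod (f (- int n - 1)))" "(\<lambda>n. f (- int n - 1)) sums y"
  shows "(f has_sum (x + y)) UNIV"
proof -
  have b1: "bij_betw int UNIV {0..}" by (rule bij_betwI[of _ _ _ nat]) auto
  have b2: "bij_betw (\<lambda>n. - int n - 1) UNIV {..<0}" by (rule bij_betwI[of _ _ _ "\<lambda>m. nat (- m - 1)"]) auto
  have "(f has_sum x) {0..}"
    using has_sum_reindex_bij_betw[OF b1, of f x] norm_summable_imp_has_sum[OF assms(1,2)] by simp
  moreover have "(f has_sum y) {..<0}"
    using has_sum_reindex_bij_betw[OF b2, of f y] norm_summable_imp_has_sum[OF assms(3,4)] by simp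
  ultimately have "(f has_sum (x + y)) ({0..} \<union> {..<0})" by (rule has_sum_Un_disjoint) auto
  moreover have "{0..} \<union> {..<0} = (UNIV :: int set)" by auto
  ultimately show ?thesis by simp
qed

lemma summable_on_int_decay:
  fixes c :: real
  assumes "0 \<le> c" "c < 1"
  shows "(\<lambda>m::int. c ^ nat \<bar>m\<bar>) summable_on UNIV"
proof -
  let ?f = "\<lambda>m::int. complex_of_real (c ^ nat \<bar>m\<bar>)"
  have e: "nat \<bar>- int n - 1\<bar> = Suc n" for n by linarith
  have s: "summable (\<lambda>n. c ^ n)" using assms by (intro summable_geometric) auto
  have s': "summable (\<lambda>n. c ^ Suc n)" using s by (subst summable_Suc_iff)
  have n: "cmod (?f m) = c ^ nat \<bar>m\<bar>" for m unfolding norm_of_real using assms by simp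
  have 1: "summable (\<lambda>n. cmod (?f (int n)))" using s by (simp only: n) simp
  have 2: "summable (\<lambda>n. cmod (?f (- int n - 1)))" proof -
    have "cmod (?f (- int n - 1)) = c ^ Suc n" for n
      by (subst n) (simp only: e)
    then show ?thesis using s' by (simp only:)
  qed
  have "?f summable_on UNIV"
    using has_sum_int_split[OF 1 summable_sums[OF summable_norm_cancel[OF 1]] 2 summable_sums[OF summable_norm_cancel[OF 2]]]
    by (rule has_sum_imp_summable)
  then have "(\<lambda>x. cmod (?f x)) summable_on UNIV" by (simp only: summable_on_iff_abs_summable_on_complex)
  then show ?thesis by (simp only: n)
qed

lemma weighted_l1_if_decay:
  assumes a: "\<And>m. cmod (a m) \<le> C / \<rho> ^ nat \<bar>m\<bar>" and R: "0 < R" "R < \<rho>"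
  shows "weighted_l1 R a"
proof -
  have "(\<lambda>m::int. C * (R / \<rho>) ^ nat \<bar>m\<bar>) summable_on UNIV"
    using R by (intro summable_on_cmult_right summable_on_int_decay) auto
  then show ?thesis unfolding weighted_l1_def
  proof (rule summable_on_comparison_test)
    fix m
    show "cmod (a m) * R ^ nat \<bar>m\<bar> \<le> C * (R / \<rho>) ^ nat \<bar>m\<bar>"
      using mult_right_mono[OF a[of m], of "R ^ nat \<bar>m\<bar>"] R by (simp add: power_divide)
  qed (use R in auto)
qed

text \<open>The Cauchy kernel is expanded in a geometric series on each of two circles. Coefficients computed on circles of
  different radii agree, which gives decay at every rate below \<open>S\<close>; invariance of \<open>H\<close> allows them to be symmetrised.\<close>

lemma laurent_expansion:
  assumes H: "H holomorphic_on annulus (1 / S) S" and S: "1 < S"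
    and sym: "\<And>t. t \<noteq> 0 \<Longrightarrow> H (1 / t) = H t"
  obtains a where
    "\<And>m. a (- m) = a m"
    "\<And>\<rho>. 1 < \<rho> \<Longrightarrow> \<rho> < S \<Longrightarrow> \<exists>C. \<forall>m. cmod (a m) \<le> C / \<rho> ^ nat \<bar>m\<bar>"
    "\<And>t. 1 / S < cmod t \<Longrightarrow> cmod t < S \<Longrightarrow> H t = laurent a t"
proof -
  define c where "c = (\<lambda>m r. contour_integral (circlepath 0 r) (\<lambda>w. H w * w powi (- m - 1)) / (2 * of_real pi * \<i>))"
  define a0 where "a0 = (\<lambda>m. c m 1)"
  define a where "a = (\<lambda>m. (a0 m + a0 (- m)) / 2)"
  have S1: "1 / S < 1" "0 < 1 / S" using S by auto
  have indep: "c m r = a0 m" if "1 / S < r" "r < S" for m r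
  proof -
    have "(\<lambda>w. H w * w powi (- m - 1)) holomorphic_on annulus (1 / S) S"
      using S1 by (intro holomorphic_intros H) (auto simp: annulus_def)
    from contour_integral_circlepath_annulus[OF this, of r 1] show ?thesis
      using that S S1 by (simp add: c_def a0_def)
  qed
  have cont: "continuous_on (sphere 0 r) H" if "1 / S < r" "r < S" for r
    by (rule holomorphic_on_imp_continuous_on[THEN continuous_on_subset, OF H])
       (use that in \<open>auto simp: annulus_def\<close>)
  have bound: "\<exists>K\<ge>0. \<forall>m. cmod (a0 m) \<le> K * r powi (- m)" if r: "1 / S < r" "r < S" for r
  proof -
    have r0: "0 < r" using r S1 by linarith
    have "compact (H ` sphere 0 r)" by (rule compact_continuous_image[OF cont[OF r]]) simp
    then obtain K where K: "\<And>w. cmod w = r \<Longrightarrow> cmod (H w) \<le> K"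
      by (force dest: compact_imp_bounded simp: bounded_iff)
    have K0: "0 \<le> K" using order_trans[OF norm_ge_zero K[of "of_real r"]] r0 by simp
    have "cmod (a0 m) \<le> K * r powi (- m)" for m
    proof -
      have int: "(\<lambda>w. H w * w powi (- m - 1)) contour_integrable_on circlepath 0 r"
        using r0 cont[OF r] by (intro contour_integrable_continuous_circlepath continuous_intros) auto
      have "cmod (contour_integral (circlepath 0 r) (\<lambda>w. H w * w powi (- m - 1))) \<le> (K * r powi (- m - 1)) * (2 * pi * r)"
        by (rule has_contour_integral_bound_circlepath[OF has_contour_integral_integral[OF int]])
           (use r0 K K0 in \<open>auto simp: norm_mult norm_power_int intro!: mult_right_mono\<close>)
      also have "\<dots> = K * (r powi (- m - 1) * r) * (2 * pi)" by (simp add: mult_ac)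
      also have "r powi (- m - 1) * r = r powi (- m)"
        using r0 power_int_add_1[of r "- m - 1"] by simp
      finally show ?thesis
        unfolding indep[OF r, symmetric] c_def by (simp add: norm_divide norm_mult field_simps)
    qed
    then show ?thesis using K0 by blast
  qed
  have decay0: "\<exists>C\<ge>0. \<forall>m. cmod (a0 m) \<le> C / \<rho> ^ nat \<bar>m\<bar>" if \<rho>: "1 < \<rho>" "\<rho> < S" for \<rho>
  proof -
    have "1 / S < 1 / \<rho>" "1 / \<rho> < S" using \<rho> S by (auto simp: field_simps intro: order.strict_trans)
    moreover have "1 / S < \<rho>" using S1 \<rho> by linarith
    ultimately obtain K1 K2 where K: "K1 \<ge> 0" "K2 \<ge> 0" "\<And>m. cmod (a0 m) \<le> K1 * \<rho> powi (- m)" "\<And>m. cmod (a0 m) \<le> K2 * (1 / \<rho>) powi (- m)"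
      using bound[of \<rho>] bound[of "1 / \<rho>"] \<rho> by metis
    have "cmod (a0 m) \<le> max K1 K2 / \<rho> ^ nat \<bar>m\<bar>" for m
    proof (cases "m \<ge> 0")
      case True
      then have "\<rho> powi (- m) = 1 / \<rho> ^ nat \<bar>m\<bar>" by (simp add: power_int_minus power_int_def divide_inverse power_inverse)
      then have "cmod (a0 m) \<le> K1 / \<rho> ^ nat \<bar>m\<bar>" using K(3)[of m] by simp
      also have "\<dots> \<le> max K1 K2 / \<rho> ^ nat \<bar>m\<bar>" using \<rho> by (intro divide_right_mono) auto
      finally show ?thesis .
    next
      case False
      then have "(1 / \<rho>) powi (- m) = 1 / \<rho> ^ nat \<bar>m\<bar>" by (simp add: power_int_def power_divide)
      then have "cmod (a0 m) \<le> K2 / \<rho> ^ nat \<bar>m\<bar>" using K(4)[of m] by simp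
      also have "\<dots> \<le> max K1 K2 / \<rho> ^ nat \<bar>m\<bar>" using \<rho> by (intro divide_right_mono) auto
      finally show ?thesis .
    qed
    then show ?thesis using K(1) by (intro exI[of _ "max K1 K2"]) auto
  qed
  have expand0: "H u = laurent a0 u" if u: "1 / S < cmod u" "cmod u < S" for u
  proof -
    obtain r where r: "max 1 (cmod u) < r" "r < S" using dense[of "max 1 (cmod u)" S] u S by auto
    obtain s where s: "1 / S < s" "s < min 1 (cmod u)" using dense[of "1 / S" "min 1 (cmod u)"] u S1 by auto
    have s0: "0 < s" "0 < r" using s S1 r by linarith+
    have rr: "1 / S < r" "s < S" using r s S1 S by auto
    have u0: "u \<noteq> 0" using s s0 by auto
    let ?i = "2 * of_real pi * \<i> :: complex"
    have 1: "(\<lambda>n. contour_integral (circlepath 0 r) (\<lambda>w. H w / w * (u / w) ^ n))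
        sums contour_integral (circlepath 0 r) (\<lambda>w. H w / w / (1 - u / w))"
      by (rule contour_integral_geometric[where c = "cmod u / r"])
         (use r s0 rr cont[of r] in \<open>auto simp: norm_divide intro!: continuous_intros\<close>)
    have e1: "contour_integral (circlepath 0 r) (\<lambda>w. H w / w * (u / w) ^ n) = ?i * (a0 (int n) * u powi (int n))" for n
    proof -
      have "contour_integral (circlepath 0 r) (\<lambda>w. H w / w * (u / w) ^ n)
          = contour_integral (circlepath 0 r) (\<lambda>w. u ^ n * (H w * w powi (- int n - 1)))"
      proof (rule contour_integral_cong)
        fix w assume "w \<in> path_image (circlepath 0 r)"
        then have "w \<noteq> 0" using s0 by auto
        then show "H w / w * (u / w) ^ n = u ^ n * (H w * w powi (- int n - 1))"
          by (simp add: power_int_diff power_int_minus power_divide divide_inverse mult_ac power_mult_distrib power_inverse)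
      qed simp
      also have "\<dots> = u ^ n * contour_integral (circlepath 0 r) (\<lambda>w. H w * w powi (- int n - 1))"
        by (intro contour_integral_lmul contour_integrable_continuous_circlepath continuous_intros)
           (use s0 cont[of r] rr r in auto)
      also have "\<dots> = ?i * (a0 (int n) * u powi (int n))"
        using indep[of r "int n"] rr r by (simp add: c_def field_simps)
      finally show ?thesis .
    qed
    have r1: "contour_integral (circlepath 0 r) (\<lambda>w. H w / w / (1 - u / w))
        = contour_integral (circlepath 0 r) (\<lambda>w. H w / (w - u))"
    proof (rule contour_integral_cong)
      fix w assume "w \<in> path_image (circlepath 0 r)"
      then have "w \<noteq> 0" "w \<noteq> u" using s0 r by auto
      then show "H w / w / (1 - u / w) = H w / (w - u)" by (simp add: field_simps)
    qed simp
    have 2: "(\<lambda>n. contour_integral (circlepath 0 s) (\<lambda>w. H w / u * (w / u) ^ n))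
        sums contour_integral (circlepath 0 s) (\<lambda>w. H w / u / (1 - w / u))"
      by (rule contour_integral_geometric[where c = "s / cmod u"])
         (use s s0 rr u0 cont[of s] in \<open>auto simp: norm_divide intro!: continuous_intros\<close>)
    have e2: "contour_integral (circlepath 0 s) (\<lambda>w. H w / u * (w / u) ^ n) = ?i * (a0 (- int n - 1) * u powi (- int n - 1))" for n
    proof -
      have "contour_integral (circlepath 0 s) (\<lambda>w. H w / u * (w / u) ^ n)
          = contour_integral (circlepath 0 s) (\<lambda>w. u powi (- int n - 1) * (H w * w powi (- (- int n - 1) - 1)))"
      proof (rule contour_integral_cong)
        fix w assume "w \<in> path_image (circlepath 0 s)"
        then have "w \<noteq> 0" using s0 by auto
        then show "H w / u * (w / u) ^ n = u powi (- int n - 1) * (H w * w powi (- (- int n - 1) - 1))"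
          using u0 by (simp add: power_int_diff power_int_minus power_divide divide_inverse mult_ac power_mult_distrib power_inverse)
      qed simp
      also have "\<dots> = u powi (- int n - 1) * contour_integral (circlepath 0 s) (\<lambda>w. H w * w powi (- (- int n - 1) - 1))"
        by (intro contour_integral_lmul contour_integrable_continuous_circlepath continuous_intros)
           (use s0 cont[of s] rr s in auto)
      also have "\<dots> = ?i * (a0 (- int n - 1) * u powi (- int n - 1))"
        using indep[of s "- int n - 1"] rr s by (simp add: c_def field_simps)
      finally show ?thesis .
    qed
    have r2: "contour_integral (circlepath 0 s) (\<lambda>w. H w / u / (1 - w / u))
        = - contour_integral (circlepath 0 s) (\<lambda>w. H w / (w - u))"
    proof -
      have "contour_integral (circlepath 0 s) (\<lambda>w. H w / u / (1 - w / u))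
        = contour_integral (circlepath 0 s) (\<lambda>w. - (H w / (w - u)))"
      proof (rule contour_integral_cong)
        fix w assume "w \<in> path_image (circlepath 0 s)"
        then have "w \<noteq> u" using s0 s by auto
        then show "H w / u / (1 - w / u) = - (H w / (w - u))"
          using u0 by (simp add: divide_simps) (simp add: algebra_simps)
      qed simp
      then show ?thesis by (simp add: contour_integral_neg)
    qed
    obtain \<rho> where \<rho>: "max (max 1 (cmod u)) (1 / cmod u) < \<rho>" "\<rho> < S"
    proof -
      have "max (max 1 (cmod u)) (1 / cmod u) < S" using u S S1 u0 by (auto simp: field_simps)
      then show ?thesis using that dense by blast
    qed
    then obtain C where C: "\<And>m. cmod (a0 m) \<le> C / \<rho> ^ nat \<bar>m\<bar>" using decay0[of \<rho>] by auto
    define q where "q = max (max 1 (cmod u)) (1 / cmod u)"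
    have w: "weighted_l1 q a0" by (rule weighted_l1_if_decay[OF C]) (use \<rho> in \<open>auto simp: q_def\<close>)
    have q: "1 \<le> q" "1 / q \<le> cmod u" "cmod u \<le> q"
    proof -
      have le: "1 / cmod u \<le> q" "0 < cmod u" using u0 by (auto simp: q_def)
      show "1 \<le> q" "cmod u \<le> q" by (auto simp: q_def)
      then show "1 / q \<le> cmod u"
        using le by (simp add: pos_divide_le_eq mult.commute)
    qed
    have abs: "(\<lambda>m. cmod (a0 m * u powi m)) summable_on UNIV"
      by (rule weighted_l1_pairing(1)[OF w, of _ 1]) (use norm_powi_le[OF q] in simp)
    have ab1: "summable (\<lambda>n. cmod (a0 (int n) * u powi (int n)))"
    proof -
      have "(\<lambda>n. cmod (a0 (int n) * u powi (int n))) summable_on UNIV"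
        using summable_on_subset_banach[OF abs, of "range int"] summable_on_reindex[of int UNIV "\<lambda>m. cmod (a0 m * u powi m)"]
        by (simp add: o_def)
      then show ?thesis by (rule summable_on_imp_summable)
    qed
    have ab2: "summable (\<lambda>n. cmod (a0 (- int n - 1) * u powi (- int n - 1)))"
    proof -
      have "inj (\<lambda>n. - int n - 1)" by (auto simp: inj_def)
      then have "(\<lambda>n. cmod (a0 (- int n - 1) * u powi (- int n - 1))) summable_on UNIV"
        using summable_on_subset_banach[OF abs, of "range (\<lambda>n. - int n - 1)"]
          summable_on_reindex[of "\<lambda>n. - int n - 1" UNIV "\<lambda>m. cmod (a0 m * u powi m)"]
        by (simp add: o_def)
      then show ?thesis by (rule summable_on_imp_summable)
    qed
    have s1: "(\<lambda>n. a0 (int n) * u powi (int n)) sums (contour_integral (circlepath 0 r) (\<lambda>w. H w / (w - u)) / ?i)"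
      using sums_divide[OF 1[unfolded e1 r1], of ?i] by simp
    have s2: "(\<lambda>n. a0 (- int n - 1) * u powi (- int n - 1)) sums (- contour_integral (circlepath 0 s) (\<lambda>w. H w / (w - u)) / ?i)"
      using sums_divide[OF 2[unfolded e2 r2], of ?i] by simp
    have "((\<lambda>m. a0 m * u powi m) has_sum (contour_integral (circlepath 0 r) (\<lambda>w. H w / (w - u)) / ?i
        + - contour_integral (circlepath 0 s) (\<lambda>w. H w / (w - u)) / ?i)) UNIV"
      by (rule has_sum_int_split[OF ab1 s1 ab2 s2])
    moreover have "contour_integral (circlepath 0 r) (\<lambda>w. H w / (w - u)) / ?i
        + - contour_integral (circlepath 0 s) (\<lambda>w. H w / (w - u)) / ?i = H u"
      using cauchy_annulus[OF H, of s r u] s r S1 u by (simp add: field_simps)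
    ultimately show ?thesis by (simp add: laurent_def infsumI)
  qed
  show ?thesis
  proof
    show "a (- m) = a m" for m by (simp add: a_def)
    fix \<rho> :: real assume "1 < \<rho>" "\<rho> < S"
    then obtain C where C: "\<And>m. cmod (a0 m) \<le> C / \<rho> ^ nat \<bar>m\<bar>" using decay0 by blast
    have "cmod (a m) \<le> C / \<rho> ^ nat \<bar>m\<bar>" for m
    proof -
      have "cmod (a m) = cmod (a0 m + a0 (- m)) / 2" by (simp add: a_def norm_divide)
      moreover have "cmod (a0 (- m)) \<le> C / \<rho> ^ nat \<bar>m\<bar>" using C[of "- m"] by simp
      ultimately show ?thesis
        using norm_triangle_ineq[of "a0 m" "a0 (- m)"] C[of m] by linarith
    qed
    then show "\<exists>C. \<forall>m. cmod (a m) \<le> C / \<rho> ^ nat \<bar>m\<bar>" by blast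
  next
    fix t assume t: "1 / S < cmod t" "cmod t < S"
    then have t0: "t \<noteq> 0" using S1 by auto
    have t': "1 / S < cmod (1 / t)" "cmod (1 / t) < S" using t t0 S by (auto simp: norm_divide field_simps)
    define q where "q = max (cmod t) (1 / cmod t)"
    have q: "1 \<le> q" "1 / q \<le> cmod t" "cmod t \<le> q" "1 / q \<le> cmod (1 / t)" "cmod (1 / t) \<le> q" "q < S"
    proof -
      have le: "1 / cmod t \<le> q" "0 < cmod t" "cmod t \<le> q" using t0 by (auto simp: q_def)
      then have q0: "0 < q" by linarith
      have 1: "1 \<le> q * cmod t" using le by (simp add: pos_divide_le_eq)
      show "1 / q \<le> cmod t" using 1 q0 by (simp add: pos_divide_le_eq mult.commute)
      show "cmod t \<le> q" using le by simp
      show "cmod (1 / t) \<le> q" using le by (simp add: norm_divide)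
      have "1 / q \<le> 1 / cmod t" using le q0 by (intro divide_left_mono mult_pos_pos) auto
      then show "1 / q \<le> cmod (1 / t)" by (simp add: norm_divide)
      have "1 \<le> q * q" using 1 mult_left_mono[OF le(3), of q] q0 by linarith
      then have "1\<^sup>2 \<le> q\<^sup>2" by (simp add: power2_eq_square)
      then show "1 \<le> q" using q0 by (rule power2_le_imp_le[OF _ less_imp_le])
      show "q < S" using t t' by (auto simp: q_def norm_divide)
    qed
    obtain \<rho> where \<rho>: "q < \<rho>" "\<rho> < S" using dense q by blast
    then obtain C where C: "\<And>m. cmod (a0 m) \<le> C / \<rho> ^ nat \<bar>m\<bar>" using decay0[of \<rho>] q by auto
    have w: "weighted_l1 q a0" by (rule weighted_l1_if_decay[OF C]) (use \<rho> q in auto)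
    have s1: "(\<lambda>m. a0 m * t powi m) summable_on UNIV" by (rule laurent_summable[OF w q(1-3)])
    have s2: "(\<lambda>m. a0 m * (1 / t) powi m) summable_on UNIV" by (rule laurent_summable[OF w q(1,4,5)])
    have bij: "bij_betw uminus UNIV (UNIV :: int set)" by (rule bij_betwI[of _ _ _ uminus]) auto
    have e: "a0 (- m) * (1 / t) powi (- m) = a0 (- m) * t powi m" for m
      by (simp add: power_int_minus power_int_one_over inverse_eq_divide)
    have s3: "(\<lambda>m. a0 (- m) * t powi m) summable_on UNIV"
      using summable_on_reindex_bij_betw[OF bij, of "\<lambda>m. a0 m * (1 / t) powi m"] s2 by (simp add: e)
    have "laurent a0 (1 / t) = (\<Sum>\<^sub>\<infinity>m. a0 (- m) * t powi m)"
      unfolding laurent_def using infsum_reindex_bij_betw[OF bij, of "\<lambda>m. a0 m * (1 / t) powi m"] by (simp add: e)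
    then have "laurent a0 t + laurent a0 (1 / t) = (\<Sum>\<^sub>\<infinity>m. a0 m * t powi m + a0 (- m) * t powi m)"
      using infsum_add[OF s1 s3] by (simp add: laurent_def)
    also have "\<dots> = (\<Sum>\<^sub>\<infinity>m. 2 * (a m * t powi m))"
      by (intro infsum_cong) (simp add: a_def distrib_right)
    also have "\<dots> = 2 * laurent a t" unfolding laurent_def by (rule infsum_cmult_right')
    finally show "H t = laurent a t"
      using expand0[OF t] expand0[OF t'] sym[OF t0] by simp
  qed
qed

section \<open>Decay of powers of holomorphic functions on a circle\<close>

text \<open>Otherwise, after scaling \<open>B\<close>, for every \<open>n\<close> there is a point where \<open>D\<close> is smaller in modulus than \<open>B ^ n / (n + 1)\<close>. These points
  accumulate at a common zero, where \<open>D\<close> vanishes to some finite order \<open>k\<close> and \<open>B ^ k\<close> is therefore dominated by \<open>D\<close>.\<close>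

lemma lojasiewicz:
  assumes V: "open V" and D: "D holomorphic_on V" and B: "B holomorphic_on V"
    and K: "compact K" "K \<subseteq> V"
    and nz: "\<And>t e. t \<in> K \<Longrightarrow> 0 < e \<Longrightarrow> \<exists>s\<in>ball t e. D s \<noteq> 0"
    and zeros: "\<And>t. t \<in> K \<Longrightarrow> D t = 0 \<Longrightarrow> B t = 0"
  shows "\<exists>r c. 0 < c \<and> (\<forall>t\<in>K. c * cmod (B t) ^ r \<le> cmod (D t))"
proof (rule ccontr)
  assume neg: "\<not> ?thesis"
  have Bc: "continuous_on V B" and Dc: "continuous_on V D"
    using B D holomorphic_on_imp_continuous_on by blast+
  have "compact (B ` K)" using compact_continuous_image[OF continuous_on_subset[OF Bc K(2)] K(1)] .
  then obtain b0 where b0: "\<And>t. t \<in> K \<Longrightarrow> cmod (B t) \<le> b0"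
    by (force dest: compact_imp_bounded simp: bounded_iff)
  define b where "b = max 1 b0"
  have b: "0 < b" "\<And>t. t \<in> K \<Longrightarrow> cmod (B t) \<le> b" using b0 by (auto simp: b_def le_max_iff_disj)
  have "\<exists>t\<in>K. cmod (D t) < 1 / real (Suc n) * (cmod (B t) / b) ^ n" for n
  proof (rule ccontr)
    assume "\<not> ?thesis"
    then have "\<forall>t\<in>K. (1 / real (Suc n) / b ^ n) * cmod (B t) ^ n \<le> cmod (D t)"
      by (simp add: not_less power_divide mult_ac)
    moreover have "0 < 1 / real (Suc n) / b ^ n" using b by simp
    ultimately show False using neg by blast
  qed
  then obtain s where s: "\<And>n. s n \<in> K" "\<And>n. cmod (D (s n)) < 1 / real (Suc n) * (cmod (B (s n)) / b) ^ n"
    by metis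
  obtain t \<sigma> where t: "t \<in> K" "strict_mono \<sigma>" "(s \<circ> \<sigma>) \<longlonglongrightarrow> t"
    using K(1) s(1) unfolding compact_def by blast
  have lim: "(\<lambda>n. s (\<sigma> n)) \<longlonglongrightarrow> t" using t(3) by (simp add: o_def)
  have tV: "t \<in> V" using t K by auto
  have small: "cmod (D (s n)) < 1 / real (Suc n)" for n
  proof -
    have "(cmod (B (s n)) / b) ^ n \<le> 1" using b(1) b(2)[OF s(1)[of n]] by (intro power_le_one) auto
    then have "1 / real (Suc n) * (cmod (B (s n)) / b) ^ n \<le> 1 / real (Suc n) * 1"
      by (intro mult_left_mono) auto
    then show ?thesis using s(2)[of n] by linarith
  qed
  have inv: "(\<lambda>n. 1 / real (Suc (\<sigma> n))) \<longlonglongrightarrow> 0"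
    using LIMSEQ_subseq_LIMSEQ[OF LIMSEQ_inverse_real_of_nat t(2)] by (simp add: o_def inverse_eq_divide)
  have Dt: "D t = 0"
  proof -
    have "(\<lambda>n. D (s (\<sigma> n))) \<longlonglongrightarrow> D t"
      using Dc V tV lim continuous_on_eq_continuous_at isCont_tendsto_compose by metis
    moreover have "(\<lambda>n. D (s (\<sigma> n))) \<longlonglongrightarrow> 0"
      by (rule Lim_null_comparison[OF _ inv]) (use small in \<open>auto intro!: always_eventually less_imp_le\<close>)
    ultimately show ?thesis by (rule LIMSEQ_unique)
  qed
  then have Bt: "B t = 0" using zeros t by blast
  obtain e where e: "0 < e" "ball t e \<subseteq> V" using V tV by (auto simp: open_contains_ball)
  have nc: "\<not> D constant_on ball t e"
    using nz[OF t(1) e(1)] Dt e(1) unfolding constant_on_def by (metis centre_in_ball)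
  obtain g \<rho> k where g: "0 < k" "0 < \<rho>" "ball t \<rho> \<subseteq> ball t e" "g holomorphic_on ball t \<rho>"
    "\<And>w. w \<in> ball t \<rho> \<Longrightarrow> D w = (w - t) ^ k * g w" "\<And>w. w \<in> ball t \<rho> \<Longrightarrow> g w \<noteq> 0"
    by (rule holomorphic_factor_zero_nonconstant[of D "ball t e" t])
       (use D e nc Dt in \<open>auto intro: holomorphic_on_subset\<close>)
  define \<beta> where "\<beta> = (\<lambda>z. if z = t then deriv B t else (B z - B t) / (z - t))"
  have \<beta>h: "\<beta> holomorphic_on V" unfolding \<beta>_def by (rule pole_lemma_open[OF B V])
  have \<beta>: "B w = (w - t) * \<beta> w" for w using Bt by (simp add: \<beta>_def)
  have gl: "(\<lambda>n. g (s (\<sigma> n))) \<longlonglongrightarrow> g t"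
    using holomorphic_on_imp_continuous_on[OF g(4)] g(2) lim
    by (metis centre_in_ball continuous_on_eq_continuous_at isCont_tendsto_compose open_ball)
  have \<beta>l: "(\<lambda>n. \<beta> (s (\<sigma> n))) \<longlonglongrightarrow> \<beta> t"
    using holomorphic_on_imp_continuous_on[OF \<beta>h] V tV lim
    by (metis continuous_on_eq_continuous_at isCont_tendsto_compose)
  have ev: "\<forall>\<^sub>F n in sequentially. cmod (g (s (\<sigma> n))) \<le> 1 / real (Suc (\<sigma> n)) * (cmod (\<beta> (s (\<sigma> n))) / b) ^ k"
  proof -
    have "\<forall>\<^sub>F n in sequentially. s (\<sigma> n) \<in> ball t \<rho>"
      using tendstoD[OF lim g(2)] by (simp add: dist_commute)
    then show ?thesis using eventually_ge_at_top[of k]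
    proof eventually_elim
      case (elim n)
      let ?w = "s (\<sigma> n)"
      have kn: "k \<le> \<sigma> n" using elim(2) seq_suble[OF t(2), of n] by simp
      have "(cmod (B ?w) / b) ^ \<sigma> n \<le> (cmod (B ?w) / b) ^ k"
        using b(1) b(2)[OF s(1)[of "\<sigma> n"]] kn by (intro power_decreasing) auto
      then have "1 / real (Suc (\<sigma> n)) * (cmod (B ?w) / b) ^ \<sigma> n \<le> 1 / real (Suc (\<sigma> n)) * (cmod (B ?w) / b) ^ k"
        by (intro mult_left_mono) auto
      then have lt: "cmod (D ?w) < 1 / real (Suc (\<sigma> n)) * (cmod (B ?w) / b) ^ k" using s(2)[of "\<sigma> n"] by linarith
      have ne: "?w \<noteq> t"
      proof
        assume "?w = t"
        then have "cmod (D ?w) < 0" using lt Bt g(1) by (simp add: zero_power)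
        then show False by simp
      qed
      have "cmod (D ?w) = cmod (?w - t) ^ k * cmod (g ?w)"
        by (simp only: g(5)[OF elim(1)] norm_mult norm_power)
      moreover have "(cmod (B ?w) / b) ^ k = cmod (?w - t) ^ k * (cmod (\<beta> ?w) / b) ^ k"
        by (simp only: \<beta>[of ?w] norm_mult power_mult_distrib[symmetric] times_divide_eq_right)
      ultimately have "cmod (?w - t) ^ k * cmod (g ?w) < cmod (?w - t) ^ k * (1 / real (Suc (\<sigma> n)) * (cmod (\<beta> ?w) / b) ^ k)"
        using lt by (simp only: mult.left_commute)
      moreover have "0 < cmod (?w - t) ^ k" using ne by simp
      ultimately show ?case by (simp only: mult_less_cancel_left_pos)
    qed
  qed
  have "cmod (g t) \<le> 0 * (cmod (\<beta> t) / b) ^ k"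
    by (rule tendsto_le[OF sequentially_bot _ _ ev])
       (intro tendsto_intros inv \<beta>l gl; use b in simp)+
  then show False using g(6)[of t] g(2) by simp
qed

lemma cube_exp_le: "0 \<le> x \<Longrightarrow> x ^ 3 \<le> 27 * exp (x :: real)"
proof -
  assume x: "0 \<le> x"
  have "x / 3 \<le> exp (x / 3)" using exp_ge_add_one_self[of "x / 3"] by linarith
  then have "(x / 3) ^ 3 \<le> exp (x / 3) ^ 3" using x by (intro power_mono) auto
  then show ?thesis by (simp add: power_divide exp_of_nat_mult[symmetric])
qed

text \<open>From \<open>u\<^sup>2 \<le> exp (- c * y)\<close> the product \<open>u ^ j * y ^ 3\<close> is of order \<open>j\<close> to the power \<open>-3\<close>, which leaves \<open>1 / j\<close>
  after two derivatives have cost a factor of order \<open>j\<^sup>2\<close>.\<close>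

lemma power_times_cube_le:
  fixes u y c :: real
  assumes y: "0 \<le> y" and c: "0 < c" and u: "0 \<le> u" "u\<^sup>2 \<le> 1 - c * y" and j: "1 \<le> j"
  shows "u ^ j * y ^ 3 * (real j + 2)\<^sup>2 \<le> 1944 / c ^ 3 / real j"
proof -
  define x where "x = c * y * real j"
  have x0: "0 \<le> x" using assms by (simp add: x_def)
  have "u\<^sup>2 \<le> exp (- (c * y))" using u(2) exp_ge_add_one_self[of "- (c * y)"] by linarith
  then have "(u\<^sup>2) ^ j \<le> exp (- (c * y)) ^ j" using u by (intro power_mono) auto
  also have "\<dots> = exp (- x)" by (simp add: x_def exp_of_nat_mult[symmetric] mult_ac)
  also have "\<dots> = (exp (- x / 2))\<^sup>2" by (simp add: exp_double[symmetric])
  finally have "(u ^ j)\<^sup>2 \<le> (exp (- x / 2))\<^sup>2" by (simp add: power_mult[symmetric] mult.commute)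
  then have uj: "u ^ j \<le> exp (- x / 2)" by (rule power2_le_imp_le) simp
  have "(x / 2) ^ 3 * exp (- x / 2) \<le> 27 * exp (x / 2) * exp (- x / 2)"
    using cube_exp_le[of "x / 2"] x0 by (intro mult_right_mono) auto
  then have "x ^ 3 * exp (- x / 2) \<le> 216" by (simp add: power_divide exp_minus field_simps)
  then have "u ^ j * x ^ 3 \<le> 216"
    using mult_right_mono[OF uj, of "x ^ 3"] x0 by (simp add: mult_ac)
  then have 1: "u ^ j * y ^ 3 \<le> 216 / (c ^ 3 * real j ^ 3)"
    using c j by (simp add: x_def power_mult_distrib field_simps)
  have "(real j + 2)\<^sup>2 \<le> (3 * real j)\<^sup>2" using j by (intro power_mono) auto
  then have "u ^ j * y ^ 3 * (real j + 2)\<^sup>2 \<le> 216 / (c ^ 3 * real j ^ 3) * (3 * real j)\<^sup>2"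
    using 1 c u y by (intro mult_mono) auto
  also have "\<dots> = 1944 / c ^ 3 / real j" using c j by (simp add: power2_eq_square power3_eq_cube field_simps)
  finally show ?thesis .
qed

text \<open>Each derivative of the power costs a factor of order \<open>j\<close>, while \<open>\<Phi> ^ j\<close> is exponentially small except near the
  zeros of \<open>B\<close>, where a high power of \<open>B\<close> compensates.\<close>

lemma power_decay:
  assumes V: "open V" and \<Phi>: "\<Phi> holomorphic_on V" and B: "B holomorphic_on V"
    and K: "compact K" "K \<subseteq> V"
    and c: "0 < c" and dom: "\<And>t. t \<in> K \<Longrightarrow> c * cmod (B t) ^ r \<le> 1 - (cmod (\<Phi> t))\<^sup>2"
  shows "\<exists>C. \<forall>j\<ge>1. \<exists>G1 G2.
     (\<forall>t\<in>V. ((\<lambda>t. \<Phi> t ^ (j + 2) * B t ^ (3 * r + 2)) has_field_derivative G1 t) (at t)) \<and>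
     (\<forall>t\<in>V. (G1 has_field_derivative G2 t) (at t)) \<and>
     (\<forall>t\<in>K. cmod (\<Phi> t ^ (j + 2) * B t ^ (3 * r + 2)) \<le> C / real j) \<and>
     (\<forall>t\<in>K. cmod (G2 t) \<le> C / real j)"
proof -
  \<comment> \<open>The two surplus factors of \<open>\<Phi>\<close> and of \<open>B\<close> are used up by the two derivatives; \<open>B ^ (3 * r)\<close> provides the
    cube of \<open>1 - (cmod \<Phi>)\<^sup>2\<close>.\<close>
  define k where "k = 3 * r"
  let ?P = "deriv \<Phi>" and ?Q = "deriv (deriv \<Phi>)" and ?S = "deriv B" and ?T = "deriv (deriv B)"
  have hol: "?P holomorphic_on V" "?Q holomorphic_on V" "?S holomorphic_on V" "?T holomorphic_on V"
    using \<Phi> B V by (auto intro!: holomorphic_deriv)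
  have bdd: "\<exists>L. \<forall>t\<in>K. cmod (f t) \<le> L" if "f holomorphic_on V" for f
  proof -
    have "compact (f ` K)"
      using compact_continuous_image[OF continuous_on_subset[OF holomorphic_on_imp_continuous_on[OF that] K(2)] K(1)] .
    then show ?thesis by (force dest: compact_imp_bounded simp: bounded_iff)
  qed
  obtain L1 where LL1: "\<And>t. t \<in> K \<Longrightarrow> cmod (\<Phi> t) \<le> L1" using bdd[OF \<Phi>] by blast
  obtain L2 where LL2: "\<And>t. t \<in> K \<Longrightarrow> cmod (B t) \<le> L2" using bdd[OF B] by blast
  obtain L3 where LL3: "\<And>t. t \<in> K \<Longrightarrow> cmod (?P t) \<le> L3" using bdd[OF hol(1)] by blast
  obtain L4 where LL4: "\<And>t. t \<in> K \<Longrightarrow> cmod (?Q t) \<le> L4" using bdd[OF hol(2)] by blast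
  obtain L5 where LL5: "\<And>t. t \<in> K \<Longrightarrow> cmod (?S t) \<le> L5" using bdd[OF hol(3)] by blast
  obtain L6 where LL6: "\<And>t. t \<in> K \<Longrightarrow> cmod (?T t) \<le> L6" using bdd[OF hol(4)] by blast
  define L where "L = 1 + \<bar>L1\<bar> + \<bar>L2\<bar> + \<bar>L3\<bar> + \<bar>L4\<bar> + \<bar>L5\<bar> + \<bar>L6\<bar>"
  have Lmax: "1 \<le> L" "L1 \<le> L" "L2 \<le> L" "L3 \<le> L" "L4 \<le> L" "L5 \<le> L" "L6 \<le> L"
    unfolding L_def by linarith+
  have L: "1 \<le> L" by (rule Lmax)
  have Lt: "cmod (\<Phi> t) \<le> L" "cmod (B t) \<le> L" "cmod (?P t) \<le> L" "cmod (?Q t) \<le> L"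
    "cmod (?S t) \<le> L" "cmod (?T t) \<le> L" if t: "t \<in> K" for t
    by (rule order_trans[OF LL1[OF t] Lmax(2)] order_trans[OF LL2[OF t] Lmax(3)] order_trans[OF LL3[OF t] Lmax(4)]
      order_trans[OF LL4[OF t] Lmax(5)] order_trans[OF LL5[OF t] Lmax(6)] order_trans[OF LL6[OF t] Lmax(7)])+
  define M where "M = 3 * L ^ 4 * (real k + 3)\<^sup>2"
  define C where "C = 1944 / c ^ 3 * M"
  have prod_le: "cmod (x * y) \<le> A * B" if "cmod x \<le> A" "cmod y \<le> B" for x y :: complex and A B :: real
    unfolding norm_mult using that by (intro mult_mono) (auto intro: order_trans[OF norm_ge_zero])
  have add_le: "cmod (x + y) \<le> A + B" if "cmod x \<le> A" "cmod y \<le> B" for x y :: complex and A B :: real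
    using that norm_triangle_mono by blast
  show ?thesis
  proof (intro exI[of _ C] allI impI)
    fix j :: nat assume j: "1 \<le> j"
    define G1 where "G1 = (\<lambda>t. \<Phi> t ^ (j + 1) * B t ^ (k + 1) * (of_nat (j + 2) * (?P t * B t) + of_nat (k + 2) * (\<Phi> t * ?S t)))"
    define Z where "Z = (\<lambda>t. (of_nat (j + 1) * (?P t * B t) + of_nat (k + 1) * (\<Phi> t * ?S t))
          * (of_nat (j + 2) * (?P t * B t) + of_nat (k + 2) * (\<Phi> t * ?S t))
        + \<Phi> t * B t * (of_nat (j + 2) * (?Q t * B t + ?P t * ?S t) + of_nat (k + 2) * (?P t * ?S t + \<Phi> t * ?T t)))"
    define G2 where "G2 = (\<lambda>t. \<Phi> t ^ j * B t ^ k * Z t)"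
    have d: "(\<Phi> has_field_derivative ?P t) (at t)" "(B has_field_derivative ?S t) (at t)"
      "(?P has_field_derivative ?Q t) (at t)" "(?S has_field_derivative ?T t) (at t)" if "t \<in> V" for t
      using that V \<Phi> B hol by (auto intro: holomorphic_derivI)
    have 1: "((\<lambda>t. \<Phi> t ^ (j + 2) * B t ^ (k + 2)) has_field_derivative G1 t) (at t)" if t: "t \<in> V" for t
      unfolding G1_def
      by (rule derivative_eq_intros d[OF t] refl)+ (simp add: algebra_simps)
    have 2: "(G1 has_field_derivative G2 t) (at t)" if t: "t \<in> V" for t
      unfolding G1_def G2_def Z_def
      by (rule derivative_eq_intros d[OF t] refl)+ (simp add: algebra_simps)
    have jk: "(real j + 2) + (real k + 2) \<le> (real j + 2) * (real k + 3)" by (simp add: algebra_simps)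
    have Zb: "cmod (Z t) \<le> M * (real j + 2)\<^sup>2" if t: "t \<in> K" for t
    proof -
      have "cmod (Z t) \<le> (real (j + 1) * (L * L) + real (k + 1) * (L * L)) * (real (j + 2) * (L * L) + real (k + 2) * (L * L))
          + L * L * (real (j + 2) * (L * L + L * L) + real (k + 2) * (L * L + L * L))"
        unfolding Z_def by (intro add_le prod_le Lt[OF t]) (simp_all only: norm_of_nat order_refl)
      also have "\<dots> \<le> L ^ 4 * ((real j + 2) * (real k + 3)) * ((real j + 2) * (real k + 3)) + L ^ 4 * (2 * ((real j + 2) * (real k + 3)))"
      proof -
        have e1: "(real (j + 1) * (L * L) + real (k + 1) * (L * L)) * (real (j + 2) * (L * L) + real (k + 2) * (L * L))
            = L ^ 4 * ((real j + 1) + (real k + 1)) * ((real j + 2) + (real k + 2))"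
          by (simp add: power4_eq_xxxx algebra_simps)
        have e2: "L * L * (real (j + 2) * (L * L + L * L) + real (k + 2) * (L * L + L * L)) = L ^ 4 * (2 * ((real j + 2) + (real k + 2)))"
          by (simp add: power4_eq_xxxx algebra_simps)
        have "L ^ 4 * ((real j + 1) + (real k + 1)) * ((real j + 2) + (real k + 2)) \<le> L ^ 4 * ((real j + 2) * (real k + 3)) * ((real j + 2) * (real k + 3))"
          using jk L by (intro mult_mono mult_nonneg_nonneg) auto
        moreover have "L ^ 4 * (2 * ((real j + 2) + (real k + 2))) \<le> L ^ 4 * (2 * ((real j + 2) * (real k + 3)))"
          using jk L by (intro mult_left_mono) auto
        ultimately show ?thesis unfolding e1 e2 by linarith
      qed
      also have "\<dots> \<le> M * (real j + 2)\<^sup>2"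
      proof -
        have "1 \<le> (real j + 2) * (real k + 3)" using mult_mono[of 1 "real j + 2" 1 "real k + 3"] by simp
        then have "L ^ 4 * (2 * ((real j + 2) * (real k + 3))) * 1 \<le> L ^ 4 * (2 * ((real j + 2) * (real k + 3))) * ((real j + 2) * (real k + 3))"
          using L by (intro mult_left_mono) auto
        then show ?thesis by (simp add: M_def power2_eq_square algebra_simps)
      qed
      finally show ?thesis .
    qed
    have base: "cmod (\<Phi> t ^ j * B t ^ k) * (real j + 2)\<^sup>2 \<le> 1944 / c ^ 3 / real j" if t: "t \<in> K" for t
      using power_times_cube_le[of "cmod (B t) ^ r" c "cmod (\<Phi> t)" j] c dom[OF t] j
      by (simp add: norm_mult norm_power k_def power_mult[symmetric] mult.commute)
    have M0: "0 \<le> M" "L ^ 4 \<le> M"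
    proof -
      have "1 \<le> (real k + 3)\<^sup>2" by (intro one_le_power) auto
      then have "L ^ 4 * 1 \<le> 3 * L ^ 4 * (real k + 3)\<^sup>2" using L by (intro mult_mono) auto
      then show "L ^ 4 \<le> M" by (simp add: M_def)
      show "0 \<le> M" using L by (simp add: M_def)
    qed
    have G2b: "cmod (G2 t) \<le> C / real j" if t: "t \<in> K" for t
    proof -
      have "cmod (G2 t) \<le> cmod (\<Phi> t ^ j * B t ^ k) * (M * (real j + 2)\<^sup>2)"
        unfolding G2_def norm_mult[of "\<Phi> t ^ j * B t ^ k"] using Zb[OF t] by (intro mult_left_mono) auto
      also have "\<dots> = (cmod (\<Phi> t ^ j * B t ^ k) * (real j + 2)\<^sup>2) * M" by (simp add: mult_ac)
      also have "\<dots> \<le> (1944 / c ^ 3 / real j) * M" using base[OF t] M0 by (intro mult_right_mono) auto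
      finally show ?thesis by (simp add: C_def mult_ac)
    qed
    have Gb: "cmod (\<Phi> t ^ (j + 2) * B t ^ (k + 2)) \<le> C / real j" if t: "t \<in> K" for t
    proof -
      have "\<Phi> t ^ (j + 2) * B t ^ (k + 2) = (\<Phi> t ^ j * B t ^ k) * (\<Phi> t * \<Phi> t * (B t * B t))"
        by (simp add: power_add power2_eq_square mult_ac)
      moreover have "cmod (\<Phi> t * \<Phi> t * (B t * B t)) \<le> M * (real j + 2)\<^sup>2"
      proof -
        have "cmod (\<Phi> t * \<Phi> t * (B t * B t)) \<le> L * L * (L * L)" by (intro prod_le Lt[OF t])
        also have "\<dots> \<le> M * 1" using M0 by (simp add: power4_eq_xxxx mult_ac)
        also have "\<dots> \<le> M * (real j + 2)\<^sup>2" using M0 by (intro mult_left_mono one_le_power) auto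
        finally show ?thesis .
      qed
      ultimately have "cmod (\<Phi> t ^ (j + 2) * B t ^ (k + 2)) \<le> cmod (\<Phi> t ^ j * B t ^ k) * (M * (real j + 2)\<^sup>2)"
        by (simp only: norm_mult[of "\<Phi> t ^ j * B t ^ k"] mult_left_mono[OF _ norm_ge_zero])
      also have "\<dots> = (cmod (\<Phi> t ^ j * B t ^ k) * (real j + 2)\<^sup>2) * M" by (simp add: mult_ac)
      also have "\<dots> \<le> (1944 / c ^ 3 / real j) * M" using base[OF t] M0 by (intro mult_right_mono) auto
      finally show ?thesis by (simp add: C_def mult_ac)
    qed
    show "\<exists>G1 G2.
     (\<forall>t\<in>V. ((\<lambda>t. \<Phi> t ^ (j + 2) * B t ^ (3 * r + 2)) has_field_derivative G1 t) (at t)) \<and>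
     (\<forall>t\<in>V. (G1 has_field_derivative G2 t) (at t)) \<and>
     (\<forall>t\<in>K. cmod (\<Phi> t ^ (j + 2) * B t ^ (3 * r + 2)) \<le> C / real j) \<and>
     (\<forall>t\<in>K. cmod (G2 t) \<le> C / real j)"
      unfolding k_def[symmetric] using 1 2 Gb G2b by blast
  qed
qed

lemma summable_on_int_inverse_square: "(\<lambda>m::int. 9 / (1 + real_of_int \<bar>m\<bar>)\<^sup>2) summable_on UNIV"
proof -
  let ?f = "\<lambda>m::int. complex_of_real (9 / (1 + real_of_int \<bar>m\<bar>)\<^sup>2)"
  have n: "cmod (?f m) = 9 / (1 + real_of_int \<bar>m\<bar>)\<^sup>2" for m unfolding norm_of_real by simp
  have "summable (\<lambda>n. inverse (real n ^ 2))" by (rule inverse_power_summable) simp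
  then have s: "summable (\<lambda>n. inverse (real (Suc n) ^ 2))" by (subst summable_Suc_iff)
  then have s': "summable (\<lambda>n. inverse (real (Suc (Suc n)) ^ 2))" by (subst summable_Suc_iff)
  have 1: "summable (\<lambda>n. cmod (?f (int n)))"
    using summable_mult[OF s, of 9] unfolding n by (simp add: divide_inverse add.commute)
  have 2: "summable (\<lambda>n. cmod (?f (- int n - 1)))"
  proof -
    have "real_of_int \<bar>- int n - 1\<bar> = real (Suc n)" for n by simp
    then show ?thesis using summable_mult[OF s', of 9] unfolding n by (simp add: divide_inverse add.commute)
  qed
  have "?f summable_on UNIV"
    using has_sum_int_split[OF 1 summable_sums[OF summable_norm_cancel[OF 1]] 2 summable_sums[OF summable_norm_cancel[OF 2]]]
    by (rule has_sum_imp_summable)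
  then have "(\<lambda>x. cmod (?f x)) summable_on UNIV" by (simp only: summable_on_iff_abs_summable_on_complex)
  then show ?thesis by (simp only: n)
qed

text \<open>Two integrations by parts bound \<open>a m * R ^ m\<close> by a multiple of \<open>\<epsilon> / (1 + m)\<^sup>2\<close> for \<open>m \<ge> 0\<close>, and the symmetry of \<open>a\<close>
  gives the same for negative \<open>m\<close>. The constant precedes all other quantifiers because it depends on \<open>R\<close> only: the lemma is
  applied to a sequence of functions.\<close>

lemma weighted_norm_le_second_derivative:
  assumes R: "1 \<le> R"
  shows "\<exists>C. \<forall>a G G1 G2 V \<epsilon>. weighted_l1 R a \<longrightarrow> (\<forall>m. a (- m) = a m) \<longrightarrow> sphere 0 R \<subseteq> V \<longrightarrow> 0 \<notin> V \<longrightarrow>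
     (\<forall>t\<in>V. (G has_field_derivative G1 t) (at t)) \<longrightarrow> (\<forall>t\<in>V. (G1 has_field_derivative G2 t) (at t)) \<longrightarrow>
     (\<forall>t\<in>sphere 0 R. G t = laurent a t \<and> cmod (G t) \<le> \<epsilon> \<and> cmod (G2 t) \<le> \<epsilon>) \<longrightarrow>
     (\<Sum>\<^sub>\<infinity>m. cmod (a m) * R ^ nat \<bar>m\<bar>) \<le> C * \<epsilon>"
proof (intro exI allI impI)
  fix a :: "int \<Rightarrow> complex" and G G1 G2 :: "complex \<Rightarrow> complex" and V :: "complex set" and \<epsilon> :: real
  assume a: "weighted_l1 R a" and sym: "\<forall>m. a (- m) = a m" and V: "sphere 0 R \<subseteq> V" "0 \<notin> V"
    and d1: "\<forall>t\<in>V. (G has_field_derivative G1 t) (at t)" and d2: "\<forall>t\<in>V. (G1 has_field_derivative G2 t) (at t)"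
    and G: "\<forall>t\<in>sphere 0 R. G t = laurent a t \<and> cmod (G t) \<le> \<epsilon> \<and> cmod (G2 t) \<le> \<epsilon>"
  let ?c = "circlepath 0 R" and ?i = "2 * of_real pi * \<i> :: complex"
  have R0: "0 < R" using R by simp
  have e0: "0 \<le> \<epsilon>" using G[rule_format, of "of_real R"] R0 by (auto intro: order_trans[OF norm_ge_zero])
  have GG: "cmod (G t) \<le> \<epsilon>" "cmod (G2 t) \<le> \<epsilon>" if "cmod (t - 0) = R" for t
    using G[rule_format, of t] that by auto
  have im: "path_image ?c \<subseteq> V" using V R0 by simp
  have Gc: "continuous_on (sphere 0 R) G"
    using d1 V by (meson DERIV_isCont continuous_at_imp_continuous_on subsetD)
  have coeff: "((\<lambda>t. G t * t powi (- m - 1)) has_contour_integral ?i * a m) ?c" for m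
  proof (rule laurent_coefficient[OF a R _ _ Gc])
    have "1 / R \<le> 1" using R by simp
    then show "1 / R \<le> R" using R by linarith
  qed (use G in auto)
  have parts: "((\<lambda>t. g' t * t powi k) has_contour_integral - of_int k * I) ?c"
    if g: "\<And>t. t \<in> V \<Longrightarrow> (g has_field_derivative g' t) (at t)"
      and I: "((\<lambda>t. g t * t powi (k - 1)) has_contour_integral I) ?c" for g g' k I
  proof -
    have "((\<lambda>t. g' t * t powi k + of_int k * (g t * t powi (k - 1))) has_contour_integral
        (g (pathfinish ?c) * pathfinish ?c powi k - g (pathstart ?c) * pathstart ?c powi k)) ?c"
    proof (rule contour_integral_primitive[OF _ _ im])
      fix t assume t: "t \<in> V"
      then have "t \<noteq> 0" using V by auto
      then show "((\<lambda>t. g t * t powi k) has_field_derivative g' t * t powi k + of_int k * (g t * t powi (k - 1))) (at t within V)"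
        by (auto intro!: derivative_eq_intros has_field_derivative_at_within[OF g[OF t]])
    qed simp
    then have "((\<lambda>t. g' t * t powi k + of_int k * (g t * t powi (k - 1)) - of_int k * (g t * t powi (k - 1)))
        has_contour_integral 0 - of_int k * I) ?c"
      by (intro has_contour_integral_diff has_contour_integral_lmul I) simp
    then show ?thesis by simp
  qed
  have two: "((\<lambda>t. G2 t * t powi (1 - m)) has_contour_integral (of_int (m - 1) * of_int m * (?i * a m))) ?c" for m
  proof -
    have "((\<lambda>t. G1 t * t powi (- m)) has_contour_integral of_int m * (?i * a m)) ?c"
      using parts[of G G1 "- m", OF _ coeff] d1 by simp
    then have "((\<lambda>t. G1 t * t powi (1 - m - 1)) has_contour_integral of_int m * (?i * a m)) ?c"
      by (simp add: algebra_simps)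
    from parts[of G1 G2 "1 - m", OF _ this] d2 show ?thesis by (simp add: algebra_simps)
  qed
  have Rp: "R powi k * R = R powi (k + 1)" for k using R0 by (simp add: power_int_add_1)
  have b0: "cmod (a m) * R ^ nat m \<le> \<epsilon>" if m: "0 \<le> m" for m
  proof -
    have "cmod (?i * a m) \<le> (\<epsilon> * R powi (- m - 1)) * (2 * pi * R)"
      by (rule has_contour_integral_bound_circlepath[OF coeff])
         (use R0 GG e0 in \<open>auto simp: norm_mult norm_power_int intro!: mult_right_mono\<close>)
    also have "\<dots> = 2 * pi * (\<epsilon> * R powi (- m))" using Rp[of "- m - 1"] by (simp add: mult_ac)
    finally have "cmod (a m) \<le> \<epsilon> * R powi (- m)" by (simp add: norm_mult)
    then have "cmod (a m) * R ^ nat m \<le> \<epsilon> * R powi (- m) * R ^ nat m" using R0 by (intro mult_right_mono) auto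
    also have "\<dots> = \<epsilon>" using m R0 by (simp add: power_int_minus power_int_def power_inverse)
    finally show ?thesis .
  qed
  have b2: "cmod (a m) * R ^ nat m * (real_of_int (m - 1) * real_of_int m) \<le> R\<^sup>2 * \<epsilon>" if m: "0 \<le> m" for m
  proof -
    have "cmod (of_int (m - 1) * of_int m * (?i * a m)) \<le> (\<epsilon> * R powi (1 - m)) * (2 * pi * R)"
      by (rule has_contour_integral_bound_circlepath[OF two])
         (use R0 GG e0 in \<open>auto simp: norm_mult norm_power_int intro!: mult_right_mono\<close>)
    also have "\<dots> = 2 * pi * (\<epsilon> * R powi (2 - m))" using Rp[of "1 - m"] by (simp add: mult_ac)
    finally have "\<bar>real_of_int (m - 1) * real_of_int m\<bar> * cmod (a m) \<le> \<epsilon> * R powi (2 - m)"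
      by (simp add: norm_mult abs_mult del: of_int_diff)
    then have "real_of_int (m - 1) * real_of_int m * cmod (a m) \<le> \<epsilon> * R powi (2 - m)"
      by (meson abs_ge_self mult_right_mono norm_ge_zero order_trans)
    then have "real_of_int (m - 1) * real_of_int m * cmod (a m) * R ^ nat m \<le> \<epsilon> * R powi (2 - m) * R ^ nat m"
      using R0 by (intro mult_right_mono) auto
    also have "\<dots> = \<epsilon> * (R powi (2 - m) * R powi m)" using m by (simp add: power_int_def)
    also have "R powi (2 - m) * R powi m = R\<^sup>2" using R0 by (simp add: power_int_add[symmetric])
    finally show ?thesis by (simp add: mult_ac)
  qed
  have R2: "1 \<le> R\<^sup>2" using R by (intro one_le_power) auto
  have pos: "cmod (a m) * R ^ nat m \<le> R\<^sup>2 * \<epsilon> * (9 / (1 + real_of_int m)\<^sup>2)" if m: "0 \<le> m" for m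
  proof (cases "m \<le> 1")
    case True
    then have "m = 0 \<or> m = 1" using m by auto
    then have "1 \<le> 9 / (1 + real_of_int m)\<^sup>2" by (auto simp: power2_eq_square)
    then have "1 * 1 * \<epsilon> \<le> R\<^sup>2 * (9 / (1 + real_of_int m)\<^sup>2) * \<epsilon>" using R2 e0 by (intro mult_mono) auto
    then show ?thesis using b0[OF m] by (simp add: mult_ac)
  next
    case False
    define x where "x = real_of_int m"
    have x: "2 \<le> x" using False by (simp add: x_def)
    have "2 * x \<le> x * x" using x by (intro mult_right_mono) auto
    moreover have "9 * ((x - 1) * x) - (1 + x)\<^sup>2 = 8 * (x * x) - 11 * x - 1" by (simp add: power2_eq_square algebra_simps)
    ultimately have "(1 + x)\<^sup>2 \<le> 9 * ((x - 1) * x)" using x by linarith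
    then have "cmod (a m) * R ^ nat m * (1 + x)\<^sup>2 \<le> cmod (a m) * R ^ nat m * (9 * ((x - 1) * x))"
      using R0 by (intro mult_left_mono) auto
    also have "\<dots> = 9 * (cmod (a m) * R ^ nat m * (real_of_int (m - 1) * real_of_int m))" by (simp add: x_def algebra_simps)
    also have "\<dots> \<le> 9 * (R\<^sup>2 * \<epsilon>)" using b2[OF m] by linarith
    finally show ?thesis using x by (simp add: x_def[symmetric] pos_le_divide_eq mult_ac)
  qed
  have all: "cmod (a m) * R ^ nat \<bar>m\<bar> \<le> R\<^sup>2 * \<epsilon> * (9 / (1 + real_of_int \<bar>m\<bar>)\<^sup>2)" for m
    using pos[of m] pos[of "- m"] sym by (cases "0 \<le> m") auto
  have "(\<Sum>\<^sub>\<infinity>m. cmod (a m) * R ^ nat \<bar>m\<bar>) \<le> (\<Sum>\<^sub>\<infinity>m::int. R\<^sup>2 * \<epsilon> * (9 / (1 + real_of_int \<bar>m\<bar>)\<^sup>2))"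
    using a all unfolding weighted_l1_def
    by (intro infsum_mono summable_on_cmult_right summable_on_int_inverse_square)
  also have "\<dots> = (R\<^sup>2 * (\<Sum>\<^sub>\<infinity>m::int. 9 / (1 + real_of_int \<bar>m\<bar>)\<^sup>2)) * \<epsilon>"
    by (simp only: infsum_cmult_right' mult_ac)
  finally show "(\<Sum>\<^sub>\<infinity>m. cmod (a m) * R ^ nat \<bar>m\<bar>) \<le> (R\<^sup>2 * (\<Sum>\<^sub>\<infinity>m::int. 9 / (1 + real_of_int \<bar>m\<bar>)\<^sup>2)) * \<epsilon>" .
qed

section \<open>The functional calculus of the normalised neighbour sum\<close>

lemma has_sum_finite_sum:
  fixes f :: "'i \<Rightarrow> 'a \<Rightarrow> complex"
  assumes "finite I" "\<And>i. i \<in> I \<Longrightarrow> (f i has_sum s i) A"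
  shows "((\<lambda>x. \<Sum>i\<in>I. f i x) has_sum (\<Sum>i\<in>I. s i)) A"
  using assms by (induction I rule: finite_induct) (auto intro!: has_sum_add has_sum_0)

lemma infsum_diff_complex:
  fixes f g :: "'a \<Rightarrow> complex"
  assumes "f summable_on A" "g summable_on A"
  shows "(\<Sum>\<^sub>\<infinity>x\<in>A. f x - g x) = infsum f A - infsum g A"
proof -
  have "((\<lambda>x. f x + (- 1) * g x) has_sum (infsum f A + (- 1) * infsum g A)) A"
    by (intro has_sum_add has_sum_cmult_right has_sum_infsum assms)
  then show ?thesis by (simp add: infsumI)
qed

context tree
begin

text \<open>The normalisation is the one for which the symbol of \<open>J\<close> is \<open>t + 1 / t\<close>.\<close>

definition J :: "('v \<Rightarrow> complex) \<Rightarrow> 'v \<Rightarrow> complex" where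
  "J f x = neighbour_sum f x / of_real (sqrt (real q))"

lemma q_pos: "0 < real q" "0 < sqrt (real q)"
  using q2 by auto

lemma J_eq_sum: "J f x = (\<Sum>y | E x y. f y / of_real (sqrt (real q)))"
  by (simp add: J_def neighbour_sum_def sum_divide_distrib)

lemma J_add: "J (\<lambda>x. f x + g x) x = J f x + J g x"
  by (simp add: J_eq_sum add_divide_distrib sum.distrib)

lemma J_diff: "J (\<lambda>x. f x - g x) x = J f x - J g x"
  by (simp add: J_eq_sum diff_divide_distrib sum_subtractf)

lemma J_cmult: "J (\<lambda>x. c * f x) x = c * J f x"
  by (simp add: J_eq_sum sum_distrib_left)

lemma J_divide: "J (\<lambda>x. f x / c) x = J f x / c"
  by (simp add: J_eq_sum sum_divide_distrib mult.commute)

lemma J_sum: "J (\<lambda>x. \<Sum>i\<in>I. f i x) x = (\<Sum>i\<in>I. J (f i) x)"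
  by (simp add: J_eq_sum sum_divide_distrib) (rule sum.swap)

lemma neighbour_sum_eq: "neighbour_sum f x = of_real (sqrt (real q)) * J f x"
  using q_pos by (simp add: J_def)

lemma J_infsum:
  assumes "\<And>y. (\<lambda>n. g n y) summable_on UNIV"
  shows "J (\<lambda>x. \<Sum>\<^sub>\<infinity>n. g n x) x = (\<Sum>\<^sub>\<infinity>n. J (g n) x)"
proof -
  have "((\<lambda>n. \<Sum>y | E x y. g n y * inverse (of_real (sqrt (real q)))) has_sum
      (\<Sum>y | E x y. (\<Sum>\<^sub>\<infinity>n. g n y) * inverse (of_real (sqrt (real q))))) UNIV"
    by (intro has_sum_finite_sum has_sum_cmult_left has_sum_infsum assms) auto
  then show ?thesis by (simp add: J_eq_sum divide_inverse infsumI)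
qed

text \<open>The Chebyshev polynomials of the first kind at \<open>J / 2\<close>; their symbols are \<open>(t ^ n + 1 / t ^ n) / 2\<close>.\<close>

fun cheb :: "nat \<Rightarrow> ('v \<Rightarrow> complex) \<Rightarrow> 'v \<Rightarrow> complex" where
  "cheb 0 f = f"
| "cheb (Suc 0) f = (\<lambda>x. J f x / 2)"
| "cheb (Suc (Suc n)) f = (\<lambda>x. J (cheb (Suc n) f) x - cheb n f x)"

text \<open>The Chebyshev polynomials of the second kind at \<open>J / 2\<close>. They are the ones that occur in sphere sums.\<close>

fun chebU :: "nat \<Rightarrow> ('v \<Rightarrow> complex) \<Rightarrow> 'v \<Rightarrow> complex" where
  "chebU 0 f = f"
| "chebU (Suc 0) f = J f"
| "chebU (Suc (Suc n)) f = (\<lambda>x. J (chebU (Suc n) f) x - chebU n f x)"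

text \<open>Indexing by all integers makes the recursion two-sided, \<open>J\<close> being the sum of the two unit translations.\<close>

definition wave :: "('v \<Rightarrow> complex) \<Rightarrow> int \<Rightarrow> 'v \<Rightarrow> complex" where
  "wave f m = cheb (nat \<bar>m\<bar>) f"

lemma wave_uminus: "wave f (- m) = wave f m"
  by (simp add: wave_def)

lemma wave_0 [simp]: "wave f 0 = f"
  by (simp add: wave_def)

lemma J_wave: "J (wave f m) x = wave f (m + 1) x + wave f (m - 1) x"
proof -
  have pos: "J (wave f m) x = wave f (m + 1) x + wave f (m - 1) x" if m: "0 \<le> m" for m
  proof (cases "m = 0")
    case True
    then show ?thesis by (simp add: wave_def)
  next
    case False
    define n where "n = nat m - 1"
    have e: "nat \<bar>m\<bar> = Suc n" "nat \<bar>m + 1\<bar> = Suc (Suc n)" "nat \<bar>m - 1\<bar> = n"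
      using m False by (auto simp: n_def)
    show ?thesis by (simp add: wave_def e)
  qed
  show ?thesis
  proof (cases "0 \<le> m")
    case False
    then have "J (wave f (- m)) x = wave f (- m + 1) x + wave f (- m - 1) x" by (intro pos) auto
    moreover have "- m + 1 = - (m - 1)" "- m - 1 = - (m + 1)" by simp_all
    then have "wave f (- m + 1) = wave f (m - 1)" "wave f (- m - 1) = wave f (m + 1)"
      by (simp_all only: wave_uminus)
    ultimately show ?thesis by (simp add: wave_uminus)
  qed (rule pos)
qed

lemma cheb_wave: "cheb m (wave f n) x = (wave f (int m + n) x + wave f (int m - n) x) / 2"
proof (induction m arbitrary: x rule: induct_nat_012)
  case 0
  then show ?case using wave_uminus[of f n] by simp
next
  case 1
  have "wave f (1 - n) = wave f (n - 1)" using wave_uminus[of f "n - 1"] by simp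
  then show ?case by (simp add: J_wave add.commute)
next
  case (ge2 m)
  have "cheb (Suc m) (wave f n) = (\<lambda>x. (1 / 2) * (wave f (int (Suc m) + n) x + wave f (int (Suc m) - n) x))"
    using ge2(2) by auto
  then have "cheb (Suc (Suc m)) (wave f n) x
      = (1 / 2) * (J (wave f (int (Suc m) + n)) x + J (wave f (int (Suc m) - n)) x)
        - (wave f (int m + n) x + wave f (int m - n) x) / 2"
    using ge2(1) by (simp only: cheb.simps(3) J_cmult J_add)
  also have "\<dots> = (wave f (int (Suc (Suc m)) + n) x + wave f (int (Suc (Suc m)) - n) x) / 2"
    by (simp add: J_wave field_simps)
  finally show ?case .
qed

definition tempered :: "real \<Rightarrow> real \<Rightarrow> ('v \<Rightarrow> complex) \<Rightarrow> bool" where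
  "tempered R C f \<longleftrightarrow> (\<forall>m x. cmod (wave f m x) \<le> C * R ^ nat \<bar>m\<bar>)"

text \<open>For symmetric \<open>a\<close> this is the operator obtained by putting \<open>J\<close> for \<open>t + 1 / t\<close> in \<open>laurent a t\<close>.\<close>

definition apply_symbol :: "(int \<Rightarrow> complex) \<Rightarrow> ('v \<Rightarrow> complex) \<Rightarrow> 'v \<Rightarrow> complex" where
  "apply_symbol a f x = (\<Sum>\<^sub>\<infinity>m. a m * wave f m x)"

lemma tempered_shift:
  assumes R: "1 \<le> R" and f: "tempered R C f"
  shows "cmod (wave f (m + n) x) \<le> C * R ^ nat \<bar>m\<bar> * R ^ nat \<bar>n\<bar>"
proof -
  have le: "cmod (wave f k y) \<le> C * R ^ nat \<bar>k\<bar>" for k y using f by (simp add: tempered_def)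
  have C: "0 \<le> C" using order_trans[OF norm_ge_zero le[of 0 undefined]] by simp
  show ?thesis
    using le[of "m + n" x] mult_left_mono[OF pow_nat_abs_add_le[OF R, of m n] C] by (simp add: mult.assoc)
qed

lemma tempered_pairing:
  assumes R: "1 \<le> R" and f: "tempered R C f" and b: "weighted_l1 R b"
  shows "(\<lambda>n. b n * wave f (m + n) x) summable_on UNIV"
    and "cmod (\<Sum>\<^sub>\<infinity>n. b n * wave f (m + n) x) \<le> C * R ^ nat \<bar>m\<bar> * (\<Sum>\<^sub>\<infinity>n. cmod (b n) * R ^ nat \<bar>n\<bar>)"
  using weighted_l1_pairing(2,3)[OF b, of "\<lambda>n. wave f (m + n) x" "C * R ^ nat \<bar>m\<bar>"] tempered_shift[OF R f]
  by auto

lemma bij_uminus_int: "bij_betw uminus UNIV (UNIV :: int set)"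
  by (rule bij_betwI[of _ _ _ uminus]) auto

lemma symmetric_wave_sum:
  assumes b: "\<And>n. b (- n) = b n"
  shows "(\<Sum>\<^sub>\<infinity>n. b n * wave f (m - n) x) = (\<Sum>\<^sub>\<infinity>n. b n * wave f (m + n) x)"
  using infsum_reindex_bij_betw[OF bij_uminus_int, of "\<lambda>n. b n * wave f (m + n) x"] by (simp add: b)

text \<open>The product formula \<open>2 cos m cos n = cos (m + n) + cos (m - n)\<close>; by symmetry of \<open>b\<close> both terms have the same sum.\<close>

lemma wave_apply_symbol:
  assumes R: "1 \<le> R" and f: "tempered R C f" and b: "weighted_l1 R b" "\<And>n. b (- n) = b n"
  shows "wave (apply_symbol b f) m x = (\<Sum>\<^sub>\<infinity>n. b n * wave f (m + n) x)"
proof -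
  have sum: "(\<lambda>n. b n * cheb k (wave f n) y) summable_on UNIV" for k y
  proof -
    have "(\<lambda>n. b n * wave f (int k + n) y) summable_on UNIV"
      by (rule tempered_pairing(1)[OF R f b(1)])
    moreover have "(\<lambda>n. b n * wave f (int k - n) y) summable_on UNIV"
      using summable_on_reindex_bij_betw[OF bij_uminus_int, of "\<lambda>n. b n * wave f (int k + n) y"]
        tempered_pairing(1)[OF R f b(1), of "int k" y] by (simp add: b(2))
    ultimately have "(\<lambda>n. (b n * wave f (int k + n) y + b n * wave f (int k - n) y) * (1 / 2)) summable_on UNIV"
      by (intro summable_on_cmult_left summable_on_add)
    then show ?thesis by (simp add: cheb_wave algebra_simps add_divide_distrib)
  qed
  have cheb: "cheb k (apply_symbol b f) y = (\<Sum>\<^sub>\<infinity>n. b n * cheb k (wave f n) y)" for k y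
  proof (induction k arbitrary: y rule: induct_nat_012)
    case 0
    then show ?case by (simp add: apply_symbol_def)
  next
    case 1
    have s0: "(\<lambda>n. b n * wave f n y) summable_on UNIV" for y using sum[of 0 y] by simp
    have "J (apply_symbol b f) y = (\<Sum>\<^sub>\<infinity>n. b n * J (wave f n) y)"
      using J_infsum[of "\<lambda>n y. b n * wave f n y" y, OF s0] by (simp add: apply_symbol_def[abs_def] J_cmult)
    then show ?case using infsum_cmult_left'[of "\<lambda>n. b n * J (wave f n) y" "1 / 2 :: complex" UNIV] by simp
  next
    case (ge2 k)
    have e: "cheb (Suc k) (apply_symbol b f) = (\<lambda>y. \<Sum>\<^sub>\<infinity>n. b n * cheb (Suc k) (wave f n) y)"
      using ge2(2) by auto
    have "J (cheb (Suc k) (apply_symbol b f)) y = (\<Sum>\<^sub>\<infinity>n. J (\<lambda>y. b n * cheb (Suc k) (wave f n) y) y)"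
      unfolding e by (rule J_infsum) (rule sum)
    also have "\<dots> = (\<Sum>\<^sub>\<infinity>n. b n * J (cheb (Suc k) (wave f n)) y)" by (simp only: J_cmult)
    finally have "cheb (Suc (Suc k)) (apply_symbol b f) y
        = (\<Sum>\<^sub>\<infinity>n. b n * J (cheb (Suc k) (wave f n)) y) - (\<Sum>\<^sub>\<infinity>n. b n * cheb k (wave f n) y)"
      using ge2(1) by simp
    also have "\<dots> = (\<Sum>\<^sub>\<infinity>n. b n * cheb (Suc (Suc k)) (wave f n) y)"
    proof -
      have "(\<lambda>n. b n * cheb (Suc (Suc k)) (wave f n) y + b n * cheb k (wave f n) y) summable_on UNIV"
        by (intro summable_on_add sum)
      then have "(\<lambda>n. b n * J (cheb (Suc k) (wave f n)) y) summable_on UNIV"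
        by (simp add: algebra_simps)
      then have "(\<Sum>\<^sub>\<infinity>n. b n * J (cheb (Suc k) (wave f n)) y - b n * cheb k (wave f n) y)
          = (\<Sum>\<^sub>\<infinity>n. b n * J (cheb (Suc k) (wave f n)) y) - (\<Sum>\<^sub>\<infinity>n. b n * cheb k (wave f n) y)"
        by (intro infsum_diff_complex sum)
      then show ?thesis by (simp add: right_diff_distrib)
    qed
    finally show ?case .
  qed
  have half: "cheb k (apply_symbol b f) x = (\<Sum>\<^sub>\<infinity>n. b n * wave f (int k + n) x)" for k
  proof -
    have s1: "(\<lambda>n. b n * wave f (int k + n) x) summable_on UNIV"
      by (rule tempered_pairing(1)[OF R f b(1)])
    have s2: "(\<lambda>n. b n * wave f (int k - n) x) summable_on UNIV"
      using summable_on_reindex_bij_betw[OF bij_uminus_int, of "\<lambda>n. b n * wave f (int k + n) x"] s1 by (simp add: b(2))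
    have "cheb k (apply_symbol b f) x = (\<Sum>\<^sub>\<infinity>n. (b n * wave f (int k + n) x + b n * wave f (int k - n) x) * (1 / 2))"
      unfolding cheb by (simp add: cheb_wave algebra_simps add_divide_distrib)
    also have "\<dots> = ((\<Sum>\<^sub>\<infinity>n. b n * wave f (int k + n) x) + (\<Sum>\<^sub>\<infinity>n. b n * wave f (int k - n) x)) * (1 / 2)"
      by (simp only: infsum_cmult_left' infsum_add[OF s1 s2])
    also have "\<dots> = (\<Sum>\<^sub>\<infinity>n. b n * wave f (int k + n) x)"
      unfolding symmetric_wave_sum[of b, OF b(2)] by simp
    finally show ?thesis .
  qed
  show ?thesis
  proof (cases "0 \<le> m")
    case True
    then show ?thesis using half[of "nat m"] by (simp add: wave_def[of "apply_symbol b f"])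
  next
    case False
    then have "wave (apply_symbol b f) m x = (\<Sum>\<^sub>\<infinity>n. b n * wave f (- m + n) x)"
      using half[of "nat (- m)"] by (simp add: wave_def[of "apply_symbol b f"])
    also have "\<dots> = (\<Sum>\<^sub>\<infinity>n. b n * wave f (m - n) x)"
    proof (rule infsum_cong)
      fix n show "b n * wave f (- m + n) x = b n * wave f (m - n) x"
        using wave_uminus[of f "m - n"] by simp
    qed
    also have "\<dots> = (\<Sum>\<^sub>\<infinity>n. b n * wave f (m + n) x)"
      by (rule symmetric_wave_sum[of b, OF b(2)])
    finally show ?thesis .
  qed
qed

lemma tempered_apply_symbol:
  assumes R: "1 \<le> R" and f: "tempered R C f" and b: "weighted_l1 R b" "\<And>n. b (- n) = b n"
  shows "tempered R (C * (\<Sum>\<^sub>\<infinity>n. cmod (b n) * R ^ nat \<bar>n\<bar>)) (apply_symbol b f)"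
  unfolding tempered_def wave_apply_symbol[OF assms]
  using tempered_pairing(2)[OF R f b(1)] by (simp add: mult_ac)

lemma apply_symbol_conv:
  assumes R: "1 \<le> R" and f: "tempered R C f" and a: "weighted_l1 R a"
    and b: "weighted_l1 R b" "\<And>n. b (- n) = b n"
  shows "apply_symbol a (apply_symbol b f) = apply_symbol (conv a b) f"
proof
  fix x
  have "apply_symbol a (apply_symbol b f) x = (\<Sum>\<^sub>\<infinity>m. a m * (\<Sum>\<^sub>\<infinity>n. b n * wave f (m + n) x))"
    unfolding apply_symbol_def[of a] wave_apply_symbol[OF R f b] ..
  also have "\<dots> = (\<Sum>\<^sub>\<infinity>N. conv a b N * wave f N x)"
    by (rule conv_pairing[OF R a b(1), of "\<lambda>N. wave f N x" C]) (use f in \<open>simp add: tempered_def\<close>)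
  finally show "apply_symbol a (apply_symbol b f) x = apply_symbol (conv a b) f x"
    by (simp add: apply_symbol_def)
qed

lemma apply_symbol_cmult: "apply_symbol (\<lambda>m. c * a m) f x = c * apply_symbol a f x"
  by (simp add: apply_symbol_def mult.assoc infsum_cmult_right')

text \<open>Both sides satisfy the same three-term recursion, except for the first step, where the larger degree of the centre is
  absorbed by the term with \<open>n - 2\<close>.\<close>

lemma chebU_sphere:
  "sphere_sum n f x = of_real (sqrt (real q)) ^ n *
     (chebU n f x - (if n < 2 then 0 else chebU (n - 2) f x / of_nat q))"
proof -
  let ?s = "complex_of_real (sqrt (real q))"
  have s2: "?s * ?s = of_nat q"
    by (simp add: of_real_mult[symmetric] del: of_real_mult)
  have q0: "(of_nat q :: complex) \<noteq> 0" using q2 by simp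
  define P where "P = (\<lambda>n. \<forall>x. sphere_sum n f x = ?s ^ n *
     (chebU n f x - (if n < 2 then 0 else chebU (n - 2) f x / of_nat q)))"
  have P1: "P (Suc 0)" by (simp add: P_def sphere_sum_1 neighbour_sum_eq)
  have P2: "P (Suc (Suc 0))"
    unfolding P_def
  proof
    fix x
    have "neighbour_sum (sphere_sum (Suc 0) f) x = sphere_sum (Suc (Suc 0)) f x + of_nat (q + 1) * f x"
      using neighbour_sum_sphere_sum[of 0 f x] by simp
    moreover have "neighbour_sum (sphere_sum (Suc 0) f) x = ?s * (?s * J (J f) x)"
      unfolding neighbour_sum_eq sphere_sum_1 by (simp add: J_cmult neighbour_sum_eq[abs_def])
    ultimately have "sphere_sum (Suc (Suc 0)) f x = ?s * ?s * J (J f) x - of_nat (q + 1) * f x"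
      by (simp add: mult.assoc algebra_simps)
    also have "\<dots> = of_nat q * (J (J f) x - f x - f x / of_nat q)"
      unfolding s2 using q0 by (simp add: right_diff_distrib distrib_right)
    finally have F: "sphere_sum (Suc (Suc 0)) f x = of_nat q * (J (J f) x - f x - f x / of_nat q)" .
    have "?s ^ Suc (Suc 0) = of_nat q" by (simp only: power_Suc power_0 mult_1_right s2)
    then show "sphere_sum (Suc (Suc 0)) f x = ?s ^ Suc (Suc 0) *
     (chebU (Suc (Suc 0)) f x - (if Suc (Suc 0) < 2 then 0 else chebU (Suc (Suc 0) - 2) f x / of_nat q))"
      by (simp add: F del: power_Suc)
  qed
  have step: "P (Suc (Suc (Suc n)))" if 1: "P (Suc n)" and 2: "P (Suc (Suc n))" for n
    unfolding P_def
  proof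
    fix x
    let ?n = "Suc (Suc n)"
    define v where "v = (\<lambda>y. if Suc n < 2 then 0 else chebU (Suc n - 2) f y)"
    have v: "J (chebU n f) x = chebU (Suc n) f x + v x"
      by (cases n) (auto simp: v_def)
    have "sphere_sum ?n f = (\<lambda>y. ?s ^ ?n * (chebU ?n f y - (1 / of_nat q) * chebU n f y))"
      using 2 by (auto simp: P_def fun_eq_iff)
    then have "neighbour_sum (sphere_sum ?n f) x = ?s * (?s ^ ?n * (J (chebU ?n f) x - (1 / of_nat q) * J (chebU n f) x))"
      by (simp only: neighbour_sum_eq J_cmult J_diff)
    moreover have "neighbour_sum (sphere_sum ?n f) x = sphere_sum (Suc ?n) f x + of_nat q * sphere_sum (Suc n) f x"
      using neighbour_sum_sphere_sum[of "Suc n" f x] by simp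
    moreover have "of_nat q * sphere_sum (Suc n) f x = ?s * (?s ^ ?n * (chebU (Suc n) f x - v x / of_nat q))"
    proof -
      have "(if Suc n < 2 then 0 else chebU (Suc n - 2) f x / of_nat q) = v x / of_nat q" by (simp add: v_def)
      then have "sphere_sum (Suc n) f x = ?s ^ Suc n * (chebU (Suc n) f x - v x / of_nat q)"
        using 1 by (simp only: P_def)
      then show ?thesis by (simp only: s2[symmetric] power_Suc mult.assoc)
    qed
    ultimately have "sphere_sum (Suc ?n) f x = ?s * (?s ^ ?n * (J (chebU ?n f) x - (1 / of_nat q) * J (chebU n f) x))
        - ?s * (?s ^ ?n * (chebU (Suc n) f x - v x / of_nat q))"
      by (metis add_diff_cancel_right')
    also have "\<dots> = ?s ^ Suc ?n * (chebU (Suc ?n) f x - chebU (Suc n) f x / of_nat q)"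
      unfolding v by (simp add: algebra_simps add_divide_distrib)
    finally show "sphere_sum (Suc ?n) f x = ?s ^ Suc ?n *
     (chebU (Suc ?n) f x - (if Suc ?n < 2 then 0 else chebU (Suc ?n - 2) f x / of_nat q))"
      by simp
  qed
  have "P (Suc n) \<and> P (Suc (Suc n))" for n
    by (induction n) (use P1 P2 step in auto)
  moreover have "P 0" by (simp add: P_def)
  ultimately have "P n" by (cases n) auto
  then show ?thesis by (simp add: P_def)
qed

lemma cheb_chebU: "cheb (Suc n) f x = (chebU (Suc n) f x - (if n = 0 then 0 else chebU (n - 1) f x)) / 2"
proof (induction n arbitrary: x rule: induct_nat_012)
  case (ge2 n)
  have "cheb (Suc (Suc n)) f = (\<lambda>x. (1 / 2) * (chebU (Suc (Suc n)) f x - chebU n f x))"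
    using ge2(2) by auto
  then have "cheb (Suc (Suc (Suc n))) f x = (1 / 2) * (J (chebU (Suc (Suc n)) f) x - J (chebU n f) x)
     - (chebU (Suc n) f x - (if n = 0 then 0 else chebU (n - 1) f x)) / 2"
    using ge2(1) by (simp only: cheb.simps(3) J_cmult J_diff)
  moreover have "J (chebU n f) x = chebU (Suc n) f x + (if n = 0 then 0 else chebU (n - 1) f x)"
    by (cases n) auto
  moreover have "chebU (Suc (Suc (Suc n))) f x = J (chebU (Suc (Suc n)) f) x - chebU (Suc n) f x"
    by (rule fun_cong[OF chebU.simps(3)])
  moreover have "l = (u - c) / 2" if "l = 1 / 2 * (a - b) - (c - v) / 2" "b = c + v" "u = a - c"
    for a b c v l u :: complex unfolding that by (simp add: field_simps)
  ultimately have "cheb (Suc (Suc (Suc n))) f x = (chebU (Suc (Suc (Suc n))) f x - chebU (Suc n) f x) / 2"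
    by metis
  then show ?case by (simp only: nat.distinct if_False diff_Suc_1)
qed (auto simp: field_simps J_divide)

definition linear_symbol :: "complex \<Rightarrow> int \<Rightarrow> complex" where
  "linear_symbol \<kappa> m = (if m = 0 then - \<kappa> else if \<bar>m\<bar> = 1 then 1 else 0)"

lemma infsum_linear_symbol:
  fixes v :: "int \<Rightarrow> complex"
  shows "(\<lambda>m. linear_symbol \<kappa> m * v m) summable_on UNIV"
    and "(\<Sum>\<^sub>\<infinity>m. linear_symbol \<kappa> m * v m) = v 1 + v (- 1) - \<kappa> * v 0"
proof -
  have "((\<lambda>m. linear_symbol \<kappa> m * v m) has_sum (\<Sum>m\<in>{-1, 0, 1}. linear_symbol \<kappa> m * v m)) {-1, 0, 1}"
    by (intro has_sum_finite) simp
  then have "((\<lambda>m. linear_symbol \<kappa> m * v m) has_sum (\<Sum>m\<in>{-1, 0, 1}. linear_symbol \<kappa> m * v m)) UNIV"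
    by (subst has_sum_cong_neutral[where T = "{-1, 0, 1}" and g = "\<lambda>m. linear_symbol \<kappa> m * v m"])
       (auto simp: linear_symbol_def)
  moreover have "(\<Sum>m\<in>{-1, 0, 1}. linear_symbol \<kappa> m * v m) = v 1 + v (- 1) - \<kappa> * v 0"
    by (simp add: linear_symbol_def)
  ultimately show "(\<lambda>m. linear_symbol \<kappa> m * v m) summable_on UNIV"
    and "(\<Sum>\<^sub>\<infinity>m. linear_symbol \<kappa> m * v m) = v 1 + v (- 1) - \<kappa> * v 0"
    by (auto simp: infsumI has_sum_imp_summable)
qed

lemma linear_symbol_uminus: "linear_symbol \<kappa> (- m) = linear_symbol \<kappa> m"
  by (simp add: linear_symbol_def)

lemma weighted_l1_linear_symbol: "weighted_l1 R (linear_symbol \<kappa>)"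
proof -
  have "(\<lambda>m. cmod (linear_symbol \<kappa> m) * R ^ nat \<bar>m\<bar>) summable_on {-1, 0, 1}" by simp
  then show ?thesis unfolding weighted_l1_def
    by (subst summable_on_cong_neutral[where T = "{-1, 0, 1}" and g = "\<lambda>m. cmod (linear_symbol \<kappa> m) * R ^ nat \<bar>m\<bar>"])
       (auto simp: linear_symbol_def)
qed

lemma laurent_linear_symbol: "laurent (linear_symbol \<kappa>) t = t + 1 / t - \<kappa>"
  by (simp add: laurent_def infsum_linear_symbol(2) power_int_minus inverse_eq_divide)

lemma apply_linear_symbol: "apply_symbol (linear_symbol \<kappa>) f x = J f x - \<kappa> * f x"
  using J_wave[of f 0 x] by (simp add: apply_symbol_def infsum_linear_symbol(2))

lemma marcinkiewicz_J:
  assumes p: "1 \<le> p" and f: "marcinkiewicz p C f"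
  shows "\<exists>C'. marcinkiewicz p C' (J f)"
proof -
  let ?s = "sqrt (real q)"
  have C: "0 \<le> C" by (rule marcinkiewicz_nonneg[OF f])
  have "marcinkiewicz p ((real q + 1) * C * (real q + 1) powr (1 / p) / ?s) (J f)"
    unfolding marcinkiewicz_def
  proof (intro allI impI)
    fix S :: "'v set" assume S: "finite S"
    let ?N = "\<Union>x\<in>S. {y. E x y}"
    have N: "finite ?N" using S by auto
    have cN: "card ?N \<le> card S * (q + 1)"
      using card_UN_le[OF S, of "\<lambda>x. {y. E x y}"] card_neighbours by simp
    have "(\<Sum>x\<in>S. cmod (neighbour_sum f x)) \<le> (\<Sum>x\<in>S. \<Sum>y | E x y. cmod (f y))"
      unfolding neighbour_sum_def by (intro sum_mono norm_sum)
    also have "\<dots> = (\<Sum>x\<in>S. \<Sum>y | y \<in> ?N \<and> E x y. cmod (f y))"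
      by (intro sum.cong refl) auto
    also have "\<dots> = (\<Sum>y\<in>?N. \<Sum>x | x \<in> S \<and> E x y. cmod (f y))"
      by (rule sum.swap_restrict[OF S N])
    also have "\<dots> \<le> (\<Sum>y\<in>?N. (real q + 1) * cmod (f y))"
    proof (rule sum_mono)
      fix y
      have "card {x \<in> S. E x y} \<le> card {x. E y x}" using E_sym by (intro card_mono) auto
      then have "real (card {x \<in> S. E x y}) \<le> real q + 1" unfolding card_neighbours by simp
      then show "(\<Sum>x | x \<in> S \<and> E x y. cmod (f y)) \<le> (real q + 1) * cmod (f y)"
        by (simp add: mult_right_mono)
    qed
    also have "\<dots> = (real q + 1) * (\<Sum>y\<in>?N. cmod (f y))" by (simp add: sum_distrib_left)
    also have "\<dots> \<le> (real q + 1) * (C * real (card ?N) powr (1 / p))"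
      by (intro mult_left_mono marcinkiewiczD[OF f N]) auto
    also have "\<dots> \<le> (real q + 1) * (C * (real (card S) * (real q + 1)) powr (1 / p))"
    proof -
      have "real (card ?N) \<le> real (card S) * (real q + 1)"
        using cN by (metis of_nat_le_iff of_nat_mult of_nat_Suc Suc_eq_plus1 add.commute)
      then show ?thesis using C p by (intro mult_left_mono powr_mono2) auto
    qed
    also have "\<dots> = (real q + 1) * C * (real q + 1) powr (1 / p) * real (card S) powr (1 / p)"
      by (simp add: powr_mult mult_ac)
    finally have "(\<Sum>x\<in>S. cmod (neighbour_sum f x)) / ?s
        \<le> (real q + 1) * C * (real q + 1) powr (1 / p) * real (card S) powr (1 / p) / ?s"
      using q_pos by (intro divide_right_mono) auto
    then show "(\<Sum>x\<in>S. cmod (J f x)) \<le> (real q + 1) * C * (real q + 1) powr (1 / p) / ?s * real (card S) powr (1 / p)"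
      using q_pos by (simp add: J_def norm_divide sum_divide_distrib)
  qed
  then show ?thesis by blast
qed

text \<open>A sphere of radius \<open>n\<close> has about \<open>q ^ n\<close> points, and \<open>q powr (1 / p) = sqrt q * R\<close>.\<close>

lemma sphere_sum_norm_le:
  assumes p: "1 \<le> p" and f: "marcinkiewicz p C f"
  shows "(\<Sum>y\<in>vsphere x n. cmod (f y)) \<le> 2 * C * (sqrt (real q) * real q powr (1 / p - 1 / 2)) ^ n"
proof -
  have C: "0 \<le> C" by (rule marcinkiewicz_nonneg[OF f])
  have "(\<Sum>y\<in>vsphere x n. cmod (f y)) \<le> C * real (card (vsphere x n)) powr (1 / p)"
    by (rule marcinkiewiczD[OF f finite_vsphere])
  also have "\<dots> \<le> C * (2 * real q ^ n) powr (1 / p)"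
    using C p card_sphere_le by (intro mult_left_mono powr_mono2) auto
  also have "(2 * real q ^ n) powr (1 / p) = 2 powr (1 / p) * (real q powr (1 / p)) ^ n"
    using q_pos by (simp add: powr_mult powr_realpow[symmetric] powr_powr mult.commute)
  also have "C * \<dots> \<le> C * (2 * (real q powr (1 / p)) ^ n)"
  proof -
    have "2 powr (1 / p) \<le> 2 powr (1 :: real)" using p by (intro powr_mono) auto
    then show ?thesis using C by (intro mult_left_mono mult_right_mono) auto
  qed
  also have "real q powr (1 / p) = sqrt (real q) * real q powr (1 / p - 1 / 2)"
    using q_pos by (simp add: powr_half_sqrt[symmetric] powr_add[symmetric])
  finally show ?thesis by (simp add: mult_ac)
qed

text \<open>Solving \<open>chebU_sphere\<close> for the Chebyshev image gives a geometric series of ratio \<open>1 / (q * R\<^sup>2) \<le> 1 / 2\<close>.\<close>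

lemma chebU_bound:
  assumes R: "1 \<le> R" and f: "\<And>n x. cmod (sphere_sum n f x) \<le> C * (sqrt (real q) * R) ^ n"
  shows "cmod (chebU n f x) \<le> 2 * C * R ^ n"
proof (induction n rule: less_induct)
  case (less n)
  let ?s = "complex_of_real (sqrt (real q))"
  have s: "cmod (?s ^ n) = sqrt (real q) ^ n" "0 < sqrt (real q) ^ n"
    using q_pos by (simp_all add: norm_power)
  have C: "0 \<le> C" using order_trans[OF norm_ge_zero f[of 0 x]] by simp
  define r where "r = (if n < 2 then 0 else chebU (n - 2) f x / of_nat q)"
  have "cmod (chebU n f x - r) * sqrt (real q) ^ n = cmod (sphere_sum n f x)"
    unfolding chebU_sphere[of n f x] r_def by (simp only: norm_mult s(1) mult.commute)
  also have "\<dots> \<le> (C * R ^ n) * sqrt (real q) ^ n" using f[of n x] by (simp add: power_mult_distrib mult_ac)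
  finally have 1: "cmod (chebU n f x - r) \<le> C * R ^ n" using s(2) by simp
  have "cmod r \<le> C * R ^ n"
  proof (cases "n < 2")
    case True
    then show ?thesis using C R by (simp add: r_def)
  next
    case False
    have "cmod r = cmod (chebU (n - 2) f x) / real q" using False by (simp add: r_def norm_divide)
    also have "\<dots> \<le> (2 * C * R ^ (n - 2)) / 2"
      using less.IH[of "n - 2"] False q2 C R by (intro frac_le) auto
    also have "\<dots> \<le> C * R ^ n" using C R by (simp add: mult_left_mono power_increasing)
    finally show ?thesis .
  qed
  then show ?case using 1 norm_triangle_ineq[of "chebU n f x - r" r] by simp
qed

text \<open>The growth rate \<open>q powr (1 / p - 1 / 2)\<close> is the modulus of \<open>t\<close> on the boundary of the strip. This is the link between
  the function space and the spectral parameter.\<close>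

lemma marcinkiewicz_imp_tempered:
  assumes p: "1 \<le> p" "p < 2" and f: "marcinkiewicz p C f"
  shows "tempered (real q powr (1 / p - 1 / 2)) (4 * C) f"
proof -
  define R where "R = real q powr (1 / p - 1 / 2)"
  have "0 \<le> 1 / p - 1 / 2" using p by (simp add: field_simps)
  then have R: "1 \<le> R" unfolding R_def using q2 by (intro ge_one_powr_ge_zero) auto
  have C: "0 \<le> C" by (rule marcinkiewicz_nonneg[OF f])
  have s: "cmod (sphere_sum n f x) \<le> 2 * C * (sqrt (real q) * R) ^ n" for n x
    using order_trans[OF norm_sum sphere_sum_norm_le[OF p(1) f, of x n]] by (simp add: sphere_sum_def R_def)
  have U: "cmod (chebU n f x) \<le> 4 * C * R ^ n" for n x
    using chebU_bound[OF R s, of n x] by simp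
  have "cmod (cheb n f x) \<le> 4 * C * R ^ n" for n x
  proof (cases n)
    case 0
    then show ?thesis using U[of 0 x] by simp
  next
    case (Suc k)
    define r where "r = (if k = 0 then 0 else chebU (k - 1) f x)"
    have "cmod r \<le> 4 * C * R ^ n"
    proof (cases "k = 0")
      case False
      have "4 * C * R ^ (k - 1) \<le> 4 * C * R ^ n" using C R Suc by (intro mult_left_mono power_increasing) auto
      then show ?thesis using U[of "k - 1" x] False by (simp add: r_def)
    qed (use C R in \<open>simp add: r_def\<close>)
    then have "cmod (chebU n f x - r) \<le> 8 * C * R ^ n"
      using U[of n x] norm_triangle_ineq4[of "chebU n f x" r] by linarith
    moreover have "cheb n f x = (chebU n f x - r) / 2" by (simp only: Suc cheb_chebU r_def)
    then have "cmod (cheb n f x) = cmod (chebU n f x - r) / 2" by (simp only: norm_divide norm_numeral)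
    ultimately show ?thesis by linarith
  qed
  then show ?thesis by (simp add: tempered_def wave_def R_def)
qed

end

section \<open>The boundary and the Poisson transform\<close>

locale tree_boundary = tree q E for q :: nat and E :: "'v \<Rightarrow> 'v \<Rightarrow> bool" +
  fixes v0 :: 'v and \<nu> :: "(nat \<Rightarrow> 'v) measure"
  assumes nu: "boundary_measure q E v0 \<nu>"
begin

abbreviation lvl :: "'v \<Rightarrow> nat" where "lvl \<equiv> d v0"

definition parent :: "'v \<Rightarrow> 'v" where
  "parent x = (SOME y. E x y \<and> Suc (lvl y) = lvl x)"

lemma parent:
  assumes "x \<noteq> v0"
  shows "E x (parent x)" "Suc (lvl (parent x)) = lvl x"
proof -
  obtain n where n: "d x v0 = Suc n" using assms by (cases "d x v0") auto
  then obtain y where "E x y" "d y v0 = n" using neighbour_closer by blast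
  then have "\<exists>y. E x y \<and> Suc (lvl y) = lvl x" using n by (auto simp: d_sym)
  then show "E x (parent x)" "Suc (lvl (parent x)) = lvl x"
    unfolding parent_def by (metis (mono_tags, lifting) someI_ex)+
qed

lemma parent_unique:
  assumes "E x y" "lvl y < lvl x"
  shows "y = parent x"
proof -
  have ne: "x \<noteq> v0" using assms by auto
  show ?thesis
    using unique_closer_neighbour[OF ne assms(1) _ parent(1)[OF ne]] assms(2) parent(2)[OF ne]
    by (simp add: d_sym)
qed

definition children :: "'v \<Rightarrow> 'v set" where
  "children x = {y. E x y \<and> lvl y = Suc (lvl x)}"

lemma finite_children [simp]: "finite (children x)"
  unfolding children_def by (rule finite_subset[OF _ finite_neighbours[of x]]) auto

lemma children_iff: "y \<in> children x \<longleftrightarrow> y \<noteq> v0 \<and> parent y = x"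
  using parent[of y] parent_unique[of y x] E_sym by (auto simp: children_def)

lemma card_children: "card (children x) = (if x = v0 then q + 1 else q)"
  using card_farther[of x v0] by (simp add: children_def d_sym)

lemma neighbours_eq: "{y. E x y} = (if x = v0 then children x else insert (parent x) (children x))"
proof (cases "x = v0")
  case True
  then show ?thesis using d_eq_1_iff[of v0] by (auto simp: children_def)
next
  case False
  have "y = parent x \<or> y \<in> children x" if "E x y" for y
    using neighbour_dist[OF that False] parent_unique[OF that] that by (auto simp: children_def d_sym)
  then show ?thesis using parent(1)[OF False] False by (auto simp: children_def)
qed

lemma parent_notin_children: "x \<noteq> v0 \<Longrightarrow> parent x \<notin> children x"
  using parent(2)[of x] by (simp add: children_def)

lemma vsphere_Suc: "vsphere v0 (Suc n) = (\<Union>x\<in>vsphere v0 n. children x)"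
proof
  show "vsphere v0 (Suc n) \<subseteq> (\<Union>x\<in>vsphere v0 n. children x)"
  proof
    fix y assume y: "y \<in> vsphere v0 (Suc n)"
    then have ne: "y \<noteq> v0" by (auto simp: vsphere_def)
    have "parent y \<in> vsphere v0 n" using parent(2)[OF ne] y by (simp add: vsphere_def)
    moreover have "y \<in> children (parent y)" using ne by (simp add: children_iff)
    ultimately show "y \<in> (\<Union>x\<in>vsphere v0 n. children x)" by blast
  qed
qed (auto simp: vsphere_def children_def)

lemma disjoint_children: "x \<noteq> y \<Longrightarrow> children x \<inter> children y = {}"
  by (auto simp: children_iff)

lemma boundaryD:
  assumes "\<omega> \<in> boundary E v0"
  shows "\<omega> 0 = v0" "lvl (\<omega> n) = n" "E (\<omega> n) (\<omega> (Suc n))" "parent (\<omega> (Suc n)) = \<omega> n" "\<omega> (Suc n) \<noteq> v0"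
proof -
  have b: "\<omega> 0 = v0" "\<And>m n. m \<le> n \<Longrightarrow> d (\<omega> m) (\<omega> n) = n - m"
    using assms by (auto simp: boundary_def)
  show "\<omega> 0 = v0" by fact
  show l: "lvl (\<omega> n) = n" for n using b(2)[of 0 n] b(1) by simp
  show e: "E (\<omega> n) (\<omega> (Suc n))" using b(2)[of n "Suc n"] d_eq_1_iff by simp
  show "\<omega> (Suc n) \<noteq> v0" using l[of "Suc n"] by auto
  show "parent (\<omega> (Suc n)) = \<omega> n"
    by (rule parent_unique[symmetric, OF E_sym[OF e]]) (simp add: l)
qed

text \<open>The Poisson kernel depends on the ray only through this level.\<close>

definition conf_level :: "'v \<Rightarrow> (nat \<Rightarrow> 'v) \<Rightarrow> nat" where
  "conf_level x \<omega> = lvl (confluence E v0 x \<omega>)"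

lemma conf_level:
  assumes w: "\<omega> \<in> boundary E v0"
  shows "conf_level x \<omega> + d (\<omega> (conf_level x \<omega>)) x = lvl x"
    and "j + d (\<omega> j) x = lvl x \<Longrightarrow> j \<le> conf_level x \<omega>"
proof -
  let ?P = "\<lambda>y. lvl y + d y x = lvl x \<and> y \<in> range \<omega>"
  have P0: "?P v0" using boundaryD(1)[OF w] by (auto intro: range_eqI[of _ _ 0])
  have bd: "\<forall>y. ?P y \<longrightarrow> lvl y < Suc (lvl x)" by auto
  have am: "?P (confluence E v0 x \<omega>) \<and> (\<forall>y. ?P y \<longrightarrow> lvl y \<le> lvl (confluence E v0 x \<omega>))"
    unfolding confluence_def by (rule arg_max_nat_lemma[of ?P, OF P0 bd])
  then obtain i where i: "confluence E v0 x \<omega> = \<omega> i" by auto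
  have ci: "conf_level x \<omega> = i" using i boundaryD(2)[OF w] by (simp add: conf_level_def)
  show "conf_level x \<omega> + d (\<omega> (conf_level x \<omega>)) x = lvl x"
    using am i ci boundaryD(2)[OF w] by simp
  assume "j + d (\<omega> j) x = lvl x"
  then have "?P (\<omega> j)" using boundaryD(2)[OF w] by simp
  then show "j \<le> conf_level x \<omega>" using am boundaryD(2)[OF w] by (metis conf_level_def)
qed

lemma conf_levelI:
  assumes w: "\<omega> \<in> boundary E v0" and "j + d (\<omega> j) x = lvl x"
    and "\<And>i. i + d (\<omega> i) x = lvl x \<Longrightarrow> i \<le> j"
  shows "conf_level x \<omega> = j"
  using conf_level[OF w] assms(2,3) by (meson order_antisym)

text \<open>The confluence point has the level of \<open>x\<close> exactly when the ray passes through \<open>x\<close>.\<close>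

lemma cylinder_eq: "cylinder E v0 x = {\<omega> \<in> boundary E v0. \<omega> (lvl x) = x}"
proof -
  have "lvl (confluence E v0 x \<omega>) = lvl x \<longleftrightarrow> \<omega> (lvl x) = x" if w: "\<omega> \<in> boundary E v0" for \<omega>
    unfolding conf_level_def[symmetric]
  proof
    assume "conf_level x \<omega> = lvl x"
    then show "\<omega> (lvl x) = x" using conf_level(1)[OF w, of x] by simp
  next
    assume "\<omega> (lvl x) = x"
    then show "conf_level x \<omega> = lvl x" using conf_level(1)[OF w, of x] conf_level(2)[OF w, of "lvl x" x] by simp
  qed
  then show ?thesis by (auto simp: cylinder_def)
qed

lemma conf_level_root: "\<omega> \<in> boundary E v0 \<Longrightarrow> conf_level v0 \<omega> = 0"
  using conf_level(1)[of \<omega> v0] by simp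

lemma conf_level_in_cylinder:
  assumes "\<omega> \<in> boundary E v0" "\<omega> (lvl x) = x"
  shows "conf_level x \<omega> = lvl x"
  using conf_level(1)[OF assms(1), of x] conf_level(2)[OF assms(1), of "lvl x" x] assms(2) by simp

lemma conf_level_parent:
  assumes w: "\<omega> \<in> boundary E v0" and x: "x \<noteq> v0" and n: "\<omega> (lvl x) \<noteq> x"
  shows "conf_level x \<omega> = conf_level (parent x) \<omega>"
proof (rule conf_levelI[OF w])
  have up: "j + d (\<omega> j) x = lvl x" if "j + d (\<omega> j) (parent x) = lvl (parent x)" for j
  proof -
    have "d (\<omega> j) x \<le> Suc (d (\<omega> j) (parent x))"
      using d_triangle[of "\<omega> j" x "parent x"] parent(1)[OF x] d_eq_1_iff[of "parent x" x] E_sym by simp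
    moreover have "lvl x \<le> j + d (\<omega> j) x" using d_triangle[of v0 x "\<omega> j"] boundaryD(2)[OF w] by simp
    ultimately show ?thesis using that parent(2)[OF x] by linarith
  qed
  show "conf_level (parent x) \<omega> + d (\<omega> (conf_level (parent x) \<omega>)) x = lvl x"
    by (rule up[OF conf_level(1)[OF w]])
  fix i assume i: "i + d (\<omega> i) x = lvl x"
  have "d x (\<omega> i) \<noteq> 0"
  proof
    assume "d x (\<omega> i) = 0"
    then have "x = \<omega> i" "i = lvl x" using i by auto
    then show False using n by simp
  qed
  then obtain k where k: "d x (\<omega> i) = Suc k" by (cases "d x (\<omega> i)") auto
  then obtain y where y: "E x y" "d y (\<omega> i) = k" using neighbour_closer by blast
  have "lvl y \<le> i + k" using d_triangle[of v0 y "\<omega> i"] boundaryD(2)[OF w] y(2) by (simp add: d_sym)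
  then have "y = parent x" using i k by (intro parent_unique y) (simp add: d_sym)
  then have "i + d (\<omega> i) (parent x) = lvl (parent x)"
    using i k y(2) parent(2)[OF x] by (simp add: d_sym)
  then show "i \<le> conf_level (parent x) \<omega>" by (rule conf_level(2)[OF w])
qed

lemma prob_space_nu: "prob_space \<nu>" and space_nu: "space \<nu> = boundary E v0"
  and measure_cylinder: "1 \<le> lvl x \<Longrightarrow> measure \<nu> (cylinder E v0 x) = 1 / ((real q + 1) * real q ^ (lvl x - 1))"
  using nu by (auto simp: boundary_measure_def)

sublocale prob_space \<nu> by (rule prob_space_nu)

lemma sets_cylinder [measurable]: "cylinder E v0 x \<in> sets \<nu>"
proof -
  have "openin (boundary_topology E v0) (cylinder E v0 x)"
    unfolding boundary_topology_def by (rule topology_generated_by_Basis) auto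
  then show ?thesis using nu by (auto simp: boundary_measure_def intro: sigma_sets.Basic)
qed

lemma cylinder_root: "cylinder E v0 v0 = space \<nu>"
  using boundaryD(1) by (auto simp: cylinder_eq space_nu)

lemma poisson_kernel_powr:
  fixes s :: complex
  shows "complex_of_real (poisson_kernel q E v0 x \<omega>) powr s = (of_nat q powr s) powi (2 * int (conf_level x \<omega>) - int (lvl x))"
proof -
  let ?k = "2 * int (conf_level x \<omega>) - int (lvl x)"
  have q0: "(0::real) < real q" using q2 by simp
  have "complex_of_real y powr s = exp (s * of_real (ln y))" if "0 < y" for y
    using that by (simp add: powr_def Ln_of_real)
  then have "complex_of_real (real q powi ?k) powr s = exp (s * of_real (ln (real q powi ?k)))"
    using q0 by (simp del: of_real_power_int)
  also have "ln (real q powi ?k) = of_int ?k * ln (real q)" using q0 by (simp add: powr_real_of_int'[symmetric] ln_powr)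
  also have "exp (s * of_real (of_int ?k * ln (real q))) = exp (s * of_real (ln (real q))) powi ?k"
    by (simp add: exp_power_int mult_ac)
  also have "exp (s * of_real (ln (real q))) = of_nat q powr s"
    using q0 Ln_of_real[OF q0] by (simp add: powr_def)
  finally show ?thesis by (simp add: poisson_kernel_def conf_level_def)
qed

lemma base_nonzero: "(of_nat q powr s :: complex) \<noteq> 0"
  using q2 by (simp add: powr_def)

definition kernel_power :: "complex \<Rightarrow> 'v \<Rightarrow> (nat \<Rightarrow> 'v) \<Rightarrow> complex" where
  "kernel_power Q x \<omega> = Q powi (2 * int (conf_level x \<omega>) - int (lvl x))"

lemma poisson_transform_eq:
  "poisson_transform q E v0 \<nu> z F x = (LINT \<omega>|\<nu>. kernel_power (of_nat q powr (1 / 2 + \<i> * z)) x \<omega> * F \<omega>)"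
  by (simp add: poisson_transform_def poisson_kernel_powr kernel_power_def)

lemma kernel_power_root: "\<omega> \<in> boundary E v0 \<Longrightarrow> kernel_power Q v0 \<omega> = 1"
  by (simp add: kernel_power_def conf_level_root)

text \<open>Passing from the parent to \<open>x\<close> changes the exponent by \<open>-1\<close> if the ray misses \<open>x\<close> and by \<open>+1\<close> if it meets \<open>x\<close>.\<close>

lemma kernel_power_step:
  assumes Q: "Q \<noteq> 0" and w: "\<omega> \<in> boundary E v0" and x: "x \<noteq> v0"
  shows "kernel_power Q x \<omega> = kernel_power Q (parent x) \<omega> / Q
     + (Q powi int (lvl x) - Q powi (int (lvl x) - 2)) * indicator (cylinder E v0 x) \<omega>"
proof (cases "\<omega> (lvl x) = x")
  case True
  have pl: "lvl x = Suc (lvl (parent x))" using parent(2)[OF x] by simp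
  have "\<omega> (lvl (parent x)) = parent x"
    using boundaryD(4)[OF w, of "lvl (parent x)"] True pl by simp
  then have c: "conf_level x \<omega> = lvl x" "conf_level (parent x) \<omega> = lvl (parent x)"
    using conf_level_in_cylinder[OF w] True by auto
  have "kernel_power Q (parent x) \<omega> = Q powi (int (lvl x) - 1)" by (simp add: kernel_power_def c pl)
  also have "\<dots> / Q = Q powi (int (lvl x) - 2)"
    using Q power_int_diff[of Q "int (lvl x) - 1" 1] by simp
  finally show ?thesis using True w by (simp add: kernel_power_def c cylinder_eq)
next
  case False
  have "kernel_power Q (parent x) \<omega> = Q powi (2 * int (conf_level x \<omega>) - int (lvl x) + 1)"
    using conf_level_parent[OF w x False] parent(2)[OF x, symmetric] by (simp add: kernel_power_def)
  then show ?thesis using False Q by (simp add: kernel_power_def cylinder_eq power_int_add)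
qed

lemma integrable_kernel_power:
  assumes Q: "Q \<noteq> 0" and F: "integrable \<nu> F"
  shows "integrable \<nu> (\<lambda>\<omega>. kernel_power Q x \<omega> * F \<omega>)"
proof (induction "lvl x" arbitrary: x)
  case 0
  have "integrable \<nu> (\<lambda>\<omega>. kernel_power Q v0 \<omega> * F \<omega>) \<longleftrightarrow> integrable \<nu> F"
    by (rule Bochner_Integration.integrable_cong) (auto simp: space_nu kernel_power_root)
  then show ?case using 0 F by simp
next
  case (Suc n)
  then have x: "x \<noteq> v0" by auto
  have ind: "integrable \<nu> (\<lambda>\<omega>. indicat_real (cylinder E v0 x) \<omega> *\<^sub>R F \<omega>)"
    by (rule integrable_mult_indicator[OF sets_cylinder F])
  have "integrable \<nu> (\<lambda>\<omega>. (1 / Q) * (kernel_power Q (parent x) \<omega> * F \<omega>)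
      + (Q powi int (lvl x) - Q powi (int (lvl x) - 2)) * (indicat_real (cylinder E v0 x) \<omega> *\<^sub>R F \<omega>))"
    using Suc parent(2)[OF x] ind by (intro Bochner_Integration.integrable_add integrable_mult_right) auto
  then show ?case
    by (rule Bochner_Integration.integrable_cong[OF refl, THEN iffD1, rotated])
       (auto simp: space_nu kernel_power_step[OF Q _ x] algebra_simps scaleR_conv_of_real indicator_def)
qed

lemma poisson_transform_root:
  "poisson_transform q E v0 \<nu> z F v0 = (LINT \<omega>|\<nu>. F \<omega>)"
  unfolding poisson_transform_eq
  by (rule Bochner_Integration.integral_cong) (auto simp: space_nu kernel_power_root)

text \<open>The recursion determines the Poisson transform from the integrals of \<open>F\<close> over the cylinders alone.\<close>

lemma poisson_transform_step:
  fixes z :: complex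
  assumes F: "integrable \<nu> F" and x: "x \<noteq> v0"
  defines "Q \<equiv> of_nat q powr (1 / 2 + \<i> * z)"
  shows "poisson_transform q E v0 \<nu> z F x = poisson_transform q E v0 \<nu> z F (parent x) / Q
     + (Q powi int (lvl x) - Q powi (int (lvl x) - 2)) * (LINT \<omega>|\<nu>. indicat_real (cylinder E v0 x) \<omega> *\<^sub>R F \<omega>)"
proof -
  have Q: "Q \<noteq> 0" unfolding Q_def by (rule base_nonzero)
  have "poisson_transform q E v0 \<nu> z F x = (LINT \<omega>|\<nu>. (1 / Q) * (kernel_power Q (parent x) \<omega> * F \<omega>)
      + (Q powi int (lvl x) - Q powi (int (lvl x) - 2)) * (indicat_real (cylinder E v0 x) \<omega> *\<^sub>R F \<omega>))"
    unfolding poisson_transform_eq Q_def[symmetric]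
    by (rule Bochner_Integration.integral_cong)
       (auto simp: space_nu kernel_power_step[OF Q _ x] algebra_simps scaleR_conv_of_real indicator_def)
  also have "\<dots> = (1 / Q) * (LINT \<omega>|\<nu>. kernel_power Q (parent x) \<omega> * F \<omega>)
      + (Q powi int (lvl x) - Q powi (int (lvl x) - 2)) * (LINT \<omega>|\<nu>. indicat_real (cylinder E v0 x) \<omega> *\<^sub>R F \<omega>)"
    by (simp only: Bochner_Integration.integral_add[OF integrable_mult_right[OF integrable_kernel_power[OF Q F]]
          integrable_mult_right[OF integrable_mult_indicator[OF sets_cylinder F]]] integral_mult_right_zero)
  finally show ?thesis by (simp add: poisson_transform_eq Q_def)
qed

text \<open>The value of the spherical function at level \<open>n\<close> for \<open>Q = q powr (1 / 2 + i z)\<close>, from the recursion for the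
  Poisson transform and the masses of the cylinders.\<close>

fun sph :: "complex \<Rightarrow> nat \<Rightarrow> complex" where
  "sph Q 0 = 1"
| "sph Q (Suc n) = sph Q n / Q + (Q powi int (Suc n) - Q powi (int (Suc n) - 2)) / ((of_nat q + 1) * of_nat q ^ n)"

lemma spherical_eq_sph: "spherical q E v0 \<nu> z x = sph (of_nat q powr (1 / 2 + \<i> * z)) (lvl x)"
proof (induction "lvl x" arbitrary: x)
  case 0
  then show ?case using poisson_transform_root[of z "\<lambda>_. 1"] by (simp add: spherical_def prob_space)
next
  case (Suc n)
  then have x: "x \<noteq> v0" by auto
  have ind: "(LINT \<omega>|\<nu>. indicat_real (cylinder E v0 x) \<omega> *\<^sub>R (1 :: complex)) = 1 / ((of_nat q + 1) * of_nat q ^ n)"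
    using measure_cylinder[of x] by (simp add: Suc(2)[symmetric] scaleR_conv_of_real)
  have l: "lvl x = Suc n" "lvl (parent x) = n" using Suc(2) parent(2)[OF x] by simp_all
  have "integrable \<nu> (\<lambda>_. 1 :: complex)" by simp
  from poisson_transform_step[OF this x, of z]
  have "spherical q E v0 \<nu> z x = spherical q E v0 \<nu> z (parent x) / (of_nat q powr (1 / 2 + \<i> * z))
      + ((of_nat q powr (1 / 2 + \<i> * z)) powi int (Suc n) - (of_nat q powr (1 / 2 + \<i> * z)) powi (int (Suc n) - 2))
        * (1 / ((of_nat q + 1) * of_nat q ^ n))"
    unfolding spherical_def ind l .
  moreover have "spherical q E v0 \<nu> z (parent x) = sph (of_nat q powr (1 / 2 + \<i> * z)) n"
    using Suc(1)[of "parent x"] l by simp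
  ultimately show ?case unfolding l sph.simps(2) by (simp only: times_divide_eq_right mult_1_right)
qed

text \<open>The sum of \<open>t ^ (n - 2 * j)\<close> over \<open>0 \<le> j \<le> n\<close>, the Chebyshev polynomial of the second kind as a function of \<open>t\<close>.\<close>

fun chebV :: "complex \<Rightarrow> nat \<Rightarrow> complex" where
  "chebV t 0 = 1"
| "chebV t (Suc n) = chebV t n / t + t ^ Suc n"

text \<open>The scalar counterpart of \<open>chebU_sphere\<close>: the spherical function summed over a sphere.\<close>

lemma sph_chebV:
  fixes t :: complex
  assumes t: "t \<noteq> 0"
  defines "s \<equiv> of_real (sqrt (real q)) :: complex"
  shows "of_nat (card (vsphere v0 n)) * sph (s * t) n
     = s ^ n * (chebV t n - (if n < 2 then 0 else chebV t (n - 2) / of_nat q))"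
proof -
  have s2: "s * s = of_nat q" unfolding s_def by (simp add: of_real_mult[symmetric] del: of_real_mult)
  have s0: "s \<noteq> 0" using q2 by (auto simp: s_def)
  define \<sigma> where "\<sigma> = (\<lambda>n. of_nat (card (vsphere v0 n)) * sph (s * t) n)"
  have "\<sigma> (Suc n) = s ^ Suc n * (chebV t (Suc n) - (if Suc n < 2 then 0 else chebV t (Suc n - 2) / of_nat q))" for n
  proof (induction n)
    case 0
    have "\<sigma> (Suc 0) = (of_nat q + 1) * sph (s * t) (Suc 0)"
      using card_sphere[of v0 0] by (simp add: \<sigma>_def)
    also have "\<dots> = (of_nat q + 1) / (s * t) + (s * t - 1 / (s * t))"
    proof -
      have q1: "(of_nat q + 1 :: complex) \<noteq> 0" by (metis of_nat_Suc of_nat_eq_0_iff nat.distinct(2) add.commute)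
      have "sph (s * t) (Suc 0) = 1 / (s * t) + (s * t - 1 / (s * t)) / (of_nat q + 1)"
        by (simp add: power_int_minus inverse_eq_divide)
      then show ?thesis using q1 by (simp only: distrib_left) simp
    qed
    also have "\<dots> = s * (1 / t + t)"
      using s0 t by (simp add: s2[symmetric] field_simps)
    finally show ?case by simp
  next
    case (Suc n)
    have c: "of_nat (card (vsphere v0 (Suc k))) = ((of_nat q + 1) * of_nat q ^ k :: complex)" for k
      unfolding card_sphere by (simp add: distrib_right)
    have q1: "(of_nat q + 1 :: complex) \<noteq> 0" by (metis of_nat_Suc of_nat_eq_0_iff nat.distinct(2) add.commute)
    have q0: "(of_nat q :: complex) \<noteq> 0" using q2 by simp
    have P: "(s * t) powi int (Suc (Suc n)) = (s * t) ^ n * (s * t) * (s * t)"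
      "(s * t) powi (int (Suc (Suc n)) - 2) = (s * t) ^ n"
      by (simp_all add: power_int_def nat_add_distrib)
    have "\<sigma> (Suc (Suc n)) = of_nat q * \<sigma> (Suc n) / (s * t) + ((s * t) ^ n * (s * t) * (s * t) - (s * t) ^ n)"
    proof -
      have "N * (a / w + b / N) = N * a / w + b" if "N \<noteq> 0" for N a b w :: complex
        using that by (simp add: distrib_left)
      moreover have "(of_nat q + 1) * of_nat q ^ Suc n \<noteq> (0 :: complex)" using q0 q1 by simp
      ultimately have "\<sigma> (Suc (Suc n)) = (of_nat q + 1) * of_nat q ^ Suc n * sph (s * t) (Suc n) / (s * t)
          + ((s * t) ^ n * (s * t) * (s * t) - (s * t) ^ n)"
        unfolding \<sigma>_def c sph.simps(2)[of _ "Suc n"] P by blast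
      then show ?thesis unfolding \<sigma>_def c by (simp only: power_Suc mult_ac)
    qed
    also have "of_nat q * \<sigma> (Suc n) / (s * t) = s * \<sigma> (Suc n) / t"
      using s0 t by (simp add: s2[symmetric])
    also have "s * \<sigma> (Suc n) / t + ((s * t) ^ n * (s * t) * (s * t) - (s * t) ^ n)
        = s ^ Suc (Suc n) * (chebV t (Suc (Suc n)) - chebV t n / of_nat q)"
    proof (cases n)
      case 0
      have "\<sigma> (Suc 0) = s * (1 / t + t)" using Suc.IH 0 by simp
      then show ?thesis using 0 s0 t by (simp add: s2[symmetric] field_simps)
    next
      case (Suc k)
      define p u c0 c1 where "p = s ^ k" and "u = t ^ k" and "c0 = chebV t k" and "c1 = chebV t (Suc n)"
      have "s * (p * s * s * (c1 - c0 / (s * s))) / t + (p * s * (u * t) * (s * t) * (s * t) - p * s * (u * t))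
          = p * s * s * s * ((c1 / t + u * t * t * t) - (c0 / t + u * t) / (s * s))"
        using s0 t by (simp add: field_simps)
      moreover have "\<sigma> (Suc n) = p * s * s * (c1 - c0 / (s * s))"
        using Suc.IH Suc by (simp add: p_def c0_def c1_def s2 mult_ac)
      moreover have "(s * t) ^ n = p * s * (u * t)" by (simp add: Suc p_def u_def power_mult_distrib mult_ac)
      moreover have "chebV t (Suc (Suc n)) = c1 / t + u * t * t * t" by (simp add: Suc c1_def u_def mult_ac)
      moreover have "chebV t n = c0 / t + u * t" by (simp add: Suc c0_def u_def mult_ac)
      moreover have "s ^ Suc (Suc n) = p * s * s * s" by (simp add: Suc p_def mult_ac)
      ultimately show ?thesis by (simp only: s2[symmetric])
    qed
    finally show ?case by simp
  qed
  moreover have "\<sigma> 0 = 1" by (simp add: \<sigma>_def)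
  ultimately show ?thesis by (cases n) (auto simp: \<sigma>_def)
qed

end

section \<open>Pairings of radial kernels with Chebyshev sequences\<close>

lemma sums_shift2:
  fixes g :: "nat \<Rightarrow> complex"
  assumes "g sums z"
  shows "(\<lambda>n. if n < 2 then 0 else g (n - 2)) sums z"
proof -
  have "(\<lambda>n. (if n + 2 < 2 then 0 else g (n + 2 - 2))) sums z" using assms by simp
  then have "(\<lambda>n. if n < 2 then 0 else g (n - 2)) sums (z + (\<Sum>i<2. if i < 2 then 0 else g (i - 2)))"
    by (subst (asm) sums_iff_shift)
  moreover have "(\<Sum>i<2::nat. if i < 2 then 0 else g (i - 2)) = 0" by (rule sum.neutral) auto
  ultimately show ?thesis by simp
qed

lemma sums_by_parts2:
  fixes k v :: "nat \<Rightarrow> complex"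
  assumes "summable (\<lambda>n. k n * v n)" "summable (\<lambda>n. k (n + 2) * v n)"
  shows "(\<lambda>n. k n * (v n - (if n < 2 then 0 else v (n - 2)))) sums (\<Sum>n. (k n - k (n + 2)) * v n)"
proof -
  have "(\<lambda>n. k n * v n - (if n < 2 then 0 else k (n - 2 + 2) * v (n - 2))) sums
      ((\<Sum>n. k n * v n) - (\<Sum>n. k (n + 2) * v n))"
    using assms by (intro sums_diff sums_shift2) (auto intro: summable_sums)
  moreover have "(\<Sum>n. k n * v n) - (\<Sum>n. k (n + 2) * v n) = (\<Sum>n. (k n - k (n + 2)) * v n)"
    using suminf_diff[OF assms] by (simp add: left_diff_distrib)
  moreover have "k n * v n - (if n < 2 then 0 else k (n - 2 + 2) * v (n - 2)) = k n * (v n - (if n < 2 then 0 else v (n - 2)))" for n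
    by (auto simp: right_diff_distrib simp del: add_2_eq_Suc' diff_Suc_Suc)
  ultimately show ?thesis by simp
qed

lemma summable_geometric_bound:
  fixes f :: "nat \<Rightarrow> complex"
  assumes "\<And>n. cmod (f n) \<le> C * c ^ n" "0 \<le> c" "c < 1"
  shows "summable f" "summable (\<lambda>n. cmod (f n))"
proof -
  have S: "summable (\<lambda>n. C * c ^ n)" using assms by (intro summable_mult summable_geometric) auto
  show "summable (\<lambda>n. cmod (f n))"
    by (rule summable_comparison_test'[OF S, of 0]) (use assms(1) in auto)
  then show "summable f" by (rule summable_norm_cancel)
qed

text \<open>Since \<open>2 * w n = v n - v (n - 2)\<close>, shifting the summation index moves the difference from \<open>v\<close> to the coefficients.
  It applies to scalar Chebyshev sequences and to Chebyshev images alike.\<close>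

lemma symbol_pairing:
  fixes a :: "int \<Rightarrow> complex" and v :: "nat \<Rightarrow> complex" and w :: "int \<Rightarrow> complex"
  assumes a: "\<And>m. a (- m) = a m" "\<And>m. cmod (a m) \<le> C / \<rho> ^ nat \<bar>m\<bar>"
    and R: "1 \<le> R" "R < \<rho>" and v: "\<And>n. cmod (v n) \<le> D * R ^ n"
    and w0: "w 0 = v 0" and w1: "\<And>n. 2 * w (int (Suc n)) = v (Suc n) - (if n = 0 then 0 else v (n - 1))"
    and w2: "\<And>m. w (- m) = w m"
  shows "(\<Sum>n. (a (int n) - a (int (n + 2))) * v n) = (\<Sum>\<^sub>\<infinity>m. a m * w m)"
proof -
  have C: "0 \<le> C" using order_trans[OF norm_ge_zero a(2)[of 0]] by simp
  have D: "0 \<le> D" using order_trans[OF norm_ge_zero v[of 0]] by simp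
  have \<rho>: "0 < \<rho>" "1 \<le> \<rho>" using R by auto
  have c: "0 \<le> R / \<rho>" "R / \<rho> < 1" using R by auto
  have s1: "summable (\<lambda>n. a (int n) * v n)" "summable (\<lambda>n. cmod (a (int n) * v n))"
  proof -
    have "cmod (a (int n) * v n) \<le> (C * D) * (R / \<rho>) ^ n" for n
      using mult_mono[OF a(2)[of "int n"] v[of n]] C R by (simp add: norm_mult power_divide)
    from summable_geometric_bound[OF this c]
    show "summable (\<lambda>n. a (int n) * v n)" "summable (\<lambda>n. cmod (a (int n) * v n))" by auto
  qed
  have s2: "summable (\<lambda>n. a (int (n + 2)) * v n)"
  proof -
    have "cmod (a (int (n + 2)) * v n) \<le> (C * D) * (R / \<rho>) ^ n" for n
    proof -
      have "C / \<rho> ^ (n + 2) \<le> C / \<rho> ^ n"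
        using \<rho> C by (intro divide_left_mono power_increasing) auto
      moreover have "cmod (a (int (n + 2))) \<le> C / \<rho> ^ (n + 2)"
        using a(2)[of "int (n + 2)"] by (simp only: abs_of_nat nat_int)
      ultimately have "cmod (a (int (n + 2))) \<le> C / \<rho> ^ n" by (rule order_trans[rotated])
      from mult_mono[OF this v[of n]] show ?thesis using C R by (simp add: norm_mult power_divide)
    qed
    from summable_geometric_bound(1)[OF this c] show ?thesis .
  qed
  have sw: "summable (\<lambda>n. cmod (a (int n) * w (int n)))"
  proof -
    have "cmod (w (int n)) \<le> D * R ^ n" for n
    proof (cases n)
      case 0
      then show ?thesis using v[of 0] w0 by simp
    next
      case (Suc m)
      define r where "r = (if m = 0 then 0 else v (m - 1))"
      have "cmod r \<le> D * R ^ n"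
      proof (cases "m = 0")
        case False
        have "D * R ^ (m - 1) \<le> D * R ^ n" using D R Suc by (intro mult_left_mono power_increasing) auto
        then show ?thesis using v[of "m - 1"] False by (simp add: r_def)
      qed (use D R in \<open>simp add: r_def\<close>)
      then have "cmod (v n - r) \<le> 2 * (D * R ^ n)"
        using v[of n] norm_triangle_ineq4[of "v n" r] by linarith
      moreover have "2 * w (int n) = v n - r" using w1[of m] unfolding Suc r_def .
      then have "w (int n) = (v n - r) / 2" by (simp add: field_simps)
      then have "cmod (w (int n)) = cmod (v n - r) / 2" by (simp only: norm_divide norm_numeral)
      ultimately show ?thesis by linarith
    qed
    then have "cmod (a (int n) * w (int n)) \<le> (C * D) * (R / \<rho>) ^ n" for n
      using mult_mono[OF a(2)[of "int n"], of "cmod (w (int n))" "D * R ^ n"] C R by (simp add: norm_mult power_divide)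
    from summable_geometric_bound(2)[OF this c] show ?thesis .
  qed
  define X where "X = (\<Sum>n. a (int n) * w (int n))"
  have X: "(\<lambda>n. a (int n) * w (int n)) sums X"
    unfolding X_def by (rule summable_sums[OF summable_norm_cancel[OF sw]])
  have e: "a (- int n - 1) * w (- int n - 1) = a (int (Suc n)) * w (int (Suc n))" for n
  proof -
    have "- int n - 1 = - int (Suc n)" by simp
    then show ?thesis by (simp only: a(1) w2)
  qed
  have Y: "(\<lambda>n. a (- int n - 1) * w (- int n - 1)) sums (X - a 0 * w 0)"
    unfolding e using X by (subst sums_Suc_iff) simp
  have Ys: "summable (\<lambda>n. cmod (a (- int n - 1) * w (- int n - 1)))"
    unfolding e using sw by (subst summable_Suc_iff)
  have "((\<lambda>m. a m * w m) has_sum (X + (X - a 0 * w 0))) UNIV"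
    by (rule has_sum_int_split[OF sw X Ys Y])
  then have L: "(\<Sum>\<^sub>\<infinity>m. a m * w m) = 2 * X - a 0 * w 0" by (simp add: infsumI)
  have "(\<lambda>n. 2 * (a (int n) * w (int n)) - (if n = 0 then a 0 * w 0 else 0)) sums (2 * X - a 0 * w 0)"
    by (intro sums_diff sums_mult X sums_single[of 0 "\<lambda>_. a 0 * w 0", simplified])
  moreover have "2 * (a (int n) * w (int n)) - (if n = 0 then a 0 * w 0 else 0)
      = a (int n) * (v n - (if n < 2 then 0 else v (n - 2)))" for n
  proof (cases n)
    case 0
    then show ?thesis using w0 by simp
  next
    case (Suc m)
    have "2 * (a (int n) * w (int n)) = a (int n) * (2 * w (int n))" by simp
    also have "\<dots> = a (int n) * (v n - (if m = 0 then 0 else v (m - 1)))" using w1[of m] Suc by simp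
    finally show ?thesis using Suc by auto
  qed
  ultimately have "(\<lambda>n. a (int n) * (v n - (if n < 2 then 0 else v (n - 2)))) sums (2 * X - a 0 * w 0)" by simp
  moreover have "(\<lambda>n. a (int n) * (v n - (if n < 2 then 0 else v (n - 2)))) sums (\<Sum>n. (a (int n) - a (int (n + 2))) * v n)"
    using sums_by_parts2[of "\<lambda>n. a (int n)" v] s1 s2 by simp
  ultimately show ?thesis unfolding L by (rule sums_unique2[rotated])
qed

text \<open>Summation over spheres followed by summation by parts: a radial kernel enters only through
  \<open>k n - k (n + 2)\<close>.\<close>

lemma kernel_pairing:
  fixes k v :: "nat \<Rightarrow> complex" and s :: complex
  assumes s: "s \<noteq> 0" and R: "0 \<le> R" "R < \<rho>" and k: "\<And>n. cmod (k n) \<le> K / (cmod s * \<rho>) ^ n"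
    and v: "\<And>n. cmod (v n) \<le> D * R ^ n"
  shows "(\<lambda>n. k n * (s ^ n * (v n - (if n < 2 then 0 else v (n - 2) / (s * s))))) sums (\<Sum>n. (k n - k (n + 2)) * s ^ n * v n)"
    and "summable (\<lambda>n. cmod (k n * (s ^ n * (v n - (if n < 2 then 0 else v (n - 2) / (s * s))))))"
proof -
  have K: "0 \<le> K" using order_trans[OF norm_ge_zero k[of 0]] by simp
  have D: "0 \<le> D" using order_trans[OF norm_ge_zero v[of 0]] by simp
  have c: "0 \<le> R / \<rho>" "R / \<rho> < 1" "0 < \<rho>" using R by auto
  have b1: "cmod (k n * (s ^ n * v n)) \<le> (K * D) * (R / \<rho>) ^ n" for n
  proof -
    have "cmod (k n * (s ^ n * v n)) = (cmod (k n) * cmod s ^ n) * cmod (v n)"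
      by (simp add: norm_mult norm_power)
    also have "\<dots> \<le> (K / (cmod s * \<rho>) ^ n * cmod s ^ n) * (D * R ^ n)"
      using k[of n] v[of n] K c by (intro mult_mono mult_nonneg_nonneg divide_nonneg_nonneg) auto
    also have "\<dots> = (K * D) * (R / \<rho>) ^ n" using s by (simp add: power_mult_distrib power_divide)
    finally show ?thesis .
  qed
  have b2: "cmod (k (n + 2) * (s ^ n * v n)) \<le> (K * D / (cmod s * \<rho>)\<^sup>2) * (R / \<rho>) ^ n" for n
  proof -
    have "cmod (k (n + 2) * (s ^ n * v n)) = (cmod (k (n + 2)) * cmod s ^ n) * cmod (v n)"
      by (simp add: norm_mult norm_power)
    also have "\<dots> \<le> (K / (cmod s * \<rho>) ^ (n + 2) * cmod s ^ n) * (D * R ^ n)"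
      using k[of "n + 2"] v[of n] K c by (intro mult_mono mult_nonneg_nonneg divide_nonneg_nonneg) auto
    also have "\<dots> = (K * D / (cmod s * \<rho>)\<^sup>2) * (R / \<rho>) ^ n"
      using s by (simp add: power_mult_distrib power_divide power_add power2_eq_square)
    finally show ?thesis .
  qed
  note s1 = summable_geometric_bound[OF b1 c(1,2)]
  note s2 = summable_geometric_bound[OF b2 c(1,2)]
  have e: "k n * (s ^ n * v n - (if n < 2 then 0 else s ^ (n - 2) * v (n - 2)))
      = k n * (s ^ n * (v n - (if n < 2 then 0 else v (n - 2) / (s * s))))" for n
  proof (cases "n < 2")
    case False
    then have "s ^ n = s ^ (n - 2) * (s * s)"
      by (metis le_add_diff_inverse2 not_less power2_eq_square power_add)
    then show ?thesis using False s by (simp add: right_diff_distrib)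
  qed simp
  show "(\<lambda>n. k n * (s ^ n * (v n - (if n < 2 then 0 else v (n - 2) / (s * s))))) sums (\<Sum>n. (k n - k (n + 2)) * s ^ n * v n)"
    using sums_by_parts2[OF s1(1) s2(1)] unfolding e by (simp add: mult.assoc)
  have "(\<lambda>n. if n < 2 then 0 else complex_of_real (cmod (k (n - 2 + 2) * (s ^ (n - 2) * v (n - 2)))))
      sums (\<Sum>n. complex_of_real (cmod (k (n + 2) * (s ^ n * v n))))"
    using s2(2) by (intro sums_shift2 summable_sums) (simp add: summable_of_real)
  then have "summable (\<lambda>n. complex_of_real (if n < 2 then 0 else cmod (k (n - 2 + 2) * (s ^ (n - 2) * v (n - 2)))))"
    by (simp add: sums_iff if_distrib cong: if_cong)
  then have "summable (\<lambda>n. if n < 2 then 0 else cmod (k (n - 2 + 2) * (s ^ (n - 2) * v (n - 2))))"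
    by (simp only: summable_of_real_iff)
  from summable_add[OF s1(2) this]
  show "summable (\<lambda>n. cmod (k n * (s ^ n * (v n - (if n < 2 then 0 else v (n - 2) / (s * s))))))"
  proof (rule summable_comparison_test'[of _ 0])
    fix n :: nat
    have "cmod (k n * (s ^ n * v n - (if n < 2 then 0 else s ^ (n - 2) * v (n - 2))))
        \<le> cmod (k n * (s ^ n * v n)) + (if n < 2 then 0 else cmod (k (n - 2 + 2) * (s ^ (n - 2) * v (n - 2))))"
      using norm_triangle_ineq4[of "k n * (s ^ n * v n)" "k n * (s ^ (n - 2) * v (n - 2))"]
      by (auto simp: right_diff_distrib simp del: add_2_eq_Suc' diff_Suc_Suc)
    then show "norm (cmod (k n * (s ^ n * (v n - (if n < 2 then 0 else v (n - 2) / (s * s))))))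
        \<le> cmod (k n * (s ^ n * v n)) + (if n < 2 then 0 else cmod (k (n - 2 + 2) * (s ^ (n - 2) * v (n - 2))))"
      unfolding e by simp
  qed
qed

text \<open>Summing the prescribed differences to infinity.\<close>

lemma kernel_exists:
  fixes b :: "nat \<Rightarrow> complex" and s :: complex
  assumes b: "\<And>n. cmod (b n) \<le> C / \<rho> ^ n" and s: "1 < cmod s * \<rho>" "0 < \<rho>"
  obtains k K where "\<And>n. (k n - k (n + 2)) * s ^ n = b n" "\<And>n. cmod (k n) \<le> K / (cmod s * \<rho>) ^ n"
proof -
  define \<theta> where "\<theta> = 1 / (cmod s * \<rho>)"
  have \<theta>: "0 < \<theta>" "\<theta> < 1" using s by (auto simp: \<theta>_def)
  have s0: "s \<noteq> 0" using s by auto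
  have C: "0 \<le> C" using order_trans[OF norm_ge_zero b[of 0]] by simp
  define g where "g = (\<lambda>n j. b (n + 2 * j) / s ^ (n + 2 * j))"
  have g: "cmod (g n j) \<le> (C * \<theta> ^ n) * (\<theta>\<^sup>2) ^ j" for n j
  proof -
    have "cmod (g n j) \<le> (C / \<rho> ^ (n + 2 * j)) / cmod s ^ (n + 2 * j)"
      unfolding g_def norm_divide norm_power by (intro divide_right_mono b) auto
    also have "\<dots> = C * \<theta> ^ (n + 2 * j)" by (simp add: \<theta>_def power_divide power_mult_distrib mult.commute)
    finally show ?thesis by (simp add: power_add power_mult mult.assoc)
  qed
  have \<theta>2: "0 \<le> \<theta>\<^sup>2" "\<theta>\<^sup>2 < 1" using \<theta> by (auto simp: power_less_one_iff abs_square_less_1)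
  note sg = summable_geometric_bound[OF g \<theta>2]
  define k where "k = (\<lambda>n. \<Sum>j. g n j)"
  have "(k n - k (n + 2)) * s ^ n = b n" for n
  proof -
    have "g (n + 2) = (\<lambda>j. g n (Suc j))" by (auto simp: g_def fun_eq_iff add.commute)
    then have "k n = g n 0 + k (n + 2)" unfolding k_def using suminf_split_head[OF sg(1)[of n]] by simp
    then show ?thesis using s0 by (simp add: g_def)
  qed
  moreover have "cmod (k n) \<le> (C / (1 - \<theta>\<^sup>2)) / (cmod s * \<rho>) ^ n" for n
  proof -
    have "cmod (k n) \<le> (\<Sum>j. cmod (g n j))" unfolding k_def by (rule summable_norm[OF sg(2)])
    also have "\<dots> \<le> (\<Sum>j. (C * \<theta> ^ n) * (\<theta>\<^sup>2) ^ j)"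
      using \<theta>2 by (intro suminf_le g sg(2) summable_mult summable_geometric) auto
    also have "\<dots> = (C * \<theta> ^ n) * (1 / (1 - \<theta>\<^sup>2))"
      using \<theta>2 suminf_mult[OF summable_geometric, of "\<theta>\<^sup>2" "C * \<theta> ^ n"] suminf_geometric[of "\<theta>\<^sup>2"] by simp
    finally show ?thesis by (simp add: \<theta>_def power_divide mult.commute)
  qed
  ultimately show ?thesis using that by blast
qed

section \<open>Spherical functions in an exponential parameter\<close>

context tree_boundary
begin

text \<open>The exponential parameter: translation of \<open>z\<close> by \<open>2 * pi / ln q\<close> disappears, and the strip becomes an annulus.\<close>

definition tz :: "complex \<Rightarrow> complex" where
  "tz z = of_nat q powr (\<i> * z)"

definition root_q :: complex where
  "root_q = of_real (sqrt (real q))"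

lemma root_q: "root_q * root_q = of_nat q" "root_q \<noteq> 0" "cmod root_q = sqrt (real q)" "1 < sqrt (real q)"
proof -
  show "root_q * root_q = of_nat q" unfolding root_q_def of_real_mult[symmetric] by simp
  show "root_q \<noteq> 0" "cmod root_q = sqrt (real q)" "1 < sqrt (real q)" using q2 by (auto simp: root_q_def)
qed

lemma tz_exp: "tz z = exp (\<i> * z * of_real (ln (real q)))"
proof -
  have "Ln (of_nat q) = of_real (ln (real q))" using Ln_of_real[of "real q"] q2 by simp
  then show ?thesis using q2 by (simp add: tz_def powr_def)
qed

lemma tz_nonzero: "tz z \<noteq> 0"
  by (simp add: tz_exp)

lemma norm_tz: "cmod (tz z) = real q powr (- Im z)"
proof -
  have "cmod (tz z) = exp (- Im z * ln (real q))"
    unfolding tz_exp norm_exp_eq_Re by simp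
  also have "\<dots> = real q powr (- Im z)" using q2 by (simp add: powr_def)
  finally show ?thesis .
qed

lemma powr_half_iz: "of_nat q powr (1 / 2 + \<i> * z) = root_q * tz z"
proof -
  have "Ln (of_nat q) = of_real (ln (real q))" using Ln_of_real[of "real q"] q2 by simp
  moreover have "root_q = exp (1 / 2 * of_real (ln (real q)))"
  proof -
    have "sqrt (real q) = exp (1 / 2 * ln (real q))"
      using q2 by (simp add: powr_half_sqrt[symmetric] powr_def)
    then show ?thesis by (simp add: root_q_def exp_of_real[symmetric])
  qed
  ultimately show ?thesis using q2 by (simp add: tz_exp powr_def exp_add[symmetric] distrib_right)
qed

lemma powr_half_minus_iz: "of_nat q powr (1 / 2 - \<i> * z) = root_q / tz z"
proof -
  have "tz (- z) = inverse (tz z)" unfolding tz_exp by (simp add: exp_minus)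
  moreover have "of_nat q powr (1 / 2 - \<i> * z) = root_q * tz (- z)"
    using powr_half_iz[of "- z"] by simp
  ultimately show ?thesis by (simp only: divide_inverse)
qed

definition gam_t :: "complex \<Rightarrow> complex" where
  "gam_t t = 1 - root_q * (t + 1 / t) / (of_nat q + 1)"

lemma gam_eq: "gam q z = gam_t (tz z)"
  unfolding gam_def gam_t_def powr_half_iz powr_half_minus_iz
  by (simp only: distrib_left times_divide_eq_right mult_1_right)

lemma tz_surj: "t \<noteq> 0 \<Longrightarrow> tz (- \<i> * Ln t / of_real (ln (real q))) = t"
proof -
  assume t: "t \<noteq> 0"
  define L where "L = complex_of_real (ln (real q))"
  have "L \<noteq> 0" using q2 by (simp add: L_def)
  then have "\<i> * (- \<i> * Ln t / L) * L = Ln t" by simp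
  then show ?thesis unfolding tz_exp L_def[symmetric] using t by simp
qed

definition radius :: "real \<Rightarrow> real" where
  "radius p = real q powr (1 / p - 1 / 2)"

lemma delta_p: "1 \<le> p \<Longrightarrow> delta (ennreal p) = 1 / p - 1 / 2"
proof -
  assume p: "1 \<le> p"
  have "ennreal 1 / ennreal p = ennreal (1 / p)" by (rule divide_ennreal) (use p in auto)
  then have "1 / ennreal p = ennreal (1 / p)" by (simp only: ennreal_1)
  moreover have "0 \<le> 1 / p" using p by simp
  ultimately show ?thesis by (simp only: delta_def enn2real_ennreal)
qed

lemma radius_gt_1: "1 \<le> p \<Longrightarrow> p < 2 \<Longrightarrow> 1 < radius p"
proof -
  assume p: "1 \<le> p" "p < 2"
  have "1 / 2 < 1 / p" using p by (intro divide_strict_left_mono) auto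
  then show ?thesis unfolding radius_def using q2 by (intro gr_one_powr) auto
qed

lemma strip_iff:
  assumes p: "1 \<le> p" "p < 2"
  shows "z \<in> strip p \<longleftrightarrow> 1 / radius p \<le> cmod (tz z) \<and> cmod (tz z) \<le> radius p"
proof -
  have "1 / 2 < 1 / p" using p by (intro divide_strict_left_mono) auto
  then have "0 < 1 / p - 1 / 2" by linarith
  moreover have "1 / radius p = real q powr (- (1 / p - 1 / 2))" by (simp only: radius_def powr_minus_divide)
  moreover have "(real q powr x \<le> real q powr y) = (x \<le> y)" for x y
    by (rule powr_le_cancel_iff) (use q2 in simp)
  ultimately show ?thesis unfolding strip_def delta_p[OF p(1)] norm_tz by (simp only: radius_def mem_Collect_eq) linarith
qed

lemma strip_image:
  assumes p: "1 \<le> p" "p < 2"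
  shows "tz ` strip p = {t. 1 / radius p \<le> cmod t \<and> cmod t \<le> radius p}"
proof (intro equalityI subsetI)
  fix t assume t: "t \<in> {t. 1 / radius p \<le> cmod t \<and> cmod t \<le> radius p}"
  have "0 < 1 / radius p" using radius_gt_1[OF p] by simp
  then have "t \<noteq> 0" using t by auto
  then have e: "tz (- \<i> * Ln t / of_real (ln (real q))) = t" by (rule tz_surj)
  have "- \<i> * Ln t / of_real (ln (real q)) \<in> strip p"
    unfolding strip_iff[OF p] e using t by simp
  from imageI[OF this, of tz] show "t \<in> tz ` strip p" unfolding e .
qed (use strip_iff[OF p] in auto)

text \<open>The scalar Chebyshev sequence at \<open>t\<close> has the size of the larger of \<open>t\<close> and \<open>1 / t\<close>.\<close>

lemma chebV_step: "t \<noteq> 0 \<Longrightarrow> chebV t (n + 2) = chebV t n + t ^ (n + 2) + 1 / t ^ (n + 2)"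
proof (induction n)
  case 0
  have "chebV t (Suc (Suc 0)) = (1 / t + t) / t + t * t" by simp
  also have "\<dots> = 1 + t * t + 1 / (t * t)" using 0 by (simp add: add_divide_distrib)
  finally show ?case by (simp add: numeral_2_eq_2)
next
  case (Suc n)
  have "chebV t (Suc n + 2) = chebV t (n + 2) / t + t ^ Suc (n + 2)"
    by (simp only: add_Suc chebV.simps(2))
  also have "\<dots> = (chebV t n + t ^ (n + 2) + 1 / t ^ (n + 2)) / t + t ^ Suc (n + 2)"
    by (simp only: Suc.IH[OF Suc.prems])
  also have "\<dots> = (chebV t n / t + t ^ Suc n) + t ^ (Suc n + 2) + 1 / t ^ (Suc n + 2)"
  proof -
    have "t ^ (n + 2) / t = t ^ Suc n" "1 / t ^ (n + 2) / t = 1 / t ^ (Suc n + 2)" "t ^ Suc (n + 2) = t ^ (Suc n + 2)"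
      using Suc.prems by simp_all
    then show ?thesis by (simp only: add_divide_distrib add_ac)
  qed
  finally show ?case by (simp only: chebV.simps(2))
qed

lemma chebV_bound:
  assumes R: "1 < R" and t: "1 / R \<le> cmod t" "cmod t \<le> R"
  shows "cmod (chebV t n) \<le> 2 * R\<^sup>2 / (R\<^sup>2 - 1) * R ^ n"
proof -
  define D where "D = 2 * R\<^sup>2 / (R\<^sup>2 - 1)"
  have R2: "1 < R\<^sup>2" using R by (simp add: one_less_power)
  then have D: "2 \<le> D" "D + 2 * R\<^sup>2 = D * R\<^sup>2" by (auto simp: D_def field_simps)
  have t0: "t \<noteq> 0" using t R by (smt (verit) divide_pos_pos norm_zero)
  have le: "cmod (t ^ k) \<le> R ^ k" "cmod (1 / t ^ k) \<le> R ^ k" for k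
    using norm_powi_le[of R t "int k"] norm_powi_le[of R t "- int k"] R t
    by (simp_all add: power_int_minus inverse_eq_divide)
  have "cmod (chebV t n) \<le> D * R ^ n"
  proof (induction n rule: induct_nat_012)
    case 0
    then show ?case using D by simp
  next
    case 1
    have "cmod (chebV t (Suc 0)) \<le> cmod (1 / t) + cmod t" by (simp add: norm_triangle_ineq)
    also have "\<dots> \<le> 2 * R" using le[of 1] by simp
    also have "\<dots> \<le> D * R" using D R by (intro mult_right_mono) auto
    finally show ?case by simp
  next
    case (ge2 n)
    have "cmod (chebV t (n + 2)) \<le> cmod (chebV t n) + cmod (t ^ (n + 2)) + cmod (1 / t ^ (n + 2))"
      unfolding chebV_step[OF t0]
      using norm_triangle_ineq[of "chebV t n + t ^ (n + 2)" "1 / t ^ (n + 2)"] norm_triangle_ineq[of "chebV t n" "t ^ (n + 2)"]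
      by linarith
    also have "\<dots> \<le> D * R ^ n + R ^ (n + 2) + R ^ (n + 2)" by (intro add_mono ge2 le)
    also have "\<dots> = (D + 2 * R\<^sup>2) * R ^ n" by (simp add: power_add power2_eq_square algebra_simps)
    also have "\<dots> = D * R ^ (n + 2)" unfolding D(2) by (simp add: power_add power2_eq_square)
    finally show ?case by (simp only: add_2_eq_Suc')
  qed
  then show ?thesis by (simp add: D_def)
qed

lemma chebV_diff: "t \<noteq> 0 \<Longrightarrow> (t - 1 / t) * chebV t n = t ^ Suc n - 1 / t ^ Suc n"
proof (induction n)
  case 0
  then show ?case by simp
next
  case (Suc n)
  have "(t - 1 / t) * chebV t (Suc n) = ((t - 1 / t) * chebV t n) / t + (t - 1 / t) * t ^ Suc n"
    by (simp only: chebV.simps(2) distrib_left times_divide_eq_right)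
  also have "\<dots> = (t ^ Suc n - 1 / t ^ Suc n) / t + (t - 1 / t) * t ^ Suc n"
    by (simp only: Suc.IH[OF Suc.prems])
  also have "\<dots> = t ^ Suc (Suc n) - 1 / t ^ Suc (Suc n)"
    using Suc.prems by (simp add: field_simps)
  finally show ?case .
qed

lemma spherical_transform_sums:
  assumes R: "1 < R" "R < \<rho>" and k: "\<And>n. cmod (k n) \<le> K / (sqrt (real q) * \<rho>) ^ n"
    and z: "1 / R \<le> cmod (tz z)" "cmod (tz z) \<le> R"
  shows "spherical_transform q E v0 \<nu> k z = (\<Sum>n. (k n - k (n + 2)) * root_q ^ n * chebV (tz z) n)"
proof -
  let ?t = "tz z"
  let ?\<sigma> = "\<lambda>n. root_q ^ n * (chebV ?t n - (if n < 2 then 0 else chebV ?t (n - 2) / (root_q * root_q)))"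
  have kb: "cmod (k n) \<le> K / (cmod root_q * \<rho>) ^ n" for n unfolding root_q(3) by (rule k)
  have pair: "(\<lambda>n. k n * ?\<sigma> n) sums (\<Sum>n. (k n - k (n + 2)) * root_q ^ n * chebV ?t n)"
    "summable (\<lambda>n. cmod (k n * ?\<sigma> n))"
    using kernel_pairing[OF root_q(2) _ R(2) kb chebV_bound[OF R(1) z]] R(1) by simp_all
  have \<sigma>: "of_nat (card (vsphere v0 n)) * sph (root_q * ?t) n = ?\<sigma> n" for n
    using sph_chebV[OF tz_nonzero, of n z] by (simp add: root_q(1) root_q_def[symmetric])
  define F where "F = (\<lambda>x. k (lvl x) * sph (root_q * ?t) (lvl x))"
  have sF: "(\<Sum>y\<in>vsphere v0 n. F y) = k n * ?\<sigma> n" for n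
  proof -
    have "(\<Sum>y\<in>vsphere v0 n. F y) = (\<Sum>y\<in>vsphere v0 n. k n * sph (root_q * ?t) n)"
      by (rule sum.cong) (auto simp: F_def vsphere_def)
    then show ?thesis unfolding \<sigma>[symmetric] by simp
  qed
  have sFn: "(\<Sum>y\<in>vsphere v0 n. cmod (F y)) = cmod (k n * ?\<sigma> n)" for n
  proof -
    have "(\<Sum>y\<in>vsphere v0 n. cmod (F y)) = (\<Sum>y\<in>vsphere v0 n. cmod (k n * sph (root_q * ?t) n))"
      by (rule sum.cong) (auto simp: F_def vsphere_def)
    then show ?thesis unfolding \<sigma>[symmetric] by (simp add: norm_mult)
  qed
  have "(F has_sum (\<Sum>n. \<Sum>y\<in>vsphere v0 n. F y)) UNIV"
    by (rule has_sum_spheres) (unfold sFn, rule pair(2))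
  then have "infsum F UNIV = (\<Sum>n. k n * ?\<sigma> n)" unfolding sF by (rule infsumI)
  moreover have "spherical_transform q E v0 \<nu> k z = infsum F UNIV"
    unfolding spherical_transform_def F_def by (simp add: spherical_eq_sph powr_half_iz)
  ultimately show ?thesis using sums_unique[OF pair(1)] by simp
qed

lemma radial_conv_sums:
  assumes p: "1 \<le> p" "p < 2" and f: "marcinkiewicz p C f" and \<rho>: "radius p < \<rho>"
    and k: "\<And>n. cmod (k n) \<le> K / (sqrt (real q) * \<rho>) ^ n"
  shows "radial_conv E f k x = (\<Sum>n. (k n - k (n + 2)) * root_q ^ n * chebU n f x)"
proof -
  have R: "1 < radius p" by (rule radius_gt_1[OF p])
  have K: "0 \<le> K" using order_trans[OF norm_ge_zero k[of 0]] by simp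
  have C: "0 \<le> C" by (rule marcinkiewicz_nonneg[OF f])
  let ?\<sigma> = "\<lambda>n. root_q ^ n * (chebU n f x - (if n < 2 then 0 else chebU (n - 2) f x / (root_q * root_q)))"
  have ss: "cmod (sphere_sum n f y) \<le> 2 * C * (sqrt (real q) * radius p) ^ n" for n y
    using order_trans[OF norm_sum sphere_sum_norm_le[OF p(1) f, of y n]] by (simp add: sphere_sum_def radius_def)
  have U: "cmod (chebU n f x) \<le> (4 * C) * radius p ^ n" for n
    using chebU_bound[OF less_imp_le[OF R] ss, of n x] by simp
  have kb: "cmod (k n) \<le> K / (cmod root_q * \<rho>) ^ n" for n unfolding root_q(3) by (rule k)
  have pair: "(\<lambda>n. k n * ?\<sigma> n) sums (\<Sum>n. (k n - k (n + 2)) * root_q ^ n * chebU n f x)"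
    using kernel_pairing(1)[OF root_q(2) _ \<rho> kb U] R by simp
  have \<sigma>: "sphere_sum n f x = ?\<sigma> n" for n
    using chebU_sphere[of n f x] by (simp add: root_q(1) root_q_def[symmetric])
  define F where "F = (\<lambda>y. f y * k (d x y))"
  have sF: "(\<Sum>y\<in>vsphere x n. F y) = k n * ?\<sigma> n" for n
  proof -
    have "(\<Sum>y\<in>vsphere x n. F y) = (\<Sum>y\<in>vsphere x n. k n * f y)"
      by (rule sum.cong) (auto simp: F_def vsphere_def)
    then show ?thesis unfolding \<sigma>[symmetric] by (simp add: sum_distrib_left sphere_sum_def)
  qed
  have sFn: "(\<Sum>y\<in>vsphere x n. cmod (F y)) \<le> (2 * C * K) * (radius p / \<rho>) ^ n" for n
  proof -
    have "(\<Sum>y\<in>vsphere x n. cmod (F y)) = cmod (k n) * (\<Sum>y\<in>vsphere x n. cmod (f y))"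
      unfolding sum_distrib_left by (rule sum.cong) (auto simp: F_def vsphere_def norm_mult)
    also have "\<dots> \<le> K / (sqrt (real q) * \<rho>) ^ n * (2 * C * (sqrt (real q) * radius p) ^ n)"
      using k[of n] sphere_sum_norm_le[OF p(1) f, of x n] K \<rho> R root_q(4)
      by (intro mult_mono) (auto simp: radius_def intro!: sum_nonneg)
    also have "\<dots> = (2 * C * K) * (radius p / \<rho>) ^ n"
      using root_q(4) by (simp add: power_mult_distrib power_divide)
    finally show ?thesis .
  qed
  have "(F has_sum (\<Sum>n. \<Sum>y\<in>vsphere x n. F y)) UNIV"
  proof (rule has_sum_spheres, rule summable_comparison_test'[of _ 0])
    show "summable (\<lambda>n. (2 * C * K) * (radius p / \<rho>) ^ n)"
      using R \<rho> by (intro summable_mult summable_geometric) auto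
    show "norm (\<Sum>y\<in>vsphere x n. cmod (F y)) \<le> (2 * C * K) * (radius p / \<rho>) ^ n" for n
      using sFn[of n] by (simp add: sum_nonneg)
  qed
  then have "infsum F UNIV = (\<Sum>n. k n * ?\<sigma> n)" unfolding sF by (rule infsumI)
  then show ?thesis using sums_unique[OF pair] by (simp add: radial_conv_def F_def)
qed

end

section \<open>Multipliers as symbols\<close>

lemma polynomial_geometric_bounded:
  fixes c :: real
  assumes c: "0 < c" "c < 1"
  shows "\<exists>B. \<forall>n. (1 + real n) ^ m * c ^ n \<le> B"
proof (cases "m = 0")
  case True
  then show ?thesis using c by (intro exI[of _ 1]) (simp add: power_le_one)
next
  case False
  define e where "e = c powr (1 / real m)"
  have e: "0 < e" "e < 1" using c False powr_less_one[of c "1 / real m"] by (auto simp: e_def powr01_less_one)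
  have em: "e ^ m = c" using c False by (simp add: e_def powr_realpow[symmetric] powr_powr)
  have "(1 + real n) * e ^ n \<le> 1 / (1 - e)" for n
  proof -
    have "(1 + real n) * e ^ n = (\<Sum>j<Suc n. e ^ n)" by simp
    also have "\<dots> \<le> (\<Sum>j<Suc n. e ^ j)" using e by (intro sum_mono power_decreasing) auto
    also have "\<dots> \<le> (\<Sum>j. e ^ j)" using e by (intro sum_le_suminf summable_geometric) auto
    also have "\<dots> = 1 / (1 - e)" using e by (intro suminf_geometric) auto
    finally show ?thesis .
  qed
  then have "((1 + real n) * e ^ n) ^ m \<le> (1 / (1 - e)) ^ m" for n
    using e by (intro power_mono) auto
  moreover have "((1 + real n) * e ^ n) ^ m = (1 + real n) ^ m * c ^ n" for n
    by (simp add: power_mult_distrib em[symmetric] power_mult[symmetric] mult.commute)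
  ultimately show ?thesis by metis
qed

context tree_boundary
begin

text \<open>Multiplication by \<open>t - 1 / t\<close> turns the expansion into a Laurent series, which vanishes on the unit circle and so has
  zero coefficients.\<close>

lemma chebV_unique:
  assumes R: "1 < R" and c: "\<And>n. cmod (c n) \<le> K / R ^ n"
    and zero: "\<And>t. cmod t = 1 \<Longrightarrow> (\<Sum>n. c n * chebV t n) = 0"
  shows "c n = 0"
proof -
  have K: "0 \<le> K" using order_trans[OF norm_ge_zero c[of 0]] by simp
  define e where "e = (\<lambda>m::int. if 0 < m then c (nat m - 1) else if m < 0 then - c (nat (- m) - 1) else 0)"
  have dec: "cmod (e m) \<le> (K * R) / R ^ nat \<bar>m\<bar>" for m
  proof (cases "m = 0")
    case False
    define j where "j = nat \<bar>m\<bar> - 1"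
    have "nat \<bar>m\<bar> = Suc j" using False by (simp add: j_def)
    moreover have "cmod (e m) = cmod (c j)" using False by (auto simp: e_def j_def)
    ultimately show ?thesis using c[of j] R by simp
  qed (use K R in \<open>simp add: e_def\<close>)
  have r: "1 < sqrt R" "sqrt R < R"
  proof -
    show "1 < sqrt R" using R by simp
    then have "sqrt R * 1 < sqrt R * sqrt R" using R by (intro mult_strict_left_mono) auto
    then show "sqrt R < R" using R by simp
  qed
  have w: "weighted_l1 (sqrt R) e" by (rule weighted_l1_if_decay[OF dec]) (use r in auto)
  have lz: "laurent e t = 0" if t: "cmod t = 1" for t
  proof -
    have t0: "t \<noteq> 0" using t by auto
    have b1: "cmod (c n * t ^ Suc n) \<le> K * (1 / R) ^ n" for n
      using c[of n] t by (simp add: norm_mult norm_power power_divide)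
    have b2: "cmod (c n * (1 / t ^ Suc n)) \<le> K * (1 / R) ^ n" for n
      using c[of n] t by (simp add: norm_mult norm_divide norm_power power_divide)
    have g: "0 \<le> 1 / R" "1 / R < 1" using R by auto
    note s1 = summable_geometric_bound[OF b1 g] and s2 = summable_geometric_bound[OF b2 g]
    define X where "X = (\<Sum>n. c n * t ^ Suc n)"
    define Y where "Y = (\<Sum>n. c n * (1 / t ^ Suc n))"
    have p: "e (int (Suc n)) * t powi int (Suc n) = c n * t ^ Suc n" for n
      by (simp add: e_def nat_add_distrib del: of_nat_Suc)
    have m: "e (- int n - 1) * t powi (- int n - 1) = - (c n * (1 / t ^ Suc n))" for n
    proof -
      have "t powi (- int n - 1) = 1 / t ^ Suc n"
      proof -
        have "- int n - 1 = - int (Suc n)" by simp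
        then show ?thesis by (simp only: power_int_minus power_int_of_nat inverse_eq_divide)
      qed
      moreover have "e (- int n - 1) = - c n" by (simp add: e_def nat_add_distrib)
      ultimately show ?thesis by simp
    qed
    have P: "(\<lambda>n. e (int (Suc n)) * t powi int (Suc n)) sums X"
      unfolding p X_def by (rule summable_sums[OF s1(1)])
    then have P': "(\<lambda>n. e (int n) * t powi int n) sums X"
      by (subst (asm) sums_Suc_iff) (simp add: e_def)
    have "summable (\<lambda>n. cmod (e (int (Suc n)) * t powi int (Suc n)))" unfolding p by (rule s1(2))
    then have Pa: "summable (\<lambda>n. cmod (e (int n) * t powi int n))" by (subst (asm) summable_Suc_iff)
    have M: "(\<lambda>n. e (- int n - 1) * t powi (- int n - 1)) sums - Y"
      unfolding m Y_def by (intro sums_minus summable_sums[OF s2(1)])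
    have Ma: "summable (\<lambda>n. cmod (e (- int n - 1) * t powi (- int n - 1)))"
      unfolding m norm_minus_cancel by (rule s2(2))
    have "((\<lambda>m. e m * t powi m) has_sum (X + - Y)) UNIV"
      by (rule has_sum_int_split[OF Pa P' Ma M])
    then have "laurent e t = X - Y" by (simp add: laurent_def infsumI)
    also have "\<dots> = (\<Sum>n. c n * t ^ Suc n - c n * (1 / t ^ Suc n))"
      unfolding X_def Y_def by (rule suminf_diff[OF s1(1) s2(1)])
    also have "\<dots> = (\<Sum>n. (t - 1 / t) * (c n * chebV t n))"
    proof (rule suminf_cong)
      fix n
      have "c n * t ^ Suc n - c n * (1 / t ^ Suc n) = c n * (t ^ Suc n - 1 / t ^ Suc n)" by (simp only: right_diff_distrib)
      also have "\<dots> = (t - 1 / t) * (c n * chebV t n)" unfolding chebV_diff[OF t0, symmetric] by (simp only: mult_ac)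
      finally show "c n * t ^ Suc n - c n * (1 / t ^ Suc n) = (t - 1 / t) * (c n * chebV t n)" .
    qed
    also have "\<dots> = (t - 1 / t) * (\<Sum>n. c n * chebV t n)"
    proof (rule suminf_mult)
      define D where "D = 2 * (sqrt R)\<^sup>2 / ((sqrt R)\<^sup>2 - 1)"
      have bd: "cmod (chebV t n) \<le> D * sqrt R ^ n" for n
        unfolding D_def by (rule chebV_bound) (use r t in auto)
      have "cmod (c n * chebV t n) \<le> (K * D) * (sqrt R / R) ^ n" for n
        using mult_mono[OF c[of n] bd[of n]] K R by (simp add: norm_mult power_divide mult_ac)
      from summable_geometric_bound(1)[OF this] show "summable (\<lambda>n. c n * chebV t n)" using r R by simp
    qed
    finally show ?thesis using zero[OF t] by simp
  qed
  have "e m = 0" for m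
  proof -
    have "((\<lambda>t. 0 * t powi (- m - 1)) has_contour_integral 2 * of_real pi * \<i> * e m) (circlepath 0 1)"
      by (rule laurent_coefficient[OF w]) (use r lz in auto)
    moreover have "((\<lambda>t. 0 * t powi (- m - 1)) has_contour_integral 0) (circlepath 0 1)" by (simp add: has_contour_integral_0)
    ultimately have "2 * of_real pi * \<i> * e m = 0" by (rule has_contour_integral_unique)
    then show ?thesis by simp
  qed
  from this[of "int (Suc n)"] show ?thesis by (simp add: e_def nat_add_distrib)
qed

text \<open>Hence the differences \<open>k n - k (n + 2)\<close> determine a kernel that decays.\<close>

lemma two_periodic_decay_zero:
  fixes k :: "nat \<Rightarrow> complex"
  assumes per: "\<And>n. k n = k (n + 2)" and bd: "\<And>n. cmod (k n) \<le> K / B ^ n" and B: "1 < B"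
  shows "k n = 0"
proof -
  have e: "k n = k (n + 2 * j)" for j
  proof (induction j)
    case (Suc j)
    then show ?case using per[of "n + 2 * j"] by simp
  qed simp
  have K: "0 \<le> K" using order_trans[OF norm_ge_zero bd[of 0]] by simp
  have "(\<lambda>j. K * (1 / B) ^ j) \<longlonglongrightarrow> K * 0" using B by (intro tendsto_intros) auto
  moreover have "cmod (k n) \<le> K * (1 / B) ^ j" for j
  proof -
    have "K / B ^ (n + 2 * j) \<le> K / B ^ j" using B K by (intro divide_left_mono power_increasing) auto
    then show ?thesis using bd[of "n + 2 * j"] e[of j] by (simp add: power_divide)
  qed
  ultimately have "cmod (k n) \<le> K * 0" by (intro LIMSEQ_le_const) auto
  then show ?thesis by simp
qed

lemma powr_level: "real q powr (real n / p) = (sqrt (real q) * radius p) ^ n"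
proof -
  have "real q powr (1 / p) = sqrt (real q) * radius p"
    using q_pos by (simp add: radius_def powr_half_sqrt[symmetric] powr_add[symmetric])
  moreover have "real q powr (real n / p) = (real q powr (1 / p)) ^ n"
    using q_pos by (simp add: powr_realpow[symmetric] powr_powr)
  ultimately show ?thesis by simp
qed

lemma schwartz_space_decay:
  assumes "(\<lambda>x. k (lvl x)) \<in> schwartz_space q E v0 p"
  shows "\<exists>K. \<forall>n. cmod (k n) \<le> K / (sqrt (real q) * radius p) ^ n"
proof -
  have "\<forall>m. bdd_above (range (\<lambda>x. (1 + real (lvl x)) ^ m * real q powr (real (lvl x) / p) * cmod (k (lvl x))))"
    using assms unfolding schwartz_space_def mem_Collect_eq .
  from this[rule_format, of 0] obtain K where K: "\<And>x. real q powr (real (lvl x) / p) * cmod (k (lvl x)) \<le> K"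
    by (auto simp: bdd_above_def)
  have "cmod (k n) \<le> K / (sqrt (real q) * radius p) ^ n" for n
  proof -
    obtain x where x: "lvl x = n" using sphere_nonempty[of v0 n] by (auto simp: vsphere_def)
    have "0 < (sqrt (real q) * radius p) ^ n" unfolding radius_def using q2 by simp
    then show ?thesis using K[of x] x by (simp add: powr_level pos_le_divide_eq mult.commute)
  qed
  then show ?thesis by blast
qed

lemma decay_schwartz_space:
  assumes k: "\<And>n. cmod (k n) \<le> K / (sqrt (real q) * \<rho>) ^ n" and p: "1 \<le> p" "p < 2" and \<rho>: "radius p < \<rho>"
  shows "(\<lambda>x. k (lvl x)) \<in> schwartz_space q E v0 p"
  unfolding schwartz_space_def
proof (intro CollectI allI)
  fix m :: nat
  have R: "1 < radius p" by (rule radius_gt_1[OF p])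
  have K: "0 \<le> K" using order_trans[OF norm_ge_zero k[of 0]] by simp
  have "0 < radius p / \<rho>" "radius p / \<rho> < 1" using R \<rho> by auto
  then obtain B where B: "\<And>n. (1 + real n) ^ m * (radius p / \<rho>) ^ n \<le> B"
    using polynomial_geometric_bounded by blast
  have "(1 + real n) ^ m * real q powr (real n / p) * cmod (k n) \<le> K * B" for n
  proof -
    have s: "0 < sqrt (real q)" using q_pos by simp
    have "(1 + real n) ^ m * real q powr (real n / p) * cmod (k n)
        \<le> (1 + real n) ^ m * (sqrt (real q) * radius p) ^ n * (K / (sqrt (real q) * \<rho>) ^ n)"
      unfolding powr_level using R s by (intro mult_left_mono k) auto
    also have "\<dots> = K * ((1 + real n) ^ m * (radius p / \<rho>) ^ n)"
      using s by (simp add: power_mult_distrib power_divide)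
    also have "\<dots> \<le> K * B" using B K by (intro mult_left_mono)
    finally show ?thesis .
  qed
  then show "bdd_above (range (\<lambda>x. (1 + real (lvl x)) ^ m * real q powr (real (lvl x) / p) * cmod (k (lvl x))))"
    by (intro bdd_aboveI[of _ "K * B"]) auto
qed

text \<open>The preimage of the open set is an open neighbourhood of the compact annulus.\<close>

lemma annulus_extension:
  assumes p: "1 \<le> p" "p < 2" and O': "open O'" "gam q ` strip p \<subseteq> O'"
  shows "\<exists>S>radius p. \<forall>t\<in>annulus (1 / S) S. gam_t t \<in> O'"
proof -
  let ?R = "radius p"
  define A where "A = {t::complex. 1 / ?R \<le> cmod t \<and> cmod t \<le> ?R}"
  have R: "1 < ?R" by (rule radius_gt_1[OF p])
  have cA: "compact A"
  proof -
    have "A = cball 0 ?R \<inter> {t. 1 / ?R \<le> cmod t}" by (auto simp: A_def)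
    moreover have "closed {t::complex. 1 / ?R \<le> cmod t}" by (intro closed_Collect_le continuous_intros)
    ultimately show ?thesis by (simp add: compact_Int_closed)
  qed
  define U where "U = {t. t \<noteq> 0 \<and> gam_t t \<in> O'}"
  have "open ((- {0}) \<inter> gam_t -` O')"
    by (rule continuous_open_preimage)
       (use O' in \<open>auto simp: gam_t_def intro!: continuous_intros simp del: of_nat_Suc\<close>,
        metis of_nat_Suc of_nat_eq_0_iff nat.distinct(2) add.commute)
  then have oU: "open U" by (simp add: U_def Int_def vimage_def)
  have sub: "A \<subseteq> U"
  proof
    fix t assume t: "t \<in> A"
    then have "t \<in> tz ` strip p" unfolding strip_image[OF p] by (simp add: A_def)
    then obtain z where "z \<in> strip p" "t = tz z" by auto
    then show "t \<in> U" using O'(2) tz_nonzero by (auto simp: U_def gam_eq[symmetric])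
  qed
  obtain e where e: "0 < e" "\<And>x y. x \<in> A \<Longrightarrow> y \<in> - U \<Longrightarrow> e \<le> dist x y"
    using separate_compact_closed[OF cA closed_Compl[OF oU]] sub by blast
  define S where "S = ?R + e / 2"
  have S: "?R < S" using e by (simp add: S_def)
  have inv: "1 / ?R - 1 / S < e"
  proof -
    have "1 / ?R - 1 / S = (S - ?R) / (?R * S)" using R S by (simp add: field_simps)
    also have "\<dots> \<le> (S - ?R) / 1"
    proof (rule divide_left_mono)
      show "1 \<le> ?R * S" using mult_mono[of 1 ?R 1 S] R S by simp
    qed (use R S in auto)
    also have "\<dots> < e" using e by (simp add: S_def)
    finally show ?thesis .
  qed
  have "gam_t t \<in> O'" if t: "t \<in> annulus (1 / S) S" for t
  proof (rule ccontr)
    assume "gam_t t \<notin> O'"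
    then have tU: "t \<in> - U" by (simp add: U_def)
    have t': "1 / S < cmod t" "cmod t < S" using t by (auto simp: annulus_def)
    have "0 < 1 / S" using R S by simp
    then have t0: "0 < cmod t" using t' by linarith
    define c where "c = max (1 / ?R) (min ?R (cmod t))"
    have c: "1 / ?R \<le> c" "c \<le> ?R" "\<bar>c - cmod t\<bar> < e" "0 < c"
    proof -
      have "1 / ?R < 1" using R by simp
      then have "1 / ?R \<le> ?R" using R by linarith
      moreover have "0 < 1 / ?R" using R by simp
      ultimately show "1 / ?R \<le> c" "c \<le> ?R" "\<bar>c - cmod t\<bar> < e" "0 < c"
        using t' inv e(1) by (auto simp: c_def S_def max_def min_def)
    qed
    define u where "u = of_real (c / cmod t) * t"
    have "cmod u = \<bar>c / cmod t\<bar> * cmod t" by (simp only: u_def norm_mult norm_of_real)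
    then have "cmod u = c" using t0 c by simp
    then have "u \<in> A" using c by (simp add: A_def)
    moreover have "dist u t = \<bar>c - cmod t\<bar>"
    proof -
      have "(c - cmod t) / cmod t = c / cmod t - 1" using t0 by (simp add: diff_divide_distrib)
      then have "u - t = of_real ((c - cmod t) / cmod t) * t"
        by (simp only: u_def of_real_diff of_real_1 left_diff_distrib mult_1_left)
      then have "cmod (u - t) = \<bar>(c - cmod t) / cmod t\<bar> * cmod t" by (simp only: norm_mult norm_of_real)
      then show ?thesis using t0 by (simp add: dist_norm)
    qed
    ultimately show False using e(2)[OF _ tU] c(3) by fastforce
  qed
  then show ?thesis using S by blast
qed

lemma nat_plus_one_nonzero: "(of_nat q + 1 :: complex) \<noteq> 0"
  by (metis of_nat_Suc of_nat_eq_0_iff nat.distinct(2) add.commute)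

lemma gam_t_holomorphic: "gam_t holomorphic_on - {0}"
  unfolding gam_t_def by (intro holomorphic_intros) (use nat_plus_one_nonzero in auto)

lemma gam_t_inverse: "t \<noteq> 0 \<Longrightarrow> gam_t (1 / t) = gam_t t"
  by (simp add: gam_t_def add.commute)

lemma laurent_cos:
  assumes a: "weighted_l1 R a" "\<And>m. a (- m) = a m" and R: "1 \<le> R" and t: "1 / R \<le> cmod t" "cmod t \<le> R"
  shows "(\<Sum>\<^sub>\<infinity>m. a m * ((t powi m + t powi (- m)) / 2)) = laurent a t"
proof -
  have s1: "(\<lambda>m. a m * t powi m) summable_on UNIV" by (rule laurent_summable[OF a(1) R t])
  have s2: "(\<lambda>m. a m * t powi (- m)) summable_on UNIV"
    using summable_on_reindex_bij_betw[OF bij_uminus_int, of "\<lambda>m. a m * t powi m"] s1 by (simp add: a(2))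
  have e2: "(\<Sum>\<^sub>\<infinity>m. a m * t powi (- m)) = laurent a t"
    using infsum_reindex_bij_betw[OF bij_uminus_int, of "\<lambda>m. a m * t powi m"] by (simp add: a(2) laurent_def)
  have "(\<Sum>\<^sub>\<infinity>m. a m * ((t powi m + t powi (- m)) / 2)) = (\<Sum>\<^sub>\<infinity>m. (a m * t powi m + a m * t powi (- m)) * (1 / 2))"
    by (simp add: distrib_left)
  also have "\<dots> = (laurent a t + laurent a t) * (1 / 2)"
    unfolding infsum_cmult_left' infsum_add[OF s1 s2] e2 laurent_def[symmetric] ..
  finally show ?thesis by simp
qed

text \<open>The Laurent coefficients \<open>a\<close> of the symbol determine a kernel with differences
  \<open>a n - a (n + 2)\<close>, up to powers of \<open>sqrt q\<close>. Its spherical transform and its convolution operator are the same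
  pairing, evaluated once on \<open>chebV t\<close> and once on Chebyshev images. As the differences determine the kernel, the definite
  description in \<open>multiplier_kernel\<close> picks this one.\<close>

theorem multiplier_eq_apply_symbol:
  assumes p: "1 \<le> p" "p < 2" and O': "open O'" "gam q ` strip p \<subseteq> O'" and \<Psi>: "\<Psi> holomorphic_on O'"
  shows "\<exists>a. weighted_l1 (radius p) a \<and> (\<forall>m. a (- m) = a m) \<and>
     (\<forall>t. 1 / radius p \<le> cmod t \<longrightarrow> cmod t \<le> radius p \<longrightarrow> laurent a t = \<Psi> (gam_t t)) \<and>
     (\<forall>C f. marcinkiewicz p C f \<longrightarrow> multiplier q E v0 \<nu> p \<Psi> f = apply_symbol a f)"
proof -
  let ?R = "radius p"
  have R: "1 < ?R" by (rule radius_gt_1[OF p])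
  obtain S where S: "?R < S" "\<And>t. t \<in> annulus (1 / S) S \<Longrightarrow> gam_t t \<in> O'"
    using annulus_extension[OF p O'] by blast
  have S1: "1 < S" using R S by linarith
  have S0: "0 < 1 / S" using S1 by simp
  have ann0: "annulus (1 / S) S \<subseteq> - {0}" using S0 by (auto simp: annulus_def)
  have "(\<Psi> \<circ> gam_t) holomorphic_on annulus (1 / S) S"
    by (rule holomorphic_on_compose_gen[OF holomorphic_on_subset[OF gam_t_holomorphic ann0] \<Psi>]) (use S in blast)
  then have H: "(\<lambda>t. \<Psi> (gam_t t)) holomorphic_on annulus (1 / S) S" by (simp add: o_def)
  obtain a where a: "\<And>m. a (- m) = a m"
    "\<And>\<rho>. 1 < \<rho> \<Longrightarrow> \<rho> < S \<Longrightarrow> \<exists>C. \<forall>m. cmod (a m) \<le> C / \<rho> ^ nat \<bar>m\<bar>"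
    "\<And>t. 1 / S < cmod t \<Longrightarrow> cmod t < S \<Longrightarrow> \<Psi> (gam_t t) = laurent a t"
    using laurent_expansion[OF H S1] gam_t_inverse by metis
  obtain \<rho> where \<rho>: "?R < \<rho>" "\<rho> < S" using dense S by blast
  then obtain C where C: "\<And>m. cmod (a m) \<le> C / \<rho> ^ nat \<bar>m\<bar>" using a(2)[of \<rho>] R by auto
  have C0: "0 \<le> C" using order_trans[OF norm_ge_zero C[of 0]] by simp
  have w: "weighted_l1 ?R a" by (rule weighted_l1_if_decay[OF C]) (use \<rho> R in auto)
  have eval: "laurent a t = \<Psi> (gam_t t)" if t: "1 / ?R \<le> cmod t" "cmod t \<le> ?R" for t
  proof -
    have "1 / S < 1 / ?R" using R S by (intro divide_strict_left_mono) auto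
    then have "1 / S < cmod t" "cmod t < S" using t S(1) by linarith+
    then show ?thesis using a(3)[of t] by simp
  qed
  define b where "b = (\<lambda>n. a (int n) - a (int (n + 2)))"
  have bb: "cmod (b n) \<le> (2 * C) / \<rho> ^ n" for n
  proof -
    have "C / \<rho> ^ (n + 2) \<le> C / \<rho> ^ n" using \<rho> R C0 by (intro divide_left_mono power_increasing) auto
    moreover have "cmod (a (int n)) \<le> C / \<rho> ^ n" "cmod (a (int (n + 2))) \<le> C / \<rho> ^ (n + 2)"
      using C[of "int n"] C[of "int (n + 2)"] by (simp_all only: abs_of_nat nat_int)
    ultimately show ?thesis using norm_triangle_ineq4[of "a (int n)" "a (int (n + 2))"] by (simp add: b_def)
  qed
  have sr: "1 < cmod root_q * \<rho>"
    using mult_strict_mono[of 1 "cmod root_q" 1 \<rho>] root_q(3,4) \<rho> R by simp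
  obtain k K where k: "\<And>n. (k n - k (n + 2)) * root_q ^ n = b n" "\<And>n. cmod (k n) \<le> K / (cmod root_q * \<rho>) ^ n"
    using kernel_exists[OF bb sr] \<rho> R by auto
  note k2 = k(2)[unfolded root_q(3)]
  have trans: "spherical_transform q E v0 \<nu> k z = \<Psi> (gam q z)" if z: "z \<in> strip p" for z
  proof -
    let ?t = "tz z"
    have t: "1 / ?R \<le> cmod ?t" "cmod ?t \<le> ?R" using z strip_iff[OF p] by auto
    have "spherical_transform q E v0 \<nu> k z = (\<Sum>n. b n * chebV ?t n)"
      unfolding spherical_transform_sums[OF R \<rho>(1) k2 t] k(1) ..
    also have "\<dots> = (\<Sum>\<^sub>\<infinity>m. a m * ((?t powi m + ?t powi (- m)) / 2))"
      unfolding b_def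
    proof (rule symbol_pairing[OF a(1) C less_imp_le[OF R] \<rho>(1) chebV_bound[OF R t]])
      fix n
      show "2 * ((?t powi int (Suc n) + ?t powi (- int (Suc n))) / 2)
          = chebV ?t (Suc n) - (if n = 0 then 0 else chebV ?t (n - 1))"
      proof (cases n)
        case 0
        then show ?thesis by (simp add: power_int_minus inverse_eq_divide)
      next
        case (Suc j)
        have n: "Suc n = j + 2" "n - 1 = j" using Suc by simp_all
        have "?t powi (- int (Suc n)) = 1 / ?t ^ Suc n" "?t powi int (Suc n) = ?t ^ Suc n"
          by (simp_all only: power_int_minus power_int_of_nat inverse_eq_divide)
        then have "2 * ((?t powi int (Suc n) + ?t powi (- int (Suc n))) / 2) = ?t ^ Suc n + 1 / ?t ^ Suc n"
          by (simp only: nonzero_mult_div_cancel_left times_divide_eq_right) simp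
        also have "\<dots> = chebV ?t (Suc n) - chebV ?t (n - 1)"
          unfolding n chebV_step[OF tz_nonzero] by simp
        finally show ?thesis using Suc by (simp only: nat.distinct if_False)
      qed
    qed (auto simp: add.commute)
    also have "\<dots> = laurent a ?t" by (rule laurent_cos[OF w a(1) less_imp_le[OF R] t])
    also have "\<dots> = \<Psi> (gam q z)" using eval[OF t] by (simp add: gam_eq)
    finally show ?thesis .
  qed
  have uniq: "k' = k" if sp: "(\<lambda>x. k' (lvl x)) \<in> schwartz_space q E v0 p"
    and tr: "\<forall>z\<in>strip p. spherical_transform q E v0 \<nu> k' z = \<Psi> (gam q z)" for k'
  proof
    fix n0
    obtain K' where k': "\<And>n. cmod (k' n) \<le> K' / (sqrt (real q) * ?R) ^ n"
      using schwartz_space_decay[OF sp] by blast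
    have kR: "cmod (k n) \<le> K / (sqrt (real q) * ?R) ^ n" for n
    proof -
      have "0 \<le> K" using order_trans[OF norm_ge_zero k2[of 0]] by simp
      then have "K / (sqrt (real q) * \<rho>) ^ n \<le> K / (sqrt (real q) * ?R) ^ n"
        using \<rho> R root_q(4) by (intro divide_left_mono power_mono mult_left_mono mult_pos_pos zero_less_power) auto
      then show ?thesis using k2[of n] by linarith
    qed
    define \<kappa> where "\<kappa> = (\<lambda>n. k' n - k n)"
    have \<kappa>: "cmod (\<kappa> n) \<le> (K' + K) / (sqrt (real q) * ?R) ^ n" for n
      using norm_triangle_ineq4[of "k' n" "k n"] k'[of n] kR[of n] by (simp add: \<kappa>_def add_divide_distrib)
    have KK: "0 \<le> K' + K" using order_trans[OF norm_ge_zero \<kappa>[of 0]] by simp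
    define c where "c = (\<lambda>n. (\<kappa> n - \<kappa> (n + 2)) * root_q ^ n)"
    have sR: "1 < sqrt (real q) * ?R"
      using mult_strict_mono[of 1 "sqrt (real q)" 1 ?R] root_q(4) R by simp
    have cb: "cmod (c n) \<le> (2 * (K' + K)) / ?R ^ n" for n
    proof -
      have "(K' + K) / (sqrt (real q) * ?R) ^ (n + 2) \<le> (K' + K) / (sqrt (real q) * ?R) ^ n"
        using sR KK q2 R by (intro divide_left_mono power_increasing mult_pos_pos zero_less_power) auto
      then have "cmod (\<kappa> n - \<kappa> (n + 2)) \<le> 2 * ((K' + K) / (sqrt (real q) * ?R) ^ n)"
        using \<kappa>[of n] \<kappa>[of "n + 2"] norm_triangle_ineq4[of "\<kappa> n" "\<kappa> (n + 2)"] by linarith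
      then have "cmod (\<kappa> n - \<kappa> (n + 2)) * sqrt (real q) ^ n \<le> 2 * ((K' + K) / (sqrt (real q) * ?R) ^ n) * sqrt (real q) ^ n"
        by (intro mult_right_mono) auto
      also have "\<dots> = (2 * (K' + K)) / ?R ^ n" using root_q(4) by (simp add: power_mult_distrib)
      finally show ?thesis by (simp add: c_def norm_mult norm_power root_q(3))
    qed
    define r where "r = sqrt ?R"
    have r: "1 < r" "r < ?R"
    proof -
      show "1 < r" using R by (simp add: r_def)
      then have "r * 1 < r * r" by (intro mult_strict_left_mono) auto
      then show "r < ?R" using R by (simp add: r_def)
    qed
    have zero: "(\<Sum>n. c n * chebV t n) = 0" if t: "cmod t = 1" for t
    proof -
      have "t \<in> tz ` strip p" unfolding strip_image[OF p] using t R by simp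
      then obtain z where z: "z \<in> strip p" "t = tz z" by auto
      have zr: "1 / r \<le> cmod (tz z)" "cmod (tz z) \<le> r" using t z r by auto
      have bdr: "cmod (chebV t n) \<le> 2 * r\<^sup>2 / (r\<^sup>2 - 1) * r ^ n" for n
        by (rule chebV_bound) (use r t in auto)
      have "(\<lambda>n. (\<kappa> n - \<kappa> (n + 2)) * root_q ^ n * chebV t n) = (\<lambda>n. c n * chebV t n)" by (simp add: c_def)
      moreover have S1: "summable (\<lambda>n. (h n - h (n + 2)) * root_q ^ n * chebV t n)"
        if h: "\<And>n. cmod (h n) \<le> B / (sqrt (real q) * ?R) ^ n" for h B
      proof -
        have B: "0 \<le> B" using order_trans[OF norm_ge_zero h[of 0]] by simp
        have "cmod ((h n - h (n + 2)) * root_q ^ n * chebV t n) \<le> (2 * B * (2 * r\<^sup>2 / (r\<^sup>2 - 1))) * (r / ?R) ^ n" for n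
        proof -
          have "B / (sqrt (real q) * ?R) ^ (n + 2) \<le> B / (sqrt (real q) * ?R) ^ n"
            using sR B q2 R by (intro divide_left_mono power_increasing mult_pos_pos zero_less_power) auto
          then have "cmod (h n - h (n + 2)) \<le> 2 * (B / (sqrt (real q) * ?R) ^ n)"
            using h[of n] h[of "n + 2"] norm_triangle_ineq4[of "h n" "h (n + 2)"] by linarith
          then have "cmod (h n - h (n + 2)) * sqrt (real q) ^ n \<le> 2 * (B / (sqrt (real q) * ?R) ^ n) * sqrt (real q) ^ n"
            by (intro mult_right_mono) auto
          also have "\<dots> = 2 * B / ?R ^ n" using root_q(4) by (simp add: power_mult_distrib)
          finally have "cmod (h n - h (n + 2)) * sqrt (real q) ^ n * cmod (chebV t n)
              \<le> 2 * B / ?R ^ n * (2 * r\<^sup>2 / (r\<^sup>2 - 1) * r ^ n)"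
            using bdr[of n] B R by (intro mult_mono) auto
          then show ?thesis by (simp add: norm_mult norm_power root_q(3) power_divide mult_ac)
        qed
        from summable_geometric_bound(1)[OF this] show ?thesis using r by simp
      qed
      moreover have "(\<Sum>n. (k' n - k' (n + 2)) * root_q ^ n * chebV t n) = \<Psi> (gam q z)"
        using spherical_transform_sums[OF r k' zr] tr z by simp
      moreover have "(\<Sum>n. (k n - k (n + 2)) * root_q ^ n * chebV t n) = \<Psi> (gam q z)"
        using spherical_transform_sums[OF r kR zr] trans z by simp
      moreover have "(\<Sum>n. (k' n - k' (n + 2)) * root_q ^ n * chebV t n - (k n - k (n + 2)) * root_q ^ n * chebV t n)
          = (\<Sum>n. (k' n - k' (n + 2)) * root_q ^ n * chebV t n) - (\<Sum>n. (k n - k (n + 2)) * root_q ^ n * chebV t n)"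
        by (rule suminf_diff[symmetric, OF S1[OF k'] S1[OF kR]])
      moreover have "(k' n - k' (n + 2)) * root_q ^ n * chebV t n - (k n - k (n + 2)) * root_q ^ n * chebV t n
          = c n * chebV t n" for n by (simp add: c_def \<kappa>_def algebra_simps)
      ultimately show ?thesis by simp
    qed
    have "c n = 0" for n by (rule chebV_unique[OF R cb zero])
    then have "\<kappa> n = \<kappa> (n + 2)" for n using root_q(2) by (simp add: c_def)
    from two_periodic_decay_zero[OF this \<kappa> sR] have "\<kappa> n0 = 0" .
    then show "k' n0 = k n0" by (simp add: \<kappa>_def)
  qed
  have ker: "multiplier_kernel q E v0 \<nu> p \<Psi> = k"
    unfolding multiplier_kernel_def
  proof (rule the_equality)
    show "(\<lambda>x. k (lvl x)) \<in> schwartz_space q E v0 p \<and> (\<forall>z\<in>strip p. spherical_transform q E v0 \<nu> k z = \<Psi> (gam q z))"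
      by (intro conjI ballI decay_schwartz_space[OF k2 p \<rho>(1)] trans)
  qed (elim conjE, rule uniq)
  have "multiplier q E v0 \<nu> p \<Psi> f = apply_symbol a f" if f: "marcinkiewicz p Cf f" for Cf f
  proof
    fix x
    have ss: "cmod (sphere_sum n f y) \<le> 2 * Cf * (sqrt (real q) * ?R) ^ n" for n y
      using order_trans[OF norm_sum sphere_sum_norm_le[OF p(1) f, of y n]] by (simp add: sphere_sum_def radius_def)
    have U: "cmod (chebU n f x) \<le> (2 * (2 * Cf)) * ?R ^ n" for n
      by (rule chebU_bound[OF less_imp_le[OF R] ss])
    have "multiplier q E v0 \<nu> p \<Psi> f x = (\<Sum>n. b n * chebU n f x)"
      unfolding multiplier_def ker radial_conv_sums[OF p f \<rho>(1) k2] k(1) ..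
    also have "\<dots> = (\<Sum>\<^sub>\<infinity>m. a m * wave f m x)"
      unfolding b_def
    proof (rule symbol_pairing[OF a(1) C less_imp_le[OF R] \<rho>(1) U])
      fix n
      have "wave f (int (Suc n)) x = cheb (Suc n) f x" by (simp only: wave_def abs_of_nat nat_int)
      then show "2 * wave f (int (Suc n)) x = chebU (Suc n) f x - (if n = 0 then 0 else chebU (n - 1) f x)"
        unfolding cheb_chebU by (simp only: times_divide_eq_right nonzero_mult_div_cancel_left[OF zero_neq_numeral[symmetric]])
    qed (simp_all add: wave_uminus)
    finally show "multiplier q E v0 \<nu> p \<Psi> f x = apply_symbol a f x" by (simp add: apply_symbol_def)
  qed
  then show ?thesis using w a(1) eval by blast
qed

end

section \<open>Splitting into eigenfunctions\<close>

context tree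
begin

definition shift :: "complex \<Rightarrow> ('v \<Rightarrow> complex) \<Rightarrow> 'v \<Rightarrow> complex" where
  "shift t f x = J f x - (t + 1 / t) * f x"

lemma marcinkiewicz_shift:
  assumes p: "1 \<le> p" and f: "\<exists>C. marcinkiewicz p C f"
  shows "\<exists>C. marcinkiewicz p C (shift t f)"
proof -
  obtain C where C: "marcinkiewicz p C f" using f by blast
  obtain C' where C': "marcinkiewicz p C' (J f)" using marcinkiewicz_J[OF p C] by blast
  have "marcinkiewicz p (C' + cmod (- (t + 1 / t)) * C) (\<lambda>x. J f x + - (t + 1 / t) * f x)"
    by (rule marcinkiewicz_add[OF C' marcinkiewicz_cmult[OF C]])
  moreover have "(\<lambda>x. J f x + - (t + 1 / t) * f x) = shift t f" by (simp add: shift_def fun_eq_iff algebra_simps)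
  ultimately show ?thesis by metis
qed

lemma marcinkiewicz_sum:
  assumes "finite I" "\<And>i. i \<in> I \<Longrightarrow> \<exists>C. marcinkiewicz p C (f i)"
  shows "\<exists>C. marcinkiewicz p C (\<lambda>x. \<Sum>i\<in>I. f i x)"
  using assms
proof (induction I rule: finite_induct)
  case empty
  then show ?case by (intro exI[of _ 0]) (simp add: marcinkiewicz_def)
next
  case (insert i I)
  obtain C where "marcinkiewicz p C (f i)" using insert.prems by blast
  moreover obtain D where "marcinkiewicz p D (\<lambda>x. \<Sum>i\<in>I. f i x)" using insert by blast
  ultimately have "marcinkiewicz p (C + D) (\<lambda>x. f i x + (\<Sum>i\<in>I. f i x))" by (rule marcinkiewicz_add)
  then show ?case using insert.hyps by auto
qed

text \<open>On a Jordan block \<open>J = \<lambda> + \<epsilon>\<close> with \<open>\<epsilon>\<^sup>2 = 0\<close> a polynomial of \<open>J\<close> is its value plus its derivative times \<open>\<epsilon>\<close>. The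
  derivative of \<open>(t ^ n + 1 / t ^ n) / 2\<close> with respect to \<open>t + 1 / t\<close> carries a factor \<open>n\<close>.\<close>

lemma cheb_jordan:
  assumes t: "t \<noteq> 0" "t - 1 / t \<noteq> 0"
    and h: "\<And>x. J h x = (t + 1 / t) * h x + e x" and e: "\<And>x. J e x = (t + 1 / t) * e x"
  shows "cheb n h x = (t ^ n + 1 / t ^ n) / 2 * h x + of_nat n / 2 * (t ^ n - 1 / t ^ n) / (t - 1 / t) * e x"
proof (induction n arbitrary: x rule: induct_nat_012)
  case 0
  then show ?case by simp
next
  case 1
  have c: "cheb (Suc 0) h x = (t + 1 / t) / 2 * h x + 1 / 2 * e x" by (simp add: h add_divide_distrib)
  have "1 / 2 * (t - 1 / t) / (t - 1 / t) = 1 / 2" by (rule nonzero_mult_div_cancel_right[OF t(2)])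
  then show ?case unfolding c by (simp only: power_one_right of_nat_1 One_nat_def[symmetric])
next
  case (ge2 n)
  define u where "u = 1 / t"
  have tu: "t * u = 1" "u * t = 1" using t by (simp_all add: u_def)
  have pu: "1 / t ^ k = u ^ k" for k by (simp add: u_def power_one_over)
  define \<delta> where "\<delta> = t - u"
  have \<delta>: "\<delta> \<noteq> 0" using t by (simp add: \<delta>_def u_def)
  define T where "T = (\<lambda>n. (t ^ n + u ^ n) / 2)"
  define Z where "Z = (\<lambda>n. t ^ n - u ^ n)"
  define D where "D = (\<lambda>n. of_nat n / 2 * Z n / \<delta>)"
  have form: "(t ^ k + 1 / t ^ k) / 2 * h y + of_nat k / 2 * (t ^ k - 1 / t ^ k) / (t - 1 / t) * e y
      = T k * h y + D k * e y" for k y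
    by (simp only: pu T_def D_def Z_def \<delta>_def u_def[symmetric])
  have E: "t * (t * a) + u * (u * b) = (t + u) * (t * a + u * b) - (a + b)" for a b
  proof -
    have "(t + u) * (t * a + u * b) = t * (t * a) + (t * u) * b + (u * t) * a + u * (u * b)"
      by (simp only: distrib_left distrib_right mult.assoc) (simp only: add_ac)
    then show ?thesis unfolding tu by simp
  qed
  have E': "t * (t * a) - u * (u * b) - (a - b) = (t - u) * (t * a + u * b)" for a b
  proof -
    have "(t - u) * (t * a + u * b) = t * (t * a) + (t * u) * b - (u * t) * a - u * (u * b)"
      by (simp add: left_diff_distrib distrib_left mult.assoc)
    then show ?thesis unfolding tu by simp
  qed
  have T2: "T (Suc (Suc n)) = (t + u) * T (Suc n) - T n"
    unfolding T_def power_Suc E by (simp only: times_divide_eq_right diff_divide_distrib)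
  have Z2: "Z (Suc (Suc n)) = (t + u) * Z (Suc n) - Z n"
    using E[of "t ^ n" "- (u ^ n)"] by (simp add: Z_def)
  have ZT: "Z (Suc (Suc n)) - Z n = 2 * \<delta> * T (Suc n)"
    unfolding Z_def power_Suc E' by (simp add: T_def \<delta>_def)
  have D2: "D (Suc (Suc n)) = (t + u) * D (Suc n) - D n + T (Suc n)"
  proof -
    have "2 * \<delta> * ((t + u) * D (Suc n) - D n + T (Suc n))
        = of_nat (Suc n) * ((t + u) * Z (Suc n)) - of_nat n * Z n + (Z (Suc (Suc n)) - Z n)"
      unfolding ZT using \<delta> by (simp add: D_def distrib_left right_diff_distrib)
    also have "(t + u) * Z (Suc n) = Z (Suc (Suc n)) + Z n" using Z2 by simp
    also have "of_nat (Suc n) * (Z (Suc (Suc n)) + Z n) - of_nat n * Z n + (Z (Suc (Suc n)) - Z n)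
        = of_nat (Suc (Suc n)) * Z (Suc (Suc n))"
      by (simp add: algebra_simps)
    also have "\<dots> = 2 * \<delta> * D (Suc (Suc n))" using \<delta> by (simp add: D_def)
    finally show ?thesis using \<delta> by simp
  qed
  have c1: "cheb (Suc n) h = (\<lambda>y. T (Suc n) * h y + D (Suc n) * e y)"
    using ge2(2) unfolding form by auto
  have c0: "cheb n h x = T n * h x + D n * e x" using ge2(1)[of x] unfolding form .
  have "cheb (Suc (Suc n)) h x = T (Suc n) * ((t + u) * h x + e x) + D (Suc n) * ((t + u) * e x) - (T n * h x + D n * e x)"
    unfolding cheb.simps(3) c1 c0 J_add J_cmult h e u_def[symmetric] ..
  also have "\<dots> = T (Suc (Suc n)) * h x + D (Suc (Suc n)) * e x"
    unfolding T2 D2 by (simp add: algebra_simps)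
  finally show ?case unfolding form .
qed

text \<open>The factor \<open>n\<close> in \<open>cheb_jordan\<close> is incompatible with growth at most \<open>R ^ n\<close>, as \<open>cmod t = R > 1\<close>.\<close>

lemma no_jordan_block:
  assumes p: "1 \<le> p" "p < 2" and f: "marcinkiewicz p C h"
    and t: "cmod t = real q powr (1 / p - 1 / 2)"
    and z: "\<And>x. shift t (shift t h) x = 0"
  shows "shift t h x = 0"
proof -
  define R where "R = real q powr (1 / p - 1 / 2)"
  have "1 / 2 < 1 / p" using p by (intro divide_strict_left_mono) auto
  then have R: "1 < R" unfolding R_def using q2 by (intro gr_one_powr) auto
  have tR: "cmod t = R" using t by (simp add: R_def)
  have t0: "t \<noteq> 0" using tR R by auto
  have lt: "cmod (1 / t) < cmod t" using tR R by (simp add: norm_divide) (smt (verit) divide_less_eq_1)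
  have t1: "t - 1 / t \<noteq> 0" using lt by auto
  define e where "e = shift t h"
  have J1: "J h x = (t + 1 / t) * h x + e x" for x by (simp add: e_def shift_def)
  have J2: "J e x = (t + 1 / t) * e x" for x using z[of x] by (simp add: e_def shift_def[of t "shift t h"])
  have bd: "cmod (cheb n h x) \<le> 4 * C * R ^ n" for n
  proof -
    have "cmod (wave h (int n) x) \<le> 4 * C * R ^ nat \<bar>int n\<bar>"
      using marcinkiewicz_imp_tempered[OF p f] unfolding tempered_def R_def by blast
    then show ?thesis by (simp add: wave_def)
  qed
  define \<delta> where "\<delta> = cmod (t - 1 / t)"
  have \<delta>: "0 < \<delta>" using t1 by (simp add: \<delta>_def)
  define B where "B = 2 * \<delta> * (4 * C + cmod (h x))"
  have key: "real n * ((1 - 1 / R) * cmod (e x)) \<le> B" if n: "1 \<le> n" for n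
  proof -
    have Rn: "0 < R ^ n" using R by simp
    have inv: "cmod (1 / t ^ n) \<le> 1" using R tR by (simp add: norm_divide norm_power)
    have "cmod ((t ^ n + 1 / t ^ n) / 2) \<le> R ^ n"
    proof -
      have "1 \<le> R ^ n" using R by simp
      then have "cmod (t ^ n + 1 / t ^ n) \<le> 2 * R ^ n"
        using norm_triangle_ineq[of "t ^ n" "1 / t ^ n"] inv tR by (simp add: norm_power)
      then show ?thesis by (simp add: norm_divide)
    qed
    then have T: "cmod ((t ^ n + 1 / t ^ n) / 2 * h x) \<le> R ^ n * cmod (h x)"
      unfolding norm_mult by (rule mult_right_mono) simp
    define X where "X = of_nat n / 2 * (t ^ n - 1 / t ^ n) / (t - 1 / t) * e x"
    have "X = cheb n h x - (t ^ n + 1 / t ^ n) / 2 * h x"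
      unfolding cheb_jordan[OF t0 t1 J1 J2, of n x] X_def by simp
    then have "cmod X \<le> cmod (cheb n h x) + cmod ((t ^ n + 1 / t ^ n) / 2 * h x)"
      by (simp only: norm_triangle_ineq4)
    then have Xle: "cmod X \<le> 4 * C * R ^ n + R ^ n * cmod (h x)" using bd[of n] T by linarith
    have low: "R ^ n * (1 - 1 / R) \<le> cmod (t ^ n - 1 / t ^ n)"
    proof -
      have "R ^ 1 \<le> R ^ n" using n R by (intro power_increasing) auto
      then have "1 \<le> R ^ n * (1 / R)" using R by simp
      then have "R ^ n * (1 - 1 / R) \<le> R ^ n - 1" by (simp add: right_diff_distrib)
      also have "\<dots> \<le> cmod (t ^ n) - cmod (1 / t ^ n)" using inv tR by (simp add: norm_power)
      also have "\<dots> \<le> cmod (t ^ n - 1 / t ^ n)" by (rule norm_triangle_ineq2)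
      finally show ?thesis .
    qed
    have "cmod X * (2 * \<delta>) = real n * cmod (t ^ n - 1 / t ^ n) * cmod (e x)"
      using \<delta> unfolding X_def norm_mult norm_divide norm_of_nat \<delta>_def[symmetric] by simp
    then have "real n * (R ^ n * (1 - 1 / R)) * cmod (e x) \<le> cmod X * (2 * \<delta>)"
      using low by (simp add: mult_left_mono mult_right_mono)
    also have "\<dots> \<le> (4 * C * R ^ n + R ^ n * cmod (h x)) * (2 * \<delta>)"
      using Xle \<delta> by (intro mult_right_mono) auto
    finally have "R ^ n * (real n * ((1 - 1 / R) * cmod (e x))) \<le> R ^ n * B"
      by (simp add: B_def algebra_simps)
    then show ?thesis using Rn by (simp only: mult_le_cancel_left_pos)
  qed
  have "\<not> 0 < (1 - 1 / R) * cmod (e x)"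
  proof
    assume "0 < (1 - 1 / R) * cmod (e x)"
    then obtain n where "B < real n * ((1 - 1 / R) * cmod (e x))" using reals_Archimedean3 by blast
    moreover have "real n * ((1 - 1 / R) * cmod (e x)) \<le> real (Suc n) * ((1 - 1 / R) * cmod (e x))"
      using R by (intro mult_right_mono mult_nonneg_nonneg) auto
    ultimately show False using key[of "Suc n"] by linarith
  qed
  moreover have "0 < 1 - 1 / R" using R by simp
  ultimately show ?thesis by (simp add: e_def[symmetric] zero_less_mult_iff)
qed

text \<open>The equation leaves \<open>s = t\<close> or \<open>s * t = 1\<close>, and the latter is impossible off the unit circle.\<close>

lemma add_inverse_inj:
  fixes s t :: complex
  assumes "1 < R" "cmod s = R" "cmod t = R" "s + 1 / s = t + 1 / t"
  shows "s = t"
proof -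
  have "cmod s \<noteq> 0" "cmod t \<noteq> 0" using assms(1-3) by linarith+
  then have n0: "s \<noteq> 0" "t \<noteq> 0" by simp_all
  have "(s - t) * (s * t - 1) = (s + 1 / s - (t + 1 / t)) * (s * t)"
    using n0 by (simp add: field_simps)
  then have "(s - t) * (s * t - 1) = 0" using assms(4) by simp
  moreover have "s * t \<noteq> 1"
  proof
    assume "s * t = 1"
    then have "cmod (s * t) = 1" by (simp only: norm_one)
    then have "cmod s * cmod t = 1" by (simp only: norm_mult)
    moreover have "1 < R * R" using mult_strict_mono[of 1 R 1 R] assms(1) by simp
    ultimately show False by (simp only: assms(2,3))
  qed
  ultimately show ?thesis by simp
qed

lemma shift_linear_combination:
  "finite I \<Longrightarrow> shift a (\<lambda>x. f x - (\<Sum>i\<in>I. c i * g i x)) x = shift a f x - (\<Sum>i\<in>I. c i * shift a (g i) x)"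
  by (simp add: shift_def J_diff J_sum J_cmult sum_distrib_left sum_subtractf right_diff_distrib algebra_simps)

text \<open>By induction on the factors. The function \<open>shift t f\<close> is a sum of eigenfunctions; those with eigenvalue other
  than \<open>t + 1 / t\<close> lie in the range of \<open>shift t\<close> and can be lifted, and a component with the same eigenvalue is excluded
  by \<open>no_jordan_block\<close>.\<close>

lemma spectral_decomposition:
  assumes p: "1 \<le> p" "p < 2" and f: "\<exists>C. marcinkiewicz p C f"
    and ts: "\<forall>t\<in>set ts. cmod t = real q powr (1 / p - 1 / 2)"
    and z: "\<And>x. fold shift ts f x = 0"
  shows "\<exists>g. (\<forall>t\<in>set ts. (\<exists>C. marcinkiewicz p C (g t)) \<and> (\<forall>x. shift t (g t) x = 0)) \<and>
             (\<forall>x. f x = (\<Sum>t\<in>set ts. g t x))"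
  using f ts z
proof (induction ts arbitrary: f)
  case Nil
  then show ?case by simp
next
  case (Cons a ts)
  define R where "R = real q powr (1 / p - 1 / 2)"
  have "1 / 2 < 1 / p" using p by (intro divide_strict_left_mono) auto
  then have R: "1 < R" unfolding R_def using q2 by (intro gr_one_powr) auto
  have "\<exists>g. (\<forall>t\<in>set ts. (\<exists>C. marcinkiewicz p C (g t)) \<and> (\<forall>x. shift t (g t) x = 0)) \<and>
             (\<forall>x. shift a f x = (\<Sum>t\<in>set ts. g t x))"
    using Cons.prems by (intro Cons.IH marcinkiewicz_shift[OF p(1)]) auto
  then obtain h where h: "\<And>t. t \<in> set ts \<Longrightarrow> \<exists>C. marcinkiewicz p C (h t)"
    "\<And>t x. t \<in> set ts \<Longrightarrow> shift t (h t) x = 0" "\<And>x. shift a f x = (\<Sum>t\<in>set ts. h t x)"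
    by blast
  define S where "S = set ts - {a}"
  define c where "c = (\<lambda>t. 1 / ((t + 1 / t) - (a + 1 / a)))"
  have c: "c t * ((t + 1 / t) - (a + 1 / a)) = 1" if "t \<in> S" for t
  proof -
    have "t + 1 / t \<noteq> a + 1 / a"
    proof
      assume "t + 1 / t = a + 1 / a"
      then have "t = a" by (rule add_inverse_inj[OF R, rotated 2]) (use that Cons.prems(2) in \<open>auto simp: S_def R_def\<close>)
      then show False using that by (simp add: S_def)
    qed
    then show ?thesis by (simp add: c_def)
  qed
  define f' where "f' = (\<lambda>x. f x - (\<Sum>t\<in>S. c t * h t x))"
  have sh: "shift a (h t) x = ((t + 1 / t) - (a + 1 / a)) * h t x" if "t \<in> S" for t x
    using h(2)[of t x] that by (simp add: S_def shift_def algebra_simps)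
  have sf: "shift a f' x = (\<Sum>t\<in>set ts. h t x) - (\<Sum>t\<in>S. h t x)" for x
  proof -
    have "shift a f' x = shift a f x - (\<Sum>t\<in>S. c t * shift a (h t) x)"
      unfolding f'_def by (rule shift_linear_combination) (simp add: S_def)
    also have "(\<Sum>t\<in>S. c t * shift a (h t) x) = (\<Sum>t\<in>S. h t x)"
      by (rule sum.cong[OF refl]) (simp only: sh mult.assoc[symmetric] c mult_1_left)
    finally show ?thesis unfolding h(3) .
  qed
  have mf: "\<exists>C. marcinkiewicz p C f'"
  proof -
    have "\<exists>C. marcinkiewicz p C (\<lambda>x. \<Sum>t\<in>S. (- c t) * h t x)"
    proof (rule marcinkiewicz_sum)
      fix t assume "t \<in> S"
      then obtain C where "marcinkiewicz p C (h t)" using h(1)[of t] by (auto simp: S_def)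
      from marcinkiewicz_cmult[OF this, of "- c t"] show "\<exists>C. marcinkiewicz p C (\<lambda>x. - c t * h t x)" by blast
    qed (simp add: S_def)
    then obtain C1 where C1: "marcinkiewicz p C1 (\<lambda>x. \<Sum>t\<in>S. (- c t) * h t x)" by blast
    obtain C2 where C2: "marcinkiewicz p C2 f" using Cons.prems(1) by blast
    have "f' = (\<lambda>x. f x + (\<Sum>t\<in>S. (- c t) * h t x))" by (simp add: f'_def fun_eq_iff sum_negf)
    then show ?thesis using marcinkiewicz_add[OF C2 C1] by metis
  qed
  then obtain Cf where Cf: "marcinkiewicz p Cf f'" by blast
  have ss: "shift a (shift a f') x = 0" for x
  proof (cases "a \<in> set ts")
    case True
    then have "shift a f' = h a"
      unfolding fun_eq_iff sf S_def by (simp add: sum.remove[of "set ts" a])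
    then show ?thesis using h(2)[OF True] by simp
  next
    case False
    then have "S = set ts" by (simp add: S_def)
    then have e0: "shift a f' = (\<lambda>x. 0)" unfolding fun_eq_iff sf by simp
    show ?thesis unfolding e0 by (simp add: shift_def J_eq_sum)
  qed
  have ev: "shift a f' x = 0" for x
    by (rule no_jordan_block[OF p Cf _ ss]) (use Cons.prems(2) in auto)
  define g where "g = (\<lambda>t. if t = a then f' else (\<lambda>x. c t * h t x))"
  have e: "set (a # ts) = insert a S" "a \<notin> S" "finite S" by (auto simp: S_def)
  show ?case
  proof (intro exI[of _ g] conjI ballI allI)
    fix t assume t: "t \<in> set (a # ts)"
    show "\<exists>C. marcinkiewicz p C (g t)"
    proof (cases "t = a")
      case False
      then obtain C where "marcinkiewicz p C (h t)" using h(1)[of t] t by auto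
      from marcinkiewicz_cmult[OF this, of "c t"] show ?thesis using False by (auto simp: g_def)
    qed (use mf in \<open>simp add: g_def\<close>)
    fix x
    show "shift t (g t) x = 0"
    proof (cases "t = a")
      case False
      have "shift t (\<lambda>x. c t * h t x) x = c t * shift t (h t) x"
        by (simp add: shift_def J_cmult algebra_simps)
      then show ?thesis using False h(2)[of t x] t by (simp add: g_def)
    qed (simp add: g_def ev)
  next
    fix x
    have "(\<Sum>t\<in>S. g t x) = (\<Sum>t\<in>S. c t * h t x)"
      by (rule sum.cong) (use e in \<open>auto simp: g_def\<close>)
    then show "f x = (\<Sum>t\<in>set (a # ts). g t x)"
      unfolding e(1) using e(2,3) by (simp add: g_def f'_def)
  qed
qed

lemma eigenvectors_independent:
  assumes "finite S" "inj_on \<kappa> S" "\<And>i x. i \<in> S \<Longrightarrow> J (w i) x = \<kappa> i * w i x"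
    and "\<And>x. (\<Sum>i\<in>S. w i x) = 0" and "i \<in> S"
  shows "w i x = 0"
  using assms
proof (induction S arbitrary: w i x rule: finite_induct)
  case empty
  then show ?case by simp
next
  case (insert a S)
  have z: "(\<Sum>i\<in>insert a S. w i y) = 0" for y by (rule insert.prems(3))
  have diff: "(\<Sum>i\<in>S. (\<kappa> i - \<kappa> a) * w i y) = 0" for y
  proof -
    have "0 = J (\<lambda>x. \<Sum>i\<in>insert a S. w i x) y - \<kappa> a * (\<Sum>i\<in>insert a S. w i y)"
      unfolding z by (simp add: J_eq_sum)
    also have "\<dots> = (\<Sum>i\<in>insert a S. (\<kappa> i - \<kappa> a) * w i y)"
      unfolding J_sum sum_distrib_left sum_subtractf[symmetric]
      by (rule sum.cong[OF refl]) (simp add: insert.prems(2) left_diff_distrib)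
    also have "\<dots> = (\<Sum>i\<in>S. (\<kappa> i - \<kappa> a) * w i y)" using insert.hyps by simp
    finally show ?thesis by simp
  qed
  have S0: "w j y = 0" if j: "j \<in> S" for j y
  proof -
    have "(\<kappa> j - \<kappa> a) * w j y = 0"
    proof (rule insert.IH[of "\<lambda>i x. (\<kappa> i - \<kappa> a) * w i x" j y, OF _ _ diff j])
      show "inj_on \<kappa> S" using insert.prems(1) by (rule inj_on_subset) auto
      show "J (\<lambda>x. (\<kappa> i - \<kappa> a) * w i x) x = \<kappa> i * ((\<kappa> i - \<kappa> a) * w i x)" if "i \<in> S" for i x
        using insert.prems(2)[of i x] that by (simp add: J_cmult)
    qed
    moreover have "\<kappa> j \<noteq> \<kappa> a" using insert.prems(1) j insert.hyps by (auto simp: inj_on_def)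
    ultimately show ?thesis by simp
  qed
  moreover have "w a y = 0" for y using z[of y] insert.hyps S0 by simp
  ultimately show ?case using insert.prems(4) by auto
qed

end

section \<open>Annihilation of bounded backward orbits\<close>

definition unit_symbol :: "int \<Rightarrow> complex" where
  "unit_symbol m = (if m = 0 then 1 else 0)"

lemma infsum_unit_symbol:
  fixes v :: "int \<Rightarrow> complex"
  shows "(\<Sum>\<^sub>\<infinity>m. unit_symbol m * v m) = v 0"
proof -
  have "(\<Sum>\<^sub>\<infinity>m. unit_symbol m * v m) = (\<Sum>\<^sub>\<infinity>m\<in>{0}. unit_symbol m * v m)"
    by (rule infsum_cong_neutral) (auto simp: unit_symbol_def)
  then show ?thesis by (simp add: unit_symbol_def)
qed

lemma weighted_l1_unit_symbol: "weighted_l1 R unit_symbol"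
proof -
  have "(\<lambda>m. cmod (unit_symbol m) * R ^ nat \<bar>m\<bar>) summable_on {0}" by simp
  then show ?thesis unfolding weighted_l1_def
    by (subst summable_on_cong_neutral[where T = "{0}" and g = "\<lambda>m. cmod (unit_symbol m) * R ^ nat \<bar>m\<bar>"])
       (auto simp: unit_symbol_def)
qed

lemma laurent_unit_symbol: "laurent unit_symbol t = 1"
  by (simp add: laurent_def infsum_unit_symbol)

lemma laurent_constant:
  assumes a: "weighted_l1 R a" and R: "1 \<le> R" and c: "\<And>t. cmod t = 1 \<Longrightarrow> laurent a t = c"
  shows "a m = c * unit_symbol m"
proof -
  have "((\<lambda>t. c * t powi (- m - 1)) has_contour_integral 2 * of_real pi * \<i> * a m) (circlepath 0 1)"
    by (rule laurent_coefficient[OF a R]) (use R c in auto)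
  moreover have "((\<lambda>t. c * t powi (- m - 1)) has_contour_integral c * (if - m - 1 = -1 then 2 * of_real pi * \<i> else 0)) (circlepath 0 1)"
    by (intro has_contour_integral_lmul contour_integral_powi) simp
  ultimately have "2 * of_real pi * \<i> * a m = c * (if - m - 1 = -1 then 2 * of_real pi * \<i> else 0)"
    by (rule has_contour_integral_unique)
  then show ?thesis by (cases "m = 0") (auto simp: unit_symbol_def)
qed

fun conv_power :: "(int \<Rightarrow> complex) \<Rightarrow> nat \<Rightarrow> int \<Rightarrow> complex" where
  "conv_power a 0 = unit_symbol"
| "conv_power a (Suc n) = conv (conv_power a n) a"

lemma conv_power_properties:
  assumes R: "1 \<le> R" and a: "weighted_l1 R a" "\<And>m. a (- m) = a m"
  shows "weighted_l1 R (conv_power a n)" "conv_power a n (- m) = conv_power a n m"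
    "1 / R \<le> cmod t \<Longrightarrow> cmod t \<le> R \<Longrightarrow> laurent (conv_power a n) t = laurent a t ^ n"
proof -
  show w: "weighted_l1 R (conv_power a n)" for n
    by (induction n) (auto intro: weighted_l1_unit_symbol weighted_l1_conv[OF R _ a(1)])
  show "conv_power a n (- m) = conv_power a n m" for m
    by (induction n arbitrary: m) (auto simp: unit_symbol_def intro: conv_symmetric a(2))
  assume t: "1 / R \<le> cmod t" "cmod t \<le> R"
  show "laurent (conv_power a n) t = laurent a t ^ n"
    by (induction n) (simp_all add: laurent_unit_symbol laurent_conv[OF R w a(1) t])
qed

context tree
begin

lemma apply_unit_symbol: "apply_symbol unit_symbol f = f"
  by (simp add: apply_symbol_def fun_eq_iff infsum_unit_symbol)

text \<open>The operator \<open>B(J)\<close> for the product \<open>B\<close> of the factors \<open>u + 1 / u - (t + 1 / t)\<close>, with repetitions allowed.\<close>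

definition shift_list :: "complex list \<Rightarrow> ('v \<Rightarrow> complex) \<Rightarrow> 'v \<Rightarrow> complex" where
  "shift_list ts = fold (\<lambda>t. apply_symbol (linear_symbol (t + 1 / t))) ts"

fun root_symbol :: "complex list \<Rightarrow> int \<Rightarrow> complex" where
  "root_symbol [] = unit_symbol"
| "root_symbol (t # ts) = conv (root_symbol ts) (linear_symbol (t + 1 / t))"

lemma root_symbol_properties:
  assumes R: "1 \<le> R"
  shows "weighted_l1 R (root_symbol ts)" "root_symbol ts (- m) = root_symbol ts m"
    "1 / R \<le> cmod u \<Longrightarrow> cmod u \<le> R \<Longrightarrow> laurent (root_symbol ts) u = (\<Prod>t\<leftarrow>ts. u + 1 / u - (t + 1 / t))"
proof -
  show w: "weighted_l1 R (root_symbol ts)" for ts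
    by (induction ts) (auto intro: weighted_l1_unit_symbol weighted_l1_conv[OF R] weighted_l1_linear_symbol)
  show "root_symbol ts (- m) = root_symbol ts m" for m
    by (induction ts arbitrary: m) (auto simp: unit_symbol_def intro: conv_symmetric linear_symbol_uminus)
  assume t: "1 / R \<le> cmod u" "cmod u \<le> R"
  show "laurent (root_symbol ts) u = (\<Prod>t\<leftarrow>ts. u + 1 / u - (t + 1 / t))"
    by (induction ts)
       (simp_all add: laurent_unit_symbol laurent_conv[OF R w weighted_l1_linear_symbol t] laurent_linear_symbol mult.commute)
qed

lemma apply_root_symbol:
  assumes R: "1 \<le> R" and f: "tempered R C f"
  shows "apply_symbol (root_symbol ts) f = shift_list ts f"
  using f
proof (induction ts arbitrary: f C)
  case Nil
  then show ?case by (simp add: apply_unit_symbol shift_list_def)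
next
  case (Cons t ts)
  let ?l = "linear_symbol (t + 1 / t)"
  have "apply_symbol (root_symbol (t # ts)) f = apply_symbol (root_symbol ts) (apply_symbol ?l f)"
    using apply_symbol_conv[OF R Cons.prems root_symbol_properties(1)[OF R] weighted_l1_linear_symbol linear_symbol_uminus]
    by simp
  also have "\<dots> = shift_list ts (apply_symbol ?l f)"
    by (rule Cons.IH[OF tempered_apply_symbol[OF R Cons.prems weighted_l1_linear_symbol linear_symbol_uminus]])
  finally show ?case by (simp add: shift_list_def)
qed

text \<open>The value of \<open>apply_symbol b (h 0)\<close> is also the value of \<open>conv b (conv_power a (\<sigma> n))\<close> at \<open>h (\<sigma> n)\<close>, and the \<open>h n\<close> obey one
  common bound.\<close>

lemma annihilated_by_damping:
  assumes R: "1 \<le> R" and a: "weighted_l1 R a" "\<And>m. a (- m) = a m"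
    and b: "weighted_l1 R b" "\<And>m. b (- m) = b m"
    and h: "\<And>n. tempered R C (h n)" and step: "\<And>n. apply_symbol a (h (Suc n)) = h n"
    and damp: "(\<lambda>n. \<Sum>\<^sub>\<infinity>m. cmod (conv b (conv_power a (\<sigma> n)) m) * R ^ nat \<bar>m\<bar>) \<longlonglongrightarrow> 0"
  shows "apply_symbol b (h 0) x = 0"
proof -
  note pw = conv_power_properties[OF R a]
  have iter: "apply_symbol (conv_power a n) (h n) = h 0" for n
  proof (induction n)
    case 0
    then show ?case by (simp add: apply_unit_symbol)
  next
    case (Suc n)
    have "apply_symbol (conv_power a (Suc n)) (h (Suc n)) = apply_symbol (conv_power a n) (apply_symbol a (h (Suc n)))"
      using apply_symbol_conv[OF R h pw(1) a] by simp
    then show ?case using Suc step by simp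
  qed
  have "cmod (apply_symbol b (h 0) x) \<le> C * (\<Sum>\<^sub>\<infinity>m. cmod (conv b (conv_power a (\<sigma> n)) m) * R ^ nat \<bar>m\<bar>)" for n
  proof -
    have "apply_symbol b (h 0) = apply_symbol (conv b (conv_power a (\<sigma> n))) (h (\<sigma> n))"
      using apply_symbol_conv[OF R h b(1) pw(1,2), of "\<sigma> n" "\<sigma> n"] iter[of "\<sigma> n"] by simp
    then have "apply_symbol b (h 0) x = apply_symbol (conv b (conv_power a (\<sigma> n))) (h (\<sigma> n)) x" by simp
    moreover have "cmod (apply_symbol (conv b (conv_power a (\<sigma> n))) (h (\<sigma> n)) x)
        \<le> C * (\<Sum>\<^sub>\<infinity>m. cmod (conv b (conv_power a (\<sigma> n)) m) * R ^ nat \<bar>m\<bar>)"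
      unfolding apply_symbol_def
      by (rule weighted_l1_pairing(3)[OF weighted_l1_conv[OF R b(1) pw(1)]])
         (use h[of "\<sigma> n"] in \<open>simp add: tempered_def\<close>)
    ultimately show ?thesis by (simp only:)
  qed
  moreover have "(\<lambda>n. C * (\<Sum>\<^sub>\<infinity>m. cmod (conv b (conv_power a (\<sigma> n)) m) * R ^ nat \<bar>m\<bar>)) \<longlonglongrightarrow> C * 0"
    by (intro tendsto_intros damp)
  ultimately have "cmod (apply_symbol b (h 0) x) \<le> C * 0" by (intro LIMSEQ_le_const) auto
  then show ?thesis by simp
qed

text \<open>With \<open>B\<close> vanishing at the unimodular points of \<open>\<Phi>\<close> on the circle, the coefficients of \<open>B ^ N * \<Phi> ^ n\<close> tend to \<open>0\<close> in the
  weighted norm for a suitable \<open>N\<close>, and \<open>annihilated_by_damping\<close> applies. Control on the outer circle suffices because the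
  symbols are symmetric.\<close>

lemma annihilator_exists:
  assumes R: "1 < R" and S: "R < S" and \<Phi>: "\<Phi> holomorphic_on annulus (1 / S) S"
    and a: "weighted_l1 R a" "\<And>m. a (- m) = a m"
    and eval: "\<And>t. 1 / R \<le> cmod t \<Longrightarrow> cmod t \<le> R \<Longrightarrow> laurent a t = \<Phi> t"
    and le1: "\<And>t. cmod t = R \<Longrightarrow> cmod (\<Phi> t) \<le> 1"
    and fin: "finite {t. cmod t = R \<and> cmod (\<Phi> t) = 1}"
    and h: "\<And>n. tempered R C (h n)" and step: "\<And>n. apply_symbol a (h (Suc n)) = h n"
  shows "\<exists>ts. set ts = {t. cmod t = R \<and> cmod (\<Phi> t) = 1} \<and> (\<forall>x. shift_list ts (h 0) x = 0)"
proof -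
  let ?T = "{t. cmod t = R \<and> cmod (\<Phi> t) = 1}"
  have R0: "0 < R" using R by simp
  obtain us where us: "set us = ?T" using finite_list[OF fin] by blast
  define B where "B = (\<lambda>u::complex. \<Prod>t\<leftarrow>us. u + 1 / u - (t + 1 / t))"
  \<comment> \<open>The modulus is not holomorphic, but on the circle of radius \<open>R\<close> the point \<open>R\<^sup>2 / cnj t\<close> is \<open>t\<close> itself,
    so the holomorphic function \<open>D\<close> equals \<open>1 - (cmod (\<Phi> t))\<^sup>2\<close> there.\<close>
  define D where "D = (\<lambda>t. 1 - \<Phi> t * cnj (\<Phi> (cnj (of_real (R\<^sup>2) / t))))"
  define V where "V = annulus (R\<^sup>2 / S) S"
  have S0: "0 < S" using R S by simp
  have VS: "R\<^sup>2 / S < R"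
  proof -
    have "R * R < R * S" using R S by (intro mult_strict_left_mono) auto
    then show ?thesis using S0 by (simp add: pos_divide_less_eq power2_eq_square)
  qed
  have R2: "1 < R\<^sup>2" using R by (simp add: one_less_power)
  have lowV: "1 / S < R\<^sup>2 / S" using R2 S0 by (intro divide_strict_right_mono) auto
  have "0 < R\<^sup>2 / S" using R2 S0 by (intro divide_pos_pos) linarith+
  then have V0: "0 \<notin> V" by (simp add: V_def annulus_def)
  have Vsub: "V \<subseteq> annulus (1 / S) S" using lowV by (auto simp: V_def annulus_def)
  have oV: "open V" unfolding V_def by (rule open_annulus)
  have circ: "sphere 0 R \<subseteq> V" using VS S by (auto simp: V_def annulus_def)
  have \<Phi>V: "\<Phi> holomorphic_on V" by (rule holomorphic_on_subset[OF \<Phi> Vsub])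
  have reflV: "of_real (R\<^sup>2) / t \<in> V" if "t \<in> V" for t
  proof -
    have t: "R\<^sup>2 / S < cmod t" "cmod t < S" using that by (auto simp: V_def annulus_def)
    have t0: "0 < cmod t" using V0 that by auto
    have n: "cmod (of_real (R\<^sup>2) / t) = R\<^sup>2 / cmod t" unfolding norm_divide norm_of_real by simp
    have "R\<^sup>2 / S < R\<^sup>2 / cmod t" using t t0 R0 S0 by (intro divide_strict_left_mono mult_pos_pos) auto
    moreover have "R\<^sup>2 < cmod t * S" using t(1) S0 by (simp only: pos_divide_less_eq)
    then have "R\<^sup>2 / cmod t < S" using t0 by (simp add: pos_divide_less_eq mult.commute)
    ultimately show ?thesis unfolding V_def annulus_def mem_Collect_eq n by blast
  qed
  have DV: "D holomorphic_on V"
  proof -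
    have cV: "cnj z \<in> V \<longleftrightarrow> z \<in> V" for z by (simp add: V_def annulus_def)
    have "cnj ` V = V"
    proof (intro equalityI subsetI)
      fix z assume "z \<in> V"
      then have "z = cnj (cnj z)" "cnj z \<in> V" by (simp_all add: cV)
      then show "z \<in> cnj ` V" by (rule image_eqI)
    qed (use cV in auto)
    then have outer: "(cnj \<circ> \<Phi> \<circ> cnj) holomorphic_on V"
      using holomorphic_on_compose_cnj_cnj[of \<Phi> V] \<Phi>V oV by simp
    have inner: "(\<lambda>t. of_real (R\<^sup>2) / t) holomorphic_on V"
      by (intro holomorphic_intros) (use V0 in auto)
    have "((cnj \<circ> \<Phi> \<circ> cnj) \<circ> (\<lambda>t. of_real (R\<^sup>2) / t)) holomorphic_on V"
      by (rule holomorphic_on_compose_gen[OF inner outer]) (use reflV in blast)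
    then have "(\<lambda>t. cnj (\<Phi> (cnj (of_real (R\<^sup>2) / t)))) holomorphic_on V" by (simp only: o_def)
    then show ?thesis unfolding D_def by (intro holomorphic_intros \<Phi>V)
  qed
  have Dcirc: "D t = of_real (1 - (cmod (\<Phi> t))\<^sup>2)" if t: "cmod t = R" for t
  proof -
    have t0: "t \<noteq> 0" using t R0 by auto
    have "of_real (R\<^sup>2) = t * cnj t" using complex_norm_square[of t] unfolding t .
    then have refl: "of_real (R\<^sup>2) / t = cnj t" using t0 by (simp only:) simp
    have "D t = 1 - \<Phi> t * cnj (\<Phi> t)" unfolding D_def refl by simp
    then show ?thesis by (simp only: of_real_diff of_real_1 complex_norm_square)
  qed
  have Dzero: "D t = 0 \<longleftrightarrow> cmod (\<Phi> t) = 1" if t: "cmod t = R" for t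
  proof -
    have "D t = 0 \<longleftrightarrow> (cmod (\<Phi> t))\<^sup>2 = 1" unfolding Dcirc[OF t] of_real_eq_0_iff by auto
    then show ?thesis using norm_ge_zero[of "\<Phi> t"] by (auto simp: power2_eq_1_iff)
  qed
  have Dabs: "cmod (D t) = 1 - (cmod (\<Phi> t))\<^sup>2" if t: "cmod t = R" for t
  proof -
    have "(cmod (\<Phi> t))\<^sup>2 \<le> 1" using le1[OF t] by (simp add: power_le_one)
    then show ?thesis unfolding Dcirc[OF t] norm_of_real by simp
  qed
  have BV: "B holomorphic_on V"
  proof -
    have "(\<lambda>u. \<Prod>t\<leftarrow>us. u + 1 / u - (t + 1 / t)) holomorphic_on V" for us
      by (induction us) (use V0 in \<open>auto intro!: holomorphic_intros\<close>)
    then show ?thesis by (simp add: B_def)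
  qed
  have Bzero: "B t = 0" if "cmod t = R" "D t = 0" for t
  proof -
    have "t \<in> set us" using that Dzero us by auto
    then show ?thesis unfolding B_def by (induction us) auto
  qed
  have nz: "\<exists>s\<in>ball t e. D s \<noteq> 0" if t: "t \<in> sphere 0 R" and e: "0 < e" for t e
  proof -
    have "of_real R \<in> sphere (0::complex) R" "- of_real R \<in> sphere (0::complex) R" "of_real R \<noteq> - (of_real R :: complex)"
      using R0 by auto
    then have "sphere (0::complex) R \<noteq> {x}" for x by (metis singletonD)
    then have "t islimpt sphere 0 R"
      by (intro connected_imp_perfect[OF connected_sphere t]) auto
    then have "infinite (sphere 0 R \<inter> ball t e)" using e by (simp add: islimpt_eq_infinite_ball)
    then have "\<not> sphere 0 R \<inter> ball t e \<subseteq> ?T" using finite_subset[OF _ fin] by blast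
    then obtain s where "s \<in> sphere 0 R" "s \<in> ball t e" "s \<notin> ?T" by blast
    then show ?thesis using Dzero[of s] by auto
  qed
  obtain r c where rc: "0 < c" "\<forall>t\<in>sphere 0 R. c * cmod (B t) ^ r \<le> cmod (D t)"
  proof -
    have "B t = 0" if "t \<in> sphere 0 R" "D t = 0" for t using that Bzero by auto
    from lojasiewicz[OF oV DV BV compact_sphere circ nz this] show ?thesis using that by blast
  qed
  have dom: "c * cmod (B t) ^ r \<le> 1 - (cmod (\<Phi> t))\<^sup>2" if "t \<in> sphere 0 R" for t
  proof -
    have t: "cmod t = R" using that by simp
    show ?thesis using rc(2)[rule_format, OF that] unfolding Dabs[OF t] .
  qed
  obtain C' where C': "\<And>j. 1 \<le> j \<Longrightarrow> \<exists>G1 G2.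
     (\<forall>t\<in>V. ((\<lambda>t. \<Phi> t ^ (j + 2) * B t ^ (3 * r + 2)) has_field_derivative G1 t) (at t)) \<and>
     (\<forall>t\<in>V. (G1 has_field_derivative G2 t) (at t)) \<and>
     (\<forall>t\<in>sphere 0 R. cmod (\<Phi> t ^ (j + 2) * B t ^ (3 * r + 2)) \<le> C' / real j) \<and>
     (\<forall>t\<in>sphere 0 R. cmod (G2 t) \<le> C' / real j)"
    using power_decay[OF oV \<Phi>V BV compact_sphere circ rc(1) dom] by blast
  \<comment> \<open>Repeating each zero \<open>3 * r + 2\<close> times makes the symbol of \<open>ts\<close> the power of \<open>B\<close> for which
    the decay was obtained.\<close>
  define ts where "ts = concat (replicate (3 * r + 2) us)"
  have set_ts: "set ts = ?T" using us by (auto simp: ts_def)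
  define b where "b = root_symbol ts"
  note bp = root_symbol_properties[OF less_imp_le[OF R], where ts = ts, folded b_def]
  have prod_ts: "(\<Prod>t\<leftarrow>ts. u + 1 / u - (t + 1 / t)) = B u ^ (3 * r + 2)" for u
  proof -
    have "(\<Prod>t\<leftarrow>concat (replicate k us). u + 1 / u - (t + 1 / t)) = B u ^ k" for k
      by (induction k) (auto simp: B_def)
    then show ?thesis by (simp only: ts_def)
  qed
  note pw = conv_power_properties[OF less_imp_le[OF R] a]
  from weighted_norm_le_second_derivative[OF less_imp_le[OF R]]
  obtain C2 where C2: "\<forall>a G G1 G2 V \<epsilon>. weighted_l1 R a \<longrightarrow> (\<forall>m. a (- m) = a m) \<longrightarrow> sphere 0 R \<subseteq> V \<longrightarrow> 0 \<notin> V \<longrightarrow>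
     (\<forall>t\<in>V. (G has_field_derivative G1 t) (at t)) \<longrightarrow> (\<forall>t\<in>V. (G1 has_field_derivative G2 t) (at t)) \<longrightarrow>
     (\<forall>t\<in>sphere 0 R. G t = laurent a t \<and> cmod (G t) \<le> \<epsilon> \<and> cmod (G2 t) \<le> \<epsilon>) \<longrightarrow>
     (\<Sum>\<^sub>\<infinity>m. cmod (a m) * R ^ nat \<bar>m\<bar>) \<le> C2 * \<epsilon>" ..
  have damp_bd: "(\<Sum>\<^sub>\<infinity>m. cmod (conv b (conv_power a (j + 2)) m) * R ^ nat \<bar>m\<bar>) \<le> C2 * (C' / real j)" if j: "1 \<le> j" for j
  proof -
    obtain G1 G2 where G: "\<forall>t\<in>V. ((\<lambda>t. \<Phi> t ^ (j + 2) * B t ^ (3 * r + 2)) has_field_derivative G1 t) (at t)"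
      "\<forall>t\<in>V. (G1 has_field_derivative G2 t) (at t)"
      "\<forall>t\<in>sphere 0 R. cmod (\<Phi> t ^ (j + 2) * B t ^ (3 * r + 2)) \<le> C' / real j"
      "\<forall>t\<in>sphere 0 R. cmod (G2 t) \<le> C' / real j"
      using C'[OF j] by blast
    have "\<Phi> t ^ (j + 2) * B t ^ (3 * r + 2) = laurent (conv b (conv_power a (j + 2))) t" if "t \<in> sphere 0 R" for t
    proof -
      have t: "1 / R \<le> cmod t" "cmod t \<le> R"
      proof -
        have "1 / R \<le> 1" using R by simp
        moreover have "cmod t = R" using that by simp
        ultimately show "1 / R \<le> cmod t" "cmod t \<le> R" using R by linarith+
      qed
      show ?thesis
        unfolding laurent_conv[OF less_imp_le[OF R] bp(1) pw(1) t] bp(3)[OF t] pw(3)[OF t] prod_ts eval[OF t] by (rule mult.commute)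
    qed
    then have all: "\<forall>t\<in>sphere 0 R. \<Phi> t ^ (j + 2) * B t ^ (3 * r + 2) = laurent (conv b (conv_power a (j + 2))) t \<and>
       cmod (\<Phi> t ^ (j + 2) * B t ^ (3 * r + 2)) \<le> C' / real j \<and> cmod (G2 t) \<le> C' / real j"
      using G(3,4) by blast
    have sym: "\<forall>m. conv b (conv_power a (j + 2)) (- m) = conv b (conv_power a (j + 2)) m"
      by (intro allI conv_symmetric bp(2) pw(2))
    show ?thesis
      by (rule C2[THEN spec, THEN spec, THEN spec, THEN spec, THEN spec, THEN spec, THEN mp, THEN mp, THEN mp, THEN mp,
            THEN mp, THEN mp, THEN mp, OF weighted_l1_conv[OF less_imp_le[OF R] bp(1) pw(1)] sym circ V0 G(1,2) all])
  qed
  have damp: "(\<lambda>n. \<Sum>\<^sub>\<infinity>m. cmod (conv b (conv_power a (n + 3)) m) * R ^ nat \<bar>m\<bar>) \<longlonglongrightarrow> 0"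
  proof (rule Lim_null_comparison)
    have "(\<lambda>n. C2 * C' * (1 / real (Suc n))) \<longlonglongrightarrow> C2 * C' * 0"
      using LIMSEQ_inverse_real_of_nat by (intro tendsto_mult tendsto_const) (simp add: inverse_eq_divide)
    then show "(\<lambda>n. C2 * (C' / real (Suc n))) \<longlonglongrightarrow> 0" by simp
    show "\<forall>\<^sub>F n in sequentially. norm (\<Sum>\<^sub>\<infinity>m. cmod (conv b (conv_power a (n + 3)) m) * R ^ nat \<bar>m\<bar>) \<le> C2 * (C' / real (Suc n))"
    proof (rule always_eventually, rule allI)
      fix n
      have e: "Suc n + 2 = n + 3" by simp
      have "0 \<le> (\<Sum>\<^sub>\<infinity>m. cmod (conv b (conv_power a (n + 3)) m) * R ^ nat \<bar>m\<bar>)"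
        using R by (intro infsum_nonneg) auto
      then show "norm (\<Sum>\<^sub>\<infinity>m. cmod (conv b (conv_power a (n + 3)) m) * R ^ nat \<bar>m\<bar>) \<le> C2 * (C' / real (Suc n))"
        using damp_bd[of "Suc n"] unfolding e by simp
    qed
  qed
  have "apply_symbol b (h 0) x = 0" for x
    by (rule annihilated_by_damping[where R = R and a = a and h = h and C = C and \<sigma> = "\<lambda>n. n + 3"])
       (use R in simp, rule a(1), rule a(2), rule bp(1), rule bp(2), rule h, rule step, rule damp)
  then have "shift_list ts (h 0) x = 0" for x
    unfolding b_def apply_root_symbol[OF less_imp_le[OF R] h] .
  then show ?thesis using set_ts by blast
qed

end

section \<open>Martingales on the boundary\<close>

context tree_boundary
begin

definition level_mass :: "nat \<Rightarrow> real" where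
  "level_mass n = (if n = 0 then 1 else 1 / ((real q + 1) * real q ^ (n - 1)))"

lemma level_mass_pos: "0 < level_mass n"
  using q_pos by (simp add: level_mass_def)

lemma measure_cylinder_level: "measure \<nu> (cylinder E v0 x) = level_mass (lvl x)"
  using measure_cylinder[of x] cylinder_root by (cases "lvl x = 0") (auto simp: level_mass_def prob_space)

lemma level_mass_Suc: "level_mass (Suc n) * (if n = 0 then real q + 1 else real q) = level_mass n"
  using q_pos by (cases n) (auto simp: level_mass_def)

lemma level_mass_bounds:
  assumes "1 \<le> n"
  shows "level_mass n \<le> 1 / real q ^ n" "1 / level_mass n \<le> 2 * real q ^ n"
proof -
  obtain k where k: "n = Suc k" using assms by (cases n) auto
  have q1: "1 \<le> real q" using q2 by simp
  have "real q * real q ^ k \<le> (real q + 1) * real q ^ k" by (intro mult_right_mono) auto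
  then show "level_mass n \<le> 1 / real q ^ n"
    unfolding level_mass_def k using q_pos by (simp add: frac_le)
  have "(real q + 1) * real q ^ k \<le> (2 * real q) * real q ^ k" using q1 by (intro mult_right_mono) auto
  then show "1 / level_mass n \<le> 2 * real q ^ n"
    unfolding level_mass_def k by simp
qed

text \<open>A function of the vertex reached at level \<open>n\<close> is a finite combination of indicators of cylinders.\<close>

lemma level_function:
  fixes \<phi> :: "'v \<Rightarrow> 'b :: {banach, second_countable_topology}"
  shows "has_bochner_integral \<nu> (\<lambda>\<omega>. \<phi> (\<omega> n)) (level_mass n *\<^sub>R (\<Sum>x\<in>vsphere v0 n. \<phi> x))"
proof -
  have "has_bochner_integral \<nu> (\<lambda>\<omega>. \<Sum>x\<in>vsphere v0 n. indicat_real (cylinder E v0 x) \<omega> *\<^sub>R \<phi> x)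
      (\<Sum>x\<in>vsphere v0 n. measure \<nu> (cylinder E v0 x) *\<^sub>R \<phi> x)"
    by (intro has_bochner_integral_sum has_bochner_integral_scaleR_left has_bochner_integral_real_indicator sets_cylinder)
       (simp add: emeasure_eq_measure)
  moreover have "(\<Sum>x\<in>vsphere v0 n. measure \<nu> (cylinder E v0 x) *\<^sub>R \<phi> x) = level_mass n *\<^sub>R (\<Sum>x\<in>vsphere v0 n. \<phi> x)"
    unfolding scaleR_sum_right by (rule sum.cong) (auto simp: measure_cylinder_level vsphere_def)
  moreover have "(\<Sum>x\<in>vsphere v0 n. indicat_real (cylinder E v0 x) \<omega> *\<^sub>R \<phi> x) = \<phi> (\<omega> n)" if "\<omega> \<in> space \<nu>" for \<omega>
  proof -
    have w: "\<omega> \<in> boundary E v0" using that by (simp add: space_nu)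
    have "(\<Sum>x\<in>vsphere v0 n. indicat_real (cylinder E v0 x) \<omega> *\<^sub>R \<phi> x) = (\<Sum>x\<in>vsphere v0 n. if x = \<omega> n then \<phi> x else 0)"
      using w by (intro sum.cong) (auto simp: vsphere_def cylinder_eq indicator_def)
    also have "\<dots> = \<phi> (\<omega> n)"
    proof -
      have "\<omega> n \<in> vsphere v0 n" using boundaryD(2)[OF w, of n] by (simp add: vsphere_def)
      then show ?thesis by (simp add: sum.delta)
    qed
    finally show ?thesis .
  qed
  ultimately show ?thesis by (simp cong: has_bochner_integral_cong)
qed

lemma integrable_level: "integrable \<nu> (\<lambda>\<omega>. (\<phi> :: 'v \<Rightarrow> 'b :: {banach, second_countable_topology}) (\<omega> n))"
  using level_function by (rule integrable.intros)

lemma integral_level: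
  "(LINT \<omega>|\<nu>. (\<phi> :: 'v \<Rightarrow> 'b :: {banach, second_countable_topology}) (\<omega> n)) = level_mass n *\<^sub>R (\<Sum>x\<in>vsphere v0 n. \<phi> x)"
  by (rule has_bochner_integral_integral_eq[OF level_function])

text \<open>The descendants of \<open>y\<close> that are \<open>m\<close> generations below it.\<close>

fun desc :: "'v \<Rightarrow> nat \<Rightarrow> 'v set" where
  "desc y 0 = {y}"
| "desc y (Suc m) = (\<Union>x\<in>desc y m. children x)"

lemma finite_desc [simp]: "finite (desc y m)"
  by (induction m) auto

lemma desc_iff: "x \<in> desc y m \<longleftrightarrow> lvl x = lvl y + m \<and> (parent ^^ m) x = y"
proof (induction m arbitrary: x)
  case 0
  then show ?case by auto
next
  case (Suc m)
  have "x \<in> desc y (Suc m) \<longleftrightarrow> x \<noteq> v0 \<and> parent x \<in> desc y m" by (auto simp: children_iff)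
  also have "\<dots> \<longleftrightarrow> x \<noteq> v0 \<and> lvl (parent x) = lvl y + m \<and> (parent ^^ m) (parent x) = y" using Suc by blast
  also have "\<dots> \<longleftrightarrow> lvl x = lvl y + Suc m \<and> (parent ^^ Suc m) x = y"
    using parent(2)[of x] by (cases "x = v0") (auto simp: funpow_swap1 simp del: funpow.simps, auto simp: funpow_swap1)
  finally show ?case .
qed

lemma sum_desc_Suc: "(\<Sum>x\<in>desc y (Suc m). f x) = (\<Sum>x\<in>desc y m. \<Sum>z\<in>children x. (f z :: 'b :: comm_monoid_add))"
  by (simp, rule sum.UNION_disjoint) (auto simp: disjoint_children)

lemma level_mass_desc: "level_mass (lvl y + m) * real (card (desc y m)) = level_mass (lvl y)"
proof (induction m)
  case (Suc m)
  have "real (card (desc y (Suc m))) = (\<Sum>x\<in>desc y (Suc m). 1)" by simp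
  also have "\<dots> = (\<Sum>x\<in>desc y m. real (card (children x)))" unfolding sum_desc_Suc by simp
  also have "\<dots> = (\<Sum>x\<in>desc y m. (if lvl y + m = 0 then real q + 1 else real q))"
  proof (rule sum.cong[OF refl])
    fix x assume "x \<in> desc y m"
    then have "lvl x = lvl y + m" by (simp add: desc_iff)
    then show "real (card (children x)) = (if lvl y + m = 0 then real q + 1 else real q)"
    proof -
      assume l: "lvl x = lvl y + m"
      have "x = v0 \<longleftrightarrow> lvl x = 0" by auto
      then show ?thesis using card_children[of x] unfolding l by simp
    qed
  qed
  finally have "level_mass (lvl y + Suc m) * real (card (desc y (Suc m)))
      = level_mass (Suc (lvl y + m)) * (if lvl y + m = 0 then real q + 1 else real q) * real (card (desc y m))"
    by simp
  then show ?case using Suc by (simp only: level_mass_Suc)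
qed simp

lemma card_desc: "1 \<le> lvl y \<Longrightarrow> card (desc y m) = q ^ m"
proof -
  assume y: "1 \<le> lvl y"
  have "card (desc y m) = q ^ m"
  proof (induction m)
    case (Suc m)
    have "card (desc y (Suc m)) = (\<Sum>x\<in>desc y (Suc m). 1)" by simp
    also have "\<dots> = (\<Sum>x\<in>desc y m. card (children x))" unfolding sum_desc_Suc by simp
    also have "\<dots> = (\<Sum>x\<in>desc y m. q)"
      using y card_children by (intro sum.cong) (auto simp: desc_iff)
    finally show ?case using Suc by simp
  qed simp
  then show ?thesis .
qed

lemma vsphere_desc: "vsphere v0 (n + m) = (\<Union>x\<in>vsphere v0 n. desc x m)"
proof (induction m)
  case (Suc m)
  have "vsphere v0 (n + Suc m) = (\<Union>x\<in>vsphere v0 (n + m). children x)" by (simp add: vsphere_Suc)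
  then show ?case unfolding Suc by simp
qed (auto simp: vsphere_def)

lemma sum_vsphere_desc: "(\<Sum>y\<in>vsphere v0 (n + m). f y) = (\<Sum>x\<in>vsphere v0 n. \<Sum>y\<in>desc x m. (f y :: 'b :: comm_monoid_add))"
  unfolding vsphere_desc by (rule sum.UNION_disjoint) (auto simp: desc_iff)

lemma boundary_funpow_parent:
  assumes w: "\<omega> \<in> boundary E v0"
  shows "(parent ^^ m) (\<omega> (n + m)) = \<omega> n"
proof (induction m)
  case (Suc m)
  then show ?case using boundaryD(4)[OF w, of "n + m"] by (simp add: funpow_swap1)
qed simp

text \<open>Since a cylinder is the disjoint union of the cylinders of its children, such a function is a finitely
  additive measure on the algebra of cylinders. Its densities with respect to \<open>\<nu>\<close>, one for each level, form a martingale.\<close>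

definition additive :: "('v \<Rightarrow> complex) \<Rightarrow> bool" where
  "additive \<mu> \<longleftrightarrow> (\<forall>x. (\<Sum>y\<in>children x. \<mu> y) = \<mu> x)"

definition level_density :: "('v \<Rightarrow> complex) \<Rightarrow> nat \<Rightarrow> 'v \<Rightarrow> complex" where
  "level_density \<mu> n y = \<mu> y / of_real (level_mass n)"

lemma additive_desc: "additive \<mu> \<Longrightarrow> (\<Sum>y\<in>desc x m. \<mu> y) = \<mu> x"
  by (induction m) (simp_all add: sum_desc_Suc additive_def del: desc.simps(2))

lemma integral_level_density_cylinder:
  assumes \<mu>: "additive \<mu>" and m: "lvl x \<le> m"
  shows "(LINT \<omega>|\<nu>. indicat_real (cylinder E v0 x) \<omega> *\<^sub>R level_density \<mu> m (\<omega> m)) = \<mu> x"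
proof -
  define k where "k = m - lvl x"
  have mk: "m = lvl x + k" using m by (simp add: k_def)
  define \<phi> where "\<phi> = (\<lambda>y. if (parent ^^ k) y = x then level_density \<mu> m y else 0)"
  have "(LINT \<omega>|\<nu>. indicat_real (cylinder E v0 x) \<omega> *\<^sub>R level_density \<mu> m (\<omega> m)) = (LINT \<omega>|\<nu>. \<phi> (\<omega> m))"
    by (rule Bochner_Integration.integral_cong)
       (auto simp: space_nu cylinder_eq \<phi>_def mk boundary_funpow_parent)
  also have "\<dots> = level_mass m *\<^sub>R (\<Sum>y\<in>vsphere v0 m. \<phi> y)" by (rule integral_level)
  also have "(\<Sum>y\<in>vsphere v0 m. \<phi> y) = (\<Sum>y\<in>desc x k. level_density \<mu> m y)"
    by (rule sum.mono_neutral_cong_right[OF finite_vsphere]) (auto simp: \<phi>_def desc_iff vsphere_def mk)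
  also have "\<dots> = \<mu> x / of_real (level_mass m)"
    unfolding level_density_def sum_divide_distrib[symmetric] additive_desc[OF \<mu>] ..
  finally show ?thesis using level_mass_pos[of m] by (simp add: scaleR_conv_of_real)
qed

text \<open>The squared \<open>L\<^sup>2\<close> norm of the density at level \<open>n\<close>.\<close>

definition energy :: "('v \<Rightarrow> complex) \<Rightarrow> nat \<Rightarrow> real" where
  "energy \<mu> n = level_mass n * (\<Sum>y\<in>vsphere v0 n. (cmod (level_density \<mu> n y))\<^sup>2)"

text \<open>The density at level \<open>n\<close> is the average of the one at level \<open>n + m\<close>, so martingale increments are orthogonal.\<close>

lemma level_density_increment:
  assumes \<mu>: "additive \<mu>"
  shows "level_mass (n + m) * (\<Sum>y\<in>vsphere v0 (n + m). (cmod (level_density \<mu> (n + m) y - level_density \<mu> n ((parent ^^ m) y)))\<^sup>2)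
     = energy \<mu> (n + m) - energy \<mu> n"
proof -
  let ?M = "level_mass (n + m)" and ?f = "level_density \<mu> (n + m)" and ?g = "level_density \<mu> n"
  have M0: "complex_of_real ?M \<noteq> 0" "complex_of_real (level_mass n) \<noteq> 0"
    using level_mass_pos[of "n + m"] level_mass_pos[of n] by simp_all
  have blk: "?M * (\<Sum>y\<in>desc x m. (cmod (?f y - ?g x))\<^sup>2)
      = ?M * (\<Sum>y\<in>desc x m. (cmod (?f y))\<^sup>2) - level_mass n * (cmod (?g x))\<^sup>2" if x: "x \<in> vsphere v0 n" for x
  proof -
    have lx: "lvl x = n" using x by (simp add: vsphere_def)
    have sq: "of_real ((cmod (a - b))\<^sup>2) = of_real ((cmod a)\<^sup>2) - a * cnj b - cnj a * b + b * cnj b" for a b :: complex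
      by (simp only: complex_norm_square complex_cnj_diff) (simp add: algebra_simps)
    have sf: "of_real ?M * (\<Sum>y\<in>desc x m. ?f y) = of_real (level_mass n) * ?g x"
    proof -
      have "of_real ?M * (\<Sum>y\<in>desc x m. ?f y) = (\<Sum>y\<in>desc x m. \<mu> y)"
        unfolding level_density_def sum_divide_distrib[symmetric] using M0 by simp
      then show ?thesis unfolding additive_desc[OF \<mu>] level_density_def using M0 by simp
    qed
    have sfc: "of_real ?M * (\<Sum>y\<in>desc x m. cnj (?f y)) = of_real (level_mass n) * cnj (?g x)"
      using arg_cong[OF sf, of cnj] by (simp add: cnj_sum)
    have cd: "of_real ?M * of_nat (card (desc x m)) = (of_real (level_mass n) :: complex)"
      using arg_cong[OF level_mass_desc[of x m], of complex_of_real] lx by simp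
    have "complex_of_real (?M * (\<Sum>y\<in>desc x m. (cmod (?f y - ?g x))\<^sup>2))
        = of_real ?M * (\<Sum>y\<in>desc x m. of_real ((cmod (?f y))\<^sup>2) - ?f y * cnj (?g x) - cnj (?f y) * ?g x + ?g x * cnj (?g x))"
      unfolding of_real_mult of_real_sum sq ..
    also have "\<dots> = of_real ?M * (\<Sum>y\<in>desc x m. of_real ((cmod (?f y))\<^sup>2))
        - (of_real ?M * (\<Sum>y\<in>desc x m. ?f y)) * cnj (?g x)
        - (of_real ?M * (\<Sum>y\<in>desc x m. cnj (?f y))) * ?g x
        + (of_real ?M * of_nat (card (desc x m))) * (?g x * cnj (?g x))"
      unfolding sum.distrib sum_subtractf sum_distrib_right[symmetric] sum_constant
      by (simp only: right_diff_distrib distrib_left mult.assoc)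
    also have "\<dots> = of_real ?M * (\<Sum>y\<in>desc x m. of_real ((cmod (?f y))\<^sup>2)) - of_real (level_mass n) * (?g x * cnj (?g x))"
      unfolding sf sfc cd by (simp add: algebra_simps)
    also have "\<dots> = complex_of_real (?M * (\<Sum>y\<in>desc x m. (cmod (?f y))\<^sup>2) - level_mass n * (cmod (?g x))\<^sup>2)"
      by (simp only: of_real_diff of_real_mult of_real_sum complex_norm_square[of "?g x"])
    finally show ?thesis by (simp only: of_real_eq_iff)
  qed
  have "?M * (\<Sum>y\<in>vsphere v0 (n + m). (cmod (?f y - ?g ((parent ^^ m) y)))\<^sup>2)
      = (\<Sum>x\<in>vsphere v0 n. ?M * (\<Sum>y\<in>desc x m. (cmod (?f y - ?g x))\<^sup>2))"
    unfolding sum_vsphere_desc sum_distrib_left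
    by (intro sum.cong refl) (auto simp: desc_iff)
  also have "\<dots> = energy \<mu> (n + m) - energy \<mu> n"
    unfolding energy_def sum_vsphere_desc sum_distrib_left[of "level_mass (n + m)"] sum_distrib_left[of "level_mass n"] sum_subtractf[symmetric]
    by (rule sum.cong[OF refl]) (rule blk[unfolded sum_distrib_left])
  finally show ?thesis .
qed

lemma level_mass_card: "level_mass n * real (card (vsphere v0 n)) = 1"
  using integral_level[of "\<lambda>_. 1 :: real" n] by (simp add: prob_space)

lemma energy_mono: "additive \<mu> \<Longrightarrow> n \<le> m \<Longrightarrow> energy \<mu> n \<le> energy \<mu> m"
proof -
  assume \<mu>: "additive \<mu>" and "n \<le> m"
  then obtain k where k: "m = n + k" using le_Suc_ex by blast
  have "0 \<le> energy \<mu> (n + k) - energy \<mu> n"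
    unfolding level_density_increment[OF \<mu>, symmetric]
    using level_mass_pos[of "n + k"] by (intro mult_nonneg_nonneg sum_nonneg) auto
  then show ?thesis by (simp add: k)
qed

text \<open>Cauchy and Schwarz in the form \<open>2 * c * s \<le> c\<^sup>2 + s\<^sup>2\<close>.\<close>

lemma l1_increment:
  assumes \<mu>: "additive \<mu>" and nm: "n \<le> m" and c: "0 < c" and en: "energy \<mu> m - energy \<mu> n \<le> c\<^sup>2"
  shows "(LINT \<omega>|\<nu>. cmod (level_density \<mu> m (\<omega> m) - level_density \<mu> n (\<omega> n))) \<le> c"
proof -
  obtain k where k: "m = n + k" using nm le_Suc_ex by blast
  define \<psi> where "\<psi> = (\<lambda>y. cmod (level_density \<mu> m y - level_density \<mu> n ((parent ^^ k) y)))"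
  have "(LINT \<omega>|\<nu>. cmod (level_density \<mu> m (\<omega> m) - level_density \<mu> n (\<omega> n))) = (LINT \<omega>|\<nu>. \<psi> (\<omega> m))"
    by (rule Bochner_Integration.integral_cong) (auto simp: space_nu \<psi>_def k boundary_funpow_parent)
  also have "\<dots> = level_mass m * (\<Sum>y\<in>vsphere v0 m. \<psi> y)" using integral_level[of \<psi> m] by simp
  also have "\<dots> \<le> level_mass m * (\<Sum>y\<in>vsphere v0 m. c / 2 + (\<psi> y)\<^sup>2 / (2 * c))"
  proof (intro mult_left_mono sum_mono)
    fix y
    have "0 \<le> (\<psi> y - c)\<^sup>2" by simp
    then have "2 * c * \<psi> y \<le> c\<^sup>2 + (\<psi> y)\<^sup>2" by (simp add: power2_diff mult_ac)
    then have "\<psi> y \<le> (c\<^sup>2 + (\<psi> y)\<^sup>2) / (2 * c)" using c by (simp add: pos_le_divide_eq mult_ac)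
    also have "\<dots> = c / 2 + (\<psi> y)\<^sup>2 / (2 * c)" using c by (simp add: add_divide_distrib power2_eq_square)
    finally show "\<psi> y \<le> c / 2 + (\<psi> y)\<^sup>2 / (2 * c)" .
  qed (use level_mass_pos[of m] in simp)
  also have "\<dots> = (level_mass m * real (card (vsphere v0 m))) * (c / 2)
      + (level_mass m * (\<Sum>y\<in>vsphere v0 m. (\<psi> y)\<^sup>2)) / (2 * c)"
    unfolding sum.distrib sum_divide_distrib[symmetric] sum_constant by (simp add: distrib_left)
  also have "level_mass m * (\<Sum>y\<in>vsphere v0 m. (\<psi> y)\<^sup>2) = energy \<mu> m - energy \<mu> n"
    using level_density_increment[OF \<mu>, of n k] by (simp only: \<psi>_def k)
  also have "level_mass m * real (card (vsphere v0 m)) * (c / 2) + (energy \<mu> m - energy \<mu> n) / (2 * c) \<le> c / 2 + c\<^sup>2 / (2 * c)"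
    unfolding level_mass_card using en c by (intro add_mono divide_right_mono) auto
  also have "\<dots> = c" using c by (simp add: power2_eq_square)
  finally show ?thesis .
qed

text \<open>Energies increase to a finite limit, so a subsequence of the densities has increments of \<open>L\<^sup>1\<close> norm at most
  \<open>(1 / 2) ^ k\<close>. Along it the densities converge almost everywhere and in \<open>L\<^sup>1\<close>, hence the integrals over cylinders
  converge too; these are constant from the level of the cylinder on. The levels are kept positive because the
  mass of the whole space does not follow the formula for the other levels.\<close>

lemma l2_bounded_limit:
  assumes \<mu>: "additive \<mu>" and B: "\<And>n. energy \<mu> n \<le> B"
  shows "\<exists>F r. integrable \<nu> F \<and> (AE \<omega> in \<nu>. (\<lambda>k. level_density \<mu> (r k) (\<omega> (r k))) \<longlonglongrightarrow> F \<omega>) \<and>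
     (\<forall>k. (1::nat) \<le> r k) \<and> (\<forall>x. (LINT \<omega>|\<nu>. indicat_real (cylinder E v0 x) \<omega> *\<^sub>R F \<omega>) = \<mu> x)"
proof -
  have inc: "incseq (energy \<mu>)" using energy_mono[OF \<mu>] by (simp add: incseq_def)
  obtain L where L: "energy \<mu> \<longlonglongrightarrow> L" "\<forall>n. energy \<mu> n \<le> L"
    using incseq_convergent[OF inc, of B] B by blast
  have "\<exists>N. \<forall>n\<ge>N. L - energy \<mu> n < (1 / 4) ^ k" for k :: nat
  proof -
    have "(0::real) < (1 / 4) ^ k" by simp
    then obtain N where "\<forall>n\<ge>N. norm (energy \<mu> n - L) < (1 / 4) ^ k" using LIMSEQ_D[OF L(1)] by blast
    then have "\<forall>n\<ge>N. L - energy \<mu> n < (1 / 4) ^ k" by (auto simp: abs_less_iff)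
    then show ?thesis by blast
  qed
  then obtain N where N: "\<And>k n. N k \<le> n \<Longrightarrow> L - energy \<mu> n < (1 / 4) ^ k" by metis
  define r where "r = (\<lambda>k. Suc (k + (\<Sum>i\<le>k. N i)))"
  have r1: "1 \<le> r k" "k \<le> r k" "r k \<le> r (Suc k)" for k by (auto simp: r_def)
  have rN: "N k \<le> r k" for k
    using member_le_sum[of k "{..k}" N] by (simp add: r_def)
  let ?f = "\<lambda>n \<omega>. level_density \<mu> n (\<omega> n)"
  define \<Delta> where "\<Delta> = (\<lambda>k \<omega>. ?f (r (Suc k)) \<omega> - ?f (r k) \<omega>)"
  have int_f: "integrable \<nu> (?f n)" for n by (rule integrable_level)
  have int_\<Delta>: "integrable \<nu> (\<Delta> k)" for k unfolding \<Delta>_def by (intro Bochner_Integration.integrable_diff int_f)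
  have \<Delta>1: "(LINT \<omega>|\<nu>. norm (\<Delta> k \<omega>)) \<le> (1 / 2) ^ k" for k
    unfolding \<Delta>_def
  proof (rule l1_increment[OF \<mu> r1(3)])
    have "energy \<mu> (r (Suc k)) - energy \<mu> (r k) \<le> (1 / 4) ^ k" using N[OF rN[of k]] L(2) by (smt (verit))
    also have "(1 / 4 :: real) ^ k = ((1 / 2) ^ k)\<^sup>2" by (simp add: power_mult_distrib[symmetric] power2_eq_square)
    finally show "energy \<mu> (r (Suc k)) - energy \<mu> (r k) \<le> ((1 / 2) ^ k)\<^sup>2" .
  qed simp
  have sum\<Delta>: "summable (\<lambda>k. (LINT \<omega>|\<nu>. norm (\<Delta> k \<omega>)))"
    by (rule summable_comparison_test'[of "\<lambda>k. (1 / 2) ^ k" 0]) (use \<Delta>1 in \<open>auto intro: summable_geometric\<close>)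
  have AEs: "AE \<omega> in \<nu>. summable (\<lambda>k. norm (\<Delta> k \<omega>))"
  proof -
    have meas: "(\<lambda>\<omega>. ennreal (norm (\<Delta> k \<omega>))) \<in> borel_measurable \<nu>" for k
      using borel_measurable_integrable[OF int_\<Delta>[of k]] by measurable
    have "(\<integral>\<^sup>+\<omega>. (\<Sum>k. ennreal (norm (\<Delta> k \<omega>))) \<partial>\<nu>) = (\<Sum>k. \<integral>\<^sup>+\<omega>. ennreal (norm (\<Delta> k \<omega>)) \<partial>\<nu>)"
      by (rule nn_integral_suminf[OF meas])
    also have "\<dots> = (\<Sum>k. ennreal (LINT \<omega>|\<nu>. norm (\<Delta> k \<omega>)))"
      by (intro suminf_cong nn_integral_eq_integral integrable_norm int_\<Delta>) auto
    also have "\<dots> = ennreal (\<Sum>k. (LINT \<omega>|\<nu>. norm (\<Delta> k \<omega>)))"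
      by (rule suminf_ennreal2[OF _ sum\<Delta>]) simp
    finally have "(\<integral>\<^sup>+\<omega>. (\<Sum>k. ennreal (norm (\<Delta> k \<omega>))) \<partial>\<nu>) \<noteq> \<infinity>" by simp
    then have "AE \<omega> in \<nu>. (\<Sum>k. ennreal (norm (\<Delta> k \<omega>))) \<noteq> \<infinity>"
      by (intro nn_integral_PInf_AE borel_measurable_suminf_order meas)
    then show ?thesis by eventually_elim (rule summable_suminf_not_top, auto)
  qed
  define F where "F = (\<lambda>\<omega>. ?f (r 0) \<omega> + (\<Sum>k. \<Delta> k \<omega>))"
  have int_F: "integrable \<nu> F" unfolding F_def
    by (intro Bochner_Integration.integrable_add int_f integrable_suminf[OF int_\<Delta> AEs sum\<Delta>])
  have tele: "(\<Sum>k<n. \<Delta> k \<omega>) = ?f (r n) \<omega> - ?f (r 0) \<omega>" for n \<omega>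
    unfolding \<Delta>_def by (rule sum_lessThan_telescope[where f = "\<lambda>k. ?f (r k) \<omega>"])
  have lim: "AE \<omega> in \<nu>. (\<lambda>k. ?f (r k) \<omega>) \<longlonglongrightarrow> F \<omega>"
    using AEs
  proof eventually_elim
    case (elim \<omega>)
    have "(\<lambda>k. \<Delta> k \<omega>) sums (\<Sum>k. \<Delta> k \<omega>)" by (rule summable_sums[OF summable_norm_cancel[OF elim]])
    then have it: "(\<lambda>n. ?f (r n) \<omega> - ?f (r 0) \<omega>) \<longlonglongrightarrow> (\<Sum>k. \<Delta> k \<omega>)"
      unfolding sums_def tele .
    have "(\<lambda>n. ?f (r 0) \<omega> + (?f (r n) \<omega> - ?f (r 0) \<omega>)) \<longlonglongrightarrow> ?f (r 0) \<omega> + (\<Sum>k. \<Delta> k \<omega>)"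
      by (rule tendsto_add[OF tendsto_const it])
    then show ?case by (simp add: F_def)
  qed
  have cyl: "(LINT \<omega>|\<nu>. indicat_real (cylinder E v0 x) \<omega> *\<^sub>R F \<omega>) = \<mu> x" for x
  proof -
    let ?i = "indicat_real (cylinder E v0 x)"
    define I where "I = (\<lambda>n. (LINT \<omega>|\<nu>. ?i \<omega> *\<^sub>R ?f n \<omega>))"
    have int_if: "integrable \<nu> (\<lambda>\<omega>. ?i \<omega> *\<^sub>R ?f n \<omega>)" for n by (rule integrable_mult_indicator[OF sets_cylinder int_f])
    have int_i: "integrable \<nu> (\<lambda>\<omega>. ?i \<omega> *\<^sub>R \<Delta> k \<omega>)" for k by (rule integrable_mult_indicator[OF sets_cylinder int_\<Delta>])
    have le: "norm (?i \<omega> *\<^sub>R \<Delta> k \<omega>) \<le> norm (\<Delta> k \<omega>)" for k \<omega> by (simp add: indicator_def)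
    have AEi: "AE \<omega> in \<nu>. summable (\<lambda>k. norm (?i \<omega> *\<^sub>R \<Delta> k \<omega>))"
      using AEs by eventually_elim (rule summable_comparison_test'[of _ 0], assumption, use le in simp)
    have sumi: "summable (\<lambda>k. (LINT \<omega>|\<nu>. norm (?i \<omega> *\<^sub>R \<Delta> k \<omega>)))"
    proof (rule summable_comparison_test'[OF sum\<Delta>, of 0])
      fix k :: nat
      have "(LINT \<omega>|\<nu>. norm (?i \<omega> *\<^sub>R \<Delta> k \<omega>)) \<le> (LINT \<omega>|\<nu>. norm (\<Delta> k \<omega>))"
        by (intro integral_mono integrable_norm int_i int_\<Delta> le)
      then show "norm (LINT \<omega>|\<nu>. norm (?i \<omega> *\<^sub>R \<Delta> k \<omega>)) \<le> (LINT \<omega>|\<nu>. norm (\<Delta> k \<omega>))" by simp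
    qed
    have Ik: "(LINT \<omega>|\<nu>. ?i \<omega> *\<^sub>R \<Delta> k \<omega>) = I (r (Suc k)) - I (r k)" for k
      unfolding I_def \<Delta>_def scaleR_diff_right by (rule Bochner_Integration.integral_diff[OF int_if int_if])
    have "(\<lambda>k. I (r (Suc k)) - I (r k)) sums (LINT \<omega>|\<nu>. (\<Sum>k. ?i \<omega> *\<^sub>R \<Delta> k \<omega>))"
      using sums_integral[OF int_i AEi sumi] unfolding Ik .
    then have "(\<lambda>n. I (r n) - I (r 0)) \<longlonglongrightarrow> (LINT \<omega>|\<nu>. (\<Sum>k. ?i \<omega> *\<^sub>R \<Delta> k \<omega>))"
      unfolding sums_def sum_lessThan_telescope[where f = "\<lambda>k. I (r k)"] .
    moreover have "(\<lambda>n. I (r n) - I (r 0)) \<longlonglongrightarrow> \<mu> x - I (r 0)"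
    proof (rule tendsto_eventually, rule eventually_sequentiallyI[of "lvl x"])
      fix n assume "lvl x \<le> n"
      then have "lvl x \<le> r n" using r1(2)[of n] by linarith
      then show "I (r n) - I (r 0) = \<mu> x - I (r 0)" unfolding I_def by (simp only: integral_level_density_cylinder[OF \<mu>])
    qed
    ultimately have S: "(LINT \<omega>|\<nu>. (\<Sum>k. ?i \<omega> *\<^sub>R \<Delta> k \<omega>)) = \<mu> x - I (r 0)" by (rule LIMSEQ_unique)
    have "?i \<omega> *\<^sub>R F \<omega> = ?i \<omega> *\<^sub>R ?f (r 0) \<omega> + (\<Sum>k. ?i \<omega> *\<^sub>R \<Delta> k \<omega>)" for \<omega>
      by (cases "\<omega> \<in> cylinder E v0 x") (simp_all add: F_def)
    then have "(LINT \<omega>|\<nu>. ?i \<omega> *\<^sub>R F \<omega>) = I (r 0) + (LINT \<omega>|\<nu>. (\<Sum>k. ?i \<omega> *\<^sub>R \<Delta> k \<omega>))"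
      unfolding I_def by (simp only: Bochner_Integration.integral_add[OF int_if integrable_suminf[OF int_i AEi sumi]])
    then show ?thesis unfolding S by simp
  qed
  show ?thesis using int_F lim r1(1) cyl by blast
qed

text \<open>Since \<open>x\<^sup>2 \<le> 1 + x powr r\<close> and \<open>\<nu>\<close> has total mass \<open>1\<close>.\<close>

lemma energy_le_of_moment:
  assumes r: "2 \<le> r" and bd: "level_mass n * (\<Sum>y\<in>vsphere v0 n. cmod (level_density \<mu> n y) powr r) \<le> B"
  shows "energy \<mu> n \<le> 1 + B"
proof -
  have le: "x\<^sup>2 \<le> 1 + x powr r" if "0 \<le> x" for x :: real
  proof (cases "x \<le> 1")
    case True
    then have "x\<^sup>2 \<le> 1" using that by (simp add: power_le_one)
    then show ?thesis by (simp add: add_increasing2)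
  next
    case False
    then have "x powr 2 \<le> x powr r" using r by (intro powr_mono) auto
    then show ?thesis using False by (simp add: powr_numeral)
  qed
  have "energy \<mu> n \<le> level_mass n * (\<Sum>y\<in>vsphere v0 n. 1 + cmod (level_density \<mu> n y) powr r)"
    unfolding energy_def using level_mass_pos[of n] le by (intro mult_left_mono sum_mono) auto
  also have "\<dots> = level_mass n * real (card (vsphere v0 n)) + level_mass n * (\<Sum>y\<in>vsphere v0 n. cmod (level_density \<mu> n y) powr r)"
    by (simp add: sum.distrib distrib_left)
  finally show ?thesis using bd level_mass_card[of n] by linarith
qed

text \<open>Fatou's lemma.\<close>

lemma Lr_limit:
  assumes r: "0 < r" and F: "integrable \<nu> F"
    and lim: "AE \<omega> in \<nu>. (\<lambda>k. level_density \<mu> (\<sigma> k) (\<omega> (\<sigma> k))) \<longlonglongrightarrow> F \<omega>"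
    and bd: "\<And>k. level_mass (\<sigma> k) * (\<Sum>y\<in>vsphere v0 (\<sigma> k). cmod (level_density \<mu> (\<sigma> k) y) powr r) \<le> B"
  shows "integrable \<nu> (\<lambda>\<omega>. cmod (F \<omega>) powr r)"
proof (rule integrableI_nonneg)
  let ?f = "\<lambda>k \<omega>. cmod (level_density \<mu> (\<sigma> k) (\<omega> (\<sigma> k))) powr r"
  have Fm: "F \<in> borel_measurable \<nu>" using F by (rule borel_measurable_integrable)
  then show "(\<lambda>\<omega>. cmod (F \<omega>) powr r) \<in> borel_measurable \<nu>" by measurable
  have int: "integrable \<nu> (?f k)" for k by (rule integrable_level[where \<phi> = "\<lambda>y. cmod (level_density \<mu> (\<sigma> k) y) powr r"])
  have fm: "(\<lambda>\<omega>. ennreal (?f k \<omega>)) \<in> borel_measurable \<nu>" for k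
    using borel_measurable_integrable[OF int[of k]] by measurable
  have le: "(\<integral>\<^sup>+\<omega>. ennreal (?f k \<omega>) \<partial>\<nu>) \<le> ennreal B" for k
  proof -
    have "(\<integral>\<^sup>+\<omega>. ennreal (?f k \<omega>) \<partial>\<nu>) = ennreal (LINT \<omega>|\<nu>. ?f k \<omega>)"
      by (rule nn_integral_eq_integral[OF int]) simp
    also have "(LINT \<omega>|\<nu>. ?f k \<omega>) \<le> B"
      using integral_level[of "\<lambda>y. cmod (level_density \<mu> (\<sigma> k) y) powr r" "\<sigma> k"] bd[of k] by simp
    finally show ?thesis by (simp add: ennreal_leI)
  qed
  have "(\<integral>\<^sup>+\<omega>. ennreal (cmod (F \<omega>) powr r) \<partial>\<nu>) = (\<integral>\<^sup>+\<omega>. liminf (\<lambda>k. ennreal (?f k \<omega>)) \<partial>\<nu>)"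
  proof (rule nn_integral_cong_AE)
    show "AE \<omega> in \<nu>. ennreal (cmod (F \<omega>) powr r) = liminf (\<lambda>k. ennreal (?f k \<omega>))"
      using lim
    proof eventually_elim
      case (elim \<omega>)
      have "(\<lambda>k. ?f k \<omega>) \<longlonglongrightarrow> cmod (F \<omega>) powr r"
        by (rule tendsto_powr2[OF tendsto_norm[OF elim] tendsto_const]) (use r in auto)
      then have "(\<lambda>k. ennreal (?f k \<omega>)) \<longlonglongrightarrow> ennreal (cmod (F \<omega>) powr r)" by (rule tendsto_ennrealI)
      from lim_imp_Liminf[OF trivial_limit_sequentially this] show ?case by (rule sym)
    qed
  qed
  also have "\<dots> \<le> liminf (\<lambda>k. \<integral>\<^sup>+\<omega>. ennreal (?f k \<omega>) \<partial>\<nu>)"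
    by (rule nn_integral_liminf[OF fm])
  also have "\<dots> \<le> ennreal B"
    by (rule order_trans[OF Liminf_le_Limsup Limsup_bounded]) (use le in auto)
  also have "\<dots> < \<infinity>" by simp
  finally show "(\<integral>\<^sup>+\<omega>. ennreal (cmod (F \<omega>) powr r) \<partial>\<nu>) < \<infinity>" .
qed auto

end

section \<open>Eigenfunctions as Poisson transforms\<close>

context tree_boundary
begin

text \<open>The Poisson transform recovers its boundary measure from the difference between a vertex and its parent, by
  \<open>poisson_transform_step\<close> read backwards.\<close>

definition eigen_measure :: "complex \<Rightarrow> ('v \<Rightarrow> complex) \<Rightarrow> 'v \<Rightarrow> complex" where
  "eigen_measure Q g x =
     (if x = v0 then g v0 else (g x - g (parent x) / Q) / (Q ^ lvl x * (1 - 1 / Q\<^sup>2)))"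

text \<open>Summing the eigenvalue equation over the children of \<open>x\<close>; the constants cancel because \<open>Q + q / Q\<close> is the eigenvalue of
  the neighbour sum.\<close>

lemma additive_eigen_measure:
  assumes Q: "Q \<noteq> 0" "Q\<^sup>2 \<noteq> 1"
    and eig: "\<And>x. (\<Sum>y | E x y. g y) = (Q + of_nat q / Q) * g x"
  shows "additive (eigen_measure Q g)"
  unfolding additive_def
proof
  fix x
  have c0: "1 - 1 / Q\<^sup>2 \<noteq> 0" using Q by simp
  define D where "D = Q ^ lvl x * (1 - 1 / Q\<^sup>2)"
  have D0: "D \<noteq> 0" using Q(1) c0 by (simp add: D_def)
  have "(\<Sum>y\<in>children x. eigen_measure Q g y) = (\<Sum>y\<in>children x. (g y - g x / Q) / (Q * D))"
  proof (rule sum.cong[OF refl])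
    fix y assume y: "y \<in> children x"
    then have y1: "y \<noteq> v0" "parent y = x" by (simp_all add: children_iff)
    have "lvl y = Suc (lvl x)" using y by (simp add: children_def)
    with y1 show "eigen_measure Q g y = (g y - g x / Q) / (Q * D)"
      by (simp add: eigen_measure_def D_def mult.assoc)
  qed
  also have "\<dots> = ((\<Sum>y\<in>children x. g y) - of_nat (card (children x)) * (g x / Q)) / (Q * D)"
    by (simp add: sum_divide_distrib[symmetric] sum_subtractf)
  also have "\<dots> = eigen_measure Q g x"
  proof (cases "x = v0")
    case True
    have S: "(\<Sum>y\<in>children x. g y) = (Q + of_nat q / Q) * g x" using eig[of x] neighbours_eq[of x] True by simp
    have "(Q + of_nat q / Q) * g x - of_nat (q + 1) * (g x / Q) = (Q * D) * g x"
      using Q(1) True by (simp add: D_def field_simps power2_eq_square)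
    then show ?thesis using True Q(1) D0 S card_children[of x] by (simp add: eigen_measure_def)
  next
    case False
    have "(\<Sum>y | E x y. g y) = g (parent x) + (\<Sum>y\<in>children x. g y)"
      using neighbours_eq[of x] False parent_notin_children[OF False] by simp
    then have S: "(\<Sum>y\<in>children x. g y) = (Q + of_nat q / Q) * g x - g (parent x)" using eig[of x] by simp
    have "(Q + of_nat q / Q) * g x - g (parent x) - of_nat q * (g x / Q) = Q * (g x - g (parent x) / Q)"
      using Q(1) by (simp add: algebra_simps)
    then have "((\<Sum>y\<in>children x. g y) - of_nat (card (children x)) * (g x / Q)) / (Q * D) = (g x - g (parent x) / Q) / D"
      using False Q(1) S card_children[of x] by simp
    then show ?thesis using False by (simp add: eigen_measure_def D_def)
  qed
  finally show "(\<Sum>y\<in>children x. eigen_measure Q g y) = eigen_measure Q g x" .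
qed

lemma poisson_transform_eigen_measure:
  fixes z :: complex
  defines "Q \<equiv> of_nat q powr (1 / 2 + \<i> * z)"
  assumes Q: "Q\<^sup>2 \<noteq> 1" and F: "integrable \<nu> F"
    and cyl: "\<And>x. (LINT \<omega>|\<nu>. indicat_real (cylinder E v0 x) \<omega> *\<^sub>R F \<omega>) = eigen_measure Q g x"
  shows "poisson_transform q E v0 \<nu> z F x = g x"
proof (induction "lvl x" arbitrary: x)
  case 0
  have "(LINT \<omega>|\<nu>. F \<omega>) = (LINT \<omega>|\<nu>. indicat_real (cylinder E v0 v0) \<omega> *\<^sub>R F \<omega>)"
    by (rule Bochner_Integration.integral_cong) (auto simp: cylinder_root)
  moreover have "eigen_measure Q g v0 = g v0" by (simp add: eigen_measure_def)
  moreover have "x = v0" using 0 by simp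
  ultimately show ?case using cyl[of v0] poisson_transform_root[of z F] by metis
next
  case (Suc n)
  then have x: "x \<noteq> v0" by auto
  have Q0: "Q \<noteq> 0" unfolding Q_def by (rule base_nonzero)
  have c0: "1 - 1 / Q\<^sup>2 \<noteq> 0" using Q Q0 by simp
  have IH: "poisson_transform q E v0 \<nu> z F (parent x) = g (parent x)"
    using Suc(1)[of "parent x"] Suc(2) parent(2)[OF x] by simp
  have "Q powi (int (lvl x) - 2) = Q powi int (lvl x) / Q\<^sup>2" using Q0 by (simp add: power_int_diff)
  then have W: "Q powi int (lvl x) - Q powi (int (lvl x) - 2) = Q ^ lvl x * (1 - 1 / Q\<^sup>2)"
    by (simp add: right_diff_distrib)
  have "poisson_transform q E v0 \<nu> z F x = g (parent x) / Q + (Q ^ lvl x * (1 - 1 / Q\<^sup>2)) * eigen_measure Q g x"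
    using poisson_transform_step[OF F x, of z] unfolding Q_def[symmetric] IH W cyl .
  also have "(Q ^ lvl x * (1 - 1 / Q\<^sup>2)) * eigen_measure Q g x = g x - g (parent x) / Q"
    using x Q0 c0 by (simp add: eigen_measure_def)
  finally show ?case by simp
qed

lemma marcinkiewicz_parent_difference:
  assumes p: "1 \<le> p" and g: "marcinkiewicz p C g"
  shows "\<exists>C. marcinkiewicz p C (\<lambda>x. g x - g (parent x) / Q)"
proof -
  have sub: "{x. parent x = y} \<subseteq> insert v0 (children y)" for y by (auto simp: children_iff)
  have "card {x. parent x = y} \<le> q + 2" for y
  proof -
    have "card {x. parent x = y} \<le> card (insert v0 (children y))" by (rule card_mono[OF _ sub]) simp
    also have "\<dots> \<le> Suc (card (children y))" by (simp add: card_insert_if)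
    also have "\<dots> \<le> q + 2" by (simp add: card_children)
    finally show ?thesis .
  qed
  then have "marcinkiewicz p (real (q + 2) * C) (\<lambda>x. g (parent x))"
    by (intro marcinkiewicz_comp[OF g p] finite_subset[OF sub]) auto
  from marcinkiewicz_add[OF g marcinkiewicz_cmult[OF this, of "- 1 / Q"]]
  show ?thesis by auto
qed

text \<open>The key estimate. For a vertex \<open>y\<close> of level \<open>N\<close> put \<open>a y = q ^ N * cmod (\<mu> y)\<close>. By additivity the descendants of \<open>y\<close> at
  level \<open>n\<close> have total mass at least \<open>cmod (\<mu> y)\<close>, so \<open>k\<close> has average at least \<open>c * a y * q powr (- n / r)\<close> on them. Choosing
  for every \<open>y\<close> the last level \<open>n y\<close> at which this is at least \<open>c * \<tau>\<close> makes the number of these descendants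
  comparable to \<open>q powr (- N) * (a y / \<tau>) powr r\<close>. On the union of the chosen sets the average of \<open>k\<close> is at least \<open>c * \<tau>\<close>, and the
  weak-type bound limits its size; this is the bound on the sum of \<open>a y powr r\<close>.\<close>

lemma moment_bound:
  assumes p: "1 < p" and \<mu>: "additive \<mu>" and N: "1 \<le> N"
    and k: "marcinkiewicz p C k" and c: "0 < c"
    and le: "\<And>x. x \<noteq> v0 \<Longrightarrow> c * real q powr (real (lvl x) / p) * cmod (\<mu> x) \<le> cmod (k x)"
  defines "r \<equiv> p / (p - 1)"
  shows "(\<Sum>y\<in>vsphere v0 N. (real q ^ N * cmod (\<mu> y)) powr r) \<le> real q ^ N * (real q * (C / c) powr r)"
proof -
  define a where "a = (\<lambda>y. real q ^ N * cmod (\<mu> y))"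
  define Y where "Y = {y \<in> vsphere v0 N. \<mu> y \<noteq> 0}"
  have r: "0 < r" "1 / p + 1 / r = 1" using p by (simp_all add: r_def field_simps)
  have q1: "1 < real q" and q0: "0 < real q" using q2 by simp_all
  have finY: "finite Y" unfolding Y_def by simp
  have apos: "0 < a y" if "y \<in> Y" for y using that q0 by (simp add: a_def Y_def)
  have lvlY: "lvl y = N" if "y \<in> Y" for y using that by (simp add: Y_def vsphere_def)
  have C0: "0 \<le> C" by (rule marcinkiewicz_nonneg[OF k])
  have red: "(\<Sum>y\<in>vsphere v0 N. a y powr r) = (\<Sum>y\<in>Y. a y powr r)"
    by (rule sum.mono_neutral_right) (auto simp: Y_def a_def)
  show ?thesis
  proof (cases "Y = {}")
    case True
    then show ?thesis using red q0 by (simp add: a_def)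
  next
    case False
    \<comment> \<open>The threshold is chosen so low that every vertex of \<open>Y\<close> may keep at least its own level.\<close>
    define \<tau> where "\<tau> = Min (a ` Y) / real q powr (real N / r)"
    have "0 < Min (a ` Y)" using finY False apos by (subst Min_gr_iff) auto
    then have \<tau>0: "0 < \<tau>" using q0 by (simp add: \<tau>_def)
    have \<tau>le: "real q powr (real N / r) \<le> a y / \<tau>" if "y \<in> Y" for y
    proof -
      have "Min (a ` Y) \<le> a y" using finY that by simp
      then have "real q powr (real N / r) * \<tau> \<le> a y" using q0 by (simp add: \<tau>_def)
      then show ?thesis using \<tau>0 by (simp add: pos_le_divide_eq)
    qed
    define u where "u = (\<lambda>y. r * log (real q) (a y / \<tau>))"
    \<comment> \<open>The last level at which the lower bound for the average of \<open>k\<close> over the descendants of \<open>y\<close>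
      is still at least \<open>c * \<tau>\<close>.\<close>
    define n where "n = (\<lambda>y. nat \<lfloor>u y\<rfloor>)"
    have u: "real q powr (u y / r) = a y / \<tau>" "real q powr u y = (a y / \<tau>) powr r" if "y \<in> Y" for y
    proof -
      have pos: "0 < a y / \<tau>" using apos[OF that] \<tau>0 by simp
      have "u y / r = log (real q) (a y / \<tau>)" using r(1) by (simp add: u_def)
      then show e: "real q powr (u y / r) = a y / \<tau>" using powr_log_cancel[OF q0 _ pos] q1 by simp
      have "real q powr u y = (real q powr (u y / r)) powr r" using r(1) by (simp add: powr_powr)
      then show "real q powr u y = (a y / \<tau>) powr r" unfolding e .
    qed
    have uN: "real N \<le> u y" if "y \<in> Y" for y
    proof -
      have "real q powr (real N / r) \<le> real q powr (u y / r)" using \<tau>le[OF that] u(1)[OF that] by simp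
      then have "real N / r \<le> u y / r" using powr_le_cancel_iff[OF q1] by blast
      then show ?thesis using r(1) by (simp add: divide_le_cancel)
    qed
    have n: "N \<le> n y" "real (n y) \<le> u y" "u y \<le> real (n y) + 1" if "y \<in> Y" for y
    proof -
      have u0: "0 \<le> u y" using uN[OF that] by linarith
      show "N \<le> n y" unfolding n_def using uN[OF that] by (simp add: le_nat_floor)
      show "real (n y) \<le> u y" "u y \<le> real (n y) + 1" unfolding n_def using u0 by linarith+
    qed
    define D where "D = (\<lambda>y. desc y (n y - N))"
    define S where "S = (\<Union>y\<in>Y. D y)"
    have lvlD: "lvl x = n y" if "y \<in> Y" "x \<in> D y" for x y
      using that n(1)[OF that(1)] lvlY[OF that(1)] by (simp add: D_def desc_iff)
    have disj: "\<forall>y\<in>Y. \<forall>y'\<in>Y. y \<noteq> y' \<longrightarrow> D y \<inter> D y' = {}"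
    proof (intro ballI impI)
      fix y y' assume y: "y \<in> Y" "y' \<in> Y" "y \<noteq> y'"
      show "D y \<inter> D y' = {}"
      proof (rule ccontr)
        assume "D y \<inter> D y' \<noteq> {}"
        then obtain x where x: "x \<in> D y" "x \<in> D y'" by blast
        then have "n y = n y'" using lvlD y(1,2) by metis
        then show False using x y(3) by (simp add: D_def desc_iff)
      qed
    qed
    have cardD: "real (card (D y)) = real q ^ (n y - N)" if "y \<in> Y" for y
      using card_desc[of y] lvlY[OF that] N by (simp add: D_def)
    have cardS: "real (card S) = (\<Sum>y\<in>Y. real q ^ (n y - N))"
    proof -
      have "card S = (\<Sum>y\<in>Y. card (D y))" unfolding S_def by (rule card_UN_disjoint[OF finY _ disj]) (simp add: D_def)
      then show ?thesis using cardD by simp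
    qed
    have block: "c * \<tau> * real q ^ (n y - N) \<le> (\<Sum>x\<in>D y. cmod (k x))" if y: "y \<in> Y" for y
    proof -
      have "real q powr (real (n y) / r) \<le> a y / \<tau>"
        unfolding u(1)[OF y, symmetric] using q1 n(2)[OF y] r(1) by (intro powr_mono divide_right_mono) auto
      then have "\<tau> * real q powr (real (n y) / r) \<le> a y" using \<tau>0 by (simp add: pos_le_divide_eq mult.commute)
      then have "c * real q powr (real (n y) / p) * (\<tau> * real q powr (real (n y) / r))
          \<le> c * real q powr (real (n y) / p) * a y"
        using c q0 by (intro mult_left_mono) auto
      moreover have "real q powr (real (n y) / p) * real q powr (real (n y) / r) = real q ^ n y"
      proof -
        have "real (n y) / p + real (n y) / r = real (n y) * (1 / p + 1 / r)" by (simp add: distrib_left)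
        then have e: "real (n y) / p + real (n y) / r = real (n y)" by (simp only: r(2) mult_1_right)
        show ?thesis unfolding powr_add[symmetric] e using q0 by (simp add: powr_realpow)
      qed
      moreover have "real q ^ n y = real q ^ N * real q ^ (n y - N)"
        using n(1)[OF y] by (simp add: power_add[symmetric])
      ultimately have "real q ^ N * (c * \<tau> * real q ^ (n y - N)) \<le> real q ^ N * (c * real q powr (real (n y) / p) * cmod (\<mu> y))"
        by (simp add: a_def mult_ac)
      then have "c * \<tau> * real q ^ (n y - N) \<le> c * real q powr (real (n y) / p) * cmod (\<mu> y)"
        using q0 by (simp add: mult_le_cancel_left)
      also have "cmod (\<mu> y) = cmod (\<Sum>x\<in>D y. \<mu> x)" unfolding D_def additive_desc[OF \<mu>] ..
      also have "c * real q powr (real (n y) / p) * \<dots> \<le> c * real q powr (real (n y) / p) * (\<Sum>x\<in>D y. cmod (\<mu> x))"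
        using c by (intro mult_left_mono norm_sum) auto
      also have "\<dots> = (\<Sum>x\<in>D y. c * real q powr (real (lvl x) / p) * cmod (\<mu> x))"
        unfolding sum_distrib_left by (intro sum.cong refl) (simp add: lvlD[OF y])
      also have "\<dots> \<le> (\<Sum>x\<in>D y. cmod (k x))"
      proof (rule sum_mono)
        fix x assume "x \<in> D y"
        then have "1 \<le> lvl x" using lvlD[OF y] n(1)[OF y] N by simp
        then have "x \<noteq> v0" by auto
        then show "c * real q powr (real (lvl x) / p) * cmod (\<mu> x) \<le> cmod (k x)" by (rule le)
      qed
      finally show ?thesis .
    qed
    define K where "K = real (card S)"
    have finS: "finite S" unfolding S_def D_def using finY by simp
    have K0: "0 < K" unfolding K_def cardS using finY False q0 by (intro sum_pos) auto
    have "c * \<tau> * K \<le> (\<Sum>y\<in>Y. \<Sum>x\<in>D y. cmod (k x))"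
      unfolding K_def cardS sum_distrib_left by (rule sum_mono[OF block])
    also have "\<dots> = (\<Sum>x\<in>S. cmod (k x))"
      unfolding S_def by (rule sum.UNION_disjoint[symmetric, OF finY _ disj]) (simp add: D_def)
    also have "\<dots> \<le> C * K powr (1 / p)" unfolding K_def by (rule marcinkiewiczD[OF k finS])
    finally have "(c * \<tau>) * (K powr (1 / r) * K powr (1 / p)) \<le> C * K powr (1 / p)"
      using K0 r(2) by (simp add: powr_add[symmetric] add.commute)
    then have "((c * \<tau>) * K powr (1 / r)) * K powr (1 / p) \<le> C * K powr (1 / p)" by (simp only: mult.assoc)
    then have "(c * \<tau>) * K powr (1 / r) \<le> C" using K0 by (simp add: mult_le_cancel_right)
    then have "K powr (1 / r) \<le> C / (c * \<tau>)" using c \<tau>0 by (simp add: pos_le_divide_eq mult.commute)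
    then have "(K powr (1 / r)) powr r \<le> (C / c / \<tau>) powr r" using r(1) by (intro powr_mono2) auto
    moreover have "(K powr (1 / r)) powr r = K" using K0 r(1) by (simp add: powr_powr)
    moreover have "(C / c / \<tau>) powr r = (C / c) powr r / \<tau> powr r"
      by (rule powr_divide)
    ultimately have KK: "K \<le> (C / c) powr r / \<tau> powr r" by linarith
    have "(\<Sum>y\<in>Y. a y powr r) = \<tau> powr r * (\<Sum>y\<in>Y. (a y / \<tau>) powr r)"
      unfolding sum_distrib_left using \<tau>0 apos by (intro sum.cong refl) (simp add: powr_divide less_imp_le)
    also have "\<dots> \<le> \<tau> powr r * (\<Sum>y\<in>Y. real q * real q ^ N * real q ^ (n y - N))"
    proof (intro mult_left_mono sum_mono)
      fix y assume y: "y \<in> Y"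
      have "(a y / \<tau>) powr r \<le> real q powr (real (n y) + 1)"
        unfolding u(2)[OF y, symmetric] using q1 n(3)[OF y] by (intro powr_mono) auto
      also have "\<dots> = real q ^ n y * real q" using q0 by (simp add: powr_add powr_realpow)
      also have "real q ^ n y = real q ^ N * real q ^ (n y - N)"
        using n(1)[OF y] by (simp add: power_add[symmetric])
      finally show "(a y / \<tau>) powr r \<le> real q * real q ^ N * real q ^ (n y - N)" by (simp only: mult_ac)
    qed simp
    also have "\<dots> = \<tau> powr r * (real q * real q ^ N * K)" unfolding K_def cardS sum_distrib_left ..
    also have "\<dots> \<le> \<tau> powr r * (real q * real q ^ N * ((C / c) powr r / \<tau> powr r))"
      using KK q0 by (intro mult_left_mono) auto
    also have "\<dots> = real q ^ N * (real q * (C / c) powr r)" using \<tau>0 by simp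
    finally show ?thesis unfolding red[symmetric] by (simp add: a_def)
  qed
qed

lemma level_density_le:
  assumes "1 \<le> n"
  shows "cmod (level_density \<mu> n y) \<le> 2 * (real q ^ n * cmod (\<mu> y))"
proof -
  have "cmod (level_density \<mu> n y) = (1 / level_mass n) * cmod (\<mu> y)"
    using level_mass_pos[of n] by (simp add: level_density_def norm_divide)
  also have "\<dots> \<le> 2 * real q ^ n * cmod (\<mu> y)"
    using level_mass_bounds(2)[OF assms] by (intro mult_right_mono) auto
  finally show ?thesis by (simp only: mult.assoc)
qed

text \<open>The energy at the root is at most the one at level \<open>1\<close>.\<close>

lemma energy_all_levels:
  assumes \<mu>: "additive \<mu>" and bd: "\<And>n. 1 \<le> n \<Longrightarrow> energy \<mu> n \<le> B"
  shows "energy \<mu> n \<le> B"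
  using bd[of n] bd[of 1] energy_mono[OF \<mu>, of 0 1] by (cases n) auto

text \<open>For \<open>p > 1\<close> the moment bound makes the densities bounded in \<open>L\<^sup>r\<close>, and \<open>r > 2\<close> gives bounded energies. For \<open>p = 1\<close> the
  hypothesis on single points already bounds the densities uniformly.\<close>

lemma density_of_additive:
  assumes p: "1 \<le> p" "p < 2" and \<mu>: "additive \<mu>"
    and k: "marcinkiewicz p C k" and c: "0 < c"
    and le: "\<And>x. x \<noteq> v0 \<Longrightarrow> c * real q powr (real (lvl x) / p) * cmod (\<mu> x) \<le> cmod (k x)"
  shows "\<exists>F\<in>Lr_space \<nu> (conj_exp p). integrable \<nu> F \<and>
      (\<forall>x. (LINT \<omega>|\<nu>. indicat_real (cylinder E v0 x) \<omega> *\<^sub>R F \<omega>) = \<mu> x)"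
proof (cases "p = 1")
  case True
  define K where "K = 2 * (C / c)"
  have den: "cmod (level_density \<mu> n y) \<le> K" if n: "1 \<le> n" "lvl y = n" for n y
  proof -
    have y: "y \<noteq> v0" using n by auto
    have "cmod (k y) \<le> C" using marcinkiewiczD[OF k, of "{y}"] by simp
    then have "c * real q powr real (lvl y) * cmod (\<mu> y) \<le> C" using le[OF y] True by simp
    then have "c * (real q ^ n * cmod (\<mu> y)) \<le> C" using n q_pos by (simp add: powr_realpow mult.assoc)
    then have "real q ^ n * cmod (\<mu> y) \<le> C / c" using c by (simp add: pos_le_divide_eq mult.commute)
    then show ?thesis using level_density_le[OF n(1), of \<mu> y] unfolding K_def by linarith
  qed
  have "energy \<mu> n \<le> K\<^sup>2" if n: "1 \<le> n" for n
  proof -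
    have "energy \<mu> n \<le> level_mass n * (\<Sum>y\<in>vsphere v0 n. K\<^sup>2)"
      unfolding energy_def using level_mass_pos[of n] den[OF n]
      by (intro mult_left_mono sum_mono power_mono) (auto simp: vsphere_def)
    also have "\<dots> = (level_mass n * real (card (vsphere v0 n))) * K\<^sup>2" by simp
    finally show ?thesis by (simp only: level_mass_card mult_1)
  qed
  then have en: "energy \<mu> n \<le> K\<^sup>2" for n by (rule energy_all_levels[OF \<mu>])
  obtain F \<sigma> where F: "integrable \<nu> F" and lim: "AE \<omega> in \<nu>. (\<lambda>k. level_density \<mu> (\<sigma> k) (\<omega> (\<sigma> k))) \<longlonglongrightarrow> F \<omega>"
    and \<sigma>: "\<And>k. 1 \<le> \<sigma> k" and cyl: "\<And>x. (LINT \<omega>|\<nu>. indicat_real (cylinder E v0 x) \<omega> *\<^sub>R F \<omega>) = \<mu> x"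
    using l2_bounded_limit[OF \<mu> en] by blast
  have "AE \<omega> in \<nu>. cmod (F \<omega>) \<le> K"
    using lim AE_space
  proof eventually_elim
    case (elim \<omega>)
    then have w: "\<omega> \<in> boundary E v0" by (simp add: space_nu)
    show ?case
      by (rule Lim_bounded[OF tendsto_norm[OF elim(1)], of 0]) (use den[OF \<sigma> boundaryD(2)[OF w]] in simp)
  qed
  then have "F \<in> Lr_space \<nu> (conj_exp p)"
    using F True by (auto simp: Lr_space_def conj_exp_def)
  then show ?thesis using F cyl by blast
next
  case False
  then have p1: "1 < p" using p by simp
  define r where "r = p / (p - 1)"
  have r2: "2 \<le> r" using p1 p(2) by (simp add: r_def pos_le_divide_eq)
  define B where "B = 2 powr r * (real q * (C / c) powr r)"
  have mom: "level_mass n * (\<Sum>y\<in>vsphere v0 n. cmod (level_density \<mu> n y) powr r) \<le> B" if n: "1 \<le> n" for n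
  proof -
    have "level_mass n * (\<Sum>y\<in>vsphere v0 n. cmod (level_density \<mu> n y) powr r)
        \<le> (1 / real q ^ n) * (\<Sum>y\<in>vsphere v0 n. 2 powr r * (real q ^ n * cmod (\<mu> y)) powr r)"
    proof (intro mult_mono sum_mono sum_nonneg)
      fix y
      have "cmod (level_density \<mu> n y) powr r \<le> (2 * (real q ^ n * cmod (\<mu> y))) powr r"
        using r2 level_density_le[OF n] by (intro powr_mono2) auto
      also have "\<dots> = 2 powr r * (real q ^ n * cmod (\<mu> y)) powr r" by (rule powr_mult)
      finally show "cmod (level_density \<mu> n y) powr r \<le> 2 powr r * (real q ^ n * cmod (\<mu> y)) powr r" .
    qed (use level_mass_bounds(1)[OF n] in auto)
    also have "\<dots> = (1 / real q ^ n) * (2 powr r * (\<Sum>y\<in>vsphere v0 n. (real q ^ n * cmod (\<mu> y)) powr r))"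
      by (simp only: sum_distrib_left)
    also have "\<dots> \<le> (1 / real q ^ n) * (2 powr r * (real q ^ n * (real q * (C / c) powr r)))"
      using moment_bound[OF p1 \<mu> n k c le] unfolding r_def by (intro mult_left_mono) auto
    also have "\<dots> = B" using q_pos by (simp add: B_def)
    finally show ?thesis .
  qed
  have en: "energy \<mu> n \<le> 1 + B" for n
    by (rule energy_all_levels[OF \<mu> energy_le_of_moment[OF r2 mom]])
  obtain F \<sigma> where F: "integrable \<nu> F" and lim: "AE \<omega> in \<nu>. (\<lambda>k. level_density \<mu> (\<sigma> k) (\<omega> (\<sigma> k))) \<longlonglongrightarrow> F \<omega>"
    and \<sigma>: "\<And>k. 1 \<le> \<sigma> k" and cyl: "\<And>x. (LINT \<omega>|\<nu>. indicat_real (cylinder E v0 x) \<omega> *\<^sub>R F \<omega>) = \<mu> x"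
    using l2_bounded_limit[OF \<mu> en] by blast
  have "integrable \<nu> (\<lambda>\<omega>. cmod (F \<omega>) powr r)"
    using r2 by (intro Lr_limit[OF _ F lim mom[OF \<sigma>]]) simp
  then have "F \<in> Lr_space \<nu> (conj_exp p)"
    using borel_measurable_integrable[OF F] conj_exp_eq_top_iff[of p] p1 enn2real_conj_exp[OF p1]
    by (simp add: Lr_space_def r_def)
  then show ?thesis using F cyl by blast
qed

text \<open>On the boundary of the strip \<open>cmod Q = q powr (1 / p)\<close>, which is exactly the growth that \<open>density_of_additive\<close> needs.\<close>

theorem eigenfunction_is_poisson_transform:
  assumes p: "1 \<le> p" "p < 2" and g: "marcinkiewicz p C g"
    and t: "cmod (tz z) = radius p"
    and eig: "\<And>x. J g x = (tz z + 1 / tz z) * g x"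
  shows "\<exists>F\<in>Lr_space \<nu> (conj_exp p). g = poisson_transform q E v0 \<nu> z F"
proof -
  define Q :: complex where "Q = of_nat q powr (1 / 2 + \<i> * z)"
  have Qt: "Q = root_q * tz z" unfolding Q_def by (rule powr_half_iz)
  have q1: "1 < real q" using q2 by simp
  have "cmod Q = real q powr (1 / 2) * real q powr (1 / p - 1 / 2)"
    unfolding Qt norm_mult t root_q(3) radius_def by (simp add: powr_half_sqrt)
  then have nQ: "cmod Q = real q powr (1 / p)" by (simp add: powr_add[symmetric])
  have Q1: "1 < cmod Q" unfolding nQ using q1 p by simp
  have Q0: "Q \<noteq> 0" using Q1 by auto
  have Q2: "Q\<^sup>2 \<noteq> 1"
  proof
    assume "Q\<^sup>2 = 1"
    then have "(cmod Q)\<^sup>2 = 1" by (simp add: norm_power[symmetric])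
    then show False using Q1 by (simp add: power2_eq_1_iff)
  qed
  have nsum: "(\<Sum>y | E x y. g y) = (Q + of_nat q / Q) * g x" for x
  proof -
    have "(\<Sum>y | E x y. g y) = root_q * J g x" unfolding root_q_def neighbour_sum_eq[symmetric] neighbour_sum_def ..
    also have "\<dots> = (root_q * tz z + root_q / tz z) * g x" by (simp add: eig algebra_simps)
    also have "root_q / tz z = of_nat q / Q" unfolding Qt root_q(1)[symmetric] using root_q(2) by simp
    finally show ?thesis by (simp only: Qt)
  qed
  define \<mu> where "\<mu> = eigen_measure Q g"
  have \<mu>: "additive \<mu>" unfolding \<mu>_def by (rule additive_eigen_measure[OF Q0 Q2 nsum])
  define c where "c = cmod (1 - 1 / Q\<^sup>2)"
  have c: "0 < c" using Q2 Q0 by (simp add: c_def)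
  obtain C1 where k: "marcinkiewicz p C1 (\<lambda>x. g x - g (parent x) / Q)"
    using marcinkiewicz_parent_difference[OF p(1) g] by blast
  have le: "c * real q powr (real (lvl x) / p) * cmod (\<mu> x) \<le> cmod (g x - g (parent x) / Q)" if x: "x \<noteq> v0" for x
  proof -
    have "real q powr (real (lvl x) / p) = cmod Q ^ lvl x"
      unfolding nQ using q1 by (simp add: powr_realpow[symmetric] powr_powr)
    moreover have "cmod (\<mu> x) = cmod (g x - g (parent x) / Q) / (cmod Q ^ lvl x * c)"
      using x by (simp add: \<mu>_def eigen_measure_def norm_divide norm_mult norm_power c_def)
    ultimately show ?thesis using c Q0 by simp
  qed
  obtain F where F: "F \<in> Lr_space \<nu> (conj_exp p)" "integrable \<nu> F"
    "\<And>x. (LINT \<omega>|\<nu>. indicat_real (cylinder E v0 x) \<omega> *\<^sub>R F \<omega>) = eigen_measure Q g x"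
    using density_of_additive[OF p \<mu> k c le] unfolding \<mu>_def by blast
  have "poisson_transform q E v0 \<nu> z F x = g x" for x
    by (rule poisson_transform_eigen_measure[OF Q2[unfolded Q_def] F(2) F(3)[unfolded Q_def]])
  then have "g = poisson_transform q E v0 \<nu> z F" by auto
  then show ?thesis using F(1) by blast
qed

end

section \<open>Eigenvalues on the boundary of the strip\<close>

context tree_boundary
begin

lemma delta_conj_exp: "1 \<le> p \<Longrightarrow> delta (conj_exp p) = 1 / 2 - 1 / p"
proof (cases "p = 1")
  case False
  assume "1 \<le> p"
  with False have p: "1 < p" by simp
  have "(1 :: ennreal) / ennreal (p / (p - 1)) = ennreal (1 / (p / (p - 1)))"
    using divide_ennreal[of 1 "p / (p - 1)"] p by simp
  then have "enn2real (1 / conj_exp p) = (p - 1) / p" using False p by (simp add: conj_exp_def)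
  then show ?thesis using p by (simp add: delta_def diff_divide_distrib)
qed (simp add: delta_def conj_exp_def)

lemma tz_Complex: "tz (Complex \<alpha> \<beta>) = rcis (real q powr (- \<beta>)) (\<alpha> * ln (real q))"
proof -
  have "\<i> * Complex \<alpha> \<beta> * of_real (ln (real q)) = Complex (- \<beta> * ln (real q)) (\<alpha> * ln (real q))"
    by (simp add: complex_eq_iff)
  then show ?thesis
    unfolding tz_exp rcis_def using q2 by (simp add: exp_eq_polar powr_def)
qed

text \<open>The value of \<open>t\<close> at \<open>z = \<alpha> + i \<delta>\<close>. Its modulus is the outer radius, because \<open>\<delta> = 1 / 2 - 1 / p\<close> is negative.\<close>

definition boundary_point :: "real \<Rightarrow> real \<Rightarrow> complex" where
  "boundary_point p \<alpha> = tz (Complex \<alpha> (delta (conj_exp p)))"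

lemma boundary_point_rcis:
  "1 \<le> p \<Longrightarrow> boundary_point p \<alpha> = rcis (radius p) (\<alpha> * ln (real q))"
  by (simp add: boundary_point_def tz_Complex delta_conj_exp radius_def)

lemma norm_boundary_point: "1 \<le> p \<Longrightarrow> cmod (boundary_point p \<alpha>) = radius p"
  by (simp add: boundary_point_rcis radius_def)

lemma range_iff_Arg:
  "- tau q / 2 < \<alpha> \<and> \<alpha> \<le> tau q / 2 \<longleftrightarrow> - pi < \<alpha> * ln (real q) \<and> \<alpha> * ln (real q) \<le> pi"
proof -
  have l: "0 < ln (real q)" using q2 by simp
  then have "- tau q / 2 < \<alpha> \<longleftrightarrow> - pi < \<alpha> * ln (real q)"
    by (simp add: tau_def minus_divide_left pos_divide_less_eq del: minus_divide_left[symmetric] divide_minus_left)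
  moreover have "\<alpha> \<le> tau q / 2 \<longleftrightarrow> \<alpha> * ln (real q) \<le> pi"
    using l by (simp add: tau_def pos_le_divide_eq)
  ultimately show ?thesis by simp
qed

lemma boundary_point_Arg:
  assumes p: "1 \<le> p" and t: "cmod t = radius p"
  shows "boundary_point p (Arg t / ln (real q)) = t"
    and "- tau q / 2 < Arg t / ln (real q) \<and> Arg t / ln (real q) \<le> tau q / 2"
proof -
  have l: "ln (real q) \<noteq> 0" using q2 by simp
  show "boundary_point p (Arg t / ln (real q)) = t"
    unfolding boundary_point_rcis[OF p] t[symmetric] using l by (simp add: rcis_cmod_Arg)
  show "- tau q / 2 < Arg t / ln (real q) \<and> Arg t / ln (real q) \<le> tau q / 2"
    unfolding range_iff_Arg using l Arg_bounded[of t] by simp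
qed

lemma boundary_point_inj:
  assumes p: "1 \<le> p" and eq: "boundary_point p \<alpha> = boundary_point p \<beta>"
    and \<alpha>: "- tau q / 2 < \<alpha> \<and> \<alpha> \<le> tau q / 2" and \<beta>: "- tau q / 2 < \<beta> \<and> \<beta> \<le> tau q / 2"
  shows "\<alpha> = \<beta>"
proof -
  have r: "radius p \<noteq> 0" "ln (real q) \<noteq> 0" using q2 by (simp_all add: radius_def)
  have "cis (\<alpha> * ln (real q)) = cis (\<beta> * ln (real q))"
    using eq r(1) by (simp add: boundary_point_rcis[OF p] rcis_def)
  moreover have "Arg (cis (\<alpha> * ln (real q))) = \<alpha> * ln (real q)"
    using \<alpha> unfolding range_iff_Arg by (intro cis_Arg_unique) simp_all
  moreover have "Arg (cis (\<beta> * ln (real q))) = \<beta> * ln (real q)"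
    using \<beta> unfolding range_iff_Arg by (intro cis_Arg_unique) simp_all
  ultimately have "\<alpha> * ln (real q) = \<beta> * ln (real q)" by metis
  then show ?thesis using r(2) by simp
qed

lemma laplacian_eigen_iff: "laplacian q E g x = gam_t t * g x \<longleftrightarrow> J g x = (t + 1 / t) * g x"
proof -
  have n: "(of_nat q + 1 :: complex) \<noteq> 0" by (rule nat_plus_one_nonzero)
  have "{y. gdist E x y = 1} = {y. E x y}" using d_eq_1_iff[of x] by simp
  then have "laplacian q E g x = g x - root_q * J g x / (of_nat q + 1)"
    using neighbour_sum_eq[of g x] by (simp add: laplacian_def neighbour_sum_def root_q_def)
  moreover have "gam_t t * g x = g x - root_q * ((t + 1 / t) * g x) / (of_nat q + 1)"
    by (simp add: gam_t_def left_diff_distrib)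
  ultimately have "laplacian q E g x = gam_t t * g x \<longleftrightarrow>
      root_q * J g x / (of_nat q + 1) = root_q * ((t + 1 / t) * g x) / (of_nat q + 1)" by simp
  also have "\<dots> \<longleftrightarrow> J g x = (t + 1 / t) * g x" using n root_q(2) by (simp only: divide_cancel_right mult_cancel_left) simp
  finally show ?thesis .
qed

text \<open>The image of the annulus under \<open>gam_t\<close> is connected and has more than one point, so all its points are limit points and
  the identity theorem applies.\<close>

lemma symbol_not_constant:
  assumes O': "open O'" "connected O'" and \<Psi>: "\<Psi> holomorphic_on O'" "\<not> \<Psi> constant_on O'"
    and R: "1 < R" "R < S" and sub: "\<And>t. t \<in> annulus (1 / S) S \<Longrightarrow> gam_t t \<in> O'"
  shows "\<not> (\<lambda>t. \<Psi> (gam_t t)) constant_on annulus (1 / S) S"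
proof
  let ?A = "annulus (1 / S) S" and ?U = "gam_t ` annulus (1 / S) S"
  assume "(\<lambda>t. \<Psi> (gam_t t)) constant_on ?A"
  then have c: "\<Psi> constant_on ?U" by (auto simp: constant_on_def)
  have S1: "1 / S < 1" "1 < S" using R by simp_all
  have A0: "?A \<subseteq> - {0}" using S1 by (auto simp: annulus_def)
  have "continuous_on ?A gam_t"
    by (rule holomorphic_on_imp_continuous_on[OF holomorphic_on_subset[OF gam_t_holomorphic A0]])
  then have conn: "connected ?U" by (rule connected_continuous_image[OF _ connected_annulus_0])
  have A: "1 \<in> ?A" "of_real R \<in> ?A"
  proof -
    show "1 \<in> ?A" using S1 by (simp add: annulus_def)
    have "1 / S < R" "0 < R" using S1 R by linarith+
    then show "of_real R \<in> ?A" using R by (simp add: annulus_def)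
  qed
  have "gam_t 1 \<noteq> gam_t (of_real R)"
  proof
    assume "gam_t 1 = gam_t (of_real R)"
    then have "(1 + 1 / 1 :: complex) = of_real R + 1 / of_real R"
      using nat_plus_one_nonzero root_q(2) by (simp add: gam_t_def divide_cancel_right)
    then have "(of_real (R + 1 / R) :: complex) = of_real 2" by simp
    then have "R + 1 / R = 2" unfolding of_real_eq_iff .
    then have "(R - 1)\<^sup>2 = 0" using R by (simp add: power2_eq_square field_simps)
    then show False using R by simp
  qed
  then have "?U \<noteq> {x}" for x using A by (metis imageI singletonD)
  then have lim: "gam_t 1 islimpt ?U" by (intro connected_imp_perfect conn imageI A)
  have "\<Psi> constant_on O'"
    by (rule analytic_continuation'[OF \<Psi>(1) O' _ _ lim c]) (use sub A in auto)
  then show False using \<Psi>(2) by contradiction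
qed

text \<open>There are finitely many unimodular values, and each is taken finitely often on the compact circle.\<close>

lemma finite_unimodular_boundary:
  assumes R: "1 < R" "R < S" and H: "H holomorphic_on annulus (1 / S) S" "\<not> H constant_on annulus (1 / S) S"
    and fin: "finite {w. cmod w = 1 \<and> (\<exists>t. 1 / R \<le> cmod t \<and> cmod t \<le> R \<and> w = H t)}"
  shows "finite {t. cmod t = R \<and> cmod (H t) = 1}"
proof -
  let ?W = "{w. cmod w = 1 \<and> (\<exists>t. 1 / R \<le> cmod t \<and> cmod t \<le> R \<and> w = H t)}"
  have R1: "1 / R \<le> R" using R by (simp add: pos_divide_le_eq mult_ge1_I)
  have SR: "1 / S < R" using R by (smt (verit) divide_less_eq_1_pos)
  have "finite {t \<in> sphere 0 R. H t - w = 0}" for w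
  proof (rule holomorphic_compact_finite_zeros[OF _ open_annulus connected_annulus_0])
    show "(\<lambda>t. H t - w) holomorphic_on annulus (1 / S) S" by (intro holomorphic_intros H)
    show "sphere 0 R \<subseteq> annulus (1 / S) S" using R SR by (auto simp: annulus_def)
    show "\<not> (\<lambda>t. H t - w) constant_on annulus (1 / S) S"
      using H(2) by (auto simp: constant_on_def) (metis diff_add_cancel)
  qed simp
  then have "finite (\<Union>w\<in>?W. {t \<in> sphere 0 R. H t - w = 0})" using fin by blast
  then show ?thesis by (rule finite_subset[rotated]) (use R1 in auto)
qed

text \<open>By the maximum principle the modulus \<open>1\<close> is not attained in the interior, and inversion exchanges the two boundary
  circles.\<close>

lemma unimodular_boundary_nonempty:
  assumes R: "1 < R" "R < S" and H: "H holomorphic_on annulus (1 / S) S" "\<not> H constant_on annulus (1 / S) S"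
    and inv: "\<And>t. t \<noteq> 0 \<Longrightarrow> H (1 / t) = H t"
    and le: "\<And>t. 1 / R \<le> cmod t \<Longrightarrow> cmod t \<le> R \<Longrightarrow> cmod (H t) \<le> 1"
    and t0: "1 / R \<le> cmod t0" "cmod t0 \<le> R" "cmod (H t0) = 1"
  shows "\<exists>t. cmod t = R \<and> cmod (H t) = 1"
proof (rule ccontr)
  assume no: "\<not> ?thesis"
  have pos: "0 < 1 / R" using R by simp
  then have n0: "t0 \<noteq> 0" using t0(1) by auto
  have n1: "cmod t0 \<noteq> R" using no t0(3) by blast
  have n2: "cmod t0 \<noteq> 1 / R"
  proof
    assume "cmod t0 = 1 / R"
    then have "cmod (1 / t0) = R" using R by (simp add: norm_divide)
    then show False using no inv[OF n0] t0(3) by metis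
  qed
  have "1 / S < 1 / R" using R by (simp add: frac_less2)
  then have sub: "annulus (1 / R) R \<subseteq> annulus (1 / S) S" using R by (auto simp: annulus_def)
  have "H constant_on annulus (1 / S) S"
  proof (rule maximum_modulus_principle[OF H(1) open_annulus connected_annulus_0 open_annulus sub])
    show "t0 \<in> annulus (1 / R) R" using t0 n1 n2 by (simp add: annulus_def)
    show "cmod (H t) \<le> cmod (H t0)" if "t \<in> annulus (1 / R) R" for t
      unfolding t0(3) using that by (intro le) (simp_all add: annulus_def)
  qed
  then show False using H(2) by contradiction
qed

lemma shift_list_eq: "shift_list ts f = fold shift ts f"
proof -
  have "(\<lambda>t. apply_symbol (linear_symbol (t + 1 / t))) = shift"
    by (intro ext) (simp add: apply_linear_symbol shift_def)
  then show ?thesis by (simp add: shift_list_def)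
qed

text \<open>The two cases of the theorem differ only in the choice of \<open>H\<close> and \<open>h\<close>.\<close>

lemma backward_orbit_decomposition:
  assumes p: "1 \<le> p" "p < 2" and S: "radius p < S"
    and H: "H holomorphic_on annulus (1 / S) S" "\<not> H constant_on annulus (1 / S) S"
    and inv: "\<And>t. t \<noteq> 0 \<Longrightarrow> H (1 / t) = H t"
    and le: "\<And>t. 1 / radius p \<le> cmod t \<Longrightarrow> cmod t \<le> radius p \<Longrightarrow> cmod (H t) \<le> 1"
    and t0: "1 / radius p \<le> cmod t0" "cmod t0 \<le> radius p" "cmod (H t0) = 1"
    and fin: "finite {w. cmod w = 1 \<and> (\<exists>t. 1 / radius p \<le> cmod t \<and> cmod t \<le> radius p \<and> w = H t)}"
    and a: "weighted_l1 (radius p) a" "\<And>m. a (- m) = a m"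
    and eval: "\<And>t. 1 / radius p \<le> cmod t \<Longrightarrow> cmod t \<le> radius p \<Longrightarrow> laurent a t = H t"
    and h: "\<And>n. marcinkiewicz p C (h n)" and step: "\<And>n. apply_symbol a (h (Suc n)) = h n"
  defines "T \<equiv> {t. cmod t = radius p \<and> cmod (H t) = 1}"
  shows "finite T \<and> T \<noteq> {} \<and>
    (\<exists>g. (\<forall>t\<in>T. (\<exists>C. marcinkiewicz p C (g t)) \<and> (\<forall>x. J (g t) x = (t + 1 / t) * g t x)) \<and>
         (\<forall>x. h 0 x = (\<Sum>t\<in>T. g t x)))"
proof -
  note R = radius_gt_1[OF p]
  have finT: "finite T" unfolding T_def by (rule finite_unimodular_boundary[OF R S H fin])
  have neT: "T \<noteq> {}" unfolding T_def using unimodular_boundary_nonempty[OF R S H inv le t0] by blast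
  have R1: "1 / radius p \<le> radius p" using R by (smt (verit) divide_le_eq_1_pos)
  have tmp: "tempered (radius p) (4 * C) (h n)" for n
    unfolding radius_def by (rule marcinkiewicz_imp_tempered[OF p h])
  obtain ts where ts: "set ts = T" "\<And>x. shift_list ts (h 0) x = 0"
    using annihilator_exists[where a = a and \<Phi> = H and S = S and h = h and C = "4 * C", OF R S H(1) a eval _ _ tmp step] finT le R1 unfolding T_def by auto
  obtain g where g: "\<And>t. t \<in> T \<Longrightarrow> (\<exists>C. marcinkiewicz p C (g t)) \<and> (\<forall>x. shift t (g t) x = 0)"
    "\<And>x. h 0 x = (\<Sum>t\<in>T. g t x)"
    using spectral_decomposition[OF p, of "h 0" ts] h[of 0] ts unfolding shift_list_eq
    by (auto simp: T_def radius_def)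
  have "J (g t) x = (t + 1 / t) * g t x" if "t \<in> T" for t x
    using g(1)[OF that] by (simp add: shift_def)
  then show ?thesis using finT neT g by blast
qed

lemma eigen_decomposition_of_boundary_points:
  assumes p: "1 \<le> p" and T: "finite T" "T \<noteq> {}"
    and T1: "\<And>t. t \<in> T \<Longrightarrow> cmod t = radius p \<and> cmod (\<Psi> (gam_t t)) = cmod A"
    and g: "\<And>t. t \<in> T \<Longrightarrow> \<exists>C. marcinkiewicz p C (g t)"
    and eig: "\<And>t x. t \<in> T \<Longrightarrow> J (g t) x = (t + 1 / t) * g t x"
    and f: "\<And>x. f x = (\<Sum>t\<in>T. g t x)"
  shows "\<exists>m\<ge>1. \<exists>\<alpha> g. eigen_decomposition q E p \<Psi> A f m \<alpha> g"
proof -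
  obtain e where e: "bij_betw e {1..card T} T" using ex_bij_betw_nat_finite_1[OF T(1)] by blast
  have eT: "e l \<in> T" if "l \<in> {1..card T}" for l using e that by (auto simp: bij_betw_def)
  define \<alpha> where "\<alpha> = (\<lambda>l. Arg (e l) / ln (real q))"
  have bp: "boundary_point p (\<alpha> l) = e l" if "l \<in> {1..card T}" for l
    unfolding \<alpha>_def using boundary_point_Arg(1)[OF p] T1[OF eT[OF that]] by blast
  have "inj_on \<alpha> {1..card T}"
  proof (rule inj_onI)
    fix i j assume ij: "i \<in> {1..card T}" "j \<in> {1..card T}" "\<alpha> i = \<alpha> j"
    then have "e i = e j" using bp by metis
    then show "i = j" using inj_onD[OF bij_betw_imp_inj_on[OF e]] ij(1,2) by blast
  qed
  moreover have "- tau q / 2 < \<alpha> l \<and> \<alpha> l \<le> tau q / 2 \<and>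
      cmod (\<Psi> (gam q (Complex (\<alpha> l) (delta (conj_exp p))))) = cmod A \<and>
      g (e l) \<in> weak_space (conj_exp p) \<and>
      (\<forall>x. laplacian q E (g (e l)) x = gam q (Complex (\<alpha> l) (delta (conj_exp p))) * g (e l) x)"
    if l: "l \<in> {1..card T}" for l
  proof -
    have gam: "gam q (Complex (\<alpha> l) (delta (conj_exp p))) = gam_t (e l)"
      using bp[OF l] by (simp add: gam_eq boundary_point_def)
    have rng: "- tau q / 2 < \<alpha> l \<and> \<alpha> l \<le> tau q / 2"
      unfolding \<alpha>_def using boundary_point_Arg(2)[OF p] T1[OF eT[OF l]] by blast
    have wk: "g (e l) \<in> weak_space (conj_exp p)"
      using g[OF eT[OF l]] marcinkiewicz_imp_weak_space[OF p] by blast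
    show ?thesis
      unfolding gam laplacian_eigen_iff using rng wk T1[OF eT[OF l]] eig[OF eT[OF l]] by blast
  qed
  moreover have "f x = (\<Sum>l=1..card T. g (e l) x)" for x
    unfolding f by (rule sum.reindex_bij_betw[OF e, symmetric])
  ultimately have "eigen_decomposition q E p \<Psi> A f (card T) \<alpha> (\<lambda>l. g (e l))"
    unfolding eigen_decomposition_def by blast
  moreover have "1 \<le> card T" using T by (simp add: Suc_le_eq card_gt_0_iff)
  ultimately show ?thesis by blast
qed

lemma eigen_decompositionD:
  assumes p: "1 \<le> p" and ed: "eigen_decomposition q E p \<Psi> A f m \<alpha> g" and l: "l \<in> {1..m}"
  shows "J (g l) x = (boundary_point p (\<alpha> l) + 1 / boundary_point p (\<alpha> l)) * g l x"
    and "- tau q / 2 < \<alpha> l \<and> \<alpha> l \<le> tau q / 2"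
    and "g l \<in> weak_space (conj_exp p)"
proof -
  have "(- tau q / 2 < \<alpha> l \<and> \<alpha> l \<le> tau q / 2) \<and> g l \<in> weak_space (conj_exp p) \<and>
      laplacian q E (g l) x = gam q (Complex (\<alpha> l) (delta (conj_exp p))) * g l x"
    using ed[unfolded eigen_decomposition_def, THEN conjunct2, THEN conjunct1, rule_format, OF l] by simp
  then show "J (g l) x = (boundary_point p (\<alpha> l) + 1 / boundary_point p (\<alpha> l)) * g l x"
    and "- tau q / 2 < \<alpha> l \<and> \<alpha> l \<le> tau q / 2" and "g l \<in> weak_space (conj_exp p)"
    unfolding gam_eq boundary_point_def[symmetric] laplacian_eigen_iff by blast+
qed

text \<open>Regrouping the terms by parameter makes two decompositions with different index sets comparable; parameters that do not
  occur have component \<open>0\<close>.\<close>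

definition component :: "nat \<Rightarrow> (nat \<Rightarrow> real) \<Rightarrow> (nat \<Rightarrow> 'v \<Rightarrow> complex) \<Rightarrow> real \<Rightarrow> 'v \<Rightarrow> complex" where
  "component m \<alpha> g a x = (\<Sum>l | l \<in> {1..m} \<and> \<alpha> l = a. g l x)"

lemma component_eq:
  assumes "inj_on \<alpha> {1..m}" "l \<in> {1..m}"
  shows "component m \<alpha> g (\<alpha> l) = g l"
proof
  fix x
  have "{i. i \<in> {1..m} \<and> \<alpha> i = \<alpha> l} = {l}" using assms by (auto dest: inj_onD)
  then show "component m \<alpha> g (\<alpha> l) x = g l x" by (simp add: component_def)
qed

lemma component_outside: "a \<notin> \<alpha> ` {1..m} \<Longrightarrow> component m \<alpha> g a = (\<lambda>_. 0)"
  unfolding component_def by (intro ext sum.neutral) blast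

lemma component_graph:
  assumes "inj_on \<alpha> {1..m}"
  shows "{(\<alpha> l, g l) | l. l \<in> {1..m} \<and> g l \<noteq> (\<lambda>_. 0)}
       = {(a, component m \<alpha> g a) | a. component m \<alpha> g a \<noteq> (\<lambda>_. 0)}"
proof -
  have "\<exists>l. l \<in> {1..m} \<and> a = \<alpha> l" if "component m \<alpha> g a \<noteq> (\<lambda>_. 0)" for a
    using component_outside[of a \<alpha> m g] that by blast
  then show ?thesis using component_eq[OF assms] by fastforce
qed

lemma sum_component:
  assumes "inj_on \<alpha> {1..m}" "finite S" "\<alpha> ` {1..m} \<subseteq> S"
  shows "(\<Sum>a\<in>S. component m \<alpha> g a x) = (\<Sum>l=1..m. g l x)"
proof -
  have "(\<Sum>a\<in>S. component m \<alpha> g a x) = (\<Sum>a\<in>\<alpha> ` {1..m}. component m \<alpha> g a x)"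
    by (rule sum.mono_neutral_right[OF assms(2,3)]) (simp add: component_outside)
  also have "\<dots> = (\<Sum>l=1..m. g l x)"
    unfolding sum.reindex[OF assms(1)] by (rule sum.cong) (simp_all add: component_eq[OF assms(1)])
  finally show ?thesis .
qed

text \<open>The differences of the components are eigenfunctions with distinct eigenvalues and sum \<open>0\<close>.\<close>

lemma eigen_decomposition_unique:
  assumes p: "1 \<le> p" "p < 2"
    and ed: "eigen_decomposition q E p \<Psi> A f m \<alpha> g" "eigen_decomposition q E p \<Psi> A f m' \<alpha>' g'"
  shows "{(\<alpha> l, g l) | l. l \<in> {1..m} \<and> g l \<noteq> (\<lambda>_. 0)} = {(\<alpha>' l, g' l) | l. l \<in> {1..m'} \<and> g' l \<noteq> (\<lambda>_. 0)}"
proof -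
  have inj: "inj_on \<alpha> {1..m}" "inj_on \<alpha>' {1..m'}" using ed by (auto simp: eigen_decomposition_def)
  have sums: "f x = (\<Sum>l=1..m. g l x)" "f x = (\<Sum>l=1..m'. g' l x)" for x
    using ed by (auto simp: eigen_decomposition_def)
  define S where "S = \<alpha> ` {1..m} \<union> \<alpha>' ` {1..m'}"
  have finS: "finite S" by (simp add: S_def)
  define \<kappa> where "\<kappa> = (\<lambda>a. boundary_point p a + 1 / boundary_point p a)"
  define w where "w = (\<lambda>a x. component m \<alpha> g a x - component m' \<alpha>' g' a x)"
  have rng: "- tau q / 2 < a \<and> a \<le> tau q / 2" if "a \<in> S" for a
    using that eigen_decompositionD(2)[OF p(1) ed(1)] eigen_decompositionD(2)[OF p(1) ed(2)] by (auto simp: S_def)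
  have "inj_on \<kappa> S"
  proof (rule inj_onI)
    fix a b assume ab: "a \<in> S" "b \<in> S" "\<kappa> a = \<kappa> b"
    have "boundary_point p a = boundary_point p b"
      by (rule add_inverse_inj[OF radius_gt_1[OF p] norm_boundary_point[OF p(1)] norm_boundary_point[OF p(1)]
            ab(3)[unfolded \<kappa>_def]])
    then show "a = b" by (rule boundary_point_inj[OF p(1) _ rng[OF ab(1)] rng[OF ab(2)]])
  qed
  moreover have Jc: "J (component m \<alpha> g a) x = \<kappa> a * component m \<alpha> g a x"
    if "eigen_decomposition q E p \<Psi> A f m \<alpha> g" for m \<alpha> g a x
  proof (cases "a \<in> \<alpha> ` {1..m}")
    case True
    then obtain l where l: "l \<in> {1..m}" "a = \<alpha> l" by blast
    have "inj_on \<alpha> {1..m}" using that by (simp add: eigen_decomposition_def)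
    then show ?thesis using eigen_decompositionD(1)[OF p(1) that l(1)] l component_eq[of \<alpha> m l g] by (simp add: \<kappa>_def)
  next
    case False
    then show ?thesis by (simp add: component_outside J_eq_sum)
  qed
  have "J (w a) x = \<kappa> a * w a x" for a x
    unfolding w_def by (simp add: J_diff Jc[OF ed(1)] Jc[OF ed(2)] right_diff_distrib)
  moreover have "(\<Sum>a\<in>S. w a x) = 0" for x
    unfolding w_def sum_subtractf
    using sum_component[OF inj(1) finS, of g x] sum_component[OF inj(2) finS, of g' x] sums[of x]
    by (simp add: S_def)
  ultimately have "w a x = 0" if "a \<in> S" for a x
    using eigenvectors_independent[OF finS, of \<kappa> w a x] that by blast
  moreover have "w a x = 0" if "a \<notin> S" for a x
    using that by (simp add: w_def S_def component_outside)
  ultimately have "w a x = 0" for a x by blast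
  then have "component m \<alpha> g a x = component m' \<alpha>' g' a x" for a x by (simp add: w_def)
  then have "component m \<alpha> g = component m' \<alpha>' g'" by (intro ext)
  then show ?thesis unfolding component_graph[OF inj(1)] component_graph[OF inj(2)] by simp
qed

end

section \<open>The decomposition theorem\<close>

theorem theorem5p6:
  fixes q :: nat and E :: "'v \<Rightarrow> 'v \<Rightarrow> bool" and v0 :: 'v
    and \<nu> :: "(nat \<Rightarrow> 'v) measure"
    and p M :: real and \<Psi> :: "complex \<Rightarrow> complex" and O' :: "complex set"
    and f :: "int \<Rightarrow> 'v \<Rightarrow> complex" and A :: complex
  assumes q: "q \<ge> 2"
    and tree: "homogeneous_tree q E"
    and nu: "boundary_measure q E v0 \<nu>"
    and p: "1 \<le> p" "p < 2"
    and O': "open O'" "connected O'" "gam q ` strip p \<subseteq> O'"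
    and Psi: "\<Psi> holomorphic_on O'" "\<not> \<Psi> constant_on O'"
    and nonzero: "\<forall>z\<in>strip p. \<Psi> (gam q z) \<noteq> 0"
    and M: "M > 0" "\<forall>k. weak_norm (conj_exp p) (f k) \<le> ennreal M"
    and A: "A \<noteq> 0"
    and cases:
      "((\<forall>k::int. k \<ge> 0 \<longrightarrow> multiplier q E v0 \<nu> p \<Psi> (f k) = (\<lambda>x. A * f (k + 1) x)) \<and>
        (\<exists>z\<in>strip p. cmod (\<Psi> (gam q z)) = cmod A) \<and>
        (\<forall>z\<in>strip p. cmod A \<le> cmod (\<Psi> (gam q z))) \<and>
        finite ((\<lambda>z. \<Psi> (gam q z)) ` strip p \<inter> {w. cmod w = cmod A}))
     \<or> ((\<forall>k::int. k \<ge> 1 \<longrightarrow> multiplier q E v0 \<nu> p \<Psi> (f (- k)) = (\<lambda>x. A * f (- k + 1) x)) \<and>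
        (\<exists>z\<in>strip p. cmod (\<Psi> (gam q z)) = cmod A) \<and>
        (\<forall>z\<in>strip p. cmod (\<Psi> (gam q z)) \<le> cmod A) \<and>
        finite ((\<lambda>z. \<Psi> (gam q z)) ` strip p \<inter> {w. cmod w = cmod A}))"
  shows "(\<exists>m\<ge>1. \<exists>\<alpha> g. eigen_decomposition q E p \<Psi> A (f 0) m \<alpha> g)
    \<and> (\<forall>m \<alpha> g m' \<alpha>' g'.
          eigen_decomposition q E p \<Psi> A (f 0) m \<alpha> g \<longrightarrow>
          eigen_decomposition q E p \<Psi> A (f 0) m' \<alpha>' g' \<longrightarrow>
          {(\<alpha> l, g l) | l. l \<in> {1..m} \<and> g l \<noteq> (\<lambda>_. 0)}
            = {(\<alpha>' l, g' l) | l. l \<in> {1..m'} \<and> g' l \<noteq> (\<lambda>_. 0)})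
    \<and> (\<forall>m \<alpha> g. eigen_decomposition q E p \<Psi> A (f 0) m \<alpha> g \<longrightarrow>
          (\<forall>l\<in>{1..m}. \<exists>F\<in>Lr_space \<nu> (conj_exp p).
             g l = poisson_transform q E v0 \<nu> (Complex (\<alpha> l) (delta (conj_exp p))) F))"
proof -
  interpret tree_boundary q E v0 \<nu>
    by unfold_locales (use q tree nu in auto)
  let ?R = "radius p" and ?ann = "\<lambda>S. annulus (1 / S) S"
  note R = radius_gt_1[OF p]
  have marc: "marcinkiewicz p (p * M) (f k)" for k
    by (rule weak_norm_imp_marcinkiewicz[OF p(1) less_imp_le[OF M(1)] M(2)[rule_format]])
  have on_strip: "\<exists>z\<in>strip p. gam q z = gam_t t" if "1 / ?R \<le> cmod t" "cmod t \<le> ?R" for t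
  proof -
    have "t \<in> tz ` strip p" using that unfolding strip_image[OF p] by simp
    then show ?thesis by (auto simp: gam_eq)
  qed
  obtain a where a: "weighted_l1 ?R a" "\<And>m. a (- m) = a m"
    "\<And>t. 1 / ?R \<le> cmod t \<Longrightarrow> cmod t \<le> ?R \<Longrightarrow> laurent a t = \<Psi> (gam_t t)"
    "\<And>C g. marcinkiewicz p C g \<Longrightarrow> multiplier q E v0 \<nu> p \<Psi> g = apply_symbol a g"
    using multiplier_eq_apply_symbol[OF p O'(1) O'(3) Psi(1)] by blast
  \<comment> \<open>Dividing by \<open>A\<close> turns the recursion into an exact one-step relation between the functions.\<close>
  define b where "b = (\<lambda>m. (1 / A) * a m)"
  have b: "weighted_l1 ?R b" "\<And>m. b (- m) = b m"
  proof -
    have "(\<lambda>m. cmod (1 / A) * (cmod (a m) * ?R ^ nat \<bar>m\<bar>)) summable_on UNIV"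
      using a(1) unfolding weighted_l1_def by (rule summable_on_cmult_right)
    then show "weighted_l1 ?R b" unfolding weighted_l1_def b_def norm_mult mult.assoc .
    show "b (- m) = b m" for m by (simp add: b_def a(2))
  qed
  have b_eval: "laurent b t = \<Psi> (gam_t t) / A" if "1 / ?R \<le> cmod t" "cmod t \<le> ?R" for t
  proof -
    have "laurent b t = (1 / A) * laurent a t"
      unfolding laurent_def b_def mult.assoc by (rule infsum_cmult_right')
    then show ?thesis using a(3)[OF that] by simp
  qed
  have b_step: "apply_symbol b (f k) = g" if "multiplier q E v0 \<nu> p \<Psi> (f k) = (\<lambda>x. A * g x)" for k g
  proof
    fix x
    have "apply_symbol a (f k) x = A * g x" using that a(4)[OF marc[of k]] by metis
    then show "apply_symbol b (f k) x = g x" unfolding b_def apply_symbol_cmult using A by simp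
  qed
  \<comment> \<open>Removing the zeros of \<open>\<Psi>\<close> keeps the symbol of the inverse multiplier holomorphic.\<close>
  define O0 where "O0 = O' \<inter> \<Psi> -` (- {0})"
  have O0: "open O0"
    unfolding O0_def by (intro continuous_open_preimage holomorphic_on_imp_continuous_on Psi O') auto
  have O0_sub: "gam q ` strip p \<subseteq> O0" using O'(3) nonzero by (auto simp: O0_def)
  have \<Psi>0: "\<Psi> holomorphic_on O0" by (rule holomorphic_on_subset[OF Psi(1)]) (simp add: O0_def)
  obtain S where S: "?R < S" and S_sub: "\<And>t. t \<in> ?ann S \<Longrightarrow> gam_t t \<in> O0"
    using annulus_extension[OF p O0 O0_sub] by blast
  define H where "H = (\<lambda>t. \<Psi> (gam_t t) / A)"
  have ann0: "?ann S \<subseteq> - {0}" using R S by (auto simp: annulus_def)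
  have Hnz: "H t \<noteq> 0" if "t \<in> ?ann S" for t using S_sub[OF that] A by (simp add: H_def O0_def)
  have Hhol: "H holomorphic_on ?ann S"
  proof -
    have "(\<Psi> \<circ> gam_t) holomorphic_on ?ann S"
      by (rule holomorphic_on_compose_gen[OF holomorphic_on_subset[OF gam_t_holomorphic ann0] \<Psi>0]) (use S_sub in blast)
    then show ?thesis unfolding H_def using A by (intro holomorphic_intros) (simp_all add: o_def)
  qed
  have Hnc: "\<not> H constant_on ?ann S"
  proof
    assume "H constant_on ?ann S"
    then obtain c where "\<And>t. t \<in> ?ann S \<Longrightarrow> H t = c" by (auto simp: constant_on_def)
    then have "\<Psi> (gam_t t) = c * A" if "t \<in> ?ann S" for t using that A by (simp add: H_def field_simps)
    then have "(\<lambda>t. \<Psi> (gam_t t)) constant_on ?ann S" unfolding constant_on_def by blast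
    moreover have "\<And>t. t \<in> ?ann S \<Longrightarrow> gam_t t \<in> O'" using S_sub by (simp add: O0_def)
    ultimately show False using symbol_not_constant[OF O'(1,2) Psi R S] by blast
  qed
  have Hinv: "H (1 / t) = H t" if "t \<noteq> 0" for t using that by (simp add: H_def gam_t_inverse)
  have Hunit: "cmod (H t) = 1 \<longleftrightarrow> cmod (\<Psi> (gam_t t)) = cmod A" for t
    using A by (auto simp: H_def norm_divide)
  have closed_sub: "t \<in> ?ann S" if "1 / ?R \<le> cmod t" "cmod t \<le> ?R" for t
  proof -
    have "1 / S < 1 / ?R" using R S by (simp add: frac_less2)
    then show ?thesis using that S by (simp add: annulus_def)
  qed
  obtain z0 where z0: "z0 \<in> strip p" "cmod (\<Psi> (gam q z0)) = cmod A" using cases by blast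
  define t0 where "t0 = tz z0"
  have t0: "1 / ?R \<le> cmod t0" "cmod t0 \<le> ?R" "cmod (H t0) = 1"
    using z0 strip_iff[OF p, of z0] by (auto simp: t0_def Hunit gam_eq)
  have "finite ((\<lambda>z. \<Psi> (gam q z)) ` strip p \<inter> {w. cmod w = cmod A})" using cases by blast
  then have "finite ((\<lambda>w. w / A) ` ((\<lambda>z. \<Psi> (gam q z)) ` strip p \<inter> {w. cmod w = cmod A}))" by (rule finite_imageI)
  then have Hfin: "finite {w. cmod w = 1 \<and> (\<exists>t. 1 / ?R \<le> cmod t \<and> cmod t \<le> ?R \<and> w = H t)}"
  proof (rule finite_subset[rotated], intro subsetI)
    fix w assume "w \<in> {w. cmod w = 1 \<and> (\<exists>t. 1 / ?R \<le> cmod t \<and> cmod t \<le> ?R \<and> w = H t)}"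
    then obtain t where t: "cmod (H t) = 1" "1 / ?R \<le> cmod t" "cmod t \<le> ?R" "w = H t" by blast
    obtain z where z: "z \<in> strip p" "gam q z = gam_t t" using on_strip[OF t(2,3)] by blast
    have "\<Psi> (gam q z) \<in> (\<lambda>z. \<Psi> (gam q z)) ` strip p \<inter> {w. cmod w = cmod A}"
      using z(1) t(1)[unfolded Hunit] unfolding z(2)[symmetric] by blast
    moreover have "w = \<Psi> (gam q z) / A" by (simp add: t(4) H_def z(2))
    ultimately show "w \<in> (\<lambda>w. w / A) ` ((\<lambda>z. \<Psi> (gam q z)) ` strip p \<inter> {w. cmod w = cmod A})" by blast
  qed

  \<comment> \<open>The common part of both cases: \<open>K\<close> is the symbol whose powers carry \<open>h n\<close> back to \<open>f 0\<close>.\<close>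
  have main: "\<exists>m\<ge>1. \<exists>\<alpha> g. eigen_decomposition q E p \<Psi> A (f 0) m \<alpha> g"
    if K: "K holomorphic_on ?ann S" "\<not> K constant_on ?ann S" "\<And>t. t \<noteq> 0 \<Longrightarrow> K (1 / t) = K t"
      "\<And>t. 1 / ?R \<le> cmod t \<Longrightarrow> cmod t \<le> ?R \<Longrightarrow> cmod (K t) \<le> 1" "\<And>t. cmod (K t) = 1 \<longleftrightarrow> cmod (H t) = 1"
      "finite {w. cmod w = 1 \<and> (\<exists>t. 1 / ?R \<le> cmod t \<and> cmod t \<le> ?R \<and> w = K t)}"
      and c: "weighted_l1 ?R c" "\<And>m. c (- m) = c m"
      "\<And>t. 1 / ?R \<le> cmod t \<Longrightarrow> cmod t \<le> ?R \<Longrightarrow> laurent c t = K t"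
      and h: "\<And>n. marcinkiewicz p (p * M) (h n)" "\<And>n. apply_symbol c (h (Suc n)) = h n" "h 0 = f 0"
    for K c and h :: "nat \<Rightarrow> 'v \<Rightarrow> complex"
  proof -
    have t0K: "cmod (K t0) = 1" using t0(3) K(5) by blast
    define T where "T = {t. cmod t = ?R \<and> cmod (K t) = 1}"
    obtain g where T: "finite T" "T \<noteq> {}"
      and g: "\<And>t. t \<in> T \<Longrightarrow> \<exists>C. marcinkiewicz p C (g t)" "\<And>t x. t \<in> T \<Longrightarrow> J (g t) x = (t + 1 / t) * g t x"
        "\<And>x. f 0 x = (\<Sum>t\<in>T. g t x)"
      using backward_orbit_decomposition[where H = K and a = c and h = h and S = S and C = "p * M",
          OF p S K(1,2,3,4) t0(1,2) t0K K(6) c h(1,2)] unfolding h(3) T_def by blast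
    have "cmod t = ?R \<and> cmod (\<Psi> (gam_t t)) = cmod A" if "t \<in> T" for t
      using that K(5) Hunit by (simp add: T_def)
    then show ?thesis by (rule eigen_decomposition_of_boundary_points[where g = g, OF p(1) T _ g])
  qed

  have existence: "\<exists>m\<ge>1. \<exists>\<alpha> g. eigen_decomposition q E p \<Psi> A (f 0) m \<alpha> g"
    using cases
  proof (elim disjE conjE)
    assume step: "\<forall>k\<ge>0. multiplier q E v0 \<nu> p \<Psi> (f k) = (\<lambda>x. A * f (k + 1) x)"
      and ge: "\<forall>z\<in>strip p. cmod A \<le> cmod (\<Psi> (gam q z))"
    have hol: "(\<lambda>w. A / \<Psi> w) holomorphic_on O0"
      by (intro holomorphic_intros \<Psi>0) (simp add: O0_def)
    obtain c where c: "weighted_l1 ?R c" "\<And>m. c (- m) = c m"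
      "\<And>t. 1 / ?R \<le> cmod t \<Longrightarrow> cmod t \<le> ?R \<Longrightarrow> laurent c t = A / \<Psi> (gam_t t)"
      using multiplier_eq_apply_symbol[OF p O0 O0_sub hol] by blast
    have cH: "laurent c t = 1 / H t" if "1 / ?R \<le> cmod t" "cmod t \<le> ?R" for t
      using c(3)[OF that] by (simp add: H_def)
    have R1: "1 \<le> ?R" "1 / ?R \<le> 1" using R by simp_all
    \<comment> \<open>The two symbols are inverse to each other, so the multiplier can be undone.\<close>
    have "conv c b m = 1 * unit_symbol m" for m
    proof (rule laurent_constant[OF weighted_l1_conv[OF R1(1) c(1) b(1)] R1(1)])
      fix t :: complex assume "cmod t = 1"
      then have t: "1 / ?R \<le> cmod t" "cmod t \<le> ?R" using R1 by simp_all
      have "laurent (conv c b) t = (1 / H t) * H t"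
        unfolding laurent_conv[OF R1(1) c(1) b(1) t] cH[OF t] b_eval[OF t] H_def ..
      then show "laurent (conv c b) t = 1" using Hnz[OF closed_sub[OF t]] by simp
    qed
    then have cb: "conv c b = unit_symbol" by auto
    have shifted: "apply_symbol c (f (int (Suc n))) = f (int n)" for n
    proof -
      have "multiplier q E v0 \<nu> p \<Psi> (f (int n)) = (\<lambda>x. A * f (int (Suc n)) x)" using step by (simp add: add.commute)
      then have e: "f (int (Suc n)) = apply_symbol b (f (int n))" by (rule b_step[symmetric])
      show ?thesis
        unfolding e apply_symbol_conv[OF R1(1) marcinkiewicz_imp_tempered[OF p marc, folded radius_def] c(1) b] cb
        by (rule apply_unit_symbol)
    qed
    show ?thesis
    proof (rule main[of "\<lambda>t. 1 / H t" c "\<lambda>n. f (int n)"])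
      show "(\<lambda>t. 1 / H t) holomorphic_on ?ann S" using Hnz by (intro holomorphic_intros Hhol) blast
      show "\<not> (\<lambda>t. 1 / H t) constant_on ?ann S"
      proof
        assume "(\<lambda>t. 1 / H t) constant_on ?ann S"
        then obtain w where w: "\<And>t. t \<in> ?ann S \<Longrightarrow> 1 / H t = w" by (auto simp: constant_on_def)
        have "H t = 1 / w" if "t \<in> ?ann S" for t using w[OF that] by auto
        then have "H constant_on ?ann S" unfolding constant_on_def by blast
        then show False using Hnc by contradiction
      qed
      show "1 / H (1 / t) = 1 / H t" if "t \<noteq> 0" for t using Hinv[OF that] by simp
      show "cmod (1 / H t) \<le> 1" if t: "1 / ?R \<le> cmod t" "cmod t \<le> ?R" for t
      proof -
        obtain z where z: "z \<in> strip p" "gam q z = gam_t t" using on_strip[OF t] by blast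
        have "cmod A \<le> cmod (\<Psi> (gam_t t))" using ge z by metis
        then have "1 \<le> cmod (H t)" using A by (simp add: H_def norm_divide pos_le_divide_eq)
        then show ?thesis by (simp add: norm_divide divide_le_eq_1)
      qed
      show "cmod (1 / H t) = 1 \<longleftrightarrow> cmod (H t) = 1" for t by (auto simp: norm_divide)
      have "{w. cmod w = 1 \<and> (\<exists>t. 1 / ?R \<le> cmod t \<and> cmod t \<le> ?R \<and> w = 1 / H t)}
          \<subseteq> (\<lambda>w. 1 / w) ` {w. cmod w = 1 \<and> (\<exists>t. 1 / ?R \<le> cmod t \<and> cmod t \<le> ?R \<and> w = H t)}"
        by (auto simp: norm_divide)
      then show "finite {w. cmod w = 1 \<and> (\<exists>t. 1 / ?R \<le> cmod t \<and> cmod t \<le> ?R \<and> w = 1 / H t)}"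
        by (rule finite_subset[OF _ finite_imageI[OF Hfin]])
    qed (use c(1,2) cH marc shifted in simp_all)
  next
    assume step: "\<forall>k\<ge>1. multiplier q E v0 \<nu> p \<Psi> (f (- k)) = (\<lambda>x. A * f (- k + 1) x)"
      and le: "\<forall>z\<in>strip p. cmod (\<Psi> (gam q z)) \<le> cmod A"
    have shifted: "apply_symbol b (f (- int (Suc n))) = f (- int n)" for n
    proof (rule b_step)
      have "- int (Suc n) + 1 = - int n" by simp
      moreover have "multiplier q E v0 \<nu> p \<Psi> (f (- int (Suc n))) = (\<lambda>x. A * f (- int (Suc n) + 1) x)"
        by (rule step[rule_format]) simp
      ultimately show "multiplier q E v0 \<nu> p \<Psi> (f (- int (Suc n))) = (\<lambda>x. A * f (- int n) x)" by metis
    qed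
    show ?thesis
    proof (rule main[of H b "\<lambda>n. f (- int n)", OF Hhol Hnc Hinv _ refl Hfin b])
      show "cmod (H t) \<le> 1" if t: "1 / ?R \<le> cmod t" "cmod t \<le> ?R" for t
      proof -
        obtain z where z: "z \<in> strip p" "gam q z = gam_t t" using on_strip[OF t] by blast
        have "cmod (\<Psi> (gam_t t)) \<le> cmod A" using le z by metis
        then show ?thesis using A by (simp add: H_def norm_divide divide_le_eq_1)
      qed
      show "laurent b t = H t" if "1 / ?R \<le> cmod t" "cmod t \<le> ?R" for t
        unfolding H_def by (rule b_eval[OF that])
    qed (use marc shifted in simp_all)
  qed

  have poisson: "\<exists>F\<in>Lr_space \<nu> (conj_exp p).
      g l = poisson_transform q E v0 \<nu> (Complex (\<alpha> l) (delta (conj_exp p))) F"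
    if ed: "eigen_decomposition q E p \<Psi> A (f 0) m \<alpha> g" and l: "l \<in> {1..m}" for m \<alpha> g l
  proof -
    have "weak_norm (conj_exp p) (g l) < \<infinity>"
      using eigen_decompositionD(3)[OF p(1) ed l] by (simp add: weak_space_def)
    then have "weak_norm (conj_exp p) (g l) \<le> ennreal (enn2real (weak_norm (conj_exp p) (g l)))" by simp
    then have mg: "marcinkiewicz p (p * enn2real (weak_norm (conj_exp p) (g l))) (g l)"
      by (rule weak_norm_imp_marcinkiewicz[OF p(1) enn2real_nonneg])
    show ?thesis
      by (rule eigenfunction_is_poisson_transform[OF p mg norm_boundary_point[OF p(1), unfolded boundary_point_def]
            eigen_decompositionD(1)[OF p(1) ed l, unfolded boundary_point_def]])
  qed
  show ?thesis
    using existence eigen_decomposition_unique[OF p] poisson by blast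
qed

end
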